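(* Let $\varphi$ be a partially monotone anisotropy in $\mathbb{R}^2$ such that $W^\varphi$ does not have vertical facets, let $I\subset\mathbb{R}$ be a bounded open interval and $p\ge1$. Let $$\sigma:=\Big(\frac{1}{4^{p-1}p}\,\min\Big\{\frac{\alpha_0\varphi(\mathbf e_1)}{4},\ \frac{\alpha_0}{2\varphi(\mathbf e_2)},\ \frac{|I|\varphi(\mathbf e_1)}{4\varphi(\mathbf e_2)}\Big\}\Big)^{1/p},\qquad \alpha_0:=\frac{\mathcal{P}_\varphi(W^\varphi)}{(2\mathcal{P}_\varphi(W^\varphi)+1)\sqrt{|W^\varphi|}}.$$ Let $g\in L^\infty(I)$ be such that $\|g\|_\infty<\sigma$. Then every minimizer $u$ of the functional $$\mathcal{G}(u)=\int_I\varphi^o(-Du,1)+\int_I|u-g|^p\,ds,\qquad u\in L^1(I),$$ is Lipschitz in $I$. Moreover, if $\varphi$ is elliptic and $C^2$, then $u\in C^{1,1}(I)$.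
   Context: An anisotropy in $\mathbb{R}^2$ is an even, convex, positively one-homogeneous function $\varphi:\mathbb{R}^2\to[0,+\infty)$ with $c\le\varphi\le 1/c$ on the unit circle for some $c\in(0,1]$ (i.e. a norm). Its dual is $\varphi^o(\xi)=\max_{\varphi(\eta)=1}\langle\xi,\eta\rangle$. $\varphi$ is partially monotone if $|x_1|\le|x_2|$, $|y_1|\le|y_2|$ imply $\varphi(x_1,y_1)\le\varphi(x_2,y_2)$ (equivalently $\varphi$ is even in each coordinate separately). $\varphi$ is $C^2$ if it is $C^2$ on $\mathbb{R}^2\setminus\{0\}$; it is elliptic if $\varphi-\lambda|\cdot|$ is an anisotropy for some $\lambda>0$ ($|\cdot|$ the Euclidean norm). $W^\varphi:=\{\varphi\le1\}$; "no vertical facets" means that $\partial W^\varphi$ contains no nondegenerate vertical segment. $\mathbf e_1,\mathbf e_2$ is the standard basis of $\mathbb{R}^2$, and $|\cdot|$ applied to sets is Lebesgue measure. For a set $E$ of locally finite perimeter in an open set $\Omega\subseteq\mathbb{R}^2$, with reduced boundary $\partial^*E$ and generalized outer unit normal $\nu_E$, $\mathcal{P}_\varphi(E,\Omega)=\int_{\Omega\cap\partial^*E}\varphi^o(\nu_E)\,d\mathcal{H}^1$ and $\mathcal{P}_\varphi(E)=\mathcal{P}_\varphi(E,\mathbb{R}^2)$. For $u\in BV(I)$, $$\int_I\varphi^o(-Du,1):=\sup\Big\{\int_I(uh_1'+h_2)\,ds:\ (h_1,h_2)\in C_c^1(I;\mathbb{R}^2),\ \|\varphi(h_1,h_2)\|_\infty\le1\Big\},$$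 and $\mathcal{G}(u)=+\infty$ if $u\notin BV(I)$ or $u-g\notin L^p(I)$. Functions are identified when equal a.e.; regularity refers to a suitable representative. $u\in C^{1,1}(I)$ means that $u$ is continuously differentiable and $u'$ is Lipschitz in $I$. *)

theory Defs
  imports "HOL-Analysis.Analysis" "HOL-Probability.Essential_Supremum"
begin

type_synonym plane = "real \<times> real"

section \<open>Anisotropies\<close>

definition anisotropy :: "(plane \<Rightarrow> real) \<Rightarrow> bool" where
  "anisotropy \<phi> \<longleftrightarrow>
     (\<forall>x. 0 \<le> \<phi> x) \<and> (\<forall>x. \<phi> (- x) = \<phi> x) \<and> convex_on UNIV \<phi> \<and>
     (\<forall>t>0. \<forall>x. \<phi> (t *\<^sub>R x) = t * \<phi> x) \<and>
     (\<exists>c. 0 < c \<and> c \<le> 1 \<and> (\<forall>x. norm x = 1 \<longrightarrow> c \<le> \<phi> x \<and> \<phi> x \<le> 1 / c))"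

text \<open>For an anisotropy the supremum is attained, since the unit sphere of \<open>\<phi>\<close> is compact.\<close>

definition dual_anisotropy :: "(plane \<Rightarrow> real) \<Rightarrow> plane \<Rightarrow> real" where
  "dual_anisotropy \<phi> \<xi> = (SUP \<eta>\<in>{\<eta>. \<phi> \<eta> = 1}. \<xi> \<bullet> \<eta>)"

definition partially_monotone :: "(plane \<Rightarrow> real) \<Rightarrow> bool" where
  "partially_monotone \<phi> \<longleftrightarrow>
     (\<forall>x1 y1 x2 y2. \<bar>x1\<bar> \<le> \<bar>x2\<bar> \<longrightarrow> \<bar>y1\<bar> \<le> \<bar>y2\<bar> \<longrightarrow> \<phi> (x1, y1) \<le> \<phi> (x2, y2))"

definition elliptic :: "(plane \<Rightarrow> real) \<Rightarrow> bool" where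
  "elliptic \<phi> \<longleftrightarrow> (\<exists>c>0. anisotropy (\<lambda>x. \<phi> x - c * norm x))"

definition C2_on :: "'a::real_normed_vector set \<Rightarrow> ('a \<Rightarrow> 'b::real_normed_vector) \<Rightarrow> bool" where
  "C2_on S f \<longleftrightarrow>
     (\<exists>(D :: 'a \<Rightarrow> 'a \<Rightarrow>\<^sub>L 'b) (D2 :: 'a \<Rightarrow> 'a \<Rightarrow>\<^sub>L ('a \<Rightarrow>\<^sub>L 'b)).
        (\<forall>x\<in>S. (f has_derivative blinfun_apply (D x)) (at x)) \<and>
        (\<forall>x\<in>S. (D has_derivative blinfun_apply (D2 x)) (at x)) \<and>
        continuous_on S D2)"

definition C2_anisotropy :: "(plane \<Rightarrow> real) \<Rightarrow> bool" where
  "C2_anisotropy \<phi> \<longleftrightarrow> C2_on (UNIV - {0}) \<phi>"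

definition wulff :: "(plane \<Rightarrow> real) \<Rightarrow> plane set" where
  "wulff \<phi> = {x. \<phi> x \<le> 1}"

definition no_vertical_facets :: "plane set \<Rightarrow> bool" where
  "no_vertical_facets W \<longleftrightarrow>
     \<not> (\<exists>x y1 y2. y1 < y2 \<and> closed_segment (x, y1) (x, y2) \<subseteq> frontier W)"

section \<open>Compactly supported test fields\<close>

text \<open>Fields in \<open>C\<^sub>c\<^sup>1(\<Omega>)\<close> are represented by their extension by zero to the whole space.\<close>

definition C1c :: "'a::real_normed_vector set \<Rightarrow> ('a \<Rightarrow> 'b::real_normed_vector) set" where
  "C1c \<Omega> =
     {h. (\<exists>D :: 'a \<Rightarrow> 'a \<Rightarrow>\<^sub>L 'b.
            (\<forall>x. (h has_derivative blinfun_apply (D x)) (at x)) \<and> continuous_on UNIV D) \<and>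
         compact (closure {x. h x \<noteq> 0}) \<and> closure {x. h x \<noteq> 0} \<subseteq> \<Omega>}"

definition divergence :: "('a::euclidean_space \<Rightarrow> 'a) \<Rightarrow> 'a \<Rightarrow> real" where
  "divergence h x = (\<Sum>i\<in>Basis. frechet_derivative h (at x) i \<bullet> i)"

section \<open>Hausdorff measure\<close>

text \<open>One-dimensional Hausdorff measure. With the usual normalisation the constant in front
  of the sum of the diameters is \<open>1\<close>. Unbounded covering sets are excluded explicitly because
  the library function \<open>diameter\<close> is real-valued.\<close>

definition hausdorff1_outer :: "'a::metric_space set \<Rightarrow> ennreal" where
  "hausdorff1_outer A =
     (SUP \<delta>\<in>{0::real<..}.
        INF C\<in>{C :: nat \<Rightarrow> 'a set.
                 A \<subseteq> (\<Union>i. C i) \<and> (\<forall>i. bounded (C i) \<and> diameter (C i) \<le> \<delta>)}.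
          (\<Sum>i. ennreal (diameter (C i))))"

text \<open>\<open>hausdorff1_outer\<close> is a metric outer measure, hence countably additive on Borel sets.\<close>

definition hausdorff1 :: "'a::metric_space measure" where
  "hausdorff1 = measure_of UNIV (sets borel) hausdorff1_outer"

section \<open>Sets of locally finite perimeter and anisotropic perimeter\<close>

text \<open>The pair \<open>(M, n)\<close> is the polar decomposition of the Gauss-Green measure of \<open>E\<close> in \<open>\<Omega>\<close>, that
  is, \<open>n M\<close> is minus the distributional gradient of the characteristic function of \<open>E\<close>;
  the sign makes \<open>n\<close> point outwards.\<close>

definition gauss_green ::
  "'a::euclidean_space set \<Rightarrow> 'a set \<Rightarrow> 'a measure \<Rightarrow> ('a \<Rightarrow> 'a) \<Rightarrow> bool" where
  "gauss_green E \<Omega> M n \<longleftrightarrow>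
     sets M = sets borel \<and> emeasure M (- \<Omega>) = 0 \<and>
     (\<forall>K. compact K \<longrightarrow> K \<subseteq> \<Omega> \<longrightarrow> emeasure M K < \<infinity>) \<and>
     n \<in> borel_measurable M \<and> (AE x in M. norm (n x) = 1) \<and>
     (\<forall>h\<in>C1c \<Omega>. (LINT x:E|lebesgue. divergence h x) = (LINT x|M. h x \<bullet> n x))"

definition locally_finite_perimeter :: "'a::euclidean_space set \<Rightarrow> 'a set \<Rightarrow> bool" where
  "locally_finite_perimeter E \<Omega> \<longleftrightarrow> E \<in> sets lebesgue \<and> (\<exists>M n. gauss_green E \<Omega> M n)"

text \<open>If \<open>E\<close> has locally finite perimeter in the open set \<open>\<Omega>\<close>, the measure \<open>M\<close> is unique and \<open>n\<close> is
  unique \<open>M\<close>-almost everywhere, so nothing below depends on the choice.\<close>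

definition gg_pair :: "'a::euclidean_space set \<Rightarrow> 'a set \<Rightarrow> 'a measure \<times> ('a \<Rightarrow> 'a)" where
  "gg_pair E \<Omega> = (SOME (M, n). gauss_green E \<Omega> M n)"

definition gg_average :: "'a::euclidean_space set \<Rightarrow> 'a set \<Rightarrow> 'a \<Rightarrow> real \<Rightarrow> 'a" where
  "gg_average E \<Omega> x r =
     (case gg_pair E \<Omega> of (M, n) \<Rightarrow>
        (1 / measure M (ball x r)) *\<^sub>R (LINT y:ball x r|M. n y))"

definition reduced_boundary :: "'a::euclidean_space set \<Rightarrow> 'a set \<Rightarrow> 'a set" where
  "reduced_boundary E \<Omega> =
     {x \<in> \<Omega>. (\<forall>r>0. emeasure (fst (gg_pair E \<Omega>)) (ball x r) > 0) \<and>
        (\<exists>\<nu>. norm \<nu> = 1 \<and> (gg_average E \<Omega> x \<longlongrightarrow> \<nu>) (at_right 0))}"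

definition outer_normal :: "'a::euclidean_space set \<Rightarrow> 'a set \<Rightarrow> 'a \<Rightarrow> 'a" where
  "outer_normal E \<Omega> x = Lim (at_right 0) (gg_average E \<Omega> x)"

text \<open>Meaningful for \<open>\<Omega>\<close> open and \<open>E\<close> of locally finite perimeter in \<open>\<Omega>\<close>.\<close>

definition perimeter :: "(plane \<Rightarrow> real) \<Rightarrow> plane set \<Rightarrow> plane set \<Rightarrow> ennreal" where
  "perimeter \<phi> E \<Omega> =
     (\<integral>\<^sup>+ x\<in>\<Omega> \<inter> reduced_boundary E \<Omega>.
        ennreal (dual_anisotropy \<phi> (outer_normal E \<Omega> x)) \<partial>hausdorff1)"

section \<open>Function spaces on an interval\<close>

definition L1_on :: "real set \<Rightarrow> (real \<Rightarrow> real) \<Rightarrow> bool" where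
  "L1_on I u \<longleftrightarrow> set_integrable lebesgue I u"

definition Lp_on :: "real \<Rightarrow> real set \<Rightarrow> (real \<Rightarrow> real) \<Rightarrow> bool" where
  "Lp_on p I f \<longleftrightarrow>
     set_borel_measurable lebesgue I f \<and> set_integrable lebesgue I (\<lambda>s. \<bar>f s\<bar> powr p)"

definition Linf_norm :: "real set \<Rightarrow> (real \<Rightarrow> real) \<Rightarrow> ereal" where
  "Linf_norm I f = esssup (restrict_space lebesgue I) (\<lambda>s. ereal \<bar>f s\<bar>)"

definition Linf_on :: "real set \<Rightarrow> (real \<Rightarrow> real) \<Rightarrow> bool" where
  "Linf_on I f \<longleftrightarrow> set_borel_measurable lebesgue I f \<and> Linf_norm I f < \<infinity>"

definition BV_on :: "real set \<Rightarrow> (real \<Rightarrow> real) \<Rightarrow> bool" where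
  "BV_on I u \<longleftrightarrow> L1_on I u \<and>
     bdd_above {(LINT s:I|lebesgue. u s * deriv h s) | h. h \<in> C1c I \<and> (\<forall>s. \<bar>h s\<bar> \<le> 1)}"

definition C11_on :: "real set \<Rightarrow> (real \<Rightarrow> real) \<Rightarrow> bool" where
  "C11_on I v \<longleftrightarrow>
     (\<exists>D. (\<forall>s\<in>I. (v has_real_derivative D s) (at s)) \<and> (\<exists>L. L-lipschitz_on I D))"

section \<open>The functional\<close>

definition anisotropic_variation :: "(plane \<Rightarrow> real) \<Rightarrow> real set \<Rightarrow> (real \<Rightarrow> real) \<Rightarrow> ereal" where
  "anisotropic_variation \<phi> I u =
     (SUP h\<in>{h. h \<in> C1c I \<and> (\<forall>s. \<phi> (h s) \<le> 1)}.
        ereal (LINT s:I|lebesgue. u s * deriv (\<lambda>t. fst (h t)) s + snd (h s)))"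

definition G_functional ::
  "(plane \<Rightarrow> real) \<Rightarrow> real \<Rightarrow> (real \<Rightarrow> real) \<Rightarrow> real set \<Rightarrow> (real \<Rightarrow> real) \<Rightarrow> ereal" where
  "G_functional \<phi> p g I u =
     (if BV_on I u \<and> Lp_on p I (\<lambda>s. u s - g s)
      then anisotropic_variation \<phi> I u + ereal (LINT s:I|lebesgue. \<bar>u s - g s\<bar> powr p)
      else \<infinity>)"

definition G_minimizer ::
  "(plane \<Rightarrow> real) \<Rightarrow> real \<Rightarrow> (real \<Rightarrow> real) \<Rightarrow> real set \<Rightarrow> (real \<Rightarrow> real) \<Rightarrow> bool" where
  "G_minimizer \<phi> p g I u \<longleftrightarrow>
     L1_on I u \<and> (\<forall>v. L1_on I v \<longrightarrow> G_functional \<phi> p g I u \<le> G_functional \<phi> p g I v)"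

section \<open>The threshold on the datum\<close>

definition alpha0 :: "(plane \<Rightarrow> real) \<Rightarrow> real" where
  "alpha0 \<phi> =
     (let P = enn2real (perimeter \<phi> (wulff \<phi>) UNIV)
      in P / ((2 * P + 1) * sqrt (measure lebesgue (wulff \<phi>))))"

definition sigma_threshold :: "(plane \<Rightarrow> real) \<Rightarrow> real \<Rightarrow> real set \<Rightarrow> real" where
  "sigma_threshold \<phi> p I =
     (1 / (4 powr (p - 1) * p) *
       Min {alpha0 \<phi> * \<phi> (1, 0) / 4,
            alpha0 \<phi> / (2 * \<phi> (0, 1)),
            measure lebesgue I * \<phi> (1, 0) / (4 * \<phi> (0, 1))}) powr (1 / p)"

end

theory Submission
  imports Defs
begin

text \<open>The Wulff shape is \<open>{(x, y). \<bar>x\<bar> \<le> 1 / \<phi> (1, 0) \<and> \<bar>y\<bar> \<le> prof x}\<close> for an even concave profile \<open>prof\<close>. With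
  \<open>supp t\<close> the maximum of \<open>x t + y\<close> over the Wulff shape, \<open>\<integral> supp ((u (s + \<delta>) - u s) / \<delta>) ds\<close> is at most the
  anisotropic variation of \<open>u\<close> and approximates it as \<open>\<delta> \<rightarrow> 0\<close>, so minimality can be tested
  through difference quotients. Let \<open>\<gamma>\<close> bound \<open>g\<close> (hence \<open>u\<close>) and let \<open>K\<close> exceed the Lipschitz constant
  \<open>p (2 \<gamma>)\<^sup>p\<^sup>-\<^sup>1\<close> of the fidelity term. Along the arc
  \<open>\<psi> s = t + (prof (m - K (s - s\<^sub>0)) - prof m) / K\<close> of the Wulff shape scaled by \<open>1 / K\<close>, the point of the Wulff shape
  at which \<open>supp (\<psi>' s)\<close> is attained moves left at speed \<open>K\<close>, so that truncating \<open>u\<close> from above by \<open>\<psi>\<close> saves more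
  variation than it costs fidelity. As long as such arcs rise by more than \<open>2 \<gamma>\<close>, they bound the increments of a minimizer
  to the right of almost every point, and applying this to \<open>- u\<close> gives the Lipschitz bound.
  The arcs can rise by almost \<open>prof 0 / K\<close>, because without vertical facets \<open>prof\<close> tends to \<open>0\<close> at its end points,
  and the threshold on \<open>g\<close> makes this sufficient since \<open>\<alpha>\<^sub>0 \<le> 1\<close>; the latter follows from a bound of the perimeter of
  the Wulff shape by a multiple of its area. If \<open>\<phi>\<close> is \<open>C\<^sup>2\<close>, the profile is semiconvex away from its end points, and
  comparing \<open>\<plusminus> u\<close> with the arc through two points of its graph shows that neighbouring difference quotients of
  \<open>u\<close> differ by at most a multiple of the distance of the points.\<close>

section \<open>The profile of the Wulff shape\<close>

text \<open>A minimizer is only a \<open>BV\<close> function, so there is no pointwise derivative to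
  insert into a convexity inequality; finite differences replace it. The two halves of the link with
  the variation serve different purposes: every \<open>DQ\<close> of the minimizer is bounded by its
  variation \<open>T\<close>, and for the competitor an eventual bound on \<open>DQ\<close> bounds
  the variation. With \<open>Q s\<close> the contact abscissa of the arc and \<open>d\<close> the
  part cut off, the saving is formally
  \<open>\<integral> Q d' = - \<integral> Q' d = K \<integral> d\<close>. It is linear in the
  removed mass, like the fidelity cost, so a strict inequality between the two constants forces
  \<open>d = 0\<close>. The second requirement on \<open>K\<close> is
  \<open>2 * \<gamma> * K < prof 0\<close>; \<open>datum_bound\<close> makes the two compatible. The
  reduced boundary is defined through a chosen Gauss-Green pair, so a pair has to be constructed
  before anything can be said about the perimeter. After that only upper estimates of Hausdorff
  measure enter, and crude ones suffice: a perimeter of at most \<open>8\<close> times the area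
  gives \<open>\<alpha>\<^sub>0 \<le> 1\<close>, and the coverings used here give the factor
  \<open>7\<close>.\<close>

lemma anisotropy_triangle:
  assumes "anisotropy \<phi>"
  shows "\<phi> (x + y) \<le> \<phi> x + \<phi> y"
proof -
  have c: "convex_on UNIV \<phi>" and h: "\<And>t x. t > 0 \<Longrightarrow> \<phi> (t *\<^sub>R x) = t * \<phi> x"
    using assms by (auto simp: anisotropy_def)
  have "\<phi> ((1 - 1/2) *\<^sub>R (2 *\<^sub>R x) + (1/2) *\<^sub>R (2 *\<^sub>R y)) \<le> (1 - 1/2) * \<phi> (2 *\<^sub>R x) + (1/2) * \<phi> (2 *\<^sub>R y)"
    by (rule convex_onD[OF c]) auto
  then show ?thesis by (simp add: h)
qed

locale monotone_anisotropy =
  fixes \<phi> :: "plane \<Rightarrow> real"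
  assumes aniso: "anisotropy \<phi>" and pmono: "partially_monotone \<phi>"
begin

lemma phi_nonneg: "0 \<le> \<phi> x"
  using aniso unfolding anisotropy_def by blast

lemma phi_zero [simp]: "\<phi> 0 = 0" "\<phi> (0, 0) = 0"
proof -
  have "\<phi> (2 *\<^sub>R 0) = 2 * \<phi> 0" using aniso unfolding anisotropy_def by (metis zero_less_numeral)
  then show "\<phi> 0 = 0" by simp
  then show "\<phi> (0, 0) = 0" by (simp add: zero_prod_def)
qed

lemma phi_scale: "\<phi> (t *\<^sub>R x) = \<bar>t\<bar> * \<phi> x"
proof -
  have h: "\<And>t x. t > 0 \<Longrightarrow> \<phi> (t *\<^sub>R x) = t * \<phi> x" and e: "\<And>x. \<phi> (- x) = \<phi> x"
    using aniso by (auto simp: anisotropy_def)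
  consider "t > 0" | "t = 0" | "t < 0" by linarith
  then show ?thesis
  proof cases
    case 3
    then have "\<phi> (t *\<^sub>R x) = \<phi> ((-t) *\<^sub>R x)" using e[of "t *\<^sub>R x"] by simp
    also have "\<dots> = (-t) * \<phi> x" using 3 by (intro h) auto
    finally show ?thesis using 3 by simp
  qed (auto simp: h)
qed

lemmas phi_triangle = anisotropy_triangle[OF aniso]

lemma phi_mono: "\<bar>x1\<bar> \<le> \<bar>x2\<bar> \<Longrightarrow> \<bar>y1\<bar> \<le> \<bar>y2\<bar> \<Longrightarrow> \<phi> (x1, y1) \<le> \<phi> (x2, y2)"
  using pmono by (auto simp: partially_monotone_def)

lemma phi_abs: "\<phi> (\<bar>x\<bar>, \<bar>y\<bar>) = \<phi> (x, y)"
  by (intro antisym phi_mono) auto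

lemma phi_reflect: "\<phi> (- x, y) = \<phi> (x, y)" "\<phi> (x, - y) = \<phi> (x, y)"
  by (auto intro!: antisym phi_mono)

lemma phi_norm_bounds: "\<exists>c>0. \<forall>x. c * norm x \<le> \<phi> x \<and> \<phi> x \<le> norm x / c"
proof -
  obtain c where c: "0 < c" "\<And>x. norm x = 1 \<Longrightarrow> c \<le> \<phi> x \<and> \<phi> x \<le> 1 / c"
    using aniso by (auto simp: anisotropy_def)
  have "c * norm x \<le> \<phi> x \<and> \<phi> x \<le> norm x / c" for x
  proof (cases "x = 0")
    case False
    have "\<phi> x = \<phi> (norm x *\<^sub>R (x /\<^sub>R norm x))" using False by simp
    also have "\<dots> = norm x * \<phi> (x /\<^sub>R norm x)" by (subst phi_scale) simp
    finally have e: "\<phi> x = norm x * \<phi> (x /\<^sub>R norm x)" .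
    have "c \<le> \<phi> (x /\<^sub>R norm x) \<and> \<phi> (x /\<^sub>R norm x) \<le> 1 / c" using False by (intro c) simp
    then have "norm x * c \<le> norm x * \<phi> (x /\<^sub>R norm x)" "norm x * \<phi> (x /\<^sub>R norm x) \<le> norm x * (1 / c)"
      by (simp_all only: mult_left_mono norm_ge_zero)
    then show ?thesis unfolding e by (metis mult.commute mult.right_neutral times_divide_eq_right)
  qed simp
  then show ?thesis using c by blast
qed

lemma phi_continuous: "continuous_on S \<phi>"
  using convex_on_continuous[of UNIV \<phi>] aniso continuous_on_subset
  by (auto simp: anisotropy_def)

text \<open>The Wulff shape meets the coordinate axes at \<open>1 / pa\<close> and
  \<open>1 / pb\<close>, and by partial monotonicity it lies in the box with these half-widths
  (\<open>wulff_bounds\<close>).\<close>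

definition pa where "pa = \<phi> (1, 0)"
definition pb where "pb = \<phi> (0, 1)"

lemma pa_pos: "pa > 0" and pb_pos: "pb > 0"
proof -
  obtain c where c: "c > 0" "\<And>x. c * norm x \<le> \<phi> x" using phi_norm_bounds by blast
  show "pa > 0" "pb > 0" using c(1) c(2)[of "(1,0)"] c(2)[of "(0,1)"]
    by (auto simp: pa_def pb_def norm_Pair)
qed

lemma phi_axis: "\<phi> (x, 0) = \<bar>x\<bar> * pa" "\<phi> (0, y) = \<bar>y\<bar> * pb"
  using phi_scale[of x "(1,0)"] phi_scale[of y "(0,1)"] by (auto simp: pa_def pb_def)

lemma wulff_iff: "z \<in> wulff \<phi> \<longleftrightarrow> \<phi> z \<le> 1" by (simp add: wulff_def)

lemma wulff_closed: "closed (wulff \<phi>)"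
  unfolding wulff_def by (intro closed_Collect_le phi_continuous continuous_on_const)

lemma wulff_compact: "compact (wulff \<phi>)"
proof -
  obtain c where c: "c > 0" "\<And>x. c * norm x \<le> \<phi> x" using phi_norm_bounds by blast
  have "norm x \<le> 1 / c" if "\<phi> x \<le> 1" for x
    using c(1) c(2)[of x] that by (simp add: field_simps)
  then have "bounded (wulff \<phi>)" unfolding wulff_def bounded_iff by auto
  with wulff_closed show ?thesis by (simp add: compact_eq_bounded_closed)
qed

lemma wulff_convex: "convex (wulff \<phi>)"
proof (rule convexI)
  fix x y :: plane and u v :: real
  assume a: "x \<in> wulff \<phi>" "y \<in> wulff \<phi>" "0 \<le> u" "0 \<le> v" "u + v = 1"
  have "\<phi> (u *\<^sub>R x + v *\<^sub>R y) \<le> u * \<phi> x + v * \<phi> y"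
    using phi_triangle[of "u *\<^sub>R x" "v *\<^sub>R y"] a by (simp add: phi_scale)
  also have "\<dots> \<le> u * 1 + v * 1"
    using a by (intro add_mono mult_left_mono) (auto simp: wulff_def)
  finally show "u *\<^sub>R x + v *\<^sub>R y \<in> wulff \<phi>" using a by (simp add: wulff_def)
qed

lemma wulff_bounds:
  assumes "(x, y) \<in> wulff \<phi>"
  shows "\<bar>x\<bar> \<le> 1 / pa" "\<bar>y\<bar> \<le> 1 / pb"
proof -
  have "\<bar>x\<bar> * pa \<le> 1" "\<bar>y\<bar> * pb \<le> 1"
    using assms phi_mono[of x x 0 y] phi_mono[of 0 x y y] by (auto simp: wulff_def phi_axis)
  then show "\<bar>x\<bar> \<le> 1 / pa" "\<bar>y\<bar> \<le> 1 / pb" using pa_pos pb_pos by (auto simp: field_simps)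
qed

text \<open>For \<open>\<bar>x\<bar> > 1 / pa\<close> this is the supremum of the empty set, an
  unspecified value; hence the range condition on \<open>x\<close> in the lemmas about
  \<open>prof\<close>.\<close>

definition prof :: "real \<Rightarrow> real" where "prof x = Sup {y. \<phi> (x, y) \<le> 1}"

lemma prof_props:
  assumes "\<bar>x\<bar> \<le> 1 / pa"
  shows "(x, prof x) \<in> wulff \<phi>" "0 \<le> prof x" "\<phi> (x, y) \<le> 1 \<longleftrightarrow> \<bar>y\<bar> \<le> prof x"
proof -
  let ?S = "{y. \<phi> (x, y) \<le> 1}"
  have 0: "0 \<in> ?S" using assms pa_pos by (auto simp: phi_axis field_simps)
  have b: "bdd_above ?S"
  proof (rule bdd_aboveI)
    fix y assume "y \<in> ?S"
    then show "y \<le> 1 / pb" using wulff_bounds(2)[of x y] by (auto simp: wulff_def)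
  qed
  have cl: "closed ?S"
    by (intro closed_Collect_le continuous_on_const continuous_on_compose2[OF phi_continuous[of UNIV]])
       (auto intro!: continuous_intros)
  have "Sup ?S \<in> ?S" using closed_contains_Sup[OF _ b cl] 0 by blast
  then have s: "\<phi> (x, prof x) \<le> 1" by (simp add: prof_def)
  show n: "0 \<le> prof x" unfolding prof_def using cSup_upper[OF 0 b] .
  show "(x, prof x) \<in> wulff \<phi>" using s by (simp add: wulff_def)
  show "\<phi> (x, y) \<le> 1 \<longleftrightarrow> \<bar>y\<bar> \<le> prof x"
  proof
    assume "\<phi> (x, y) \<le> 1"
    then have "\<bar>y\<bar> \<in> ?S" using phi_mono[of x x "\<bar>y\<bar>" y] by simp
    then show "\<bar>y\<bar> \<le> prof x" unfolding prof_def by (intro cSup_upper b)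
  next
    assume "\<bar>y\<bar> \<le> prof x"
    then show "\<phi> (x, y) \<le> 1" using s phi_mono[of x x y "prof x"] n by simp
  qed
qed

lemma wulff_prof: "(x, y) \<in> wulff \<phi> \<longleftrightarrow> \<bar>x\<bar> \<le> 1 / pa \<and> \<bar>y\<bar> \<le> prof x"
  using wulff_bounds(1) prof_props(3) by (auto simp: wulff_def)

lemma prof_even: "prof (- x) = prof x"
  by (simp add: prof_def phi_reflect)

lemma prof_antimono:
  assumes "\<bar>x\<bar> \<le> \<bar>y\<bar>" "\<bar>y\<bar> \<le> 1 / pa"
  shows "prof y \<le> prof x"
proof -
  have "\<phi> (x, prof y) \<le> \<phi> (y, prof y)" using assms by (intro phi_mono) auto
  also have "\<dots> \<le> 1" using prof_props(1)[OF assms(2)] by (simp add: wulff_def)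
  finally show ?thesis using prof_props(3)[of x "prof y"] assms by auto
qed

lemma prof_0: "prof 0 = 1 / pb"
proof (rule antisym)
  show "prof 0 \<le> 1 / pb" using prof_props(1)[of 0] wulff_bounds(2)[of 0 "prof 0"] pa_pos by auto
  have "\<phi> (0, 1 / pb) \<le> 1" using pb_pos by (simp add: phi_axis)
  then show "1 / pb \<le> prof 0" using prof_props(3)[of 0 "1 / pb"] pa_pos pb_pos by auto
qed

lemma prof_le: "\<bar>x\<bar> \<le> 1 / pa \<Longrightarrow> prof x \<le> 1 / pb"
  using prof_antimono[of 0 x] by (simp add: prof_0)

lemma prof_concave: "concave_on {-1/pa..1/pa} prof"
proof (rule concave_on_iff[THEN iffD2], intro conjI ballI allI impI)
  show "convex {-1/pa..1/pa}" by simp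
  fix x y u v :: real
  assume a: "x \<in> {-1/pa..1/pa}" "y \<in> {-1/pa..1/pa}" "u \<ge> 0" "v \<ge> 0" "u + v = 1"
  then have b: "\<bar>x\<bar> \<le> 1/pa" "\<bar>y\<bar> \<le> 1/pa" by auto
  have "u *\<^sub>R (x, prof x) + v *\<^sub>R (y, prof y) \<in> wulff \<phi>"
    by (intro convexD[OF wulff_convex] prof_props a b)
  then show "u * prof x + v * prof y \<le> prof (u *\<^sub>R x + v *\<^sub>R y)"
    by (auto simp: wulff_prof)
qed

lemma prof_slopes:
  assumes "-1/pa \<le> x" "x < y" "y < z" "z \<le> 1/pa"
  shows "(prof z - prof y) / (z - y) \<le> (prof y - prof x) / (y - x)"
    "(prof z - prof x) / (z - x) \<le> (prof y - prof x) / (y - x)"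
    "(prof z - prof y) / (z - y) \<le> (prof z - prof x) / (z - x)"
proof -
  define t where "t = (y - x) / (z - x)"
  have t: "0 < t" "t < 1" using assms by (auto simp: t_def field_simps)
  have y: "y = (1 - t) * x + t * z" using assms by (simp add: t_def divide_simps) (simp add: algebra_simps)
  have "(1 - t) * prof x + t * prof z \<le> prof ((1 - t) *\<^sub>R x + t *\<^sub>R z)"
    using t assms by (intro concave_onD[OF prof_concave]) auto
  then have le: "(1 - t) * prof x + t * prof z \<le> prof y" by (simp add: y)
  have yx: "y - x = t * (z - x)" "z - y = (1 - t) * (z - x)" using y by (auto simp: algebra_simps)
  define d where "d = z - x"
  have d: "d > 0" using assms by (simp add: d_def)
  have k: "t * (prof z - prof x) \<le> prof y - prof x" "prof z - prof y \<le> (1 - t) * (prof z - prof x)"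
    using le by (auto simp: algebra_simps)
  have 1: "(prof z - prof x) / (z - x) \<le> (prof y - prof x) / (y - x)"
  proof -
    have "((prof z - prof x) / d) * (t * d) \<le> prof y - prof x" using k(1) d by (simp add: mult.commute)
    then show ?thesis unfolding yx d_def[symmetric] using t d by (subst pos_le_divide_eq) auto
  qed
  have 2: "(prof z - prof y) / (z - y) \<le> (prof z - prof x) / (z - x)"
  proof -
    have "prof z - prof y \<le> ((prof z - prof x) / d) * ((1 - t) * d)" using k(2) d by (simp add: mult.commute)
    then show ?thesis unfolding yx d_def[symmetric] using t d by (subst pos_divide_le_eq) auto
  qed
  show "(prof z - prof y) / (z - y) \<le> (prof y - prof x) / (y - x)"
    "(prof z - prof x) / (z - x) \<le> (prof y - prof x) / (y - x)"
    "(prof z - prof y) / (z - y) \<le> (prof z - prof x) / (z - x)" using 1 2 by auto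
qed

lemma prof_continuous: "continuous_on {-1/pa<..<1/pa} prof"
proof -
  have "concave_on {-1/pa<..<1/pa} prof"
    unfolding concave_on_def
    by (rule convex_on_subset[OF prof_concave[unfolded concave_on_def]]) auto
  then have "continuous_on {-1/pa<..<1/pa} (\<lambda>x. - prof x)"
    by (intro convex_on_continuous) (auto simp: concave_on_def)
  then show ?thesis using continuous_on_minus by fastforce
qed

text \<open>Here the hypothesis on facets enters. If the profile stayed above \<open>e\<close> up to
  the end point, closedness would put \<open>(1 / pa, e)\<close> into the Wulff shape, and the
  segment from \<open>(1 / pa, 0)\<close> to it would be a vertical facet.\<close>

lemma prof_small:
  assumes nv: "no_vertical_facets (wulff \<phi>)" and e: "e > 0"
  obtains m where "0 \<le> m" "m < 1 / pa" "prof m < e"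
proof (rule ccontr)
  note hyp = that
  assume "\<not> thesis"
  then have ge: "prof m \<ge> e" if "0 \<le> m" "m < 1 / pa" for m
    using hyp[of m] that by (cases "prof m < e") auto
  have M: "1 / pa > 0" using pa_pos by simp
  have "(1 / pa, e) \<in> wulff \<phi>"
  proof -
    have "(\<lambda>n. ((1 / pa) * (1 - 1 / real (Suc n)), e)) \<longlonglongrightarrow> ((1 / pa) * (1 - 0), e)"
      by (intro tendsto_intros LIMSEQ_inverse_real_of_nat[unfolded inverse_eq_divide])
    moreover have "((1 / pa) * (1 - 1 / real (Suc n)), e) \<in> wulff \<phi>" for n
    proof -
      have "0 \<le> (1 / pa) * (1 - 1 / real (Suc n))" using M by simp
      moreover have "(1 / pa) * (1 - 1 / real (Suc n)) < (1 / pa) * 1" using M by (intro mult_strict_left_mono) auto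
      ultimately show ?thesis using ge[of "(1 / pa) * (1 - 1 / real (Suc n))"] e
        unfolding wulff_prof by auto
    qed
    ultimately show ?thesis using closed_sequentially[OF wulff_closed] by fastforce
  qed
  then have pe: "prof (1 / pa) \<ge> e" using e by (auto simp: wulff_prof)
  have "closed_segment (1/pa, 0) (1/pa, e) \<subseteq> frontier (wulff \<phi>)"
  proof
    fix z assume "z \<in> closed_segment (1/pa, 0) (1/pa, e)"
    then obtain u where u: "0 \<le> u" "u \<le> 1" "z = (1 - u) *\<^sub>R (1/pa, 0) + u *\<^sub>R (1/pa, e)"
      by (auto simp: in_segment)
    have "u / pa + (1 - u) / pa = 1 / pa" by (simp add: add_divide_distrib[symmetric])
    then have z: "z = (1/pa, u * e)" using u by simp
    have ue: "0 \<le> u * e" "u * e \<le> e" using u e by (auto simp: mult_left_le_one_le)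
    have "z \<in> wulff \<phi>" unfolding z wulff_prof using pe ue M by auto
    moreover have "z \<notin> interior (wulff \<phi>)"
    proof
      assume "z \<in> interior (wulff \<phi>)"
      then obtain r where r: "r > 0" "cball z r \<subseteq> wulff \<phi>" by (meson mem_interior_cball)
      have "(1/pa + r, u * e) \<in> cball z r" using r z by (simp add: dist_Pair_Pair dist_real_def)
      then show False using r wulff_bounds(1)[of "1/pa + r" "u * e"] M by auto
    qed
    ultimately show "z \<in> frontier (wulff \<phi>)" by (simp add: frontier_def wulff_closed)
  qed
  then show False using nv e unfolding no_vertical_facets_def by blast
qed

text \<open>The dual anisotropy at \<open>(t, 1)\<close>, hence by symmetry also at \<open>(- t, 1)\<close>.\<close>

definition supp :: "real \<Rightarrow> real" where
  "supp t = (SUP z\<in>wulff \<phi>. fst z * t + snd z)"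

lemma supp_ge: "(x, y) \<in> wulff \<phi> \<Longrightarrow> x * t + y \<le> supp t"
proof -
  assume a: "(x, y) \<in> wulff \<phi>"
  have "bounded ((\<lambda>z. fst z * t + snd z) ` wulff \<phi>)"
    by (intro compact_imp_bounded compact_continuous_image wulff_compact) (auto intro!: continuous_intros)
  then have b: "bdd_above ((\<lambda>z. fst z * t + snd z) ` wulff \<phi>)" by (rule bounded_imp_bdd_above)
  show ?thesis unfolding supp_def using cSUP_upper[OF a b] by simp
qed

lemma supp_ge': "\<bar>q\<bar> \<le> 1 / pa \<Longrightarrow> q * t + prof q \<le> supp t"
  by (rule supp_ge) (rule prof_props)

lemma supp_attained: "\<exists>q. \<bar>q\<bar> \<le> 1 / pa \<and> supp t = q * t + prof q"
proof -
  have "wulff \<phi> \<noteq> {}" using prof_props(1)[of 0] pa_pos by auto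
  moreover have "continuous_on (wulff \<phi>) (\<lambda>z. fst z * t + snd z)" by (intro continuous_intros)
  ultimately obtain z where z: "z \<in> wulff \<phi>" "\<And>w. w \<in> wulff \<phi> \<Longrightarrow> fst w * t + snd w \<le> fst z * t + snd z"
    using continuous_attains_sup[OF wulff_compact] by blast
  obtain q y where qy: "z = (q, y)" by force
  have q: "\<bar>q\<bar> \<le> 1/pa" "\<bar>y\<bar> \<le> prof q" using z(1) unfolding qy wulff_prof by auto
  have "supp t \<le> q * t + y" unfolding supp_def
    using z by (intro cSUP_least) (auto simp: qy)
  also have "\<dots> \<le> q * t + prof q" using q by simp
  finally show ?thesis using supp_ge'[OF q(1), of t] q(1) by (auto intro!: exI[of _ q])
qed

definition sel :: "real \<Rightarrow> real" where
  "sel t = (SOME q. \<bar>q\<bar> \<le> 1 / pa \<and> supp t = q * t + prof q)"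

lemma sel: "\<bar>sel t\<bar> \<le> 1 / pa" "supp t = sel t * t + prof (sel t)"
  using someI_ex[OF supp_attained[of t]] by (auto simp: sel_def)

text \<open>\<open>sel t\<close> is a subgradient of the convex function \<open>supp\<close> at
  \<open>t\<close>, so adding the two optimality inequalities gives monotonicity. Its purpose is
  measurability: a monotone selection is Borel.\<close>

lemma sel_mono: "mono sel"
proof (rule monoI, rule ccontr)
  fix s t :: real assume "s \<le> t" "\<not> sel s \<le> sel t"
  then have lt: "sel t < sel s" "s < t" by (auto simp: less_le)
  have "sel t * s + prof (sel t) \<le> sel s * s + prof (sel s)" using supp_ge'[OF sel(1)[of t], of s] sel(2)[of s] by simp
  moreover have "sel s * t + prof (sel s) \<le> sel t * t + prof (sel t)" using supp_ge'[OF sel(1)[of s], of t] sel(2)[of t] by simp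
  ultimately have "(sel s - sel t) * (t - s) \<le> 0" by (simp add: algebra_simps)
  then show False using lt by (simp add: mult_le_0_iff)
qed

lemma supp_lipschitz: "supp s \<le> supp t + \<bar>s - t\<bar> / pa"
proof -
  have "supp s = sel s * t + prof (sel s) + sel s * (s - t)" using sel(2)[of s] by (simp add: algebra_simps)
  moreover have "sel s * (s - t) \<le> (1 / pa) * \<bar>s - t\<bar>"
  proof -
    have "sel s * (s - t) \<le> \<bar>sel s\<bar> * \<bar>s - t\<bar>" by (simp add: abs_mult[symmetric])
    also have "\<dots> \<le> (1 / pa) * \<bar>s - t\<bar>" by (intro mult_right_mono sel) auto
    finally show ?thesis .
  qed
  ultimately show ?thesis using supp_ge'[OF sel(1)[of s], of t] by simp
qed

lemma supp_continuous: "continuous_on S supp"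
proof -
  have "(1 / pa)-lipschitz_on UNIV supp"
  proof (rule lipschitz_onI)
    fix x y show "dist (supp x) (supp y) \<le> (1 / pa) * dist x y"
      using supp_lipschitz[of x y] supp_lipschitz[of y x] by (auto simp: dist_real_def abs_le_iff abs_minus_commute)
  qed (use pa_pos in simp)
  then show ?thesis using lipschitz_on_continuous_on continuous_on_subset by blast
qed

lemma supp_even: "supp (- t) = supp t"
proof -
  have "supp (- t) \<le> supp t" for t
  proof -
    have "supp (- t) = (- sel (- t)) * t + prof (- sel (- t))" using sel(2)[of "-t"] by (simp add: prof_even)
    also have "\<dots> \<le> supp t" using sel(1)[of "-t"] by (intro supp_ge') auto
    finally show ?thesis .
  qed
  from this[of t] this[of "-t"] show ?thesis by simp
qed

text \<open>The contact point may be reflected into the right half of the shape, where a larger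
  slope gives a larger value. This is why clamping a function does not raise its variation.\<close>

lemma supp_mono: assumes "\<bar>s\<bar> \<le> \<bar>t\<bar>" shows "supp s \<le> supp t"
proof -
  have e: "supp \<bar>t\<bar> = supp t" using supp_even[of t] by (simp add: abs_if)
  have "sel s * s \<le> \<bar>sel s\<bar> * \<bar>s\<bar>" by (simp add: abs_mult[symmetric])
  also have "\<dots> \<le> \<bar>sel s\<bar> * \<bar>t\<bar>" using assms by (intro mult_left_mono) auto
  finally have "sel s * s + prof (sel s) \<le> \<bar>sel s\<bar> * \<bar>t\<bar> + prof \<bar>sel s\<bar>"
    using prof_even[of "sel s"] by (auto simp: abs_if split: if_splits)
  also have "\<dots> \<le> supp \<bar>t\<bar>" using sel(1)[of s] by (intro supp_ge') auto
  finally show ?thesis using sel(2)[of s] e by simp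
qed

lemma supp_ge_abs: "\<bar>t\<bar> / pa \<le> supp t"
proof -
  have "1 / pa * \<bar>t\<bar> + prof (1 / pa) \<le> supp \<bar>t\<bar>" using pa_pos by (intro supp_ge') auto
  moreover have "supp \<bar>t\<bar> = supp t" using supp_even[of t] by (simp add: abs_if)
  ultimately show ?thesis using prof_props(2)[of "1 / pa"] pa_pos by auto
qed

lemma supp_0: "supp 0 = 1 / pb"
  using sel[of 0] prof_le[of "sel 0"] supp_ge'[of 0 0] prof_0 pa_pos by (auto intro: antisym)

lemma supp_le: "supp t \<le> \<bar>t\<bar> / pa + 1 / pb"
  using supp_lipschitz[of t 0] supp_0 by simp

text \<open>The threshold on \<open>x\<close> is minus the slope of the chord of the profile over
  \<open>[q1, q0]\<close>. For such \<open>x\<close> the concave function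
  \<open>q * x + prof q\<close> does not decrease up to \<open>q1\<close>, so a maximizer lies at or
  to the right of \<open>q1\<close>, and it is a subgradient of \<open>supp\<close> at
  \<open>x\<close>.\<close>

lemma supp_increment_ge:
  assumes q: "-1/pa \<le> q1" "q1 < q0" "q0 \<le> 1/pa" and s: "(prof q1 - prof q0) / (q0 - q1) \<le> x" and xy: "x \<le> y"
  shows "supp y - supp x \<ge> q1 * (y - x)"
proof -
  obtain q where q': "q1 \<le> q" "\<bar>q\<bar> \<le> 1/pa" "supp x = q * x + prof q"
  proof (cases "q1 \<le> sel x")
    case True
    then show ?thesis using that[of "sel x"] sel[of x] by blast
  next
    case False
    have q1: "\<bar>q1\<bar> \<le> 1 / pa" using q by auto
    have "(prof q0 - prof q1) / (q0 - q1) \<le> (prof q1 - prof (sel x)) / (q1 - sel x)"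
      using False q sel(1)[of x] by (intro prof_slopes) auto
    moreover have "(prof q0 - prof q1) / (q0 - q1) \<ge> - x"
      using s by (simp add: minus_divide_left[symmetric] diff_divide_distrib)
    ultimately have "- x \<le> (prof q1 - prof (sel x)) / (q1 - sel x)" by linarith
    then have "- x * (q1 - sel x) \<le> prof q1 - prof (sel x)" using False by (simp add: pos_le_divide_eq)
    then have "supp x \<le> q1 * x + prof q1" using sel(2)[of x] by (simp add: algebra_simps)
    then have "supp x = q1 * x + prof q1" using supp_ge'[OF q1, of x] by simp
    then show ?thesis using that[of q1] q1 by simp
  qed
  have "supp y \<ge> q * y + prof q" using q' by (intro supp_ge')
  then have "supp y - supp x \<ge> q * (y - x)" using q' by (simp add: algebra_simps)
  moreover have "q * (y - x) \<ge> q1 * (y - x)" using q' xy by (intro mult_right_mono) auto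
  ultimately show ?thesis by simp
qed

text \<open>The mirror image of \<open>supp_increment_ge\<close>: negate slopes and abscissae and
  use that \<open>supp\<close> and \<open>prof\<close> are even.\<close>

lemma supp_increment_le:
  assumes q: "-1/pa \<le> q1" "q1 < q0" "q0 \<le> 1/pa" and s: "x \<le> (prof q1 - prof q0) / (q0 - q1)" and xy: "y \<le> x"
  shows "supp x - supp y \<le> q0 * (x - y)"
proof -
  have "supp (- y) - supp (- x) \<ge> (- q0) * (- y - - x)"
  proof (rule supp_increment_ge[where ?q0.0 = "- q1"])
    show "(prof (- q0) - prof (- q1)) / (- q1 - - q0) \<le> - x"
      using s by (simp add: prof_even minus_divide_left[symmetric] diff_divide_distrib)
  qed (use q xy in auto)
  then show ?thesis by (simp add: supp_even algebra_simps)
qed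

text \<open>The calibration inequality on one window of length \<open>\<delta>\<close>. The slope of
  the arc over the window is exactly the threshold of the two preceding lemmas. If the removed part
  grows, the truncated function ends on the arc and the subgradient \<open>q1\<close> is available;
  if it shrinks, it starts on the arc and \<open>q0\<close> is. Using \<open>q0\<close> in both
  cases costs \<open>K * \<bar>d1 - d0\<bar>\<close>, since
  \<open>(q0 - q1) / \<delta> = K\<close>.\<close>

lemma supp_truncation_increment:
  fixes K \<delta> :: real
  assumes d: "\<delta> > 0" and K: "K > 0" and q: "-1/pa \<le> q1" "q0 \<le> 1/pa" "q0 - q1 = K * \<delta>"
    and psi: "\<psi>1 - \<psi>0 = (prof q1 - prof q0) / K"
    and v: "v0 = u0 - d0" "v1 = u1 - d1" "d0 = max 0 (u0 - \<psi>0)" "d1 = max 0 (u1 - \<psi>1)"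
  shows "supp ((u1 - u0) / \<delta>) - supp ((v1 - v0) / \<delta>) \<ge> q0 * ((d1 - d0) / \<delta>) - K * \<bar>d1 - d0\<bar>"
proof -
  have lt: "q1 < q0" using q d K by (metis diff_gt_0_iff_gt mult_pos_pos)
  have sl: "(prof q1 - prof q0) / (q0 - q1) = (\<psi>1 - \<psi>0) / \<delta>" using psi q(3) K d by simp
  have iff: "(\<psi>1 - \<psi>0) / \<delta> = (prof q1 - prof q0) / (q0 - q1)" using sl ..
  have diff: "(u1 - u0) / \<delta> - (v1 - v0) / \<delta> = (d1 - d0) / \<delta>" using v(1,2) by (simp add: diff_divide_distrib)
  consider "d1 = d0" | "d1 > d0" | "d1 < d0" by linarith
  then show ?thesis
  proof cases
    case 1
    then show ?thesis using v by simp
  next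
    case 2
    then have "v1 = \<psi>1" "v0 \<le> \<psi>0" using v by (auto simp: max_def split: if_splits)
    then have "(\<psi>1 - \<psi>0) / \<delta> \<le> (v1 - v0) / \<delta>" using d by (simp add: divide_right_mono)
    moreover have "(v1 - v0) / \<delta> \<le> (u1 - u0) / \<delta>" using v 2 d by (intro divide_right_mono) auto
    ultimately have "supp ((u1 - u0) / \<delta>) - supp ((v1 - v0) / \<delta>) \<ge> q1 * ((u1 - u0) / \<delta> - (v1 - v0) / \<delta>)"
      using q(1,2) lt unfolding iff by (intro supp_increment_ge[of q1 q0])
    moreover have "q1 * ((d1 - d0) / \<delta>) = q0 * ((d1 - d0) / \<delta>) - K * \<bar>d1 - d0\<bar>"
    proof -
      have "q1 = q0 - K * \<delta>" using q by simp
      then show ?thesis using 2 d by (simp only:) (simp add: field_simps)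
    qed
    ultimately show ?thesis by (simp add: diff)
  next
    case 3
    then have "v0 = \<psi>0" "v1 \<le> \<psi>1" using v by (auto simp: max_def split: if_splits)
    then have "(\<psi>1 - \<psi>0) / \<delta> \<ge> (v1 - v0) / \<delta>" using d by (simp add: divide_right_mono)
    moreover have "(v1 - v0) / \<delta> \<ge> (u1 - u0) / \<delta>" using v 3 d by (intro divide_right_mono) auto
    ultimately have "supp ((v1 - v0) / \<delta>) - supp ((u1 - u0) / \<delta>) \<le> q0 * ((v1 - v0) / \<delta> - (u1 - u0) / \<delta>)"
      using q(1,2) lt unfolding iff by (intro supp_increment_le[of q1 q0])
    also have "\<dots> = - (q0 * ((d1 - d0) / \<delta>))" using diff by (metis minus_diff_eq mult_minus_right)
    finally have "supp ((u1 - u0) / \<delta>) - supp ((v1 - v0) / \<delta>) \<ge> q0 * ((d1 - d0) / \<delta>)" by simp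
    then show ?thesis using K by (smt (verit) abs_ge_zero mult_nonneg_nonneg)
  qed
qed

end

section \<open>Difference quotients and the anisotropic variation\<close>

lemma antiderivative_exists:
  fixes f :: "real \<Rightarrow> 'a::euclidean_space"
  assumes "continuous_on UNIV f"
  shows "\<exists>F. \<forall>x. (F has_vector_derivative f x) (at x)"
  using einterval_antiderivative[of "-\<infinity>" "\<infinity>" f] assms
  by (auto simp: continuous_on_eq_continuous_at)

lemma lborel_integral_shift:
  fixes f :: "real \<Rightarrow> real"
  shows "(LINT s|lborel. f (s + t)) = (LINT s|lborel. f s)"
  using lborel_integral_real_affine[of 1 f t] by (simp add: add.commute)

lemma lborel_integrable_shift:
  fixes f :: "real \<Rightarrow> real"
  assumes "integrable lborel f"
  shows "integrable lborel (\<lambda>s. f (s + t))"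
  using lborel_integrable_real_affine[of f 1 t] assms by (simp add: add.commute)

lemma integrable_mult_bounded:
  fixes u f :: "'a \<Rightarrow> real"
  assumes "integrable M u" "f \<in> borel_measurable M" "\<And>x. \<bar>f x\<bar> \<le> C"
  shows "integrable M (\<lambda>x. u x * f x)"
proof (rule Bochner_Integration.integrable_bound)
  show "integrable M (\<lambda>x. C * \<bar>u x\<bar>)" using assms by auto
  show "(\<lambda>x. u x * f x) \<in> borel_measurable M" using assms by measurable
  have "\<bar>u x\<bar> * \<bar>f x\<bar> \<le> C * \<bar>u x\<bar>" for x
    using mult_left_mono[OF assms(3)[of x], of "\<bar>u x\<bar>"] by (simp add: mult.commute)
  then show "AE x in M. norm (u x * f x) \<le> norm (C * \<bar>u x\<bar>)"
    by (intro AE_I2) (metis abs_mult order_trans abs_ge_self real_norm_def)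
qed

lemma compact_subset_interval:
  fixes a b :: real
  assumes "compact K" "K \<subseteq> {a<..<b}" "a < b"
  obtains c d where "a < c" "c \<le> d" "d < b" "K \<subseteq> {c..d}"
proof (cases "K = {}")
  case True
  then show ?thesis using that[of "(a+b)/2" "(a+b)/2"] assms by auto
next
  case False
  have b: "bdd_below K" "bdd_above K"
    using assms by (auto simp: compact_imp_bounded bounded_imp_bdd_below bounded_imp_bdd_above)
  have "Inf K \<in> K" "Sup K \<in> K"
    using False assms b by (auto intro!: closed_contains_Inf closed_contains_Sup compact_imp_closed)
  moreover have "K \<subseteq> {Inf K..Sup K}" using b by (auto intro: cInf_lower cSup_upper)
  ultimately show ?thesis using that[of "Inf K" "Sup K"] assms(2) by fastforce
qed

lemma C1c_intervalI:
  fixes h :: "real \<Rightarrow> 'b::real_normed_vector"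
  assumes "\<And>s. (h has_vector_derivative h' s) (at s)" "continuous_on UNIV h'"
    and "a < c" "d < b" "\<And>s. s \<notin> {c..d} \<Longrightarrow> h s = 0"
  shows "h \<in> C1c {a<..<b}"
proof -
  have "{x. h x \<noteq> 0} \<subseteq> {c..d}" using assms(5) by blast
  then have c: "closure {x. h x \<noteq> 0} \<subseteq> {c..d}" by (intro closure_minimal) auto
  have "compact (closure {x. h x \<noteq> 0})"
    using c by (metis bounded_closed_interval bounded_subset closed_closure compact_eq_bounded_closed)
  moreover have "closure {x. h x \<noteq> 0} \<subseteq> {a<..<b}" using c assms(3,4) by auto
  moreover have "\<forall>x. (h has_derivative blinfun_apply (blinfun_scaleR_left (h' x))) (at x)"
    using assms(1) by (simp add: has_vector_derivative_def)
  moreover have "continuous_on UNIV (\<lambda>x. blinfun_scaleR_left (h' x))"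
    by (intro bounded_linear.continuous_on[OF bounded_linear_blinfun_scaleR_left] assms(2))
  ultimately show ?thesis unfolding C1c_def mem_Collect_eq
    by (intro conjI exI[of _ "\<lambda>x. blinfun_scaleR_left (h' x)"]) simp_all
qed

lemma C1c_intervalE:
  fixes h :: "real \<Rightarrow> 'b::real_normed_vector"
  assumes "h \<in> C1c {a<..<b}" "a < b"
  obtains h' c d where "\<And>s. (h has_vector_derivative h' s) (at s)" "continuous_on UNIV h'"
    "a < c" "c \<le> d" "d < b" "\<And>s. s \<notin> {c..d} \<Longrightarrow> h s = 0" "\<And>s. s \<notin> {c..d} \<Longrightarrow> h' s = 0"
proof -
  obtain D where D: "\<And>x. (h has_derivative blinfun_apply (D x)) (at x)" "continuous_on UNIV D"
    using assms(1) unfolding C1c_def by auto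
  let ?K = "closure {x. h x \<noteq> 0}"
  obtain c d where cd: "a < c" "c \<le> d" "d < b" "?K \<subseteq> {c..d}"
    using compact_subset_interval[of ?K a b] assms unfolding C1c_def by auto
  have 1: "(h has_vector_derivative blinfun_apply (D s) 1) (at s)" for s
  proof -
    have eq: "blinfun_apply (D s) = (\<lambda>x. x *\<^sub>R blinfun_apply (D s) 1)"
    proof
      fix x show "blinfun_apply (D s) x = x *\<^sub>R blinfun_apply (D s) 1"
        using blinfun.scaleR_right[of "D s" x 1] by (simp only: real_scaleR_def mult_1_right)
    qed
    show ?thesis unfolding has_vector_derivative_def by (rule has_derivative_eq_rhs[OF D(1) eq])
  qed
  have 2: "continuous_on UNIV (\<lambda>s. blinfun_apply (D s) 1)" by (intro continuous_intros D)
  have z: "h s = 0" if "s \<notin> {c..d}" for s using that subsetD[OF cd(4), of s] subsetD[OF closure_subset, of s "{x. h x \<noteq> 0}"] by blast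
  have z': "blinfun_apply (D s) 1 = 0" if "s \<notin> {c..d}" for s
  proof -
    have "((\<lambda>_. 0) has_vector_derivative 0) (at s)" by simp
    then have "(h has_vector_derivative 0) (at s)"
      by (rule has_vector_derivative_transform_within_open[where S="- {c..d}"]) (use that z in auto)
    then show ?thesis using 1[of s] vector_derivative_at by metis
  qed
  show ?thesis using that[OF 1 2 cd(1-3) z z'] by blast
qed

definition diffq :: "(real \<Rightarrow> real) \<Rightarrow> real \<Rightarrow> real \<Rightarrow> real" where
  "diffq u \<delta> s = (u (s + \<delta>) - u s) / \<delta>"

lemma diffq_integrable: "integrable lborel u \<Longrightarrow> integrable lborel (diffq u \<delta>)"
  unfolding diffq_def by (intro integrable_divide Bochner_Integration.integrable_diff lborel_integrable_shift)

lemma measurable_lborel_lebesgue: "f \<in> borel_measurable lborel \<Longrightarrow> f \<in> borel_measurable lebesgue"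
  by (rule measurable_completion)

context monotone_anisotropy
begin

text \<open>The range stops at \<open>b - \<delta>\<close> so that both points of every difference
  quotient lie in the interval on which the variation is taken.\<close>

definition DQ :: "real \<Rightarrow> real \<Rightarrow> (real \<Rightarrow> real) \<Rightarrow> real \<Rightarrow> real" where
  "DQ a b u \<delta> = (LINT s:{a<..<b - \<delta>}|lborel. supp (diffq u \<delta> s))"

lemma supp_measurable [measurable]: "supp \<in> borel_measurable borel"
  by (intro borel_measurable_continuous_onI supp_continuous)

lemma supp_nonneg: "0 \<le> supp t"
proof -
  have "0 \<le> \<bar>t\<bar> / pa" using pa_pos by simp
  with supp_ge_abs[of t] show ?thesis by linarith
qed

lemma supp_diffq_integrable:
  assumes [measurable]: "integrable lborel u"
  shows "set_integrable lborel {c<..<d} (\<lambda>s. supp (diffq u \<delta> s))"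
  unfolding set_integrable_def
proof (rule Bochner_Integration.integrable_bound)
  have [measurable]: "diffq u \<delta> \<in> borel_measurable lborel" using diffq_integrable[OF assms] by auto
  show "integrable lborel (\<lambda>s. \<bar>diffq u \<delta> s\<bar> / pa + indicator {c<..<d} s * (1 / pb))"
  proof (intro Bochner_Integration.integrable_add integrable_mult_left)
    have "emeasure lborel {c<..<d} < \<infinity>" by (cases "c \<le> d") (simp_all add: less_top[symmetric])
    then show "integrable lborel (indicator {c<..<d} :: real \<Rightarrow> real)"
      by (intro integrable_real_indicator) (auto simp: less_top[symmetric])
  qed (use diffq_integrable[OF assms] in auto)
  show "(\<lambda>x. indicator {c<..<d} x *\<^sub>R supp (diffq u \<delta> x)) \<in> borel_measurable lborel" by measurable
  show "AE x in lborel. norm (indicator {c<..<d} x *\<^sub>R supp (diffq u \<delta> x))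
           \<le> norm (\<bar>diffq u \<delta> x\<bar> / pa + indicator {c<..<d} x * (1 / pb))"
  proof (rule AE_I2)
    fix x
    show "norm (indicator {c<..<d} x *\<^sub>R supp (diffq u \<delta> x)) \<le> norm (\<bar>diffq u \<delta> x\<bar> / pa + indicator {c<..<d} x * (1 / pb))"
      using supp_le[of "diffq u \<delta> x"] supp_nonneg[of "diffq u \<delta> x"] pa_pos pb_pos by (auto simp: indicator_def)
  qed
qed

text \<open>Moves the energy of a test field from \<open>lebesgue\<close> on the interval to
  \<open>lborel\<close> on the line, where translation invariance is at hand; the field and its
  derivative vanish outside \<open>[c, d]\<close>.\<close>

lemma test_energy_eq:
  assumes u: "integrable lborel u" and d: "\<And>s. (h has_vector_derivative h' s) (at s)" "continuous_on UNIV h'"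
    and s: "a < c" "c \<le> d" "d < b" "\<And>s. s \<notin> {c..d} \<Longrightarrow> h s = 0" "\<And>s. s \<notin> {c..d} \<Longrightarrow> h' s = (0::plane)"
  shows "(LINT s:{a<..<b}|lebesgue. u s * deriv (\<lambda>t. fst (h t)) s + snd (h s)) =
     (LINT s|lborel. u s * fst (h' s)) + (LINT s|lborel. snd (h s))"
    "integrable lborel (\<lambda>s. u s * fst (h' s))" "integrable lborel (\<lambda>s. snd (h s))"
    "\<exists>B. \<forall>s. \<bar>fst (h' s)\<bar> \<le> B"
proof -
  have dv: "deriv (\<lambda>t. fst (h t)) s = fst (h' s)" for s
  proof -
    have "((\<lambda>t. fst (h t)) has_real_derivative fst (h' s)) (at s)"
      unfolding has_real_derivative_iff_has_vector_derivative
      by (rule bounded_linear.has_vector_derivative[OF bounded_linear_fst d(1)])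
    then show ?thesis by (rule DERIV_imp_deriv)
  qed
  have hc: "continuous_on UNIV h"
    using d(1) by (meson continuous_at_imp_continuous_on has_vector_derivative_continuous)
  have [measurable]: "h \<in> borel_measurable borel" "h' \<in> borel_measurable borel" "u \<in> borel_measurable borel"
    using hc d(2) u by (auto intro: borel_measurable_continuous_onI)
  have [measurable]: "(\<lambda>s. fst (h' s)) \<in> borel_measurable borel" "(\<lambda>s. snd (h s)) \<in> borel_measurable borel"
    by (auto intro!: borel_measurable_continuous_onI continuous_intros hc d(2))
  have "compact ((\<lambda>s. fst (h' s)) ` {c..d})"
    by (intro compact_continuous_image) (auto intro!: continuous_intros continuous_on_subset[OF d(2)])
  then obtain B where "\<And>s. s \<in> {c..d} \<Longrightarrow> \<bar>fst (h' s)\<bar> \<le> B"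
    using compact_imp_bounded[of "(\<lambda>s. fst (h' s)) ` {c..d}"] unfolding bounded_iff by (metis image_eqI real_norm_def)
  then have B: "\<bar>fst (h' s)\<bar> \<le> max B 0" for s using s(5)[of s] by (cases "s \<in> {c..d}") (auto simp: le_max_iff_disj)
  then show "\<exists>B. \<forall>s. \<bar>fst (h' s)\<bar> \<le> B" by blast
  show i1: "integrable lborel (\<lambda>s. u s * fst (h' s))"
    by (rule integrable_mult_bounded[OF u _ B]) measurable
  have "integrable lborel (\<lambda>s. indicator {c..d} s *\<^sub>R snd (h s))"
    by (intro borel_integrable_compact) (auto intro!: continuous_intros continuous_on_subset[OF hc])
  moreover have "indicator {c..d} s *\<^sub>R snd (h s) = snd (h s)" for s by (cases "s \<in> {c..d}") (use s(4)[of s] in simp_all)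
  ultimately show i2: "integrable lborel (\<lambda>s. snd (h s))" by (simp only:)
  have "(LINT s:{a<..<b}|lebesgue. u s * deriv (\<lambda>t. fst (h t)) s + snd (h s))
      = (LINT s|lebesgue. u s * fst (h' s) + snd (h s))"
    unfolding set_lebesgue_integral_def
  proof (rule Bochner_Integration.integral_cong)
    fix x show "indicator {a<..<b} x *\<^sub>R (u x * deriv (\<lambda>t. fst (h t)) x + snd (h x)) = u x * fst (h' x) + snd (h x)"
      using s(1-3) s(4,5)[of x] by (cases "x \<in> {c..d}") (auto simp: dv indicator_def)
  qed simp
  also have "\<dots> = (LINT s|lborel. u s * fst (h' s) + snd (h s))"
    by (intro integral_completion) measurable
  also have "\<dots> = (LINT s|lborel. u s * fst (h' s)) + (LINT s|lborel. snd (h s))"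
    using i1 i2 by simp
  finally show "(LINT s:{a<..<b}|lebesgue. u s * deriv (\<lambda>t. fst (h t)) s + snd (h s)) =
     (LINT s|lborel. u s * fst (h' s)) + (LINT s|lborel. snd (h s))" .
qed

text \<open>For a fixed test field \<open>h\<close> the difference quotient is shifted from
  \<open>v\<close> to \<open>h\<close>. The integrand becomes
  \<open>- fst (h s) * diffq v (\<delta> k) s + snd (h s)\<close>, which is at most
  \<open>supp (diffq v (\<delta> k) s)\<close> because the reflected value of \<open>h\<close> lies
  in the Wulff shape. As \<open>\<delta> k\<close> tends to \<open>0\<close>, the quotients of
  \<open>h\<close> converge boundedly to its derivative.\<close>

lemma variation_le_liminf_DQ:
  assumes v: "integrable lborel v" and ab: "a < b" and \<delta>: "\<And>k. \<delta> k > 0" "\<delta> \<longlonglongrightarrow> 0"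
    and R: "\<And>e. e > 0 \<Longrightarrow> \<forall>\<^sub>F k in sequentially. DQ a b v (\<delta> k) \<le> R + e"
  shows "anisotropic_variation \<phi> {a<..<b} v \<le> ereal R"
  unfolding anisotropic_variation_def
proof (rule SUP_least, clarify)
  fix h assume h: "h \<in> C1c {a<..<b}" "\<forall>s. \<phi> (h s) \<le> 1"
  obtain h' c d where d: "\<And>s. (h has_vector_derivative h' s) (at s)" "continuous_on UNIV h'"
    and s: "a < c" "c \<le> d" "d < b" "\<And>s. s \<notin> {c..d} \<Longrightarrow> h s = 0" "\<And>s. s \<notin> {c..d} \<Longrightarrow> h' s = 0"
    using C1c_intervalE[OF h(1) ab] by blast
  note te = test_energy_eq[OF v d s]
  obtain B where B: "\<And>s. \<bar>fst (h' s)\<bar> \<le> B" using te(4) by blast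
  have hc: "continuous_on UNIV h"
    using d(1) by (meson continuous_at_imp_continuous_on has_vector_derivative_continuous)
  have [measurable]: "(\<lambda>s. fst (h' s)) \<in> borel_measurable borel" "(\<lambda>s. snd (h s)) \<in> borel_measurable borel"
     "(\<lambda>s. fst (h s)) \<in> borel_measurable borel" "v \<in> borel_measurable borel"
    using v by (auto intro!: borel_measurable_continuous_onI continuous_intros hc d(2))
  have fd: "((\<lambda>t. fst (h t)) has_real_derivative fst (h' s)) (at s)" for s
    unfolding has_real_derivative_iff_has_vector_derivative
    by (rule bounded_linear.has_vector_derivative[OF bounded_linear_fst d(1)])
  define X where "X k = (LINT s|lborel. v s * ((fst (h s) - fst (h (s - \<delta> k))) / \<delta> k))" for k
  have bd: "\<bar>(fst (h s) - fst (h (s - \<delta> k))) / \<delta> k\<bar> \<le> B" for s k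
  proof -
    have "\<exists>z>s - \<delta> k. z < s \<and> fst (h s) - fst (h (s - \<delta> k)) = (s - (s - \<delta> k)) * fst (h' z)"
      using \<delta>(1)[of k] by (intro MVT2) (auto intro: fd)
    then obtain z where "fst (h s) - fst (h (s - \<delta> k)) = \<delta> k * fst (h' z)" by auto
    then show ?thesis using B[of z] \<delta>(1)[of k] by simp
  qed
  have "X \<longlonglongrightarrow> (LINT s|lborel. v s * fst (h' s))"
    unfolding X_def
  proof (rule integral_dominated_convergence[where w="\<lambda>s. \<bar>v s\<bar> * B"])
    show "integrable lborel (\<lambda>s. \<bar>v s\<bar> * B)" using v by auto
    show "AE s in lborel. norm (v s * ((fst (h s) - fst (h (s - \<delta> i))) / \<delta> i)) \<le> \<bar>v s\<bar> * B" for i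
      using bd by (intro AE_I2) (simp only: real_norm_def abs_mult, intro mult_left_mono, auto)
    show "AE x in lborel. (\<lambda>i. v x * ((fst (h x) - fst (h (x - \<delta> i))) / \<delta> i)) \<longlonglongrightarrow> v x * fst (h' x)"
    proof (intro AE_I2 tendsto_mult tendsto_const)
      fix x
      have "((\<lambda>t. (fst (h (x + t)) - fst (h x)) / t) \<longlongrightarrow> fst (h' x)) (at 0)"
        using fd[of x] by (simp add: DERIV_def)
      moreover have "filterlim (\<lambda>i. - \<delta> i) (at 0) sequentially"
        using tendsto_minus[OF \<delta>(2)] \<delta>(1) by (auto simp: filterlim_at less_imp_neq[THEN not_sym])
      ultimately have "((\<lambda>i. (fst (h (x + - \<delta> i)) - fst (h x)) / - \<delta> i) \<longlongrightarrow> fst (h' x)) sequentially"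
        by (rule filterlim_compose)
      moreover have "(fst (h (x + - \<delta> i)) - fst (h x)) / - \<delta> i = (fst (h x) - fst (h (x - \<delta> i))) / \<delta> i" for i
        by (simp add: minus_divide_left[symmetric] diff_divide_distrib)
      ultimately show "(\<lambda>i. (fst (h x) - fst (h (x - \<delta> i))) / \<delta> i) \<longlonglongrightarrow> fst (h' x)" by simp
    qed
  qed measurable
  then have lim: "(\<lambda>k. X k + (LINT s|lborel. snd (h s))) \<longlonglongrightarrow> (LINT s|lborel. v s * fst (h' s)) + (LINT s|lborel. snd (h s))"
    by (intro tendsto_add tendsto_const)
  obtain C where C: "\<And>s. \<bar>fst (h s)\<bar> \<le> C"
    using wulff_bounds(1) h(2) by (metis prod.collapse wulff_iff)
  have key: "\<forall>\<^sub>F k in sequentially. X k + (LINT s|lborel. snd (h s)) \<le> DQ a b v (\<delta> k)"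
  proof -
    \<comment> \<open>From then on the support \<open>[c, d]\<close> of \<open>h\<close> is
      contained in the range of integration of \<open>DQ\<close>.\<close>
    have "\<forall>\<^sub>F k in sequentially. \<delta> k < b - d" using \<delta>(2) s(3) by (auto dest: order_tendstoD(2)[of _ _ _ "b - d"])
    then show ?thesis
    proof eventually_elim
      case (elim k)
      have iv: "integrable lborel (\<lambda>s. v s * fst (h s))" "integrable lborel (\<lambda>s. v (s + \<delta> k) * fst (h s))" "integrable lborel (\<lambda>s. v s * fst (h (s - \<delta> k)))"
        using v C by (auto intro!: integrable_mult_bounded[of _ _ _ C] lborel_integrable_shift)
      have sh: "(LINT s|lborel. v s * fst (h (s - \<delta> k))) = (LINT s|lborel. v (s + \<delta> k) * fst (h s))"
        using lborel_integral_shift[of "\<lambda>s. v s * fst (h (s - \<delta> k))" "\<delta> k"] by simp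
      have "X k = (LINT s|lborel. (v s * fst (h s) - v s * fst (h (s - \<delta> k))) / \<delta> k)"
        unfolding X_def by (intro Bochner_Integration.integral_cong) (auto simp: algebra_simps)
      also have "\<dots> = ((LINT s|lborel. v s * fst (h s)) - (LINT s|lborel. v (s + \<delta> k) * fst (h s))) / \<delta> k"
        using iv sh by simp
      also have "\<dots> = (LINT s|lborel. (v s * fst (h s) - v (s + \<delta> k) * fst (h s)) / \<delta> k)"
        using iv by simp
      also have "\<dots> = (LINT s|lborel. - fst (h s) * diffq v (\<delta> k) s)"
        by (intro Bochner_Integration.integral_cong) (auto simp: diffq_def field_simps)
      finally have X: "X k = (LINT s|lborel. - fst (h s) * diffq v (\<delta> k) s)" .
      have i3: "integrable lborel (\<lambda>s. - fst (h s) * diffq v (\<delta> k) s)"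
      proof -
        have "integrable lborel (\<lambda>s. (v s * fst (h s) - v (s + \<delta> k) * fst (h s)) / \<delta> k)" using iv by auto
        moreover have "(v s * fst (h s) - v (s + \<delta> k) * fst (h s)) / \<delta> k = - fst (h s) * diffq v (\<delta> k) s" for s
          by (auto simp: diffq_def field_simps)
        ultimately show ?thesis by simp
      qed
      have "X k + (LINT s|lborel. snd (h s)) = (LINT s|lborel. - fst (h s) * diffq v (\<delta> k) s + snd (h s))"
        unfolding X using i3 te(3) by simp
      also have "\<dots> \<le> DQ a b v (\<delta> k)"
        unfolding DQ_def set_lebesgue_integral_def
      proof (rule integral_mono)
        show "integrable lborel (\<lambda>s. - fst (h s) * diffq v (\<delta> k) s + snd (h s))" using i3 te(3) by (intro Bochner_Integration.integrable_add)
        show "integrable lborel (\<lambda>x. indicator {a<..<b - \<delta> k} x *\<^sub>R supp (diffq v (\<delta> k) x))"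
          using supp_diffq_integrable[OF v] by (simp add: set_integrable_def)
        fix x
        show "- fst (h x) * diffq v (\<delta> k) x + snd (h x) \<le> indicator {a<..<b - \<delta> k} x *\<^sub>R supp (diffq v (\<delta> k) x)"
        proof (cases "x \<in> {c..d}")
          case True
          then have "x \<in> {a<..<b - \<delta> k}" using s elim by auto
          moreover have "(- fst (h x), snd (h x)) \<in> wulff \<phi>"
            using h(2) phi_reflect(1)[of "fst (h x)" "snd (h x)"] by (simp add: wulff_iff)
          ultimately show ?thesis using supp_ge[of "- fst (h x)" "snd (h x)" "diffq v (\<delta> k) x"] by simp
        next
          case False
          then show ?thesis using s(4)[of x] supp_nonneg by (simp add: indicator_def)
        qed
      qed
      finally show ?case .
    qed
  qed
  have "(LINT s|lborel. v s * fst (h' s)) + (LINT s|lborel. snd (h s)) \<le> R + e" if "e > 0" for e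
  proof (rule tendsto_upperbound[OF lim])
    show "\<forall>\<^sub>F k in sequentially. X k + (LINT s|lborel. snd (h s)) \<le> R + e"
      using key R[OF that] by eventually_elim simp
  qed simp
  then have "(LINT s|lborel. v s * fst (h' s)) + (LINT s|lborel. snd (h s)) \<le> R"
    by (rule field_le_epsilon)
  then show "ereal (LINT s:{a<..<b}|lebesgue. v s * deriv (\<lambda>t. fst (h t)) s + snd (h s)) \<le> ereal R"
    using te(1) by simp
qed

end

text \<open>The second property is the mean value theorem for each scalar component
  \<open>w \<bullet> H s\<close>. Combined with a separating hyperplane it shows that the averages
  stay in any closed convex set containing the values of \<open>h\<close>.\<close>

lemma moving_average:
  fixes h :: "real \<Rightarrow> 'a::euclidean_space"
  assumes hc: "continuous_on UNIV h" and \<delta>: "\<delta> > 0"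
  obtains H where "\<And>s. (H has_vector_derivative (h s - h (s - \<delta>)) /\<^sub>R \<delta>) (at s)"
    "\<And>w s. \<exists>z. s - \<delta> < z \<and> z < s \<and> w \<bullet> H s = w \<bullet> h z"
proof -
  obtain P where P: "\<And>x. (P has_vector_derivative h x) (at x)" using antiderivative_exists[OF hc] by blast
  define H where "H s = (P s - P (s - \<delta>)) /\<^sub>R \<delta>" for s
  have "((\<lambda>s. P (s - \<delta>)) has_vector_derivative h (s - \<delta>)) (at s)" for s
  proof -
    have "((\<lambda>s. s - \<delta>) has_real_derivative 1) (at s)" by (auto intro!: derivative_eq_intros)
    then have "((P \<circ> (\<lambda>s. s - \<delta>)) has_vector_derivative 1 *\<^sub>R h (s - \<delta>)) (at s)"
      using P[of "s - \<delta>"] by (intro vector_diff_chain_at) (auto simp: has_real_derivative_iff_has_vector_derivative)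
    then show ?thesis by (simp add: o_def)
  qed
  then have 1: "(H has_vector_derivative (h s - h (s - \<delta>)) /\<^sub>R \<delta>) (at s)" for s
    unfolding H_def by (intro bounded_linear.has_vector_derivative[OF bounded_linear_scaleR_right] has_vector_derivative_diff P)
  have 2: "\<exists>z. s - \<delta> < z \<and> z < s \<and> w \<bullet> H s = w \<bullet> h z" for w s
  proof -
    have "((\<lambda>s. w \<bullet> P s) has_real_derivative w \<bullet> h x) (at x)" for x
      unfolding has_real_derivative_iff_has_vector_derivative
      by (rule bounded_linear.has_vector_derivative[OF bounded_linear_inner_right P])
    then have "\<exists>z>s - \<delta>. z < s \<and> w \<bullet> P s - w \<bullet> P (s - \<delta>) = (s - (s - \<delta>)) * (w \<bullet> h z)"
      using \<delta> by (intro MVT2) auto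
    then obtain z where z: "s - \<delta> < z" "z < s" "w \<bullet> P s - w \<bullet> P (s - \<delta>) = \<delta> * (w \<bullet> h z)" by auto
    then have "w \<bullet> H s = w \<bullet> h z" using \<delta> by (simp add: H_def inner_diff_right)
    then show ?thesis using z by blast
  qed
  show ?thesis using that[OF 1 2] by blast
qed

text \<open>With \<open>P\<close> an antiderivative of \<open>h\<close> and \<open>Q\<close> one of
  \<open>P\<close>, the average is a difference quotient of \<open>P\<close>, so its integral is a
  second difference of \<open>Q\<close>. Since \<open>P\<close> is constant on either side of
  \<open>[c, d]\<close>, this equals the total increment of \<open>P\<close>.\<close>

lemma integral_moving_average:
  fixes h H :: "real \<Rightarrow> real"
  assumes hc: "continuous_on UNIV h" and \<delta>: "\<delta> > 0" and s: "c \<le> d" "\<And>s. s \<notin> {c..d} \<Longrightarrow> h s = 0"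
    and H: "\<And>s. (H has_vector_derivative (h s - h (s - \<delta>)) / \<delta>) (at s)" "\<And>s. s \<notin> {c..d + \<delta>} \<Longrightarrow> H s = 0"
  shows "(LINT s|lborel. H s) = (LINT s|lborel. h s)"
proof -
  obtain P where P: "\<And>x. (P has_vector_derivative h x) (at x)" using antiderivative_exists[OF hc] by blast
  have Pc: "continuous_on UNIV P" using P by (meson continuous_at_imp_continuous_on has_vector_derivative_continuous)
  obtain Q where Q: "\<And>x. (Q has_vector_derivative P x) (at x)" using antiderivative_exists[OF Pc] by blast
  have Hc: "continuous_on UNIV H" using H(1) by (meson continuous_at_imp_continuous_on has_vector_derivative_continuous)
  \<comment> \<open>The end points \<open>c\<close> and \<open>d\<close> may be met because
    continuity forces \<open>h\<close> to vanish there as well.\<close>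
  have const: "P x = P y" if "{x..y} \<inter> {c..d} \<subseteq> {c, d}" "x < y" for x y
  proof -
    have "\<exists>z>x. z < y \<and> P y - P x = (y - x) * h z"
      using that(2) P by (intro MVT2) (auto simp: has_real_derivative_iff_has_vector_derivative)
    then obtain z where z: "x < z" "z < y" "P y - P x = (y - x) * h z" by blast
    have "h z = 0"
    proof (cases "z \<in> {c..d}")
      case True
      then have "z \<in> {x..y} \<inter> {c..d}" using z by auto
      then have "z \<in> {c, d}" using that(1) by blast
      moreover have "h c = 0"
      proof -
        have "((\<lambda>n. h (c - 1 / real (Suc n))) \<longlonglongrightarrow> h (c - 0))"
          using hc by (intro isCont_tendsto_compose[of _ h] tendsto_intros LIMSEQ_inverse_real_of_nat[unfolded inverse_eq_divide])
             (auto simp: continuous_on_eq_continuous_at)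
        moreover have "h (c - 1 / real (Suc n)) = 0" for n by (intro s(2)) auto
        ultimately show ?thesis using LIMSEQ_unique[OF _ tendsto_const[of 0]] by simp
      qed
      moreover have "h d = 0"
      proof -
        have "((\<lambda>n. h (d + 1 / real (Suc n))) \<longlonglongrightarrow> h (d + 0))"
          using hc by (intro isCont_tendsto_compose[of _ h] tendsto_intros LIMSEQ_inverse_real_of_nat[unfolded inverse_eq_divide])
             (auto simp: continuous_on_eq_continuous_at)
        moreover have "h (d + 1 / real (Suc n)) = 0" for n by (intro s(2)) auto
        ultimately show ?thesis using LIMSEQ_unique[OF _ tendsto_const[of 0]] by simp
      qed
      ultimately show ?thesis by auto
    qed (rule s(2))
    then show ?thesis using z by simp
  qed
  have low: "P x = P c" if "x \<le> c" for x
  proof -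
    have "{x..c} \<inter> {c..d} \<subseteq> {c, d}" by (auto simp del: Int_atLeastAtMost)
    then show ?thesis using const[of x c] that by (cases "x = c") auto
  qed
  have up: "P x = P d" if "x \<ge> d" for x
  proof -
    have "{d..x} \<inter> {c..d} \<subseteq> {c, d}" by (auto simp del: Int_atLeastAtMost)
    then show ?thesis using const[of d x] that by (cases "x = d") auto
  qed
  define a b where "a = c - \<delta>" and "b = d + 2 * \<delta>"
  have ab: "a < c" "d + \<delta> < b" "a \<le> b" using \<delta> s(1) by (auto simp: a_def b_def)
  have ih: "(LINT s|lborel. h s) = P b - P a"
  proof -
    have "(LINT s|lborel. h s) = (LINT s|lborel. indicator {a..b} s *\<^sub>R h s)"
    proof (rule Bochner_Integration.integral_cong)
      fix x show "h x = indicator {a..b} x *\<^sub>R h x"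
        by (cases "x \<in> {c..d}") (use s(2)[of x] ab \<delta> in auto)
    qed simp
    also have "\<dots> = P b - P a"
      by (rule integral_FTC_atLeastAtMost[OF ab(3) has_vector_derivative_at_within[OF P] continuous_on_subset[OF hc]]) auto
    finally show ?thesis .
  qed
  define G where "G s = (P s - P (s - \<delta>)) / \<delta>" for s
  have Pd: "((\<lambda>s. P (s - \<delta>)) has_real_derivative h (s - \<delta>)) (at s)" for s
    using P[of "s - \<delta>"] DERIV_shift[of P "h (s - \<delta>)" s "- \<delta>"]
    by (simp add: has_real_derivative_iff_has_vector_derivative)
  have Qd: "((\<lambda>s. Q (s - \<delta>)) has_real_derivative P (s - \<delta>)) (at s)" for s
    using Q[of "s - \<delta>"] DERIV_shift[of Q "P (s - \<delta>)" s "- \<delta>"]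
    by (simp add: has_real_derivative_iff_has_vector_derivative)
  have "((\<lambda>s. G s - H s) has_real_derivative 0) (at s)" for s
  proof -
    have "(H has_real_derivative (h s - h (s - \<delta>)) / \<delta>) (at s)"
      using H(1) by (simp add: has_real_derivative_iff_has_vector_derivative)
    moreover have "(G has_real_derivative (h s - h (s - \<delta>)) / \<delta>) (at s)"
      unfolding G_def using P[of s] Pd[of s] \<delta>
      by (auto intro!: derivative_eq_intros simp: has_real_derivative_iff_has_vector_derivative[symmetric])
    ultimately show ?thesis using DERIV_diff by fastforce
  qed
  then have "\<And>x y. G x - H x = G y - H y" using DERIV_isconst_all by blast
  moreover have "G a - H a = 0" using H(2)[of a] low[of a] low[of "a - \<delta>"] ab \<delta> by (simp add: G_def)
  ultimately have GH: "H s = G s" for s by (metis eq_iff_diff_eq_0)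
  have "(LINT s|lborel. H s) = (LINT s|lborel. indicator {a..b} s *\<^sub>R H s)"
  proof (rule Bochner_Integration.integral_cong)
    fix x show "H x = indicator {a..b} x *\<^sub>R H x"
      by (cases "x \<in> {c..d + \<delta>}") (use H(2)[of x] ab \<delta> in auto)
  qed simp
  also have "\<dots> = (Q b - Q (b - \<delta>)) / \<delta> - (Q a - Q (a - \<delta>)) / \<delta>"
  proof (rule integral_FTC_atLeastAtMost)
    fix x
    have "((\<lambda>x. (Q x - Q (x - \<delta>)) / \<delta>) has_real_derivative H x) (at x)"
      unfolding GH G_def using Q[of x] Qd[of x] \<delta>
      by (auto intro!: derivative_eq_intros simp: has_real_derivative_iff_has_vector_derivative[symmetric])
    then show "((\<lambda>x. (Q x - Q (x - \<delta>)) / \<delta>) has_vector_derivative H x) (at x within {a..b})"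
      by (simp add: has_real_derivative_iff_has_vector_derivative has_vector_derivative_at_within)
  qed (use ab continuous_on_subset[OF Hc] in auto)
  also have "Q b - Q (b - \<delta>) = \<delta> * P b"
  proof -
    have "\<exists>z>b - \<delta>. z < b \<and> Q b - Q (b - \<delta>) = (b - (b - \<delta>)) * P z"
      using \<delta> Q by (intro MVT2) (auto simp: has_real_derivative_iff_has_vector_derivative)
    then obtain z where z: "z > b - \<delta>" "Q b - Q (b - \<delta>) = (b - (b - \<delta>)) * P z" by blast
    moreover have "P z = P b" using up[of z] up[of b] z(1) \<delta> by (simp add: b_def)
    ultimately show ?thesis by simp
  qed
  also have "Q a - Q (a - \<delta>) = \<delta> * P a"
  proof -
    have "\<exists>z>a - \<delta>. z < a \<and> Q a - Q (a - \<delta>) = (a - (a - \<delta>)) * P z"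
      using \<delta> Q by (intro MVT2) (auto simp: has_real_derivative_iff_has_vector_derivative)
    then obtain z where z: "z < a" "Q a - Q (a - \<delta>) = (a - (a - \<delta>)) * P z" by blast
    moreover have "P z = P a" using low[of z] low[of a] z(1) \<delta> by (simp add: a_def)
    ultimately show ?thesis by simp
  qed
  finally show ?thesis using ih \<delta> by simp
qed

lemma lebesgue_ae_limit_continuous:
  fixes f :: "real \<Rightarrow> real"
  assumes "f \<in> borel_measurable lborel"
  obtains g where "\<And>n::nat. continuous_on UNIV (g n)" "AE x in lborel. (\<lambda>n. g n x) \<longlonglongrightarrow> f x"
proof -
  have "f measurable_on UNIV"
    using assms by (intro lebesgue_measurable_imp_measurable_on_real measurable_lborel_lebesgue) auto
  then obtain N g where g: "negligible N" "\<And>n. continuous_on UNIV (g n)" "\<And>x. x \<notin> N \<Longrightarrow> (\<lambda>n. g n x) \<longlonglongrightarrow> f x"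
    unfolding measurable_on_def by auto
  have "AE x in lebesgue. x \<notin> N" using g(1) by (intro AE_not_in) (simp add: negligible_iff_null_sets)
  then have "AE x in lebesgue. (\<lambda>n. g n x) \<longlonglongrightarrow> f x" by eventually_elim (rule g(3))
  then show ?thesis using that[of g] g(2) by (simp add: AE_completion_iff)
qed

context monotone_anisotropy
begin

text \<open>Averaging \<open>h\<close> over windows of length \<open>\<delta>\<close> gives an admissible \<open>C\<^sup>1\<close> field whose derivative is a difference quotient of \<open>h\<close>.\<close>

lemma continuous_field_le_variation:
  assumes u: "integrable lborel u" and \<delta>: "\<delta> > 0" and hc: "continuous_on UNIV h" and hW: "\<And>s. \<phi> (h s) \<le> 1"
    and s: "a < c" "c \<le> d" "d + \<delta> < b" "\<And>s. s \<notin> {c..d} \<Longrightarrow> h s = 0"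
  shows "ereal (LINT s|lborel. - fst (h s) * diffq u \<delta> s + snd (h s)) \<le> anisotropic_variation \<phi> {a<..<b} u"
proof -
  obtain H where H: "\<And>s. (H has_vector_derivative (h s - h (s - \<delta>)) /\<^sub>R \<delta>) (at s)"
    and Hm: "\<And>w s. \<exists>z. s - \<delta> < z \<and> z < s \<and> w \<bullet> H s = w \<bullet> h z"
    using moving_average[OF hc \<delta>] by blast
  have H0: "H s = 0" if "s \<notin> {c..d + \<delta>}" for s
  proof -
    obtain z where z: "s - \<delta> < z" "z < s" "H s \<bullet> H s = H s \<bullet> h z" using Hm[of s "H s"] by blast
    then have "h z = 0" using that by (intro s(4)) auto
    then show ?thesis using z by simp
  qed
  have h'0: "(h s - h (s - \<delta>)) /\<^sub>R \<delta> = 0" if "s \<notin> {c..d + \<delta>}" for s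
    using that s(4)[of s] s(4)[of "s - \<delta>"] \<delta> by auto
  have h'c: "continuous_on UNIV (\<lambda>s. (h s - h (s - \<delta>)) /\<^sub>R \<delta>)"
    by (intro continuous_intros hc continuous_on_compose2[OF hc]) auto
  have HW: "\<phi> (H s) \<le> 1" for s
  proof (rule ccontr)
    assume "\<not> \<phi> (H s) \<le> 1"
    then have "H s \<notin> wulff \<phi>" by (simp add: wulff_iff)
    then obtain w \<beta> where w: "w \<bullet> H s < \<beta>" "\<And>x. x \<in> wulff \<phi> \<Longrightarrow> w \<bullet> x > \<beta>"
      using separating_hyperplane_closed_point[OF wulff_convex wulff_closed] by blast
    obtain z where "w \<bullet> H s = w \<bullet> h z" using Hm by blast
    moreover have "w \<bullet> h z > \<beta>" using hW by (intro w) (simp add: wulff_iff)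
    ultimately show False using w(1) by simp
  qed
  have s': "c \<le> d + \<delta>" using s \<delta> by simp
  have mem: "H \<in> C1c {a<..<b}" by (rule C1c_intervalI[OF H h'c s(1,3) H0])
  note te = test_energy_eq[OF u H h'c s(1) s' s(3) H0 h'0]
  have [measurable]: "(\<lambda>s. fst (h s)) \<in> borel_measurable borel" "(\<lambda>s. snd (h s)) \<in> borel_measurable borel" "u \<in> borel_measurable borel"
    using u by (auto intro!: borel_measurable_continuous_onI continuous_intros hc)
  have C: "\<bar>fst (h s)\<bar> \<le> 1 / pa" for s
    using wulff_bounds(1) hW by (metis prod.collapse wulff_iff)
  have iv: "integrable lborel (\<lambda>s. u s * fst (h s))" "integrable lborel (\<lambda>s. u (s + \<delta>) * fst (h s))" "integrable lborel (\<lambda>s. u s * fst (h (s - \<delta>)))"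
    using u C by (auto intro!: integrable_mult_bounded[of _ _ _ "1/pa"] lborel_integrable_shift)
  have sh: "(LINT s|lborel. u s * fst (h (s - \<delta>))) = (LINT s|lborel. u (s + \<delta>) * fst (h s))"
    using lborel_integral_shift[of "\<lambda>s. u s * fst (h (s - \<delta>))" "\<delta>"] by simp
  have eq: "(u s * fst (h s) - u (s + \<delta>) * fst (h s)) / \<delta> = - fst (h s) * diffq u \<delta> s" for s
    by (auto simp: diffq_def field_simps)
  have "(LINT s|lborel. u s * fst ((h s - h (s - \<delta>)) /\<^sub>R \<delta>)) = (LINT s|lborel. (u s * fst (h s) - u s * fst (h (s - \<delta>))) / \<delta>)"
    by (intro Bochner_Integration.integral_cong) (auto simp: algebra_simps divide_inverse)
  also have "\<dots> = ((LINT s|lborel. u s * fst (h s)) - (LINT s|lborel. u (s + \<delta>) * fst (h s))) / \<delta>"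
    using iv sh by simp
  also have "\<dots> = (LINT s|lborel. (u s * fst (h s) - u (s + \<delta>) * fst (h s)) / \<delta>)"
    using iv by simp
  also have "\<dots> = (LINT s|lborel. - fst (h s) * diffq u \<delta> s)" by (simp only: eq)
  finally have X: "(LINT s|lborel. u s * fst ((h s - h (s - \<delta>)) /\<^sub>R \<delta>)) = (LINT s|lborel. - fst (h s) * diffq u \<delta> s)" .
  have i3: "integrable lborel (\<lambda>s. - fst (h s) * diffq u \<delta> s)"
  proof -
    have "integrable lborel (\<lambda>s. (u s * fst (h s) - u (s + \<delta>) * fst (h s)) / \<delta>)" using iv by auto
    then show ?thesis by (simp only: eq)
  qed
  have Y: "(LINT s|lborel. snd (H s)) = (LINT s|lborel. snd (h s))"
  proof (rule integral_moving_average[OF _ \<delta> s(2)])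
    show "continuous_on UNIV (\<lambda>s. snd (h s))" by (intro continuous_intros hc)
    show "((\<lambda>s. snd (H s)) has_vector_derivative (snd (h s) - snd (h (s - \<delta>))) / \<delta>) (at s)" for s
      using bounded_linear.has_vector_derivative[OF bounded_linear_snd H[of s]] by (simp add: divide_inverse mult.commute)
    show "s \<notin> {c..d} \<Longrightarrow> snd (h s) = 0" for s by (simp add: s(4))
    show "s \<notin> {c..d + \<delta>} \<Longrightarrow> snd (H s) = 0" for s by (simp add: H0)
  qed
  have i4: "integrable lborel (\<lambda>s. snd (h s))"
  proof -
    have "integrable lborel (\<lambda>s. indicator {c..d} s *\<^sub>R snd (h s))"
      by (intro borel_integrable_compact) (auto intro!: continuous_intros continuous_on_subset[OF hc])
    moreover have "indicator {c..d} s *\<^sub>R snd (h s) = snd (h s)" for s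
      by (cases "s \<in> {c..d}") (use s(4)[of s] in simp_all)
    ultimately show ?thesis by (simp only:)
  qed
  have "ereal (LINT s:{a<..<b}|lebesgue. u s * deriv (\<lambda>t. fst (H t)) s + snd (H s)) \<le> anisotropic_variation \<phi> {a<..<b} u"
    unfolding anisotropic_variation_def by (rule SUP_upper) (use mem HW in auto)
  also have "(LINT s:{a<..<b}|lebesgue. u s * deriv (\<lambda>t. fst (H t)) s + snd (H s)) = (LINT s|lborel. - fst (h s) * diffq u \<delta> s + snd (h s))"
    using te(1) X Y i3 i4 by simp
  finally show ?thesis .
qed

text \<open>The field \<open>(- q s, r s)\<close> built from \<open>sel\<close> attains
  \<open>supp (diffq u \<delta> s)\<close> pointwise but is merely measurable. It is an almost
  everywhere limit of continuous admissible fields with support in the open interval; each of these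
  is controlled by \<open>continuous_field_le_variation\<close>, and dominated convergence gives
  \<open>DQ\<close>.\<close>

lemma DQ_le_variation:
  assumes u: "integrable lborel u" and \<delta>: "0 < \<delta>" "\<delta> < b - a"
  shows "ereal (DQ a b u \<delta>) \<le> anisotropic_variation \<phi> {a<..<b} u"
proof -
  have [measurable]: "u \<in> borel_measurable borel" using u by auto
  have [measurable]: "diffq u \<delta> \<in> borel_measurable borel" using diffq_integrable[OF u, of \<delta>] by auto
  have [measurable]: "sel \<in> borel_measurable borel" by (rule borel_measurable_mono[OF sel_mono])
  define q where "q s = sel (diffq u \<delta> s)" for s
  define r where "r s = supp (diffq u \<delta> s) - q s * diffq u \<delta> s" for s
  have [measurable]: "q \<in> borel_measurable lborel" "r \<in> borel_measurable lborel" unfolding q_def r_def by measurable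
  have W: "\<phi> (- q s, r s) \<le> 1" for s
    using sel[of "diffq u \<delta> s"] prof_props(1)[of "q s"] by (simp add: q_def r_def wulff_iff phi_reflect)
  obtain qn where qn: "\<And>n::nat. continuous_on UNIV (qn n)" "AE x in lborel. (\<lambda>n. qn n x) \<longlonglongrightarrow> q x"
    using lebesgue_ae_limit_continuous[of q] by auto
  obtain rn where rn: "\<And>n::nat. continuous_on UNIV (rn n)" "AE x in lborel. (\<lambda>n. rn n x) \<longlonglongrightarrow> r x"
    using lebesgue_ae_limit_continuous[of r] by auto
  define l where "l = b - \<delta> - a"
  have l: "l > 0" using \<delta> by (simp add: l_def)
  \<comment> \<open>The summand \<open>2\<close> gives \<open>\<eta> n \<le> l / 2\<close> already
    for \<open>n = 0\<close>, so that the supporting interval of \<open>h n\<close> is never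
    empty.\<close>
  define \<eta> where "\<eta> n = l / (real n + 2)" for n :: nat
  have \<eta>: "\<eta> n > 0" "\<eta> n \<le> l / 2" for n using l by (auto simp: \<eta>_def field_simps)
  have \<eta>0: "\<eta> \<longlonglongrightarrow> 0"
    using LIMSEQ_ignore_initial_segment[OF lim_const_over_n[of l], of 2] by (simp add: \<eta>_def[abs_def] add.commute)
  define \<theta> where "\<theta> n s = max 0 (min 1 (min (s - (a + \<eta> n)) (b - \<delta> - \<eta> n - s) / \<eta> n))" for n s
  have \<theta>: "0 \<le> \<theta> n s" "\<theta> n s \<le> 1" for n s by (auto simp: \<theta>_def)
  have \<theta>c: "continuous_on UNIV (\<theta> n)" for n unfolding \<theta>_def using \<eta>(1)[of n] by (intro continuous_intros) auto
  have \<theta>0: "\<theta> n s = 0" if "s \<notin> {a + \<eta> n..b - \<delta> - \<eta> n}" for n s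
  proof -
    have "min (s - (a + \<eta> n)) (b - \<delta> - \<eta> n - s) / \<eta> n \<le> 0"
      using that \<eta>(1)[of n] by (intro divide_nonpos_pos) auto
    then show ?thesis unfolding \<theta>_def by simp
  qed
  have \<theta>1: "(\<lambda>n. \<theta> n s) \<longlonglongrightarrow> indicator {a<..<b - \<delta>} s" for s
  proof (cases "s \<in> {a<..<b - \<delta>}")
    case True
    define e where "e = min (s - a) (b - \<delta> - s)"
    have e: "e > 0" using True by (auto simp: e_def)
    have "\<forall>\<^sub>F n in sequentially. \<eta> n < e / 2" using \<eta>0 e by (auto dest: order_tendstoD(2)[of _ _ _ "e / 2"])
    then have "\<forall>\<^sub>F n in sequentially. \<theta> n s = 1"
    proof eventually_elim
      case (elim n)
      then have "1 \<le> min (s - (a + \<eta> n)) (b - \<delta> - \<eta> n - s) / \<eta> n" using \<eta>(1)[of n] by (auto simp: e_def field_simps)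
      then show ?case unfolding \<theta>_def by simp
    qed
    then show ?thesis using True by (simp add: tendsto_eventually)
  next
    case False
    then have "\<theta> n s = 0" for n using \<eta>(1)[of n] by (intro \<theta>0) auto
    then show ?thesis using False by simp
  qed
  \<comment> \<open>Division by \<open>max 1 (\<phi> _)\<close> retracts the approximating values
    radially into the Wulff shape. The divisor tends to \<open>1\<close> because the limit field
    already has values there.\<close>
  define h where "h n s = (\<theta> n s / max 1 (\<phi> (- qn n s, rn n s))) *\<^sub>R (- qn n s, rn n s)" for n s
  have hc: "continuous_on UNIV (h n)" for n
    unfolding h_def by (intro continuous_intros \<theta>c qn rn continuous_on_compose2[OF phi_continuous[of UNIV]]) auto
  have hW: "\<phi> (h n s) \<le> 1" for n s
  proof -
    let ?P = "\<phi> (- qn n s, rn n s)"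
    have "\<phi> (h n s) = \<theta> n s * (?P / max 1 ?P)"
      using \<theta>(1)[of n s] by (simp add: h_def phi_scale del: scaleR_Pair)
    also have "\<dots> \<le> 1 * 1" using \<theta>[of n s] phi_nonneg[of "(- qn n s, rn n s)"] by (intro mult_mono) (auto simp: max_def)
    finally show ?thesis by simp
  qed
  have h0: "h n s = 0" if "s \<notin> {a + \<eta> n..b - \<delta> - \<eta> n}" for n s using \<theta>0[OF that] by (simp add: h_def zero_prod_def)
  define Y where "Y n = (LINT s|lborel. - fst (h n s) * diffq u \<delta> s + snd (h n s))" for n
  have le: "ereal (Y n) \<le> anisotropic_variation \<phi> {a<..<b} u" for n
    unfolding Y_def
  proof (rule continuous_field_le_variation[OF u \<delta>(1) hc hW])
    show "a < a + \<eta> n" "a + \<eta> n \<le> b - \<delta> - \<eta> n" "b - \<delta> - \<eta> n + \<delta> < b" using \<eta>[of n] by (auto simp: l_def)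
  qed (rule h0)
  have lim: "Y \<longlonglongrightarrow> DQ a b u \<delta>"
    unfolding Y_def DQ_def set_lebesgue_integral_def
  proof (rule integral_dominated_convergence[where w="\<lambda>s. \<bar>diffq u \<delta> s\<bar> / pa + indicator {a<..<b - \<delta>} s * (1 / pb)"])
    have "emeasure lborel {a<..<b - \<delta>} < \<infinity>" using \<delta> by (simp add: less_top[symmetric])
    then have "integrable lborel (indicator {a<..<b - \<delta>} :: real \<Rightarrow> real)"
      by (intro integrable_real_indicator) (auto simp: less_top[symmetric])
    then show "integrable lborel (\<lambda>s. \<bar>diffq u \<delta> s\<bar> / pa + indicator {a<..<b - \<delta>} s * (1 / pb))"
      using diffq_integrable[OF u] by (intro Bochner_Integration.integrable_add integrable_mult_left) auto
    have [measurable]: "(\<lambda>s. fst (h i s)) \<in> borel_measurable borel" "(\<lambda>s. snd (h i s)) \<in> borel_measurable borel" for i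
      by (auto intro!: borel_measurable_continuous_onI continuous_intros hc)
    show "(\<lambda>s. - fst (h i s) * diffq u \<delta> s + snd (h i s)) \<in> borel_measurable lborel" for i by measurable
    show "(\<lambda>x. indicat_real {a<..<b - \<delta>} x *\<^sub>R supp (diffq u \<delta> x)) \<in> borel_measurable lborel" by measurable
    show "AE x in lborel. norm (- fst (h i x) * diffq u \<delta> x + snd (h i x))
             \<le> \<bar>diffq u \<delta> x\<bar> / pa + indicator {a<..<b - \<delta>} x * (1 / pb)" for i
    proof (rule AE_I2)
      fix x
      have "(fst (h i x), snd (h i x)) \<in> wulff \<phi>" using hW[of i x] by (simp add: wulff_iff)
      note b = wulff_bounds[OF this]
      show "norm (- fst (h i x) * diffq u \<delta> x + snd (h i x)) \<le> \<bar>diffq u \<delta> x\<bar> / pa + indicator {a<..<b - \<delta>} x * (1 / pb)"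
      proof (cases "x \<in> {a<..<b - \<delta>}")
        case True
        have "norm (- fst (h i x) * diffq u \<delta> x + snd (h i x)) \<le> \<bar>fst (h i x)\<bar> * \<bar>diffq u \<delta> x\<bar> + \<bar>snd (h i x)\<bar>"
          using abs_triangle_ineq[of "- fst (h i x) * diffq u \<delta> x" "snd (h i x)"] by (simp add: abs_mult)
        also have "\<dots> \<le> (1 / pa) * \<bar>diffq u \<delta> x\<bar> + 1 / pb" using b by (intro add_mono mult_right_mono) auto
        finally show ?thesis using True by simp
      next
        case False
        then have "h i x = 0" using \<eta>(1)[of i] by (intro h0) auto
        then show ?thesis using False pa_pos by simp
      qed
    qed
    show "AE x in lborel. (\<lambda>i. - fst (h i x) * diffq u \<delta> x + snd (h i x)) \<longlonglongrightarrow> indicat_real {a<..<b - \<delta>} x *\<^sub>R supp (diffq u \<delta> x)"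
      using qn(2) rn(2)
    proof eventually_elim
      case (elim x)
      have "(\<lambda>n. (- qn n x, rn n x)) \<longlonglongrightarrow> (- q x, r x)" by (intro tendsto_intros elim)
      then have "(\<lambda>n. max 1 (\<phi> (- qn n x, rn n x))) \<longlonglongrightarrow> max 1 (\<phi> (- q x, r x))"
        using phi_continuous[of UNIV] by (intro tendsto_max tendsto_const isCont_tendsto_compose[of _ \<phi>]) (auto simp: continuous_on_eq_continuous_at)
      moreover have "max 1 (\<phi> (- q x, r x)) = 1" using W[of x] by (simp add: max_absorb1)
      ultimately have "(\<lambda>n. max 1 (\<phi> (- qn n x, rn n x))) \<longlonglongrightarrow> 1" by metis
      then have fl: "(\<lambda>n. \<theta> n x / max 1 (\<phi> (- qn n x, rn n x))) \<longlonglongrightarrow> indicator {a<..<b - \<delta>} x / 1"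
        by (intro tendsto_divide \<theta>1) auto
      have "fst (h i x) = \<theta> i x / max 1 (\<phi> (- qn i x, rn i x)) * - qn i x"
        "snd (h i x) = \<theta> i x / max 1 (\<phi> (- qn i x, rn i x)) * rn i x" for i by (simp_all add: h_def)
      then have "(\<lambda>i. - fst (h i x) * diffq u \<delta> x + snd (h i x)) \<longlonglongrightarrow>
            - (indicator {a<..<b - \<delta>} x / 1 * - q x) * diffq u \<delta> x + indicator {a<..<b - \<delta>} x / 1 * r x"
        by (simp only:) (intro tendsto_intros fl elim)
      then show ?case by (simp add: r_def algebra_simps)
    qed
  qed
  show ?thesis
  proof (rule LIMSEQ_le_const2)
    show "(\<lambda>n. ereal (Y n)) \<longlonglongrightarrow> ereal (DQ a b u \<delta>)" using lim by simp
  qed (use le in auto)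
qed

end

section \<open>Truncation by Wulff arcs\<close>

lemma integrable_bounded_support:
  fixes f :: "real \<Rightarrow> real"
  assumes "f \<in> borel_measurable borel" "\<And>s. \<bar>f s\<bar> \<le> C" "\<And>s. s \<notin> {c..d} \<Longrightarrow> f s = 0"
  shows "integrable lborel f"
proof (rule Bochner_Integration.integrable_bound)
  have "emeasure lborel {c..d} < \<infinity>" by (rule emeasure_lborel_Icc_eq[THEN ssubst]) (simp add: less_top[symmetric])
  then have "integrable lborel (indicator {c..d} :: real \<Rightarrow> real)"
    by (intro integrable_real_indicator) (auto simp: less_top[symmetric])
  then show "integrable lborel (\<lambda>s. C * indicator {c..d} s)" by simp
  show "AE s in lborel. norm (f s) \<le> norm (C * indicator {c..d} s)"
  proof (rule AE_I2)
    fix s show "norm (f s) \<le> norm (C * indicator {c..d} s)"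
      using assms(2)[of s] assms(3)[of s] by (cases "s \<in> {c..d}") auto
  qed
qed (use assms in simp)

text \<open>The truncation argument leaves the error
  \<open>K * \<integral> \<bar>d (s + \<delta>) - d s\<bar> ds\<close>, which has to vanish with
  \<open>\<delta>\<close>. As usual, \<open>f\<close> is approximated in mean by continuous
  functions of compact support.\<close>

lemma translation_continuous_L1:
  fixes f :: "real \<Rightarrow> real"
  assumes f [measurable]: "f \<in> borel_measurable borel" and C: "\<And>s. \<bar>f s\<bar> \<le> C"
    and supp: "\<And>s. s \<notin> {c..d} \<Longrightarrow> f s = 0" and \<delta>: "\<delta> \<longlonglongrightarrow> 0"
  shows "(\<lambda>k::nat. LINT s|lborel. \<bar>f (s + \<delta> k) - f s\<bar>) \<longlonglongrightarrow> 0"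
proof -
  have C0: "C \<ge> 0" using C[of 0] by linarith
  obtain g where g: "\<And>n::nat. continuous_on UNIV (g n)" "AE x in lborel. (\<lambda>n. g n x) \<longlonglongrightarrow> f x"
    using lebesgue_ae_limit_continuous[of f] by auto
  define cut where "cut s = max 0 (min 1 (min (s - c + 1) (d + 1 - s)))" for s
  \<comment> \<open>Clamping at \<open>C\<close> and multiplying by a cut-off that is
    \<open>1\<close> on \<open>[c, d]\<close> bound the approximants and their supports without
    changing their limit \<open>f\<close>.\<close>
  define G where "G n s = cut s * max (- C) (min C (g n s))" for n s
  have Gc: "continuous_on UNIV (G n)" for n unfolding G_def cut_def by (intro continuous_intros g)
  have [measurable]: "G n \<in> borel_measurable borel" for n by (intro borel_measurable_continuous_onI Gc)
  have cut: "0 \<le> cut s" "cut s \<le> 1" for s by (auto simp: cut_def)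
  have GC: "\<bar>G n s\<bar> \<le> C" for n s
  proof -
    have "\<bar>G n s\<bar> = cut s * \<bar>max (- C) (min C (g n s))\<bar>" using cut by (simp add: G_def abs_mult)
    also have "\<dots> \<le> 1 * C" using cut C0 by (intro mult_mono) auto
    finally show ?thesis by simp
  qed
  have G0: "G n s = 0" if "s \<notin> {c - 1..d + 1}" for n s
  proof -
    have "min (s - c + 1) (d + 1 - s) \<le> 0" using that by auto
    then show ?thesis by (simp add: G_def cut_def)
  qed
  have Gi: "integrable lborel (G n)" for n by (rule integrable_bounded_support[OF _ GC G0]) simp
  have fi: "integrable lborel f" by (rule integrable_bounded_support[OF f C supp])
  have lim: "(\<lambda>n. LINT s|lborel. \<bar>f s - G n s\<bar>) \<longlonglongrightarrow> (LINT s::real|lborel. (0::real))"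
  proof (rule integral_dominated_convergence[where w="\<lambda>s. 2 * C * indicator {c - 1..d + 1} s"])
    show "integrable lborel (\<lambda>s. 2 * C * indicator {c - 1..d + 1} s)"
      by (rule integrable_bounded_support[of _ "2 * C" "c - 1" "d + 1"]) (use C0 in \<open>auto simp: indicator_def\<close>)
    show "AE s in lborel. norm \<bar>f s - G n s\<bar> \<le> 2 * C * indicator {c - 1..d + 1} s" for n
    proof (rule AE_I2)
      fix s
      show "norm \<bar>f s - G n s\<bar> \<le> 2 * C * indicator {c - 1..d + 1} s"
        using G0[of s n] supp[of s] C[of s] GC[of n s] by (cases "s \<in> {c - 1..d + 1}") auto
    qed
    show "AE s in lborel. (\<lambda>n. \<bar>f s - G n s\<bar>) \<longlonglongrightarrow> 0"
      using g(2)
    proof eventually_elim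
      case (elim s)
      have "(\<lambda>n. G n s) \<longlonglongrightarrow> cut s * max (- C) (min C (f s))" unfolding G_def by (intro tendsto_intros elim)
      also have "cut s * max (- C) (min C (f s)) = f s"
        using C[of s] supp[of s] by (cases "s \<in> {c..d}") (auto simp: cut_def)
      finally show ?case using tendsto_rabs[OF tendsto_diff[OF tendsto_const[of "f s"]]] by fastforce
    qed
  qed measurable
  have Glim: "(\<lambda>k. LINT s|lborel. \<bar>G n (s + \<delta> k) - G n s\<bar>) \<longlonglongrightarrow> 0" for n
  proof -
    obtain B where B: "\<And>k. \<bar>\<delta> k\<bar> \<le> B" using convergent_imp_Bseq[OF convergentI[OF \<delta>]] by (auto simp: Bseq_def)
    have B0: "B \<ge> 0" using B[of 0] by linarith
    have "(\<lambda>k. LINT s|lborel. \<bar>G n (s + \<delta> k) - G n s\<bar>) \<longlonglongrightarrow> (LINT s::real|lborel. (0::real))"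
    proof (rule integral_dominated_convergence[where w="\<lambda>s. 2 * C * indicator {c - 1 - B..d + 1 + B} s"])
      show "integrable lborel (\<lambda>s. 2 * C * indicator {c - 1 - B..d + 1 + B} s)"
        by (rule integrable_bounded_support[of _ "2 * C" "c - 1 - B" "d + 1 + B"]) (use C0 in \<open>auto simp: indicator_def\<close>)
      show "AE s in lborel. norm \<bar>G n (s + \<delta> k) - G n s\<bar> \<le> 2 * C * indicator {c - 1 - B..d + 1 + B} s" for k
      proof (rule AE_I2)
        fix s
        show "norm \<bar>G n (s + \<delta> k) - G n s\<bar> \<le> 2 * C * indicator {c - 1 - B..d + 1 + B} s"
        proof (cases "s \<in> {c - 1 - B..d + 1 + B}")
          case True then show ?thesis using GC[of n s] GC[of n "s + \<delta> k"] by auto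
        next
          case False
          then have "s \<notin> {c - 1..d + 1}" "s + \<delta> k \<notin> {c - 1..d + 1}" using B[of k] B0 by auto
          then show ?thesis using False G0[of s n] G0[of "s + \<delta> k" n] by simp
        qed
      qed
      show "AE s in lborel. (\<lambda>k. \<bar>G n (s + \<delta> k) - G n s\<bar>) \<longlonglongrightarrow> 0"
      proof (rule AE_I2)
        fix s
        have "(\<lambda>k. s + \<delta> k) \<longlonglongrightarrow> s + 0" by (intro tendsto_intros \<delta>)
        then have "(\<lambda>k. G n (s + \<delta> k)) \<longlonglongrightarrow> G n s"
          using Gc[of n] by (auto intro!: isCont_tendsto_compose[of _ "G n"] simp: continuous_on_eq_continuous_at)
        from tendsto_rabs[OF tendsto_diff[OF this tendsto_const[of "G n s"]]]
        show "(\<lambda>k. \<bar>G n (s + \<delta> k) - G n s\<bar>) \<longlonglongrightarrow> 0" by simp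
      qed
    qed measurable
    then show ?thesis by simp
  qed
  show ?thesis
  proof (rule LIMSEQ_I)
    fix e :: real assume e: "e > 0"
    obtain n where n: "(LINT s|lborel. \<bar>f s - G n s\<bar>) < e / 3"
      using order_tendstoD(2)[OF lim, of "e / 3"] e by (auto simp: eventually_sequentially)
    obtain K where K: "\<And>k. k \<ge> K \<Longrightarrow> (LINT s|lborel. \<bar>G n (s + \<delta> k) - G n s\<bar>) < e / 3"
      using order_tendstoD(2)[OF Glim[of n], of "e / 3"] e by (auto simp: eventually_sequentially)
    have "norm ((LINT s|lborel. \<bar>f (s + \<delta> k) - f s\<bar>) - 0) < e" if "k \<ge> K" for k
    proof -
      have i1: "integrable lborel (\<lambda>s. \<bar>f s - G n s\<bar>)" using fi Gi by auto
      have i2: "integrable lborel (\<lambda>s. \<bar>f (s + \<delta> k) - G n (s + \<delta> k)\<bar>)" by (rule lborel_integrable_shift[OF i1])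
      have i3: "integrable lborel (\<lambda>s. \<bar>G n (s + \<delta> k) - G n s\<bar>)"
        by (intro integrable_abs Bochner_Integration.integrable_diff lborel_integrable_shift Gi)
      have i4: "integrable lborel (\<lambda>s. \<bar>f (s + \<delta> k) - f s\<bar>)"
        by (intro integrable_abs Bochner_Integration.integrable_diff lborel_integrable_shift fi)
      have "(LINT s|lborel. \<bar>f (s + \<delta> k) - f s\<bar>) \<le>
        (LINT s|lborel. \<bar>f (s + \<delta> k) - G n (s + \<delta> k)\<bar> + \<bar>G n (s + \<delta> k) - G n s\<bar> + \<bar>f s - G n s\<bar>)"
        by (intro integral_mono Bochner_Integration.integrable_add i1 i2 i3 i4) linarith
      also have "\<dots> = (LINT s|lborel. \<bar>f s - G n s\<bar>) + (LINT s|lborel. \<bar>G n (s + \<delta> k) - G n s\<bar>) + (LINT s|lborel. \<bar>f s - G n s\<bar>)"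
        using i1 i2 i3 lborel_integral_shift[of "\<lambda>s. \<bar>f s - G n s\<bar>" "\<delta> k"] by simp
      also have "\<dots> < e" using n K[OF that] by linarith
      finally have "(LINT s|lborel. \<bar>f (s + \<delta> k) - f s\<bar>) < e" .
      moreover have "(LINT s|lborel. \<bar>f (s + \<delta> k) - f s\<bar>) \<ge> 0" by simp
      ultimately show ?thesis by simp
    qed
    then show "\<exists>K. \<forall>k\<ge>K. norm ((LINT s|lborel. \<bar>f (s + \<delta> k) - f s\<bar>) - 0) < e" by blast
  qed
qed

text \<open>A substitute for Lebesgue points, good enough along one sequence of radii.\<close>

lemma right_averages_converge_AE:
  fixes f :: "real \<Rightarrow> real"
  assumes f [measurable]: "f \<in> borel_measurable borel" and C: "\<And>s. \<bar>f s\<bar> \<le> C"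
    and supp: "\<And>s. s \<notin> {c..d} \<Longrightarrow> f s = 0"
  shows "\<exists>\<delta>::nat \<Rightarrow> real. (\<forall>k. 0 < \<delta> k) \<and> \<delta> \<longlonglongrightarrow> 0 \<and>
    (AE s in lborel. (\<lambda>k. (LINT r:{s<..s + \<delta> k}|lborel. \<bar>f r - f s\<bar>) / \<delta> k) \<longlonglongrightarrow> 0)"
proof -
  have C0: "C \<ge> 0" using C[of 0] by linarith
  define \<delta> where "\<delta> k = 1 / real (Suc k)" for k
  have \<delta>: "\<delta> k > 0" "\<delta> k \<le> 1" for k by (auto simp: \<delta>_def)
  have \<delta>0: "\<delta> \<longlonglongrightarrow> 0" unfolding \<delta>_def using LIMSEQ_inverse_real_of_nat by (simp add: inverse_eq_divide)
  define \<omega> where "\<omega> r = (LINT s|lborel. \<bar>f (s + r) - f s\<bar>)" for r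
  define F where "F k s = (LINT r|lborel. indicator {0<..\<delta> k} r * \<bar>f (s + r) - f s\<bar>) / \<delta> k" for k s
  have fi: "integrable lborel f" by (rule integrable_bounded_support[OF f C supp])
  have int_r: "integrable lborel (\<lambda>r. indicator {0<..\<delta> k} r * \<bar>f (s + r) - f s\<bar>)" for k s
  proof (rule integrable_bounded_support[where C="2 * C" and c=0 and d=1])
    show "\<bar>indicator {0<..\<delta> k} r * \<bar>f (s + r) - f s\<bar>\<bar> \<le> 2 * C" for r
      using C[of s] C[of "s + r"] C0 by (auto simp: indicator_def)
    show "indicator {0<..\<delta> k} r * \<bar>f (s + r) - f s\<bar> = 0" if "r \<notin> {0..1}" for r
      using that \<delta>(2)[of k] by (auto simp: indicator_def)
  qed measurable
  have Fnn: "F k s \<ge> 0" for k s unfolding F_def using \<delta>(1)[of k] by (intro divide_nonneg_pos integral_nonneg_AE) auto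
  have [measurable]: "F k \<in> borel_measurable borel" for k
    unfolding F_def by measurable
  have \<omega>nn: "\<omega> r \<ge> 0" for r by (simp add: \<omega>_def)
  \<comment> \<open>By Tonelli the integral of \<open>F k\<close> is the mean of
    \<open>\<omega>\<close> over \<open>(0, \<delta> k]\<close>, which tends to \<open>0\<close>. So
    \<open>F k\<close> tends to \<open>0\<close> in mean, and a subsequence does so almost
    everywhere.\<close>
  have F_nn: "(\<integral>\<^sup>+s. ennreal (F k s) \<partial>lborel) = (\<integral>\<^sup>+r. indicator {0<..\<delta> k} r * ennreal (\<omega> r) \<partial>lborel) / ennreal (\<delta> k)" for k
  proof -
    have "ennreal (F k s) = (\<integral>\<^sup>+r. ennreal (indicator {0<..\<delta> k} r * \<bar>f (s + r) - f s\<bar>) \<partial>lborel) / ennreal (\<delta> k)" for s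
      unfolding F_def using int_r[of k s] \<delta>(1)[of k]
      by (subst nn_integral_eq_integral) (auto simp: divide_ennreal)
    then have "(\<integral>\<^sup>+s. ennreal (F k s) \<partial>lborel) =
       (\<integral>\<^sup>+s. (\<integral>\<^sup>+r. ennreal (indicator {0<..\<delta> k} r * \<bar>f (s + r) - f s\<bar>) \<partial>lborel) \<partial>lborel) / ennreal (\<delta> k)"
      by (simp add: nn_integral_divide)
    also have "(\<integral>\<^sup>+s. (\<integral>\<^sup>+r. ennreal (indicator {0<..\<delta> k} r * \<bar>f (s + r) - f s\<bar>) \<partial>lborel) \<partial>lborel)
      = (\<integral>\<^sup>+r. (\<integral>\<^sup>+s. ennreal (indicator {0<..\<delta> k} r * \<bar>f (s + r) - f s\<bar>) \<partial>lborel) \<partial>lborel)"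
      by (rule lborel_pair.Fubini') measurable
    also have "\<dots> = (\<integral>\<^sup>+r. indicator {0<..\<delta> k} r * ennreal (\<omega> r) \<partial>lborel)"
    proof (rule nn_integral_cong)
      fix r :: real
      have "integrable lborel (\<lambda>s. \<bar>f (s + r) - f s\<bar>)"
        by (intro integrable_abs Bochner_Integration.integrable_diff lborel_integrable_shift fi)
      then have "(\<integral>\<^sup>+s. ennreal \<bar>f (s + r) - f s\<bar> \<partial>lborel) = ennreal (\<omega> r)"
        unfolding \<omega>_def by (intro nn_integral_eq_integral) auto
      then show "(\<integral>\<^sup>+s. ennreal (indicator {0<..\<delta> k} r * \<bar>f (s + r) - f s\<bar>) \<partial>lborel) = indicator {0<..\<delta> k} r * ennreal (\<omega> r)"
        by (auto simp: indicator_def)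
    qed
    finally show ?thesis .
  qed
  have \<omega>0: "\<exists>r0>0. \<forall>r. 0 < r \<and> r < r0 \<longrightarrow> \<omega> r \<le> e" if e: "e > 0" for e
  proof (rule ccontr)
    assume "\<not> ?thesis"
    then have "\<forall>n. \<exists>r. 0 < r \<and> r < 1 / real (Suc n) \<and> \<omega> r > e" by (metis not_le of_nat_0_less_iff zero_less_Suc zero_less_divide_1_iff)
    then obtain r where r: "\<And>n. 0 < r n \<and> r n < 1 / real (Suc n) \<and> \<omega> (r n) > e" by metis
    have "r \<longlonglongrightarrow> 0"
    proof (rule tendsto_sandwich[of "\<lambda>_. 0" r sequentially "\<lambda>n. 1 / real (Suc n)"])
      show "(\<lambda>n. 1 / real (Suc n)) \<longlonglongrightarrow> 0" using LIMSEQ_inverse_real_of_nat by (simp add: inverse_eq_divide)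
    qed (use r in \<open>auto intro!: always_eventually less_imp_le\<close>)
    from translation_continuous_L1[OF f C supp this]
    have "(\<lambda>n. \<omega> (r n)) \<longlonglongrightarrow> 0" unfolding \<omega>_def by simp
    then have "\<forall>\<^sub>F n in sequentially. \<omega> (r n) < e" using e by (auto dest: order_tendstoD(2)[of _ _ _ e])
    then obtain n where "\<omega> (r n) < e" by (auto simp: eventually_sequentially)
    then show False using r[of n] by simp
  qed
  have F_small: "\<forall>\<^sub>F k in sequentially. (\<integral>\<^sup>+s. ennreal (F k s) \<partial>lborel) \<le> ennreal e" if e: "e > 0" for e
  proof -
    obtain r0 where r0: "r0 > 0" "\<And>r. 0 < r \<Longrightarrow> r < r0 \<Longrightarrow> \<omega> r \<le> e" using \<omega>0[OF e] by blast
    have "\<forall>\<^sub>F k in sequentially. \<delta> k < r0" using \<delta>0 r0(1) by (auto dest: order_tendstoD(2)[of _ _ _ r0])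
    then show ?thesis
    proof eventually_elim
      case (elim k)
      have "(\<integral>\<^sup>+r. indicator {0<..\<delta> k} r * ennreal (\<omega> r) \<partial>lborel) \<le> (\<integral>\<^sup>+r. ennreal e * indicator {0<..\<delta> k} r \<partial>lborel)"
        using r0(2) elim by (intro nn_integral_mono) (auto simp: indicator_def ennreal_leI)
      also have "\<dots> = ennreal e * ennreal (\<delta> k)" using \<delta>(1)[of k] by (simp add: nn_integral_cmult)
      finally have "(\<integral>\<^sup>+r. indicator {0<..\<delta> k} r * ennreal (\<omega> r) \<partial>lborel) / ennreal (\<delta> k) \<le> ennreal e * ennreal (\<delta> k) / ennreal (\<delta> k)"
        by (rule divide_right_mono_ennreal)
      also have "\<dots> = ennreal e" using \<delta>(1)[of k] e by (simp add: ennreal_mult[symmetric] divide_ennreal)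
      finally show ?case unfolding F_nn .
    qed
  qed
  obtain k0 where k0: "\<And>k. k \<ge> k0 \<Longrightarrow> (\<integral>\<^sup>+s. ennreal (F k s) \<partial>lborel) \<le> ennreal 1"
    using F_small[of 1] by (auto simp: eventually_sequentially)
  \<comment> \<open>The index shift by \<open>k0\<close> discards the finitely many
    \<open>F k\<close> whose integrability is not yet known.\<close>
  have Fi: "integrable lborel (F (k + k0))" for k
  proof (rule integrableI_nonneg)
    show "(\<integral>\<^sup>+s. ennreal (F (k + k0) s) \<partial>lborel) < \<infinity>"
      using k0[of "k + k0"] by (simp add: le_less_trans[OF _ ennreal_less_top[of 1]])
  qed (use Fnn in auto)
  have "(\<lambda>k. LINT s|lborel. norm (F (k + k0) s)) \<longlonglongrightarrow> 0"
  proof (rule LIMSEQ_I)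
    fix e :: real assume e: "e > 0"
    obtain K where K: "\<And>k. k \<ge> K \<Longrightarrow> (\<integral>\<^sup>+s. ennreal (F k s) \<partial>lborel) \<le> ennreal (e / 2)"
      using F_small[of "e / 2"] e by (auto simp: eventually_sequentially)
    have "norm ((LINT s|lborel. norm (F (k + k0) s)) - 0) < e" if "k \<ge> K" for k
    proof -
      have "ennreal (LINT s|lborel. F (k + k0) s) = (\<integral>\<^sup>+s. ennreal (F (k + k0) s) \<partial>lborel)"
        using Fnn by (intro nn_integral_eq_integral[symmetric] Fi) auto
      also have "\<dots> \<le> ennreal (e / 2)" using that by (intro K) auto
      finally have "(LINT s|lborel. F (k + k0) s) \<le> e / 2" using e by (simp add: ennreal_le_iff)
      moreover have "norm (F (k + k0) s) = F (k + k0) s" for s using Fnn by simp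
      moreover have "(LINT s|lborel. F (k + k0) s) \<ge> 0" using Fnn by (intro integral_nonneg_AE) auto
      ultimately show ?thesis using e by simp
    qed
    then show "\<exists>K. \<forall>k\<ge>K. norm ((LINT s|lborel. norm (F (k + k0) s)) - 0) < e" by blast
  qed
  from tendsto_L1_AE_subseq[OF Fi this] obtain \<rho> :: "nat \<Rightarrow> nat" where
    \<rho>: "strict_mono \<rho>" "AE s in lborel. (\<lambda>n. F (\<rho> n + k0) s) \<longlonglongrightarrow> 0" by auto
  have Feq: "F k s = (LINT r:{s<..s + \<delta> k}|lborel. \<bar>f r - f s\<bar>) / \<delta> k" for k s
  proof -
    have "(LINT r:{s<..s + \<delta> k}|lborel. \<bar>f r - f s\<bar>) = (LINT r|lborel. indicator {s<..s + \<delta> k} (r + s) * \<bar>f (r + s) - f s\<bar>)"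
      unfolding set_lebesgue_integral_def using lborel_integral_shift[of "\<lambda>r. indicator {s<..s + \<delta> k} r * \<bar>f r - f s\<bar>" s] by simp
    also have "\<dots> = (LINT r|lborel. indicator {0<..\<delta> k} r * \<bar>f (s + r) - f s\<bar>)"
      by (intro Bochner_Integration.integral_cong) (auto simp: indicator_def add.commute)
    finally show ?thesis by (simp add: F_def)
  qed
  have "(\<lambda>n. \<delta> (\<rho> n + k0)) \<longlonglongrightarrow> 0"
  proof -
    have "filterlim (\<lambda>n. \<rho> n + k0) sequentially sequentially"
      by (rule filterlim_subseq) (use \<rho>(1) in \<open>auto simp: strict_mono_def\<close>)
    then show ?thesis by (rule filterlim_compose[OF \<delta>0])
  qed
  then show ?thesis using \<rho>(2) \<delta>(1) unfolding Feq
    by (intro exI[of _ "\<lambda>n. \<delta> (\<rho> n + k0)"]) auto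
qed

text \<open>With \<open>r = 2 * \<gamma>\<close> this bounds the rate at which a truncation can
  raise the fidelity term; the constant is the one that \<open>K\<close> has to exceed.\<close>

lemma powr_diff_le:
  fixes x y r p :: real
  assumes "p \<ge> 1" "\<bar>x\<bar> \<le> r" "\<bar>y\<bar> \<le> r"
  shows "\<bar>x\<bar> powr p - \<bar>y\<bar> powr p \<le> p * r powr (p - 1) * \<bar>x - y\<bar>"
proof (cases "\<bar>x\<bar> \<le> \<bar>y\<bar>")
  case True
  then have "\<bar>x\<bar> powr p - \<bar>y\<bar> powr p \<le> 0" using assms by (simp add: powr_mono2)
  also have "0 \<le> p * r powr (p - 1) * \<bar>x - y\<bar>" using assms by simp
  finally show ?thesis .
next
  case False
  have main: "\<bar>x\<bar> powr p - \<bar>y\<bar> powr p \<le> p * r powr (p - 1) * (\<bar>x\<bar> - \<bar>y\<bar>)"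
  \<comment> \<open>\<open>MVT2\<close> asks for a derivative at the end points too, hence the
    separate treatment of \<open>0\<close>.\<close>
  proof (cases "y = 0")
    case True
    have "\<bar>x\<bar> powr p = \<bar>x\<bar> powr (p - 1) * \<bar>x\<bar>" using False by (simp add: powr_mult_base[of "\<bar>x\<bar>" "p - 1"] mult.commute)
    also have "\<dots> \<le> r powr (p - 1) * \<bar>x\<bar>" using assms by (intro mult_right_mono powr_mono2) auto
    also have "\<dots> \<le> p * (r powr (p - 1) * \<bar>x\<bar>)"
      using mult_right_mono[OF assms(1), of "r powr (p - 1) * \<bar>x\<bar>"] by simp
    finally show ?thesis using True by simp
  next
    case y: False
    have "\<exists>z>\<bar>y\<bar>. z < \<bar>x\<bar> \<and> \<bar>x\<bar> powr p - \<bar>y\<bar> powr p = (\<bar>x\<bar> - \<bar>y\<bar>) * (p * z powr (p - 1))"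
      using False y by (intro MVT2) (auto intro!: derivative_eq_intros)
    then obtain z where z: "\<bar>y\<bar> < z" "z < \<bar>x\<bar>" "\<bar>x\<bar> powr p - \<bar>y\<bar> powr p = (\<bar>x\<bar> - \<bar>y\<bar>) * (p * z powr (p - 1))" by blast
    have "(\<bar>x\<bar> - \<bar>y\<bar>) * (p * z powr (p - 1)) \<le> (\<bar>x\<bar> - \<bar>y\<bar>) * (p * r powr (p - 1))"
      using assms z False y by (intro mult_left_mono powr_mono2) auto
    then show ?thesis using z(3) by (simp add: mult.commute)
  qed
  also have "\<dots> \<le> p * r powr (p - 1) * \<bar>x - y\<bar>" using assms by (intro mult_left_mono) auto
  finally show ?thesis .
qed

lemma set_integrable_bounded_interval:
  fixes f :: "real \<Rightarrow> real"
  assumes "f \<in> borel_measurable borel" "\<And>s. \<bar>f s\<bar> \<le> C"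
  shows "set_integrable lborel {c<..<d} f"
  unfolding set_integrable_def
proof (rule integrable_bounded_support)
  show "\<bar>indicator {c<..<d} s *\<^sub>R f s\<bar> \<le> C" for s
    using assms(2)[of s] by (auto simp: indicator_def)
  show "s \<notin> {c..d} \<Longrightarrow> indicator {c<..<d} s *\<^sub>R f s = 0" for s by (auto simp: indicator_def)
qed (use assms(1) in measurable)

section \<open>Comparison of a minimizer with its truncation by an arc\<close>

context monotone_anisotropy
begin

text \<open>A bounded Borel version of the minimality of \<open>u\<close>, with \<open>T\<close> in the role of its variation.\<close>

definition minimizing :: "real \<Rightarrow> real \<Rightarrow> real \<Rightarrow> real \<Rightarrow> (real \<Rightarrow> real) \<Rightarrow> (real \<Rightarrow> real) \<Rightarrow> real \<Rightarrow> bool" where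
  "minimizing a b p \<gamma> g u T \<longleftrightarrow>
     u \<in> borel_measurable borel \<and> (\<forall>s. \<bar>u s\<bar> \<le> \<gamma>) \<and> (\<forall>s. s \<notin> {a<..<b} \<longrightarrow> u s = 0) \<and>
     g \<in> borel_measurable borel \<and> (\<forall>s. \<bar>g s\<bar> \<le> \<gamma>) \<and>
     (\<forall>\<delta>. 0 < \<delta> \<longrightarrow> \<delta> < b - a \<longrightarrow> DQ a b u \<delta> \<le> T) \<and>
     (\<forall>v R. v \<in> borel_measurable borel \<longrightarrow> (\<forall>s. \<bar>v s\<bar> \<le> \<gamma>) \<longrightarrow> (\<forall>s. s \<notin> {a<..<b} \<longrightarrow> v s = 0) \<longrightarrow>
        anisotropic_variation \<phi> {a<..<b} v \<le> ereal R \<longrightarrow>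
        T + (LINT s:{a<..<b}|lborel. \<bar>u s - g s\<bar> powr p) \<le> R + (LINT s:{a<..<b}|lborel. \<bar>v s - g s\<bar> powr p))"

text \<open>The truncation removes \<open>d\<close>, and \<open>left\<close>, \<open>right\<close> keep it from creating jumps at the ends of the arc. No condition is needed at
  \<open>b\<close> if the arc is still increasing there.\<close>

lemma comparison:
  fixes \<delta> :: "nat \<Rightarrow> real"
  assumes min: "minimizing a b p \<gamma> g u T" and p: "p \<ge> 1" and \<gamma>: "\<gamma> > 0" and ab: "a < b"
    and K: "p * (2 * \<gamma>) powr (p - 1) < K"
    and J: "a \<le> s0" "s0 < s1" "s1 \<le> b"
    and m: "m \<le> 1 / pa" "-1 / pa \<le> m - K * (s1 - s0)"
    and psi: "\<And>s. \<psi> s = t + (prof (m - K * (s - s0)) - prof m) / K"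
    and low: "\<And>s. s0 < s \<Longrightarrow> s < s1 \<Longrightarrow> - \<gamma> \<le> \<psi> s"
    and d: "\<And>s. d s = (if s \<in> {s0<..<s1} then max 0 (u s - \<psi> s) else 0)"
    and \<delta>: "\<And>k. \<delta> k > 0" "\<delta> \<longlonglongrightarrow> 0"
    and left: "(\<lambda>k. (LINT s:{s0<..s0 + \<delta> k}|lborel. d s) / \<delta> k) \<longlonglongrightarrow> 0"
    and right: "(s1 = b \<and> K * (b - s0) \<le> m) \<or> (\<lambda>k. (LINT s:{s1 - \<delta> k..<s1}|lborel. d s) / \<delta> k) \<longlonglongrightarrow> 0"
  shows "AE s in lborel. d s = 0"
proof -
  have u: "u \<in> borel_measurable borel" "\<And>s. \<bar>u s\<bar> \<le> \<gamma>" "\<And>s. s \<notin> {a<..<b} \<Longrightarrow> u s = 0"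
    and g: "g \<in> borel_measurable borel" "\<And>s. \<bar>g s\<bar> \<le> \<gamma>"
    and T: "\<And>\<delta>. 0 < \<delta> \<Longrightarrow> \<delta> < b - a \<Longrightarrow> DQ a b u \<delta> \<le> T"
    and opt: "\<And>v R. v \<in> borel_measurable borel \<Longrightarrow> (\<And>s. \<bar>v s\<bar> \<le> \<gamma>) \<Longrightarrow> (\<And>s. s \<notin> {a<..<b} \<Longrightarrow> v s = 0) \<Longrightarrow>
        anisotropic_variation \<phi> {a<..<b} v \<le> ereal R \<Longrightarrow>
        T + (LINT s:{a<..<b}|lborel. \<bar>u s - g s\<bar> powr p) \<le> R + (LINT s:{a<..<b}|lborel. \<bar>v s - g s\<bar> powr p)"
    using min unfolding minimizing_def by blast+
  note [measurable] = u(1) g(1)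
  define Kq where "Kq = p * (2 * \<gamma>) powr (p - 1)"
  have Kq: "0 \<le> Kq" "Kq < K" using p K by (auto simp: Kq_def)
  then have K0: "K > 0" by simp
  \<comment> \<open>The abscissa at which \<open>supp\<close> of the slope of the arc at
    \<open>s\<close> is attained, thus a subgradient of \<open>supp\<close> there; it is affine with
    derivative \<open>- K\<close>.\<close>
  define Q where "Q s = m - K * (s - s0)" for s
  have Qs: "Q (s - h) = Q s + K * h" "Q (s + h) = Q s - K * h" for s h by (auto simp: Q_def algebra_simps)
  have Qin: "-1/pa < Q s \<and> Q s < 1/pa" if "s0 < s" "s < s1" for s
  proof -
    have "K * (s - s0) > 0" "K * (s - s0) < K * (s1 - s0)" using that K0 by auto
    then show ?thesis using m by (auto simp: Q_def)
  qed
  have \<psi>m: "(\<lambda>s. indicator {s0<..<s1} s *\<^sub>R \<psi> s) \<in> borel_measurable borel"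
  proof (rule borel_measurable_continuous_on_indicator)
    have "continuous_on {s0<..<s1} (\<lambda>s. prof (m - K * (s - s0)))"
      by (rule continuous_on_compose2[OF prof_continuous]) (use Qin in \<open>auto intro!: continuous_intros simp: Q_def\<close>)
    then show "continuous_on {s0<..<s1} \<psi>"
      unfolding psi using K0 by (intro continuous_intros) auto
  qed simp
  have d_eq: "d s = max 0 (indicator {s0<..<s1} s * u s - indicator {s0<..<s1} s *\<^sub>R \<psi> s)" for s
    by (auto simp: d indicator_def)
  have [measurable]: "d \<in> borel_measurable borel" unfolding d_eq[abs_def] using \<psi>m by measurable
  have d0: "d s \<ge> 0" for s by (auto simp: d)
  have d2: "d s \<le> 2 * \<gamma>" for s using u(2)[of s] low[of s] \<gamma> by (auto simp: d max_def)
  have dz: "d s = 0" if "s \<le> s0 \<or> s \<ge> s1" for s using that by (auto simp: d)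
  have di: "integrable lborel d"
    by (rule integrable_bounded_support[where C="2 * \<gamma>" and c=a and d=b]) (use d0 d2 dz J in \<open>auto simp: abs_of_nonneg\<close>)
  define v where "v s = u s - d s" for s
  have [measurable]: "v \<in> borel_measurable borel" unfolding v_def by measurable
  have v\<gamma>: "\<bar>v s\<bar> \<le> \<gamma>" for s
    using u(2)[of s] low[of s] unfolding v_def d by (auto simp: max_def abs_le_iff)
  have vz: "v s = 0" if "s \<notin> {a<..<b}" for s using that u(3)[of s] dz[of s] J by (auto simp: v_def)
  have ui: "integrable lborel u" by (rule integrable_bounded_support[where C=\<gamma> and c=a and d=b]) (use u in auto)
  have vi: "integrable lborel v" unfolding v_def using ui di by simp
  define D where "D = (LINT s|lborel. d s)"
  \<comment> \<open>The weight of the error at the right end. It is \<open>0\<close> exactly if the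
    arc arrives at \<open>b\<close> no later than at its summit.\<close>
  define w :: real where "w = (if s1 = b \<and> K * (b - s0) \<le> m then 0 else 1)"
  define \<alpha> where "\<alpha> \<delta> = (LINT s:{s0<..s0 + \<delta>}|lborel. d s) / \<delta>" for \<delta>
  define \<beta> where "\<beta> \<delta> = (LINT s:{s1 - \<delta>..<s1}|lborel. d s) / \<delta>" for \<delta>
  define \<omega> where "\<omega> \<delta> = (LINT s|lborel. \<bar>d (s + \<delta>) - d s\<bar>)" for \<delta>
  \<comment> \<open>Discrete integration by parts: shifting \<open>d\<close> against the affine
    \<open>Q\<close> produces \<open>K * D\<close>. What remains is the translation error and the
    means of \<open>d\<close> over short intervals at the two ends of the arc.\<close>
  have main: "DQ a b v h \<le> T - K * D + (K * \<omega> h + (2 / pa) * (\<alpha> h + w * \<beta> h))" if h: "0 < h" "h < s1 - s0" for h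
  proof -
    define E where "E s = supp (diffq u h s) - supp (diffq v h s)" for s
    \<comment> \<open>A pointwise lower bound for the saving. On windows that straddle
      \<open>s0\<close> or \<open>s1\<close> only the Lipschitz constant \<open>1 / pa\<close> of
      \<open>supp\<close> is available. Of the factor \<open>2 / pa\<close>, one half absorbs the
      term with \<open>Q\<close> and the other half the Lipschitz estimate.\<close>
    define R where "R s = (Q s * d (s + h) - Q s * d s) / h - K * \<bar>d (s + h) - d s\<bar>
       - (2 / pa) * ((indicator {s0 - h<..s0} s * d (s + h) + w * (indicator {s1 - h..<s1} s * d s)) / h)" for s
    have ediff: "diffq u h s - diffq v h s = (d (s + h) - d s) / h" for s
      by (simp add: diffq_def v_def diff_divide_distrib add_divide_distrib)
    have Elip: "E s \<ge> - (\<bar>d (s + h) - d s\<bar> / h / pa)" for s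
    proof -
      have "supp (diffq v h s) \<le> supp (diffq u h s) + \<bar>diffq v h s - diffq u h s\<bar> / pa" by (rule supp_lipschitz)
      moreover have "\<bar>diffq v h s - diffq u h s\<bar> = \<bar>d (s + h) - d s\<bar> / h"
        using ediff[of s] h by (metis abs_minus_commute abs_divide abs_of_pos)
      ultimately show ?thesis by (simp add: E_def)
    qed
    have ptw: "R s \<le> indicator {a<..<b - h} s * E s" for s
    proof -
      have hd: "x / h \<ge> 0" if "x \<ge> 0" for x using that h by simp
      consider (A) "s0 < s" "s + h < s1" | (B) "s \<le> s0" | (C) "s0 < s" "s1 \<le> s + h" by linarith
      then show ?thesis
      proof cases
        case A
        have "E s \<ge> Q s * ((d (s + h) - d s) / h) - K * \<bar>d (s + h) - d s\<bar>"
          unfolding E_def diffq_def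
        proof (rule supp_truncation_increment[where ?\<psi>0.0 = "\<psi> s" and ?\<psi>1.0 = "\<psi> (s + h)" and ?q1.0 = "Q (s + h)"])
          show "h > 0" "K > 0" by (use h K0 in auto)
          show "- 1 / pa \<le> Q (s + h)" "Q s \<le> 1 / pa" using Qin[of s] Qin[of "s + h"] A h by auto
          show "Q s - Q (s + h) = K * h" by (simp add: Qs)
          show "\<psi> (s + h) - \<psi> s = (prof (Q (s + h)) - prof (Q s)) / K"
            by (simp add: psi Q_def diff_divide_distrib)
          show "v s = u s - d s" "v (s + h) = u (s + h) - d (s + h)" by (auto simp: v_def)
          show "d s = max 0 (u s - \<psi> s)" "d (s + h) = max 0 (u (s + h) - \<psi> (s + h))"
            using A h by (auto simp: d)
        qed
        moreover have "indicator {a<..<b - h} s = (1::real)" using A J by auto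
        moreover have "(2 / pa) * ((indicator {s0 - h<..s0} s * d (s + h) + w * (indicator {s1 - h..<s1} s * d s)) / h) \<ge> 0"
          using d0 pa_pos h by (intro mult_nonneg_nonneg hd add_nonneg_nonneg) (auto simp: w_def)
        ultimately show ?thesis by (simp add: R_def right_diff_distrib diff_divide_distrib)
      next
        case B
        have D0: "d s = 0" using B by (intro dz) auto
        show ?thesis
        proof (cases "s + h \<le> s0")
          case True
          then have D1: "d (s + h) = 0" by (intro dz) auto
          then have "v s = u s" "v (s + h) = u (s + h)" using D0 by (auto simp: v_def)
          then have "E s = 0" by (simp add: E_def diffq_def)
          then show ?thesis by (simp add: R_def D0 D1)
        next
          case False
          define x where "x = d (s + h) / h"
          have x: "x \<ge> 0" "d (s + h) = x * h" using d0 h by (auto simp: x_def)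
          have "Q s \<le> 1 / pa + K * h"
          proof -
            have "K * (s0 - s) \<le> K * h" using False K0 by (intro mult_left_mono) auto
            then show ?thesis using m by (simp add: Q_def algebra_simps)
          qed
          then have "Q s * x \<le> (1 / pa + K * h) * x" using x by (intro mult_right_mono) auto
          moreover have "R s = Q s * x - K * (x * h) - 2 / pa * x"
            using False B D0 x h by (simp add: R_def)
          ultimately have "R s \<le> - (x / pa)" by (simp add: algebra_simps)
          moreover have "E s \<ge> - (x / pa)" using Elip[of s] D0 x h by simp
          moreover have "x / pa \<ge> 0" using x pa_pos by simp
          ultimately show ?thesis by (cases "s \<in> {a<..<b - h}") auto
        qed
      next
        case C
        have D1: "d (s + h) = 0" using C by (intro dz) auto
        show ?thesis
        proof (cases "s \<ge> s1")
          case True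
          then have D0: "d s = 0" by (intro dz) auto
          then have "v s = u s" "v (s + h) = u (s + h)" using D1 by (auto simp: v_def)
          then have "E s = 0" by (simp add: E_def diffq_def)
          then show ?thesis by (simp add: R_def D0 D1)
        next
          case False
          define x where "x = d s / h"
          have x: "x \<ge> 0" "d s = x * h" using d0 h by (auto simp: x_def)
          have R: "R s = - (Q s * x) - K * (x * h) - 2 / pa * (w * x)"
            using False C D1 x h by (simp add: R_def)
          have Kx: "K * (x * h) \<ge> 0" using K0 x h by simp
          show ?thesis
          proof (cases "w = 0")
            case True
            \<comment> \<open>Such a window reaches beyond \<open>b\<close> and is outside the range
              of \<open>DQ\<close>, so \<open>R s \<le> 0\<close> suffices; it follows from
              \<open>Q s \<ge> 0\<close>, that is, from the arc still being increasing.\<close>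
            then have b: "s1 = b" "K * (b - s0) \<le> m" by (auto simp: w_def split: if_splits)
            have "K * (s - s0) \<le> K * (b - s0)" using False b K0 by (intro mult_left_mono) auto
            then have "Q s \<ge> 0" using b by (simp add: Q_def)
            then have "Q s * x \<ge> 0" using x by simp
            then have "R s \<le> 0" using R Kx True by simp
            moreover have "s \<notin> {a<..<b - h}" using C b by auto
            ultimately show ?thesis by simp
          next
            case False
            then have w: "w = 1" by (auto simp: w_def split: if_splits)
            have "(-1 / pa) * x \<le> Q s * x" using Qin[of s] C \<open>\<not> s \<ge> s1\<close> x by (intro mult_right_mono) auto
            then have "R s \<le> - (x / pa)" using R Kx w by simp
            moreover have "E s \<ge> - (x / pa)" using Elip[of s] D1 x h by simp
            moreover have "x / pa \<ge> 0" using x pa_pos by simp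
            ultimately show ?thesis by (cases "s \<in> {a<..<b - h}") auto
          qed
        qed
      qed
    qed
    define B where "B = \<bar>m\<bar> + K * (b - a) + K * h"
    have QB: "\<bar>Q s\<bar> \<le> B" if "s0 - h \<le> s" "s \<le> s1" for s
    proof -
      have "\<bar>s - s0\<bar> \<le> (b - a) + h" using that J ab h by auto
      then have "K * \<bar>s - s0\<bar> \<le> K * ((b - a) + h)" using K0 by (intro mult_left_mono) auto
      moreover have "\<bar>K * (s - s0)\<bar> = K * \<bar>s - s0\<bar>" using K0 by (simp only: abs_mult abs_of_pos)
      ultimately have "\<bar>K * (s - s0)\<bar> \<le> K * (b - a) + K * h" by (simp only: distrib_left)
      then show ?thesis unfolding Q_def B_def by linarith
    qed
    have [measurable]: "Q \<in> borel_measurable borel" unfolding Q_def by measurable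
    have iQ: "integrable lborel (\<lambda>s. Q s * d s)"
    proof (rule integrable_bounded_support[where C="B * (2 * \<gamma>)" and c=s0 and d=s1])
      show "\<bar>Q s * d s\<bar> \<le> B * (2 * \<gamma>)" for s
      proof (cases "s \<in> {s0..s1}")
        case True
        then show ?thesis using QB[of s] h d0[of s] d2[of s] by (auto simp: abs_mult intro!: mult_mono order_trans[OF abs_ge_zero QB])
      next
        case False
        then have "d s = 0" by (intro dz) auto
        moreover have "B \<ge> 0" using K0 ab h by (simp add: B_def)
        ultimately show ?thesis using \<gamma> by simp
      qed
    qed (use dz in auto)
    \<comment> \<open>After the substitution \<open>s \<mapsto> s - h\<close>, the identity
      \<open>Q (s - h) = Q s + K * h\<close> yields the whole gain.\<close>
    have iQ1: "integrable lborel (\<lambda>s. Q s * d (s + h))" "(LINT s|lborel. Q s * d (s + h)) = (LINT s|lborel. Q s * d s) + K * h * D"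
    proof -
      have i: "integrable lborel (\<lambda>s. Q (s - h) * d s)"
        unfolding Qs by (simp add: distrib_right) (intro Bochner_Integration.integrable_add iQ, use di in simp)
      show "integrable lborel (\<lambda>s. Q s * d (s + h))" using lborel_integrable_shift[OF i, of h] by simp
      have "(LINT s|lborel. Q s * d (s + h)) = (LINT s|lborel. Q (s - h) * d s)"
        using lborel_integral_shift[of "\<lambda>s. Q (s - h) * d s" h] by simp
      also have "\<dots> = (LINT s|lborel. Q s * d s + (K * h) * d s)" by (simp add: Qs algebra_simps)
      also have "\<dots> = (LINT s|lborel. Q s * d s) + K * h * D" using iQ di by (simp add: D_def)
      finally show "(LINT s|lborel. Q s * d (s + h)) = (LINT s|lborel. Q s * d s) + K * h * D" .
    qed
    have i\<omega>: "integrable lborel (\<lambda>s. \<bar>d (s + h) - d s\<bar>)"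
      by (intro integrable_abs Bochner_Integration.integrable_diff lborel_integrable_shift di)
    have i1: "integrable lborel (\<lambda>s. indicator {s0 - h<..s0} s * d (s + h))" "(LINT s|lborel. indicator {s0 - h<..s0} s * d (s + h)) = h * \<alpha> h"
    proof -
      have i: "integrable lborel (\<lambda>s. indicator {s0<..s0 + h} s * d s)"
        using integrable_mult_indicator[of "{s0<..s0 + h}" lborel d] di by simp
      have e: "indicator {s0 - h<..s0} s * d (s + h) = indicator {s0<..s0 + h} (s + h) * d (s + h)" for s
        by (auto simp: indicator_def)
      show "integrable lborel (\<lambda>s. indicator {s0 - h<..s0} s * d (s + h))"
        unfolding e by (rule lborel_integrable_shift[OF i])
      show "(LINT s|lborel. indicator {s0 - h<..s0} s * d (s + h)) = h * \<alpha> h"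
        unfolding e lborel_integral_shift[of "\<lambda>s. indicator {s0<..s0 + h} s * d s" h]
        using h by (simp add: \<alpha>_def set_lebesgue_integral_def)
    qed
    have i2: "integrable lborel (\<lambda>s. indicator {s1 - h..<s1} s * d s)" "(LINT s|lborel. indicator {s1 - h..<s1} s * d s) = h * \<beta> h"
      using integrable_mult_indicator[of "{s1 - h..<s1}" lborel d] di h by (auto simp: \<beta>_def set_lebesgue_integral_def)
    have iR: "integrable lborel R" unfolding R_def[abs_def] using iQ iQ1 i\<omega> i1 i2 by simp
    have "(LINT s|lborel. R s) = ((LINT s|lborel. Q s * d (s + h)) - (LINT s|lborel. Q s * d s)) / h - K * \<omega> h - (2 / pa) * ((h * \<alpha> h + w * (h * \<beta> h)) / h)"
      unfolding R_def \<omega>_def using iQ iQ1(1) i\<omega> i1 i2 by simp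
    also have "\<dots> = K * D - (K * \<omega> h + (2 / pa) * (\<alpha> h + w * \<beta> h))"
    proof -
      have "(h * \<alpha> h + w * (h * \<beta> h)) / h = \<alpha> h + w * \<beta> h" using h by (simp add: add_divide_distrib)
      moreover have "((LINT s|lborel. Q s * d s) + K * h * D - (LINT s|lborel. Q s * d s)) / h = K * D" using h by simp
      ultimately show ?thesis unfolding iQ1(2) by simp
    qed
    finally have IR: "(LINT s|lborel. R s) = K * D - (K * \<omega> h + (2 / pa) * (\<alpha> h + w * \<beta> h))" .
    have iu: "integrable lborel (\<lambda>s. indicator {a<..<b - h} s * supp (diffq u h s))"
      "integrable lborel (\<lambda>s. indicator {a<..<b - h} s * supp (diffq v h s))"
      using supp_diffq_integrable[OF ui, of a "b - h" h] supp_diffq_integrable[OF vi, of a "b - h" h] by (auto simp: set_integrable_def)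
    have Eeq: "indicator {a<..<b - h} s * E s = indicator {a<..<b - h} s * supp (diffq u h s) - indicator {a<..<b - h} s * supp (diffq v h s)" for s
      by (simp add: E_def algebra_simps)
    have "(LINT s|lborel. R s) \<le> (LINT s|lborel. indicator {a<..<b - h} s * E s)"
      by (intro integral_mono iR ptw) (use iu in \<open>simp add: Eeq\<close>)
    also have "\<dots> = DQ a b u h - DQ a b v h"
      unfolding Eeq DQ_def set_lebesgue_integral_def using iu by simp
    also have "\<dots> \<le> T - DQ a b v h" using T[of h] h J by simp
    finally show ?thesis unfolding IR by simp
  qed
  have \<omega>0: "(\<lambda>k. \<omega> (\<delta> k)) \<longlonglongrightarrow> 0"
  proof -
    have "\<bar>d s\<bar> \<le> 2 * \<gamma>" for s using d0[of s] d2[of s] by simp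
    moreover have "s \<notin> {a..b} \<Longrightarrow> d s = 0" for s using J by (intro dz) auto
    ultimately show ?thesis using translation_continuous_L1[of d "2 * \<gamma>" a b \<delta>] \<delta>(2) unfolding \<omega>_def by simp
  qed
  have w\<beta>0: "(\<lambda>k. w * \<beta> (\<delta> k)) \<longlonglongrightarrow> 0"
    using right by (cases "w = 0") (auto simp: \<beta>_def w_def split: if_splits)
  have err: "(\<lambda>k. K * \<omega> (\<delta> k) + (2 / pa) * (\<alpha> (\<delta> k) + w * \<beta> (\<delta> k))) \<longlonglongrightarrow> K * 0 + (2 / pa) * (0 + 0)"
    by (intro tendsto_intros \<omega>0 w\<beta>0 left[folded \<alpha>_def])
  have "anisotropic_variation \<phi> {a<..<b} v \<le> ereal (T - K * D)"
  proof (rule variation_le_liminf_DQ[OF vi ab \<delta>])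
    fix e :: real assume e: "e > 0"
    have "\<forall>\<^sub>F k in sequentially. K * \<omega> (\<delta> k) + (2 / pa) * (\<alpha> (\<delta> k) + w * \<beta> (\<delta> k)) < e"
      using order_tendstoD(2)[OF err, of e] e by simp
    moreover have "\<forall>\<^sub>F k in sequentially. \<delta> k < s1 - s0" using \<delta>(2) J by (auto dest: order_tendstoD(2)[of _ _ _ "s1 - s0"])
    ultimately show "\<forall>\<^sub>F k in sequentially. DQ a b v (\<delta> k) \<le> T - K * D + e"
    proof eventually_elim
      case (elim k)
      then show ?case using main[OF \<delta>(1)[of k]] by simp
    qed
  qed
  then have "T + (LINT s:{a<..<b}|lborel. \<bar>u s - g s\<bar> powr p) \<le> T - K * D + (LINT s:{a<..<b}|lborel. \<bar>v s - g s\<bar> powr p)"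
    by (intro opt v\<gamma> vz) simp_all
  moreover have "(LINT s:{a<..<b}|lborel. \<bar>v s - g s\<bar> powr p) \<le> (LINT s:{a<..<b}|lborel. \<bar>u s - g s\<bar> powr p) + Kq * D"
  proof -
    have bnd: "\<bar>u s - g s\<bar> \<le> 2 * \<gamma>" "\<bar>v s - g s\<bar> \<le> 2 * \<gamma>" for s using u(2)[of s] g(2)[of s] v\<gamma>[of s] by auto
    have i: "set_integrable lborel {a<..<b} (\<lambda>s. \<bar>u s - g s\<bar> powr p)" "set_integrable lborel {a<..<b} (\<lambda>s. \<bar>v s - g s\<bar> powr p)"
      by (intro set_integrable_bounded_interval[where C="(2 * \<gamma>) powr p"]; use p bnd in \<open>auto intro!: powr_mono2\<close>)+
    have "(LINT s:{a<..<b}|lborel. \<bar>v s - g s\<bar> powr p) \<le> (LINT s|lborel. indicator {a<..<b} s *\<^sub>R \<bar>u s - g s\<bar> powr p + Kq * d s)"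
      unfolding set_lebesgue_integral_def
    proof (rule integral_mono)
      show "integrable lborel (\<lambda>s. indicator {a<..<b} s *\<^sub>R \<bar>v s - g s\<bar> powr p)" using i(2) by (simp add: set_integrable_def)
      show "integrable lborel (\<lambda>s. indicator {a<..<b} s *\<^sub>R \<bar>u s - g s\<bar> powr p + Kq * d s)" using i(1) di by (simp add: set_integrable_def)
      fix s
      have "\<bar>v s - g s\<bar> powr p - \<bar>u s - g s\<bar> powr p \<le> Kq * \<bar>(v s - g s) - (u s - g s)\<bar>"
        unfolding Kq_def by (rule powr_diff_le[OF p bnd(2,1)])
      also have "\<bar>(v s - g s) - (u s - g s)\<bar> = d s" using d0[of s] by (simp add: v_def)
      finally have "\<bar>v s - g s\<bar> powr p \<le> \<bar>u s - g s\<bar> powr p + Kq * d s" by simp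
      then show "indicator {a<..<b} s *\<^sub>R \<bar>v s - g s\<bar> powr p \<le> indicator {a<..<b} s *\<^sub>R \<bar>u s - g s\<bar> powr p + Kq * d s"
        using Kq d0[of s] by (auto simp: indicator_def)
    qed
    also have "\<dots> = (LINT s:{a<..<b}|lborel. \<bar>u s - g s\<bar> powr p) + Kq * D"
      using i(1) di by (simp add: set_integrable_def set_lebesgue_integral_def D_def)
    finally show ?thesis .
  qed
  ultimately have "K * D \<le> Kq * D" by simp
  moreover have D0: "D \<ge> 0" unfolding D_def using d0 by simp
  ultimately have "D = 0" using Kq(2) by (metis antisym_conv2 mult_less_cancel_right_pos not_less le_less)
  then show ?thesis using integral_nonneg_eq_0_iff_AE[OF di] d0 unfolding D_def by simp
qed

end

section \<open>Reduction to bounded Borel representatives and the Lipschitz bound\<close>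

lemma AE_lborel_ex_between:
  assumes "AE r in lborel. P r" "c < (d::real)"
  shows "\<exists>r. c < r \<and> r < d \<and> P r"
proof (rule ccontr)
  assume "\<not> ?thesis"
  then have "AE r in lborel. \<not> (c < r \<and> r < d)" using assms(1) by (auto elim: eventually_mono)
  then have "emeasure lborel {r \<in> space lborel. c < r \<and> r < d} = 0" by (rule emeasure_eq_0_AE)
  moreover have "{r \<in> space lborel. c < r \<and> r < d} = {c<..<d}" by auto
  ultimately show False using assms(2) by simp
qed

lemma borel_version_on:
  fixes f :: "real \<Rightarrow> real"
  assumes "set_borel_measurable lebesgue {a<..<b} f"
  obtains g where "g \<in> borel_measurable borel" "AE s in lebesgue. s \<in> {a<..<b} \<longrightarrow> g s = f s" "\<And>s. s \<notin> {a<..<b} \<Longrightarrow> g s = 0"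
proof -
  obtain g0 where g0: "g0 \<in> borel_measurable lborel" "AE s in lborel. indicator {a<..<b} s *\<^sub>R f s = g0 s"
    using completion_ex_borel_measurable_real[of "\<lambda>s. indicator {a<..<b} s *\<^sub>R f s" lborel] assms
    unfolding set_borel_measurable_def by auto
  from AE_completion[OF g0(2)] have "AE s in lebesgue. s \<in> {a<..<b} \<longrightarrow> indicator {a<..<b} s * g0 s = f s"
    by eventually_elim (auto simp: indicator_def)
  then show ?thesis using g0(1) by (intro that[of "\<lambda>s. indicator {a<..<b} s * g0 s"]) auto
qed

context monotone_anisotropy
begin

lemma variation_nonneg: "a < b \<Longrightarrow> 0 \<le> anisotropic_variation \<phi> {a<..<b} v"
proof -
  assume ab: "a < b"
  have "(\<lambda>_. 0) \<in> C1c {a<..<b}" using ab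
    by (intro C1c_intervalI[of _ "\<lambda>_. 0" _ "(a+b)/2" "(a+b)/2"]) auto
  then have "ereal (LINT s:{a<..<b}|lebesgue. v s * deriv (\<lambda>t. fst (0::plane)) s + snd (0::plane)) \<le> anisotropic_variation \<phi> {a<..<b} v"
    unfolding anisotropic_variation_def by (intro SUP_upper2[of "\<lambda>_. 0"]) auto
  then show ?thesis by (simp add: set_lebesgue_integral_def zero_ereal_def)
qed

lemma variation_cong_AE:
  assumes "set_borel_measurable lebesgue {a<..<b} u" "set_borel_measurable lebesgue {a<..<b} v"
    and "AE s in lebesgue. s \<in> {a<..<b} \<longrightarrow> u s = v s" and ab: "a < b"
  shows "anisotropic_variation \<phi> {a<..<b} u = anisotropic_variation \<phi> {a<..<b} v"
  unfolding anisotropic_variation_def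
proof (rule SUP_cong[OF refl])
  fix h assume "h \<in> {h. h \<in> C1c {a<..<b} \<and> (\<forall>s. \<phi> (h s) \<le> 1)}"
  then have h: "h \<in> C1c {a<..<b}" by simp
  obtain h' c d where d: "\<And>s. (h has_vector_derivative h' s) (at s)" "continuous_on UNIV h'"
    and "a < c" "c \<le> d" "d < b" "\<And>s. s \<notin> {c..d} \<Longrightarrow> h s = 0" "\<And>s. s \<notin> {c..d} \<Longrightarrow> h' s = 0"
    using C1c_intervalE[OF h ab] by blast
  have dv: "deriv (\<lambda>t. fst (h t)) = (\<lambda>s. fst (h' s))"
  proof
    fix s
    have "((\<lambda>t. fst (h t)) has_real_derivative fst (h' s)) (at s)"
      unfolding has_real_derivative_iff_has_vector_derivative
      by (rule bounded_linear.has_vector_derivative[OF bounded_linear_fst d(1)])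
    then show "deriv (\<lambda>t. fst (h t)) s = fst (h' s)" by (rule DERIV_imp_deriv)
  qed
  have hc: "continuous_on UNIV h"
    using d(1) by (meson continuous_at_imp_continuous_on has_vector_derivative_continuous)
  have "(\<lambda>s. fst (h' s)) \<in> borel_measurable borel" "(\<lambda>s. snd (h s)) \<in> borel_measurable borel"
    by (auto intro!: borel_measurable_continuous_onI continuous_intros hc d(2))
  then have [measurable]: "(\<lambda>s. fst (h' s)) \<in> borel_measurable lebesgue" "(\<lambda>s. snd (h s)) \<in> borel_measurable lebesgue"
    by (auto intro: measurable_lborel_lebesgue)
  have m: "(\<lambda>s. indicator {a<..<b} s *\<^sub>R (w s * fst (h' s) + snd (h s))) \<in> borel_measurable lebesgue"
    if "set_borel_measurable lebesgue {a<..<b} w" for w :: "real \<Rightarrow> real"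
  proof -
    have [measurable]: "(\<lambda>s. indicator {a<..<b} s *\<^sub>R w s) \<in> borel_measurable lebesgue" using that by (simp add: set_borel_measurable_def)
    have [measurable]: "(\<lambda>s. indicator {a<..<b} s :: real) \<in> borel_measurable lebesgue"
      by (rule measurable_lborel_lebesgue) simp
    have "(\<lambda>s. (indicator {a<..<b} s *\<^sub>R w s) * fst (h' s) + indicator {a<..<b} s * snd (h s)) \<in> borel_measurable lebesgue" by measurable
    then show ?thesis by (simp add: distrib_left mult.assoc)
  qed
  have "(LINT s:{a<..<b}|lebesgue. u s * fst (h' s) + snd (h s)) = (LINT s:{a<..<b}|lebesgue. v s * fst (h' s) + snd (h s))"
    unfolding set_lebesgue_integral_def
  proof (rule integral_cong_AE)
    show "AE s in lebesgue. indicator {a<..<b} s *\<^sub>R (u s * fst (h' s) + snd (h s)) = indicator {a<..<b} s *\<^sub>R (v s * fst (h' s) + snd (h s))"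
      using assms(3) by eventually_elim (auto simp: indicator_def)
  qed (intro m assms)+
  then show "ereal (LINT s:{a<..<b}|lebesgue. u s * deriv (\<lambda>t. fst (h t)) s + snd (h s)) =
        ereal (LINT s:{a<..<b}|lebesgue. v s * deriv (\<lambda>t. fst (h t)) s + snd (h s))" by (simp add: dv)
qed

text \<open>A scalar test function \<open>h\<close> with \<open>\<bar>h\<bar> \<le> 1\<close>
  becomes the admissible field \<open>(h / pa, 0)\<close>. Competitors whose variation is bounded
  through \<open>DQ\<close> are thereby in the domain where the functional is finite.\<close>

lemma BV_on_if_variation_finite:
  assumes v: "L1_on {a<..<b} v" and R: "anisotropic_variation \<phi> {a<..<b} v \<le> ereal R" and ab: "a < b"
  shows "BV_on {a<..<b} v"
  unfolding BV_on_def
proof (intro conjI v bdd_aboveI)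
  fix x assume "x \<in> {(LINT s:{a<..<b}|lebesgue. v s * deriv h s) | h. h \<in> C1c {a<..<b} \<and> (\<forall>s. \<bar>h s\<bar> \<le> 1)}"
  then obtain h where x: "x = (LINT s:{a<..<b}|lebesgue. v s * deriv h s)" and h: "h \<in> C1c {a<..<b}" "\<And>s. \<bar>h s\<bar> \<le> 1" by auto
  obtain h' c d where d: "\<And>s. (h has_vector_derivative h' s) (at s)" "continuous_on UNIV h'"
    "a < c" "c \<le> d" "d < b" "\<And>s. s \<notin> {c..d} \<Longrightarrow> h s = 0" "\<And>s. s \<notin> {c..d} \<Longrightarrow> h' s = 0"
    using C1c_intervalE[OF h(1) ab] by blast
  define H where "H s = (h s / pa, 0::real)" for s
  have "H \<in> C1c {a<..<b}"
  proof (rule C1c_intervalI[of _ "\<lambda>s. (h' s / pa, 0)"])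
    show "(H has_vector_derivative (h' s / pa, 0)) (at s)" for s
      unfolding H_def by (intro has_vector_derivative_Pair has_vector_derivative_divide has_vector_derivative_const d)
    show "continuous_on UNIV (\<lambda>s. (h' s / pa, 0::real))" using pa_pos by (intro continuous_intros d) auto
    show "H s = 0" if "s \<notin> {c..d}" for s using d(6)[OF that] by (simp add: H_def zero_prod_def)
  qed (use d in auto)
  moreover have "\<phi> (H s) \<le> 1" for s using h(2)[of s] pa_pos by (simp add: H_def phi_axis)
  ultimately have "ereal (LINT s:{a<..<b}|lebesgue. v s * deriv (\<lambda>t. fst (H t)) s + snd (H s)) \<le> anisotropic_variation \<phi> {a<..<b} v"
    unfolding anisotropic_variation_def by (intro SUP_upper) auto
  also note R
  also have "(LINT s:{a<..<b}|lebesgue. v s * deriv (\<lambda>t. fst (H t)) s + snd (H s)) = (LINT s:{a<..<b}|lebesgue. (v s * deriv h s) / pa)"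
  proof -
    have "deriv (\<lambda>t. fst (H t)) s = deriv h s / pa" for s
    proof -
      have "(h has_real_derivative h' s) (at s)" using d(1) by (simp add: has_real_derivative_iff_has_vector_derivative)
      then show ?thesis unfolding H_def fst_conv by (metis DERIV_cdivide DERIV_imp_deriv)
    qed
    then show ?thesis by (simp add: H_def)
  qed
  also have "\<dots> = x / pa" by (simp add: x)
  finally show "x \<le> R * pa" using pa_pos by (simp add: field_simps)
qed

lemma integrable_lborel_imp_L1_on: "integrable lborel v \<Longrightarrow> L1_on {a<..<b} v"
  unfolding L1_on_def set_integrable_def
  by (intro integrable_mult_indicator) (auto simp: integrable_completion)

text \<open>Clamping does not increase distances, so every difference quotient shrinks in absolute
  value, and \<open>supp_mono\<close> applies.\<close>

lemma supp_diffq_clamp_le: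
  assumes "\<gamma> \<ge> 0" "\<delta> > 0"
  shows "supp (diffq (\<lambda>s. max (- \<gamma>) (min \<gamma> (u s))) \<delta> s) \<le> supp (diffq u \<delta> s)"
  unfolding diffq_def using assms by (intro supp_mono) (auto simp: abs_divide divide_right_mono max_def min_def)

lemma G_functional_eq:
  assumes ab: "a < b" and p: "p \<ge> 1"
    and u: "L1_on {a<..<b} u" and g: "set_borel_measurable lebesgue {a<..<b} g"
    and u': "u' \<in> borel_measurable borel" "AE s in lebesgue. s \<in> {a<..<b} \<longrightarrow> u' s = u s"
    and g': "g' \<in> borel_measurable borel" "AE s in lebesgue. s \<in> {a<..<b} \<longrightarrow> g' s = g s"
  shows "(LINT s:{a<..<b}|lebesgue. \<bar>u s - g s\<bar> powr p) = (LINT s:{a<..<b}|lborel. \<bar>u' s - g' s\<bar> powr p)"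
    "Lp_on p {a<..<b} (\<lambda>s. u s - g s) \<longleftrightarrow> set_integrable lborel {a<..<b} (\<lambda>s. \<bar>u' s - g' s\<bar> powr p)"
proof -
  note [measurable] = u'(1) g'(1)
  have um: "set_borel_measurable lebesgue {a<..<b} u"
    using u unfolding L1_on_def set_integrable_def set_borel_measurable_def by auto
  have m1: "(\<lambda>s. indicator {a<..<b} s *\<^sub>R \<bar>u' s - g' s\<bar> powr p) \<in> borel_measurable lborel" by measurable
  have m0: "(\<lambda>s. indicator {a<..<b} s *\<^sub>R (u s - g s)) \<in> borel_measurable lebesgue"
    using borel_measurable_diff[OF um[unfolded set_borel_measurable_def] g[unfolded set_borel_measurable_def]]
    by (simp add: right_diff_distrib)
  have "(\<lambda>s. \<bar>indicator {a<..<b} s *\<^sub>R (u s - g s)\<bar> powr p) \<in> borel_measurable lebesgue" using m0 by measurable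
  moreover have "\<bar>indicator {a<..<b} s *\<^sub>R (u s - g s)\<bar> powr p = indicator {a<..<b} s *\<^sub>R \<bar>u s - g s\<bar> powr p" for s
    by (auto simp: indicator_def)
  ultimately have m2: "(\<lambda>s. indicator {a<..<b} s *\<^sub>R \<bar>u s - g s\<bar> powr p) \<in> borel_measurable lebesgue" by simp
  have ae: "AE s in lebesgue. indicator {a<..<b} s *\<^sub>R \<bar>u s - g s\<bar> powr p = indicator {a<..<b} s *\<^sub>R \<bar>u' s - g' s\<bar> powr p"
    using u'(2) g'(2) by eventually_elim (auto simp: indicator_def)
  show "(LINT s:{a<..<b}|lebesgue. \<bar>u s - g s\<bar> powr p) = (LINT s:{a<..<b}|lborel. \<bar>u' s - g' s\<bar> powr p)"
    unfolding set_lebesgue_integral_def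
    using integral_cong_AE[OF m2 measurable_lborel_lebesgue[OF m1] ae] integral_completion[OF m1] by simp
  show "Lp_on p {a<..<b} (\<lambda>s. u s - g s) \<longleftrightarrow> set_integrable lborel {a<..<b} (\<lambda>s. \<bar>u' s - g' s\<bar> powr p)"
    unfolding Lp_on_def set_integrable_def set_borel_measurable_def
    using m0 integrable_cong_AE[OF m2 measurable_lborel_lebesgue[OF m1] ae] integrable_completion[OF m1] by simp
qed

text \<open>Clamping to \<open>[- \<gamma>, \<gamma>]\<close> does not raise the variation, and it
  strictly lowers \<open>\<bar>u - g\<bar>\<close> wherever it changes \<open>u\<close>. So the
  clamped function \<open>w\<close> is a minimizer too and agrees with \<open>u\<close> almost
  everywhere. The datum is clamped as well, which turns its almost everywhere bound into a pointwise
  one.\<close>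

lemma minimizer_minimizing:
  assumes ab: "a < b" and p: "p \<ge> 1" and \<gamma>: "\<gamma> > 0"
    and g: "set_borel_measurable lebesgue {a<..<b} g" "AE s in lebesgue. s \<in> {a<..<b} \<longrightarrow> \<bar>g s\<bar> \<le> \<gamma>"
    and min: "G_minimizer \<phi> p g {a<..<b} u"
  obtains g' w T where "minimizing a b p \<gamma> g' w T" "AE s in lebesgue. s \<in> {a<..<b} \<longrightarrow> w s = u s"
proof -
  let ?I = "{a<..<b}"
  obtain g0 where g0: "g0 \<in> borel_measurable borel" "AE s in lebesgue. s \<in> ?I \<longrightarrow> g0 s = g s"
    using borel_version_on[OF g(1)] by blast
  define g' where "g' s = max (- \<gamma>) (min \<gamma> (g0 s))" for s
  have g'm [measurable]: "g' \<in> borel_measurable borel" unfolding g'_def using g0(1) by measurable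
  have g'\<gamma>: "\<bar>g' s\<bar> \<le> \<gamma>" for s using \<gamma> by (auto simp: g'_def)
  have g'g: "AE s in lebesgue. s \<in> ?I \<longrightarrow> g' s = g s"
    using g0(2) g(2) by eventually_elim (auto simp: g'_def)
  have u: "L1_on ?I u" and opt: "\<And>v. L1_on ?I v \<Longrightarrow> G_functional \<phi> p g ?I u \<le> G_functional \<phi> p g ?I v"
    using min by (auto simp: G_minimizer_def)
  have um: "set_borel_measurable lebesgue ?I u"
    using u unfolding L1_on_def set_integrable_def set_borel_measurable_def by auto
  obtain u' where u': "u' \<in> borel_measurable borel" "AE s in lebesgue. s \<in> ?I \<longrightarrow> u' s = u s" "\<And>s. s \<notin> ?I \<Longrightarrow> u' s = 0"
    using borel_version_on[OF um] by blast
  note [measurable] = u'(1)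
  have u'i: "integrable lborel u'"
  proof -
    have "integrable lebesgue (\<lambda>s. indicator ?I s *\<^sub>R u s)" using u by (simp add: L1_on_def set_integrable_def)
    moreover have "AE s in lebesgue. indicator ?I s *\<^sub>R u s = u' s"
      using u'(2) by eventually_elim (use u'(3) in \<open>auto simp: indicator_def\<close>)
    moreover have "u' \<in> borel_measurable lebesgue" using u'(1) by (intro measurable_lborel_lebesgue) simp
    ultimately have "integrable lebesgue u'"
      using integrable_cong_AE[of "\<lambda>s. indicator ?I s *\<^sub>R u s" lebesgue u', OF borel_measurable_integrable] by blast
    then show ?thesis using integrable_completion[of u' lborel] by simp
  qed
  have um': "set_borel_measurable lebesgue ?I v" if "v \<in> borel_measurable borel" for v :: "real \<Rightarrow> real"
    unfolding set_borel_measurable_def using that by (intro measurable_lborel_lebesgue) auto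
  have "AE s in lebesgue. s \<in> ?I \<longrightarrow> u s = u' s" using u'(2) by eventually_elim auto
  note TVeq = variation_cong_AE[OF um um'[OF u'(1)] this ab]
  define J where "J v = (LINT s:?I|lborel. \<bar>v s - g' s\<bar> powr p)" for v
  have comp: "G_functional \<phi> p g ?I u \<le> ereal (R + J v)"
    if v: "v \<in> borel_measurable borel" "\<And>s. \<bar>v s\<bar> \<le> \<gamma>" "\<And>s. s \<notin> ?I \<Longrightarrow> v s = 0" "anisotropic_variation \<phi> ?I v \<le> ereal R" for v R
  proof -
    have "integrable lborel v" by (rule integrable_bounded_support[where C=\<gamma> and c=a and d=b]) (use v in auto)
    then have L1: "L1_on ?I v" by (rule integrable_lborel_imp_L1_on)
    note e = G_functional_eq[OF ab p L1 g(1) v(1) _ g'm g'g]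
    have "set_integrable lborel ?I (\<lambda>s. \<bar>v s - g' s\<bar> powr p)"
    proof (rule set_integrable_bounded_interval[where C="(2 * \<gamma>) powr p"])
      show "(\<lambda>s. \<bar>v s - g' s\<bar> powr p) \<in> borel_measurable borel" using v(1) by measurable
      show "\<bar>\<bar>v s - g' s\<bar> powr p\<bar> \<le> (2 * \<gamma>) powr p" for s
        using v(2)[of s] g'\<gamma>[of s] p by (auto intro!: powr_mono2)
    qed
    then have "G_functional \<phi> p g ?I v = anisotropic_variation \<phi> ?I v + ereal (J v)"
      unfolding G_functional_def J_def using e BV_on_if_variation_finite[OF L1 v(4) ab] by simp
    also have "\<dots> \<le> ereal R + ereal (J v)" by (intro add_mono v) simp
    finally show ?thesis using opt[OF L1] by simp
  qed
  \<comment> \<open>The zero function has finite energy. This gives a finite minimal value, and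
    hence \<open>BV\<close> regularity and a real number \<open>T\<close> for the minimizer.\<close>
  have "anisotropic_variation \<phi> ?I (\<lambda>_. 0) \<le> ereal ((b - a) / pb)"
  proof (rule variation_le_liminf_DQ[OF _ ab, where \<delta>="\<lambda>n. 1 / real (Suc n)"])
    show "(\<lambda>n. 1 / real (Suc n)) \<longlonglongrightarrow> 0" using LIMSEQ_inverse_real_of_nat by (simp add: inverse_eq_divide)
    fix e :: real assume e: "e > 0"
    have "DQ a b (\<lambda>_. 0) (1 / real (Suc n)) \<le> (b - a) / pb + e" for n
    proof -
      have "DQ a b (\<lambda>_. 0) (1 / real (Suc n)) = measure lborel {a<..<b - 1 / real (Suc n)} * (1 / pb)"
        by (simp add: DQ_def diffq_def supp_0 set_lebesgue_integral_def)
      also have "\<dots> \<le> (b - a) * (1 / pb)"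
      proof (rule mult_right_mono)
        show "measure lborel {a<..<b - 1 / real (Suc n)} \<le> b - a"
          using ab by (cases "a \<le> b - 1 / real (Suc n)") auto
      qed (use pb_pos in simp)
      finally show ?thesis using e by simp
    qed
    then show "\<forall>\<^sub>F n in sequentially. DQ a b (\<lambda>_. 0) (1 / real (Suc n)) \<le> (b - a) / pb + e" by simp
  qed auto
  then have "G_functional \<phi> p g ?I u \<le> ereal ((b - a) / pb + J (\<lambda>_. 0))"
    using \<gamma> by (intro comp) auto
  then have "G_functional \<phi> p g ?I u < \<infinity>" by (rule le_less_trans) simp
  then have fin: "BV_on ?I u" "Lp_on p ?I (\<lambda>s. u s - g s)" "G_functional \<phi> p g ?I u < \<infinity>"
    by (auto simp: G_functional_def split: if_splits)
  note e = G_functional_eq[OF ab p u g(1) u'(1,2) g'm g'g]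
  have ju: "set_integrable lborel ?I (\<lambda>s. \<bar>u' s - g' s\<bar> powr p)" using e(2) fin(2) by simp
  have Gu: "G_functional \<phi> p g ?I u = anisotropic_variation \<phi> ?I u' + ereal (J u')"
    unfolding G_functional_def J_def using e fin TVeq by simp
  have "anisotropic_variation \<phi> ?I u' \<noteq> \<infinity>" "anisotropic_variation \<phi> ?I u' \<noteq> -\<infinity>"
    using fin(3) Gu variation_nonneg[OF ab, of u'] by auto
  then obtain T where T: "anisotropic_variation \<phi> ?I u' = ereal T" by (cases "anisotropic_variation \<phi> ?I u'") auto
  have DQu: "DQ a b u' \<delta> \<le> T" if "0 < \<delta>" "\<delta> < b - a" for \<delta>
    using DQ_le_variation[OF u'i that] T by simp
  define w where "w s = max (- \<gamma>) (min \<gamma> (u' s))" for s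
  have wm [measurable]: "w \<in> borel_measurable borel" unfolding w_def by measurable
  have w\<gamma>: "\<bar>w s\<bar> \<le> \<gamma>" for s using \<gamma> by (auto simp: w_def)
  have wz: "w s = 0" if "s \<notin> ?I" for s using u'(3)[OF that] \<gamma> by (simp add: w_def)
  have wi: "integrable lborel w" by (rule integrable_bounded_support[where C=\<gamma> and c=a and d=b]) (use w\<gamma> wz in auto)
  have DQw: "DQ a b w \<delta> \<le> T" if "0 < \<delta>" "\<delta> < b - a" for \<delta>
  proof -
    have "DQ a b w \<delta> \<le> DQ a b u' \<delta>"
      unfolding DQ_def
      by (intro set_integral_mono supp_diffq_integrable wi u'i, unfold w_def, rule supp_diffq_clamp_le) (use that \<gamma> in auto)
    then show ?thesis using DQu[OF that] by simp
  qed
  have "anisotropic_variation \<phi> ?I w \<le> ereal T"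
  proof (rule variation_le_liminf_DQ[OF wi ab, where \<delta>="\<lambda>n. 1 / real (Suc n)"])
    show l: "(\<lambda>n. 1 / real (Suc n)) \<longlonglongrightarrow> 0" using LIMSEQ_inverse_real_of_nat by (simp add: inverse_eq_divide)
    fix e :: real assume e: "e > 0"
    have "\<forall>\<^sub>F n in sequentially. 1 / real (Suc n) < b - a" using order_tendstoD(2)[OF l, of "b - a"] ab by simp
    then show "\<forall>\<^sub>F n in sequentially. DQ a b w (1 / real (Suc n)) \<le> T + e"
    proof eventually_elim
      case (elim n)
      then show ?case using DQw[of "1 / real (Suc n)"] e by simp
    qed
  qed simp
  from comp[OF wm w\<gamma> wz this] have JJ: "J u' \<le> J w" unfolding Gu T by simp
  have le: "\<bar>w s - g' s\<bar> \<le> \<bar>u' s - g' s\<bar>" "w s \<noteq> u' s \<Longrightarrow> \<bar>w s - g' s\<bar> < \<bar>u' s - g' s\<bar>" for s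
    using g'\<gamma>[of s] by (auto simp: w_def max_def min_def)
  have jw: "set_integrable lborel ?I (\<lambda>s. \<bar>w s - g' s\<bar> powr p)"
  proof (rule set_integrable_bounded_interval[where C="(2 * \<gamma>) powr p"])
    show "\<bar>\<bar>w s - g' s\<bar> powr p\<bar> \<le> (2 * \<gamma>) powr p" for s
      using w\<gamma>[of s] g'\<gamma>[of s] p by (auto intro!: powr_mono2)
  qed measurable
  define \<Delta> where "\<Delta> s = indicator ?I s *\<^sub>R \<bar>u' s - g' s\<bar> powr p - indicator ?I s *\<^sub>R \<bar>w s - g' s\<bar> powr p" for s
  have \<Delta>i: "integrable lborel \<Delta>" unfolding \<Delta>_def using ju jw by (simp add: set_integrable_def)
  have \<Delta>0: "\<Delta> s \<ge> 0" for s using le(1)[of s] p by (auto simp: \<Delta>_def indicator_def intro!: powr_mono2)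
  have "(LINT s|lborel. \<Delta> s) = J u' - J w"
    unfolding \<Delta>_def J_def set_lebesgue_integral_def using ju jw by (simp add: set_integrable_def)
  moreover have "(LINT s|lborel. \<Delta> s) \<ge> 0" using \<Delta>0 by simp
  ultimately have \<Delta>z: "(LINT s|lborel. \<Delta> s) = 0" and Jeq: "J u' = J w" using JJ by auto
  have "AE s in lborel. \<Delta> s = 0" using integral_nonneg_eq_0_iff_AE[OF \<Delta>i] \<Delta>0 \<Delta>z by simp
  then have "AE s in lborel. s \<in> ?I \<longrightarrow> w s = u' s"
  proof eventually_elim
    case (elim s)
    show ?case
    proof (rule impI, rule ccontr)
      assume "s \<in> ?I" "w s \<noteq> u' s"
      then have "\<bar>w s - g' s\<bar> powr p < \<bar>u' s - g' s\<bar> powr p" using le(2) p by (intro powr_less_mono2) auto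
      then show False using elim \<open>s \<in> ?I\<close> by (simp add: \<Delta>_def)
    qed
  qed
  from AE_completion[OF this] u'(2) have "AE s in lebesgue. s \<in> ?I \<longrightarrow> w s = u s" by eventually_elim auto
  moreover have "minimizing a b p \<gamma> g' w T"
    unfolding minimizing_def
  proof (intro conjI allI impI)
    fix v R assume v: "v \<in> borel_measurable borel" "\<forall>s. \<bar>v s\<bar> \<le> \<gamma>" "\<forall>s. s \<notin> ?I \<longrightarrow> v s = 0" "anisotropic_variation \<phi> ?I v \<le> ereal R"
    have "ereal T + ereal (J u') \<le> ereal (R + J v)" using comp[of v R] v unfolding Gu T by auto
    then show "T + (LINT s:?I|lborel. \<bar>w s - g' s\<bar> powr p) \<le> R + (LINT s:?I|lborel. \<bar>v s - g' s\<bar> powr p)"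
      using Jeq by (simp add: J_def)
  qed (use wm w\<gamma> wz g'm g'\<gamma> DQw in auto)
  ultimately show ?thesis using that by blast
qed

text \<open>Since \<open>supp\<close> is even, \<open>DQ\<close> does not see the sign. The
  variation of \<open>- v\<close> is bounded by passing through \<open>DQ\<close>: from the
  variation of \<open>v\<close> down to \<open>DQ\<close>, and back up by
  \<open>variation_le_liminf_DQ\<close>.\<close>

lemma minimizing_uminus:
  assumes min: "minimizing a b p \<gamma> g u T" and ab: "a < b"
  shows "minimizing a b p \<gamma> (\<lambda>s. - g s) (\<lambda>s. - u s) T"
proof -
  have dq: "diffq (\<lambda>s. - v s) \<delta> s = - diffq v \<delta> s" for v \<delta> s by (simp add: diffq_def diff_divide_distrib)
  have DQ: "DQ a b (\<lambda>s. - v s) \<delta> = DQ a b v \<delta>" for v \<delta> by (simp add: DQ_def dq supp_even)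
  show ?thesis
    unfolding minimizing_def DQ
  proof (intro conjI allI impI)
    fix v R assume v: "v \<in> borel_measurable borel" "\<forall>s. \<bar>v s\<bar> \<le> \<gamma>" "\<forall>s. s \<notin> {a<..<b} \<longrightarrow> v s = 0" "anisotropic_variation \<phi> {a<..<b} v \<le> ereal R"
    have vi: "integrable lborel v" by (rule integrable_bounded_support[where C=\<gamma> and c=a and d=b]) (use v in auto)
    have "anisotropic_variation \<phi> {a<..<b} (\<lambda>s. - v s) \<le> ereal R"
    proof (rule variation_le_liminf_DQ[OF _ ab, where \<delta>="\<lambda>n. 1 / real (Suc n)"])
      show l: "(\<lambda>n. 1 / real (Suc n)) \<longlonglongrightarrow> 0" using LIMSEQ_inverse_real_of_nat by (simp add: inverse_eq_divide)
      fix e :: real assume e: "e > 0"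
      have "\<forall>\<^sub>F n in sequentially. 1 / real (Suc n) < b - a" using order_tendstoD(2)[OF l, of "b - a"] ab by simp
      then show "\<forall>\<^sub>F n in sequentially. DQ a b (\<lambda>s. - v s) (1 / real (Suc n)) \<le> R + e"
      proof eventually_elim
        case (elim n)
        have "ereal (DQ a b v (1 / real (Suc n))) \<le> ereal R"
          by (rule order_trans[OF DQ_le_variation[OF vi _ elim] v(4)]) simp
        then show ?case unfolding DQ using e by simp
      qed
    qed (use vi in auto)
    then have "T + (LINT s:{a<..<b}|lborel. \<bar>u s - g s\<bar> powr p) \<le> R + (LINT s:{a<..<b}|lborel. \<bar>- v s - g s\<bar> powr p)"
      using min v unfolding minimizing_def by simp
    moreover have "\<bar>- u s - - g s\<bar> = \<bar>u s - g s\<bar>" "\<bar>v s - - g s\<bar> = \<bar>- v s - g s\<bar>" for s by auto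
    ultimately show "T + (LINT s:{a<..<b}|lborel. \<bar>- u s - - g s\<bar> powr p) \<le> R + (LINT s:{a<..<b}|lborel. \<bar>v s - - g s\<bar> powr p)"
      by (simp only:)
  qed (use min in \<open>auto simp: minimizing_def\<close>)
qed

text \<open>The arc starts at height \<open>u s0\<close> and, by the assumption on \<open>m\<close>, passes \<open>\<gamma>\<close> before its summit.\<close>

lemma minimizing_increase_bound:
  assumes min: "minimizing a b p \<gamma> g u T" and p: "p \<ge> 1" and \<gamma>: "\<gamma> > 0" and ab: "a < b"
    and K: "p * (2 * \<gamma>) powr (p - 1) < K"
    and m: "0 \<le> m" "m \<le> 1 / pa" "2 * \<gamma> < (prof 0 - prof m) / K"
    and L: "\<And>q. 0 \<le> q \<Longrightarrow> q < m \<Longrightarrow> prof q - prof m \<le> L * (m - q)"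
  shows "AE s0 in lborel. a < s0 \<longrightarrow> s0 < b \<longrightarrow> (AE s in lborel. s0 < s \<longrightarrow> s < b \<longrightarrow> u s \<le> u s0 + L * (s - s0))"
proof -
  have u [measurable]: "u \<in> borel_measurable borel" and u\<gamma>: "\<And>s. \<bar>u s\<bar> \<le> \<gamma>" and uz: "\<And>s. s \<notin> {a<..<b} \<Longrightarrow> u s = 0"
    using min unfolding minimizing_def by blast+
  have K0: "K > 0" using K p by (smt (verit) mult_nonneg_nonneg powr_ge_zero)
  have m0: "m > 0" using m \<gamma> by (cases "m = 0") auto
  have Lp: "L > 0"
  proof -
    have "0 < 2 * \<gamma> * K" using \<gamma> K0 by simp
    also have "\<dots> < prof 0 - prof m" using m(3) K0 by (simp add: field_simps)
    also have "\<dots> \<le> L * m" using L[of 0] m0 by simp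
    finally show ?thesis using m0 by (simp add: zero_less_mult_iff)
  qed
  have "u s = 0" if "s \<notin> {a..b}" for s using uz[of s] that by auto
  from right_averages_converge_AE[OF u u\<gamma> this] obtain \<delta> :: "nat \<Rightarrow> real" where
    \<delta>: "\<And>k. 0 < \<delta> k" "\<delta> \<longlonglongrightarrow> 0"
    "AE s in lborel. (\<lambda>k. (LINT r:{s<..s + \<delta> k}|lborel. \<bar>u r - u s\<bar>) / \<delta> k) \<longlonglongrightarrow> 0" by blast
  from \<delta>(3) show ?thesis
  proof (eventually_elim, intro impI)
    fix s0 assume s0: "a < s0" "s0 < b"
      and lim: "(\<lambda>k. (LINT r:{s0<..s0 + \<delta> k}|lborel. \<bar>u r - u s0\<bar>) / \<delta> k) \<longlonglongrightarrow> 0"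
    \<comment> \<open>The parameter \<open>m - K * (s - s0)\<close> of the arc reaches
      \<open>0\<close>, its summit, at \<open>s0 + m / K\<close>.\<close>
    define s1 where "s1 = min b (s0 + m / K)"
    have s1: "s0 < s1" "s1 \<le> b" "s1 \<le> s0 + m / K" using s0 m0 K0 by (auto simp: s1_def)
    have Km: "K * (s - s0) \<le> m" if "s \<le> s0 + m / K" for s
    proof -
      have "s - s0 \<le> m / K" using that by simp
      then show ?thesis using K0 by (simp add: pos_le_divide_eq mult.commute)
    qed
    define \<psi> where "\<psi> s = u s0 + (prof (m - K * (s - s0)) - prof m) / K" for s
    define d where "d s = (if s \<in> {s0<..<s1} then max 0 (u s - \<psi> s) else 0)" for s
    have \<psi>t: "u s0 \<le> \<psi> s" if "s0 < s" "s < s1" for s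
    proof -
      have "0 \<le> m - K * (s - s0)" "m - K * (s - s0) \<le> m" using Km[of s] that s1 K0 by auto
      then have "prof m \<le> prof (m - K * (s - s0))" using m by (intro prof_antimono) auto
      then show ?thesis using K0 by (simp add: \<psi>_def)
    qed
    have d_le: "0 \<le> d s" "d s \<le> \<bar>u s - u s0\<bar>" for s using \<psi>t[of s] by (auto simp: d_def)
    have dm: "d \<in> borel_measurable borel"
    proof -
      have "(\<lambda>s. indicator {s0<..<s1} s *\<^sub>R \<psi> s) \<in> borel_measurable borel"
      proof (rule borel_measurable_continuous_on_indicator)
        have "continuous_on {s0<..<s1} (\<lambda>s. prof (m - K * (s - s0)))"
        proof (rule continuous_on_compose2[OF prof_continuous])
          show "(\<lambda>s. m - K * (s - s0)) ` {s0<..<s1} \<subseteq> {- 1 / pa<..<1 / pa}"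
          proof clarsimp
            fix s assume s: "s0 < s" "s < s1"
            then have "K * (s - s0) > 0" "K * (s - s0) \<le> m" using Km[of s] s1 K0 by auto
            then show "- (1 / pa) < m - K * (s - s0) \<and> m - K * (s - s0) < 1 / pa" using m pa_pos
              by (auto intro: less_le_trans[of _ 0])
          qed
        qed (auto intro!: continuous_intros)
        then show "continuous_on {s0<..<s1} \<psi>"
          unfolding \<psi>_def using K0 by (intro continuous_intros) auto
      qed simp
      then have "(\<lambda>s. max 0 (indicator {s0<..<s1} s * u s - indicator {s0<..<s1} s *\<^sub>R \<psi> s)) \<in> borel_measurable borel" by measurable
      moreover have "d s = max 0 (indicator {s0<..<s1} s * u s - indicator {s0<..<s1} s *\<^sub>R \<psi> s)" for s
        by (auto simp: d_def indicator_def)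
      ultimately show ?thesis by (simp only: fun_eq_iff[symmetric] cong: measurable_cong)
    qed
    \<comment> \<open>The arc stays above its initial height \<open>u s0\<close>, so
      \<open>d\<close> is dominated by \<open>\<bar>u - u s0\<bar>\<close>, whose right averages
      vanish at the chosen \<open>s0\<close>.\<close>
    have left: "(\<lambda>k. (LINT s:{s0<..s0 + \<delta> k}|lborel. d s) / \<delta> k) \<longlonglongrightarrow> 0"
    proof (rule tendsto_sandwich[OF _ _ tendsto_const lim])
      show "\<forall>\<^sub>F k in sequentially. 0 \<le> (LINT s:{s0<..s0 + \<delta> k}|lborel. d s) / \<delta> k"
        using \<delta>(1) d_le(1) by (auto intro!: always_eventually divide_nonneg_pos integral_nonneg_AE simp: set_lebesgue_integral_def)
      show "\<forall>\<^sub>F k in sequentially. (LINT s:{s0<..s0 + \<delta> k}|lborel. d s) / \<delta> k \<le> (LINT r:{s0<..s0 + \<delta> k}|lborel. \<bar>u r - u s0\<bar>) / \<delta> k"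
      proof (intro always_eventually allI divide_right_mono)
        fix k
        have b: "\<bar>u s - u s0\<bar> \<le> 2 * \<gamma>" for s using u\<gamma>[of s] u\<gamma>[of s0] by linarith
        have i: "set_integrable lborel {s0<..s0 + \<delta> k} f" if "f \<in> borel_measurable borel" "\<And>s. \<bar>f s\<bar> \<le> 2 * \<gamma>" for f :: "real \<Rightarrow> real"
          unfolding set_integrable_def
          by (rule integrable_bounded_support[where C="2 * \<gamma>" and c=s0 and d="s0 + \<delta> k"]) (use that \<gamma> in \<open>auto simp: indicator_def\<close>)
        show "(LINT s:{s0<..s0 + \<delta> k}|lborel. d s) \<le> (LINT r:{s0<..s0 + \<delta> k}|lborel. \<bar>u r - u s0\<bar>)"
        proof (intro set_integral_mono i dm d_le)
          show "\<bar>d s\<bar> \<le> 2 * \<gamma>" for s using d_le[of s] b[of s] by linarith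
        qed (use b in auto)
      qed (use \<delta>(1) in \<open>auto simp: less_imp_le\<close>)
    qed
    \<comment> \<open>Either the interval ends no later than the summit, or the arc has risen by
      more than \<open>2 * \<gamma>\<close> just before \<open>s1\<close>; in the second case
      nothing is removed near \<open>s1\<close>.\<close>
    have right: "(s1 = b \<and> K * (b - s0) \<le> m) \<or> (\<lambda>k. (LINT s:{s1 - \<delta> k..<s1}|lborel. d s) / \<delta> k) \<longlonglongrightarrow> 0"
    proof (cases "b \<le> s0 + m / K")
      case True
      then show ?thesis using Km[of b] by (simp add: s1_def)
    next
      case False
      then have s1e: "s1 = s0 + m / K" by (simp add: s1_def)
      have "isCont prof 0"
        using prof_continuous pa_pos by (auto simp: continuous_on_eq_continuous_at)
      then have "((\<lambda>q. (prof q - prof m) / K) \<longlongrightarrow> (prof 0 - prof m) / K) (at 0)"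
        using K0 by (intro tendsto_intros) (auto simp: isCont_def)
      then have "\<forall>\<^sub>F q in at 0. 2 * \<gamma> < (prof q - prof m) / K" using m(3) by (rule order_tendstoD(1))
      then obtain \<eta> where \<eta>: "\<eta> > 0" "\<And>q. q \<noteq> 0 \<Longrightarrow> \<bar>q\<bar> < \<eta> \<Longrightarrow> 2 * \<gamma> < (prof q - prof m) / K"
        unfolding eventually_at by (auto simp: dist_real_def)
      have "\<forall>\<^sub>F k in sequentially. \<delta> k < \<eta> / K" using \<delta>(2) \<eta>(1) K0 by (auto dest: order_tendstoD(2)[of _ _ _ "\<eta> / K"])
      then have "\<forall>\<^sub>F k in sequentially. (LINT s:{s1 - \<delta> k..<s1}|lborel. d s) / \<delta> k = 0"
      proof eventually_elim
        case (elim k)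
        have "indicator {s1 - \<delta> k..<s1} s *\<^sub>R d s = 0" for s
        proof (cases "s \<in> {s1 - \<delta> k..<s1} \<and> s > s0")
          case True
          then have "0 < s1 - s" "s1 - s < \<eta> / K" using elim by auto
          then have "0 < K * (s1 - s)" "K * (s1 - s) < \<eta>" using K0 by (auto simp: pos_less_divide_eq mult.commute)
          moreover have "K * (s1 - s) = m - K * (s - s0)" using K0 by (simp add: s1e field_simps)
          ultimately have "2 * \<gamma> < (prof (m - K * (s - s0)) - prof m) / K" by (intro \<eta>) auto
          then have "u s \<le> \<psi> s" using u\<gamma>[of s] u\<gamma>[of s0] unfolding \<psi>_def by linarith
          then show ?thesis using True by (simp add: d_def)
        next
          case False then show ?thesis by (auto simp: d_def indicator_def)
        qed
        then show ?case by (simp only: set_lebesgue_integral_def) simp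
      qed
      then show ?thesis by (intro disjI2 tendsto_eventually)
    qed
    have "AE s in lborel. d s = 0"
    proof (rule comparison[OF min p \<gamma> ab K _ s1(1,2) m(2) _ \<psi>_def _ d_def \<delta>(1,2) left right])
      have "- 1 / pa \<le> 0" using pa_pos by simp
      then show "- 1 / pa \<le> m - K * (s1 - s0)" using Km[of s1] s1 by linarith
      show "- \<gamma> \<le> \<psi> s" if "s0 < s" "s < s1" for s using \<psi>t[OF that] u\<gamma>[of s0] by linarith
    qed (use s0 in simp)
    then show "AE s in lborel. s0 < s \<longrightarrow> s < b \<longrightarrow> u s \<le> u s0 + L * (s - s0)"
    proof (eventually_elim, intro impI)
      fix s assume ds: "d s = 0" and s: "s0 < s" "s < b"
      show "u s \<le> u s0 + L * (s - s0)"
      proof (cases "s < s1")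
        case True
        have "u s \<le> \<psi> s" using ds s True by (auto simp: d_def max_def split: if_splits)
        also have "prof (m - K * (s - s0)) - prof m \<le> L * (m - (m - K * (s - s0)))"
          using Km[of s] True s1 s K0 by (intro L) auto
        then have "(prof (m - K * (s - s0)) - prof m) / K \<le> L * (s - s0)" using K0 by (simp add: field_simps)
        then have "\<psi> s \<le> u s0 + L * (s - s0)" by (simp add: \<psi>_def)
        finally show ?thesis .
      next
        case False
        \<comment> \<open>From the summit on the oscillation bound is enough: \<open>u\<close> grows
          by at most \<open>2 * \<gamma>\<close>, less than the height of the arc, which is itself
          at most \<open>L * (s1 - s0)\<close>.\<close>
        then have s1e: "s1 = s0 + m / K" using s by (simp add: s1_def min_def split: if_splits)
        have "u s \<le> u s0 + 2 * \<gamma>" using u\<gamma>[of s] u\<gamma>[of s0] by linarith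
        also have "2 * \<gamma> \<le> (prof 0 - prof m) / K" using m(3) by simp
        also have "\<dots> \<le> (L * (m - 0)) / K" using L[of 0] m0 K0 by (intro divide_right_mono) auto
        also have "\<dots> = L * (s1 - s0)" by (simp add: s1e)
        also have "\<dots> \<le> L * (s - s0)" using False Lp by (intro mult_left_mono) auto
        finally show ?thesis by simp
      qed
    qed
  qed
qed

text \<open>Each good point controls almost every point to its right but no prescribed one. Two good
  points are therefore compared through a common point \<open>r\<close> slightly to the right of the
  later one. Good points are dense in the interval, and \<open>u\<close> extends from them to a
  Lipschitz function.\<close>

lemma minimizing_lipschitz:
  assumes min: "minimizing a b p \<gamma> g u T" and p: "p \<ge> 1" and \<gamma>: "\<gamma> > 0" and ab: "a < b"
    and K: "p * (2 * \<gamma>) powr (p - 1) < K"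
    and m: "0 \<le> m" "m \<le> 1 / pa" "2 * \<gamma> < (prof 0 - prof m) / K"
    and L: "0 \<le> L" "\<And>q. 0 \<le> q \<Longrightarrow> q < m \<Longrightarrow> prof q - prof m \<le> L * (m - q)"
  obtains v where "L-lipschitz_on {a<..<b} v" "AE s in lborel. s \<in> {a<..<b} \<longrightarrow> v s = u s"
proof -
  define good where "good s0 \<longleftrightarrow> a < s0 \<and> s0 < b \<and> (AE s in lborel. s0 < s \<longrightarrow> s < b \<longrightarrow> \<bar>u s - u s0\<bar> \<le> L * (s - s0))" for s0
  have up: "AE s0 in lborel. a < s0 \<longrightarrow> s0 < b \<longrightarrow> (AE s in lborel. s0 < s \<longrightarrow> s < b \<longrightarrow> u s \<le> u s0 + L * (s - s0))"
    by (rule minimizing_increase_bound[OF min p \<gamma> ab K m]) (rule L(2))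
  have low: "AE s0 in lborel. a < s0 \<longrightarrow> s0 < b \<longrightarrow> (AE s in lborel. s0 < s \<longrightarrow> s < b \<longrightarrow> - u s \<le> - u s0 + L * (s - s0))"
    by (rule minimizing_increase_bound[OF minimizing_uminus[OF min ab] p \<gamma> ab K m]) (rule L(2))
  have good_AE: "AE s0 in lborel. a < s0 \<longrightarrow> s0 < b \<longrightarrow> good s0"
    using up low
  proof (eventually_elim, intro impI)
    fix s0 assume s0: "a < s0" "s0 < b"
      and 1: "a < s0 \<longrightarrow> s0 < b \<longrightarrow> (AE s in lborel. s0 < s \<longrightarrow> s < b \<longrightarrow> u s \<le> u s0 + L * (s - s0))"
      and 2: "a < s0 \<longrightarrow> s0 < b \<longrightarrow> (AE s in lborel. s0 < s \<longrightarrow> s < b \<longrightarrow> - u s \<le> - u s0 + L * (s - s0))"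
    have "AE s in lborel. s0 < s \<longrightarrow> s < b \<longrightarrow> u s \<le> u s0 + L * (s - s0)"
      "AE s in lborel. s0 < s \<longrightarrow> s < b \<longrightarrow> - u s \<le> - u s0 + L * (s - s0)" using 1 2 s0 by auto
    then have "AE s in lborel. s0 < s \<longrightarrow> s < b \<longrightarrow> \<bar>u s - u s0\<bar> \<le> L * (s - s0)"
      by eventually_elim auto
    then show "good s0" using s0 by (simp add: good_def)
  qed
  have lip: "\<bar>u t - u s\<bar> \<le> L * (t - s)" if "good s" "good t" "s < t" for s t
  proof (rule field_le_epsilon)
    fix e :: real assume e: "e > 0"
    define e' where "e' = e / (2 * L + 1)"
    have e': "e' > 0" "2 * L * e' \<le> e" using e L(1) by (auto simp: e'_def field_simps)
    have "AE r in lborel. s < r \<longrightarrow> r < b \<longrightarrow> \<bar>u r - u s\<bar> \<le> L * (r - s)" "AE r in lborel. t < r \<longrightarrow> r < b \<longrightarrow> \<bar>u r - u t\<bar> \<le> L * (r - t)"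
      using that by (auto simp: good_def)
    then have "AE r in lborel. (t < r \<longrightarrow> r < b \<longrightarrow> \<bar>u r - u s\<bar> \<le> L * (r - s) \<and> \<bar>u r - u t\<bar> \<le> L * (r - t))"
      by eventually_elim (use that(3) in auto)
    moreover have "t < min b (t + e')" using that(2) e' by (auto simp: good_def)
    ultimately obtain r where r: "t < r" "r < min b (t + e')" "\<bar>u r - u s\<bar> \<le> L * (r - s)" "\<bar>u r - u t\<bar> \<le> L * (r - t)"
      using AE_lborel_ex_between[of _ t "min b (t + e')"] by force
    have "\<bar>u t - u s\<bar> \<le> L * (r - s) + L * (r - t)" using r by linarith
    also have "\<dots> = L * (t - s) + 2 * L * (r - t)" by (simp add: algebra_simps)
    also have "2 * L * (r - t) \<le> 2 * L * e'" using r L(1) by (intro mult_left_mono) auto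
    finally show "\<bar>u t - u s\<bar> \<le> L * (t - s) + e" using e' by linarith
  qed
  have "L-lipschitz_on {s. good s} u"
  proof (rule lipschitz_onI[OF _ L(1)])
    fix x y assume "x \<in> {s. good s}" "y \<in> {s. good s}"
    then show "dist (u x) (u y) \<le> L * dist x y"
      using lip[of x y] lip[of y x] by (cases x y rule: linorder_cases) (auto simp: dist_real_def abs_minus_commute)
  qed
  then obtain v where v: "L-lipschitz_on (closure {s. good s}) v" "\<And>x. good x \<Longrightarrow> v x = u x"
    using lipschitz_extend_closure[of L "{s. good s}" u] by auto
  have "{a<..<b} \<subseteq> closure {s. good s}"
  proof
    fix x assume x: "x \<in> {a<..<b}"
    show "x \<in> closure {s. good s}"
      unfolding closure_approachable
    proof (intro allI impI)
      fix e :: real assume "e > 0"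
      then have "x < min b (x + e)" using x by auto
      from AE_lborel_ex_between[OF good_AE this] x obtain r where "x < r" "r < min b (x + e)" "good r" by auto
      then show "\<exists>y\<in>{s. good s}. dist y x < e" by (intro bexI[of _ r]) (auto simp: dist_real_def)
    qed
  qed
  then have "L-lipschitz_on {a<..<b} v" using v(1) lipschitz_on_subset by blast
  moreover have "AE s in lborel. s \<in> {a<..<b} \<longrightarrow> v s = u s"
    using good_AE by eventually_elim (use v(2) in auto)
  ultimately show ?thesis using that by blast
qed

end

section \<open>Second-order regularity\<close>

lemma AE_le_imp_le:
  fixes f g :: "real \<Rightarrow> real"
  assumes "continuous_on {c<..<d} f" "continuous_on {c<..<d} g"
    and "AE s in lborel. s \<in> {c<..<d} \<longrightarrow> f s \<le> g s" and s: "s \<in> {c<..<d}"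
  shows "f s \<le> g s"
proof (rule ccontr)
  assume "\<not> f s \<le> g s"
  then have "f s - g s > 0" by simp
  moreover have "isCont (\<lambda>x. f x - g x) s"
    using assms(1,2) s by (auto intro!: continuous_intros simp: continuous_on_eq_continuous_at)
  ultimately have "\<forall>\<^sub>F x in at s. f x - g x > 0" by (auto simp: isCont_def dest: order_tendstoD(1)[of _ _ _ 0])
  then obtain e where e: "e > 0" "\<And>x. x \<noteq> s \<Longrightarrow> \<bar>x - s\<bar> < e \<Longrightarrow> f x - g x > 0"
    unfolding eventually_at by (auto simp: dist_real_def)
  have "s < min d (s + e)" using s e by auto
  from AE_lborel_ex_between[OF assms(3) this] obtain r where "s < r" "r < min d (s + e)" "r \<in> {c<..<d} \<longrightarrow> f r \<le> g r" by blast
  then show False using e(2)[of r] s by auto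
qed

definition slope :: "(real \<Rightarrow> real) \<Rightarrow> real \<Rightarrow> real \<Rightarrow> real" where
  "slope v x y = (v y - v x) / (y - x)"

lemma slope_commute: "slope v x y = slope v y x"
  by (simp add: slope_def) (metis minus_diff_eq minus_divide_divide)

lemma slope_split:
  assumes "x < y" "y < z"
  shows "slope v x z - slope v x y = (z - y) / (z - x) * (slope v y z - slope v x y)"
proof -
  define p q where "p = y - x" and "q = z - y"
  have pq: "p > 0" "q > 0" "z - x = p + q" using assms by (auto simp: p_def q_def)
  have 1: "v y - v x = p * slope v x y" "v z - v y = q * slope v y z"
    using pq(1,2) unfolding slope_def p_def[symmetric] q_def[symmetric] by simp_all
  then have "v z - v x = p * slope v x y + q * slope v y z" by simp
  then have e: "slope v x z = (p * slope v x y + q * slope v y z) / (p + q)" using pq(3) by (simp add: slope_def)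
  have "(p * A + q * B) / (p + q) - A = q / (p + q) * (B - A)" for A B
  proof -
    have "(p * A + q * B) / (p + q) - A = (p * A + q * B - A * (p + q)) / (p + q)"
      using pq by (subst diff_divide_distrib) simp
    then show ?thesis by (simp add: algebra_simps)
  qed
  then show ?thesis unfolding e pq(3) q_def[symmetric] .
qed

text \<open>\<open>slope_split\<close> turns the control of consecutive secants into control of
  secants from a common point, so these converge with error \<open>2 * C * \<bar>h\<bar>\<close>.
  Two near points share a secant, whence the constant \<open>4 * C\<close>. For points more than
  \<open>\<eta> / 2\<close> apart the bound \<open>\<bar>D\<bar> \<le> L\<close> gives
  \<open>4 * L / \<eta>\<close>.\<close>

lemma C11_on_if_slopes_close:
  assumes lip: "L-lipschitz_on {a<..<b} v" and C: "C \<ge> 0" and \<eta>: "\<eta> > 0"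
    and sl: "\<And>x y z. a < x \<Longrightarrow> x < y \<Longrightarrow> y < z \<Longrightarrow> z < b \<Longrightarrow> z - x \<le> \<eta> \<Longrightarrow> \<bar>slope v x y - slope v y z\<bar> \<le> C * (z - x)"
  shows "C11_on {a<..<b} v"
proof -
  have L0: "L \<ge> 0" using lip by (rule lipschitz_on_nonneg)
  have close: "\<bar>slope v s (s + h) - slope v s (s + k)\<bar> \<le> 2 * C * r"
    if "h \<noteq> 0" "k \<noteq> 0" "\<bar>h\<bar> \<le> r" "\<bar>k\<bar> \<le> r" "2 * r \<le> \<eta>" "a < s" "s < b" "a < s + h" "s + h < b" "a < s + k" "s + k < b" for s h k r
  proof -
    have r0: "r > 0" using that by linarith
    note nz = that(1,2)
    have right: "\<bar>slope v s (s + h) - slope v s (s + k)\<bar> \<le> 2 * C * r"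
      if "0 < h" "h < k" "k \<le> r" "s + k < b" for h k
    proof -
      have "slope v s (s + k) - slope v s (s + h) = (k - h) / k * (slope v (s + h) (s + k) - slope v s (s + h))"
        using slope_split[of s "s + h" "s + k" v] that by simp
      then have "\<bar>slope v s (s + k) - slope v s (s + h)\<bar> = (k - h) / k * \<bar>slope v (s + h) (s + k) - slope v s (s + h)\<bar>"
        using that by (simp add: abs_mult)
      also have "\<dots> \<le> 1 * (C * (s + k - s))"
        using sl[of s "s + h" "s + k"] that \<open>a < s\<close> \<open>2 * r \<le> \<eta>\<close> r0 C by (intro mult_mono) (auto simp: abs_minus_commute)
      also have "\<dots> \<le> C * (2 * r)" using that r0 C by (simp, intro mult_left_mono) auto
      finally show ?thesis by (simp add: abs_minus_commute mult.commute mult.left_commute)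
    qed
    have left: "\<bar>slope v s (s - h) - slope v s (s - k)\<bar> \<le> 2 * C * r"
      if "0 < h" "h < k" "k \<le> r" "a < s - k" for h k
    proof -
      have "slope v (s - k) s - slope v (s - k) (s - h) = h / k * (slope v (s - h) s - slope v (s - k) (s - h))"
        using slope_split[of "s - k" "s - h" s v] that by simp
      then have e: "slope v (s - h) s - slope v (s - k) s = (1 - h / k) * (slope v (s - h) s - slope v (s - k) (s - h))"
        by (simp add: algebra_simps)
      have "\<bar>slope v (s - h) s - slope v (s - k) s\<bar> = (1 - h / k) * \<bar>slope v (s - h) s - slope v (s - k) (s - h)\<bar>"
        unfolding e using that by (simp add: abs_mult)
      also have "\<dots> \<le> 1 * (C * (s - (s - k)))"
        using sl[of "s - k" "s - h" s] that \<open>s < b\<close> \<open>2 * r \<le> \<eta>\<close> r0 C by (intro mult_mono) (auto simp: abs_minus_commute)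
      also have "\<dots> \<le> C * (2 * r)" using that r0 C by (simp, intro mult_left_mono) auto
      finally show ?thesis by (simp add: slope_commute[of v s] mult.commute mult.left_commute)
    qed
    have both: "\<bar>slope v s (s + h) - slope v s (s - k)\<bar> \<le> 2 * C * r"
      if "0 < h" "0 < k" "h \<le> r" "k \<le> r" "s + h < b" "a < s - k" for h k
    proof -
      have "\<bar>slope v (s - k) s - slope v s (s + h)\<bar> \<le> C * (s + h - (s - k))"
        using that \<open>2 * r \<le> \<eta>\<close> by (intro sl) auto
      also have "\<dots> \<le> C * (2 * r)" using that C by (intro mult_left_mono) auto
      finally show ?thesis by (simp add: slope_commute[of v s "s - k"] abs_minus_commute mult.commute mult.left_commute)
    qed
    have Cr: "0 \<le> 2 * C * r" using C r0 by simp
    consider "h = k" | "0 < h" "h < k" | "0 < k" "k < h" | "h < 0" "k < h" | "k < 0" "h < k" "h < 0" | "h < 0" "0 < k" | "k < 0" "0 < h"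
      using nz by linarith
    then show ?thesis
    proof cases
      case 1 then show ?thesis using Cr by simp
    next
      case 2 then show ?thesis using right[of h k] that by auto
    next
      case 3 then show ?thesis using right[of k h] that by (auto simp: abs_minus_commute)
    next
      case 4 then show ?thesis using left[of "- h" "- k"] that by auto
    next
      case 5 then show ?thesis using left[of "- k" "- h"] that by (auto simp: abs_minus_commute)
    next
      case 6 then show ?thesis using both[of k "- h"] that by (auto simp: abs_minus_commute)
    next
      case 7 then show ?thesis using both[of h "- k"] that by auto
    qed
  qed
  have "\<exists>D. \<forall>h. h \<noteq> 0 \<longrightarrow> \<bar>h\<bar> \<le> \<eta> / 2 \<longrightarrow> a < s + h \<longrightarrow> s + h < b \<longrightarrow> \<bar>slope v s (s + h) - D\<bar> \<le> 2 * C * \<bar>h\<bar>"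
    if s: "a < s" "s < b" for s
  proof -
    define \<rho> where "\<rho> = min (\<eta> / 2) ((b - s) / 2)"
    have \<rho>: "\<rho> > 0" "\<rho> \<le> \<eta> / 2" "s + \<rho> < b" using \<eta> s by (auto simp: \<rho>_def min_def field_simps)
    define e where "e n = \<rho> / real (Suc n)" for n
    have e: "0 < e n" "e n \<le> \<rho>" for n using \<rho> by (auto simp: e_def field_simps)
    have e_anti: "e n \<le> e m" if "m \<le> n" for m n using that \<rho> by (auto simp: e_def intro!: divide_left_mono)
    have e0: "e \<longlonglongrightarrow> 0"
      unfolding e_def using tendsto_mult[OF tendsto_const[of \<rho>] LIMSEQ_inverse_real_of_nat] by (simp add: divide_inverse)
    define x where "x n = slope v s (s + e n)" for n
    have xx: "\<bar>x m - x n\<bar> \<le> 2 * C * e N" if "m \<ge> N" "n \<ge> N" for m n N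
      unfolding x_def using e[of m] e[of n] e[of N] e_anti[OF that(1)] e_anti[OF that(2)] \<rho> s by (intro close) auto
    have "Cauchy x"
    proof (rule CauchyI)
      fix \<epsilon> :: real assume \<epsilon>: "\<epsilon> > 0"
      have "(\<lambda>n. 2 * C * e n) \<longlonglongrightarrow> 2 * C * 0" by (intro tendsto_intros e0)
      then obtain N where "2 * C * e N < \<epsilon>" using order_tendstoD(2)[of _ _ _ \<epsilon>] \<epsilon> by (fastforce simp: eventually_sequentially)
      then show "\<exists>M. \<forall>m\<ge>M. \<forall>n\<ge>M. norm (x m - x n) < \<epsilon>"
        using le_less_trans[OF xx] by (intro exI[of _ N]) auto
    qed
    then obtain D where D: "x \<longlonglongrightarrow> D" using Cauchy_convergent_iff convergent_def by blast
    have "\<bar>slope v s (s + h) - D\<bar> \<le> 2 * C * \<bar>h\<bar>" if h: "h \<noteq> 0" "\<bar>h\<bar> \<le> \<eta> / 2" "a < s + h" "s + h < b" for h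
    proof (rule tendsto_upperbound)
      show "(\<lambda>n. \<bar>slope v s (s + h) - x n\<bar>) \<longlonglongrightarrow> \<bar>slope v s (s + h) - D\<bar>" by (intro tendsto_intros D)
      have "\<forall>\<^sub>F n in sequentially. e n < \<bar>h\<bar>" using order_tendstoD(2)[OF e0, of "\<bar>h\<bar>"] h by simp
      then show "\<forall>\<^sub>F n in sequentially. \<bar>slope v s (s + h) - x n\<bar> \<le> 2 * C * \<bar>h\<bar>"
      proof eventually_elim
        case (elim n)
        then show ?case unfolding x_def using h e[of n] \<rho> s by (intro close) auto
      qed
    qed simp
    then show ?thesis by blast
  qed
  then have "\<forall>s. \<exists>D. a < s \<longrightarrow> s < b \<longrightarrow> (\<forall>h. h \<noteq> 0 \<longrightarrow> \<bar>h\<bar> \<le> \<eta> / 2 \<longrightarrow> a < s + h \<longrightarrow> s + h < b \<longrightarrow> \<bar>slope v s (s + h) - D\<bar> \<le> 2 * C * \<bar>h\<bar>)" by blast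
  then obtain D where D: "\<And>s h. a < s \<Longrightarrow> s < b \<Longrightarrow> h \<noteq> 0 \<Longrightarrow> \<bar>h\<bar> \<le> \<eta> / 2 \<Longrightarrow> a < s + h \<Longrightarrow> s + h < b \<Longrightarrow> \<bar>slope v s (s + h) - D s\<bar> \<le> 2 * C * \<bar>h\<bar>"
    by metis
  have deriv: "(v has_real_derivative D s) (at s)" if s: "s \<in> {a<..<b}" for s
    unfolding DERIV_def
  proof (rule LIM_zero_cancel, rule Lim_null_comparison)
    show "((\<lambda>h. 2 * C * \<bar>h\<bar>) \<longlongrightarrow> 0) (at 0)" by (auto intro!: tendsto_eq_intros)
    have "\<forall>\<^sub>F h in at 0. h \<noteq> 0 \<and> \<bar>h\<bar> < min (\<eta> / 2) (min (s - a) (b - s))"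
      unfolding eventually_at using \<eta> s by (intro exI[of _ "min (\<eta> / 2) (min (s - a) (b - s))"]) (auto simp: dist_real_def)
    then show "\<forall>\<^sub>F h in at 0. norm ((v (s + h) - v s) / h - D s) \<le> 2 * C * \<bar>h\<bar>"
    proof eventually_elim
      case (elim h)
      have "slope v s (s + h) = (v (s + h) - v s) / h" by (simp add: slope_def)
      then show ?case using D[of s h] elim s by auto
    qed
  qed
  have DL: "\<bar>D s\<bar> \<le> L" if s: "s \<in> {a<..<b}" for s
  proof (rule tendsto_upperbound)
    show "((\<lambda>h. \<bar>(v (s + h) - v s) / h\<bar>) \<longlongrightarrow> \<bar>D s\<bar>) (at 0)" using deriv[OF s] by (intro tendsto_intros) (simp add: DERIV_def)
    have "\<forall>\<^sub>F h in at 0. h \<noteq> 0 \<and> \<bar>h\<bar> < min (s - a) (b - s)"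
      unfolding eventually_at using s by (intro exI[of _ "min (s - a) (b - s)"]) (auto simp: dist_real_def)
    then show "\<forall>\<^sub>F h in at 0. \<bar>(v (s + h) - v s) / h\<bar> \<le> L"
    proof eventually_elim
      case (elim h)
      then have "a < s + h" "s + h < b" by linarith+
      then have "\<bar>v (s + h) - v s\<bar> \<le> L * \<bar>h\<bar>" using lipschitz_onD[OF lip, of "s + h" s] s by (simp add: dist_real_def)
      then show ?case using elim by (simp add: field_simps)
    qed
  qed simp
  have "(max (4 * C) (4 * L / \<eta>))-lipschitz_on {a<..<b} D"
  proof (rule lipschitz_onI)
    fix x y assume xy: "x \<in> {a<..<b}" "y \<in> {a<..<b}"
    have "\<bar>D x - D y\<bar> \<le> max (4 * C) (4 * L / \<eta>) * \<bar>x - y\<bar>"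
    proof (cases "x = y \<or> \<bar>x - y\<bar> > \<eta> / 2")
      case True
      show ?thesis
      proof (cases "x = y")
        case False
        then have far: "\<eta> / 2 \<le> \<bar>x - y\<bar>" using True by auto
        have "\<bar>D x - D y\<bar> \<le> 2 * L" using DL[OF xy(1)] DL[OF xy(2)] by linarith
        also have "\<dots> = (4 * L / \<eta>) * (\<eta> / 2)" using \<eta> by simp
        also have "\<dots> \<le> (4 * L / \<eta>) * \<bar>x - y\<bar>" using far L0 \<eta> by (intro mult_left_mono) auto
        also have "\<dots> \<le> max (4 * C) (4 * L / \<eta>) * \<bar>x - y\<bar>" by (intro mult_right_mono) auto
        finally show ?thesis .
      qed simp
    next
      case False
      have "\<bar>slope v x y - D x\<bar> \<le> 2 * C * \<bar>y - x\<bar>" using D[of x "y - x"] False xy by (auto simp: abs_minus_commute)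
      moreover have "\<bar>slope v y x - D y\<bar> \<le> 2 * C * \<bar>x - y\<bar>" using D[of y "x - y"] False xy by auto
      ultimately have "\<bar>D x - D y\<bar> \<le> 4 * C * \<bar>x - y\<bar>" using slope_commute[of v x y] by (simp add: abs_minus_commute)
      also have "\<dots> \<le> max (4 * C) (4 * L / \<eta>) * \<bar>x - y\<bar>" by (intro mult_right_mono) auto
      finally show ?thesis .
    qed
    then show "dist (D x) (D y) \<le> max (4 * C) (4 * L / \<eta>) * dist x y" by (simp add: dist_real_def)
  qed (use C in auto)
  then show ?thesis unfolding C11_on_def using deriv by blast
qed

context monotone_anisotropy
begin

lemma phi_prof: "\<bar>y\<bar> \<le> 1 / pa \<Longrightarrow> \<bar>y\<bar> < 1 / pa \<Longrightarrow> \<phi> (y, prof y) = 1"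
proof (rule ccontr)
  assume y: "\<bar>y\<bar> \<le> 1 / pa" and "\<phi> (y, prof y) \<noteq> 1"
  then have lt: "\<phi> (y, prof y) < 1" using prof_props(1)[OF y] by (simp add: wulff_iff)
  define e where "e = (1 - \<phi> (y, prof y)) / pb"
  have e: "e > 0" "e * pb = 1 - \<phi> (y, prof y)" using lt pb_pos by (auto simp: e_def)
  have "\<phi> (y, prof y + e) \<le> \<phi> (y, prof y) + \<phi> (0, e)" using phi_triangle[of "(y, prof y)" "(0, e)"] by simp
  also have "\<dots> = 1" using e by (simp add: phi_axis)
  finally show False using prof_props(3)[OF y, of "prof y + e"] prof_props(2)[OF y] e by simp
qed

text \<open>A second-order Taylor estimate of \<open>\<phi>\<close> at \<open>(y, prof y)\<close>
  shows that a parabola through this point, bent downwards from the tangent line, stays in the Wulff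
  shape. It requires bounds on the derivatives of \<open>\<phi>\<close> on the compact ring
  \<open>A\<close> and a positive lower bound for the vertical derivative; the latter comes from
  keeping \<open>y\<close> away from the ends.\<close>

lemma prof_support_parabola:
  assumes C2: "C2_anisotropy \<phi>" and m1: "0 \<le> m1" "m1 < 1 / pa"
  obtains C h0 where "C \<ge> 0" "h0 > 0"
    "\<And>y. \<bar>y\<bar> \<le> m1 \<Longrightarrow> \<exists>\<tau>. \<forall>h. \<bar>h\<bar> \<le> h0 \<longrightarrow> prof y + \<tau> * h - C * h\<^sup>2 \<le> prof (y + h)"
proof -
  obtain D :: "plane \<Rightarrow> plane \<Rightarrow>\<^sub>L real" and D2 :: "plane \<Rightarrow> plane \<Rightarrow>\<^sub>L (plane \<Rightarrow>\<^sub>L real)" where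
    D: "\<And>x. x \<noteq> 0 \<Longrightarrow> (\<phi> has_derivative blinfun_apply (D x)) (at x)"
    and D2: "\<And>x. x \<noteq> 0 \<Longrightarrow> (D has_derivative blinfun_apply (D2 x)) (at x)" "continuous_on (UNIV - {0}) D2"
    using C2 unfolding C2_anisotropy_def C2_on_def by blast
  define A where "A = {z. 1/2 \<le> \<phi> z \<and> \<phi> z \<le> 2}"
  have A0: "0 \<notin> A" by (simp add: A_def)
  have "closed A" unfolding A_def Collect_conj_eq
    by (intro closed_Int closed_Collect_le phi_continuous continuous_on_const)
  moreover have "bounded A"
  proof -
    obtain c where c: "c > 0" "\<And>x. c * norm x \<le> \<phi> x" using phi_norm_bounds by blast
    have "norm x \<le> 2 / c" if "\<phi> x \<le> 2" for x using c(1) c(2)[of x] that by (simp add: field_simps)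
    then show ?thesis unfolding A_def bounded_iff by auto
  qed
  ultimately have Ac: "compact A" by (simp add: compact_eq_bounded_closed)
  have "bounded (D2 ` A)"
    using A0 by (intro compact_imp_bounded compact_continuous_image continuous_on_subset[OF D2(2)] Ac) auto
  then obtain B where B: "\<And>z. z \<in> A \<Longrightarrow> norm (D2 z) \<le> B" unfolding bounded_iff by auto
  have "continuous_on A D" using D2(1) A0 by (intro continuous_at_imp_continuous_on) (metis has_derivative_continuous)
  then have "bounded (D ` A)" by (intro compact_imp_bounded compact_continuous_image Ac)
  then obtain B1 where B1: "\<And>z. z \<in> A \<Longrightarrow> norm (D z) \<le> B1" unfolding bounded_iff by auto
  have in_A: "(1 / 2 / pb) *\<^sub>R (0, 1) \<in> A" unfolding A_def using pb_pos by (simp add: phi_axis)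
  have B0: "B \<ge> 0" "B1 \<ge> 0" using B[OF in_A] B1[OF in_A] norm_ge_zero order_trans by blast+
  define r0 where "r0 = pb * (1 - m1 * pa)"
  have r0: "r0 > 0" using m1 pa_pos pb_pos by (simp add: r0_def field_simps)
  define T where "T = B1 / r0"
  have T0: "T \<ge> 0" using B0 r0 by (simp add: T_def)
  \<comment> \<open>\<open>T\<close> bounds the tangent slope, so a displacement of width
    \<open>h\<close> has squared length at most \<open>(1 + (T + 1)\<^sup>2) * h\<^sup>2\<close>.
    With this \<open>C\<close> the descent of the parabola pays for the Taylor remainder.\<close>
  define C where "C = B * (1 + (T + 1)\<^sup>2) / r0"
  have C0: "C \<ge> 0" using B0 r0 by (simp add: C_def)
  \<comment> \<open>The first bound gives \<open>C * \<bar>h\<bar> \<le> 1\<close>; the second keeps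
    \<open>\<phi> w \<le> 1 / 2\<close>, so that the whole segment from \<open>z\<close> to
    \<open>z + w\<close> lies in \<open>A\<close>.\<close>
  define h0 where "h0 = min (1 / (C + 1)) (1 / (2 * (pa + (T + 1) * pb)))"
  have h0: "h0 > 0" using C0 pa_pos pb_pos T0 by (auto simp: h0_def intro!: add_pos_nonneg)
  have "\<exists>\<tau>. \<forall>h. \<bar>h\<bar> \<le> h0 \<longrightarrow> prof y + \<tau> * h - C * h\<^sup>2 \<le> prof (y + h)" if y: "\<bar>y\<bar> \<le> m1" for y
  proof -
    define z where "z = (y, prof y)"
    have \<phi>z: "\<phi> z = 1" using phi_prof[of y] y m1 by (simp add: z_def)
    have zA: "z \<in> A" using \<phi>z by (simp add: A_def)
    then have z0: "z \<noteq> 0" using A0 by auto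
    define p r where "p = blinfun_apply (D z) (1, 0)" and "r = blinfun_apply (D z) (0, 1)"
    have Dw: "blinfun_apply (D z) (w1, w2) = p * w1 + r * w2" for w1 w2
    proof -
      have "(w1, w2) = w1 *\<^sub>R (1, 0) + w2 *\<^sub>R (0::real, 1::real)" by simp
      then show ?thesis by (simp only: blinfun.add_right blinfun.scaleR_right p_def r_def) simp
    qed
    have p: "\<bar>p\<bar> \<le> B1" using norm_blinfun[of "D z" "(1,0)"] B1[OF zA] by (simp add: p_def norm_Pair)
    \<comment> \<open>Convexity of \<open>\<phi>\<close> on the vertical segment from
      \<open>z\<close> down to \<open>(y, 0)\<close> gives
      \<open>1 - \<bar>y\<bar> * pa \<le> r * prof y\<close>, and
      \<open>prof y \<le> 1 / pb\<close>.\<close>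
    have r: "r \<ge> r0"
    proof -
      define g where "g t = \<phi> (z + t *\<^sub>R (0, - prof y))" for t
      have "convex_on UNIV g"
      proof (rule convex_onI)
        fix t x w :: real assume t: "0 < t" "t < 1"
        have "z + ((1 - t) *\<^sub>R x + t *\<^sub>R w) *\<^sub>R (0, - prof y) = (1 - t) *\<^sub>R (z + x *\<^sub>R (0, - prof y)) + t *\<^sub>R (z + w *\<^sub>R (0, - prof y))"
          by (simp add: algebra_simps z_def)
        then show "g ((1 - t) *\<^sub>R x + t *\<^sub>R w) \<le> (1 - t) * g x + t * g w"
          unfolding g_def using phi_triangle[of "(1 - t) *\<^sub>R (z + x *\<^sub>R (0, - prof y))" "t *\<^sub>R (z + w *\<^sub>R (0, - prof y))"] t
          by (simp add: phi_scale del: scaleR_Pair)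
      qed simp
      moreover have "(g has_real_derivative blinfun_apply (D z) (0, - prof y)) (at 0)"
      proof -
        have "((\<lambda>t. z + t *\<^sub>R (0, - prof y)) has_derivative (\<lambda>t. t *\<^sub>R (0, - prof y))) (at 0)"
          by (auto intro!: derivative_eq_intros)
        moreover have "(\<phi> has_derivative blinfun_apply (D z)) (at (z + 0 *\<^sub>R (0, - prof y)))" using D[OF z0] by (simp del: scaleR_Pair)
        ultimately have "((\<phi> \<circ> (\<lambda>t. z + t *\<^sub>R (0, - prof y))) has_derivative (blinfun_apply (D z) \<circ> (\<lambda>t. t *\<^sub>R (0, - prof y)))) (at 0)"
          by (rule diff_chain_at)
        then show ?thesis unfolding has_field_derivative_def g_def o_def
          by (rule has_derivative_eq_rhs) (auto simp only: blinfun.scaleR_right fun_eq_iff real_scaleR_def mult.commute)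
      qed
      ultimately have "blinfun_apply (D z) (0, - prof y) * (1 - 0) \<le> g 1 - g 0"
        by (intro convex_on_imp_above_tangent) auto
      moreover have "g 0 = 1" by (simp add: g_def \<phi>z del: scaleR_Pair)
      moreover have "g 1 = \<bar>y\<bar> * pa" by (simp add: g_def z_def phi_axis)
      ultimately have "1 - \<bar>y\<bar> * pa \<le> r * prof y" by (simp add: Dw)
      moreover have "\<bar>y\<bar> * pa \<le> m1 * pa" using y pa_pos by simp
      ultimately have le: "1 - m1 * pa \<le> r * prof y" by linarith
      have pos: "1 - m1 * pa > 0" using m1 pa_pos by (simp add: field_simps)
      have py: "0 \<le> prof y" "prof y \<le> 1 / pb" using prof_props(2)[of y] prof_le[of y] y m1 by auto
      have "r > 0" using le pos py by (metis less_le_trans not_less mult_nonpos_nonneg)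
      then have "r * prof y \<le> r * (1 / pb)" using py by (intro mult_left_mono) auto
      then have "1 - m1 * pa \<le> r / pb" using le by simp
      then show ?thesis using pb_pos by (simp add: r0_def field_simps)
    qed
    \<comment> \<open>Implicit differentiation of \<open>\<phi> = 1\<close>. With this slope the
      first-order term of \<open>\<phi>\<close> along \<open>w\<close> reduces to
      \<open>- (r * C * h\<^sup>2)\<close>.\<close>
    define \<tau> where "\<tau> = - p / r"
    have \<tau>: "\<bar>\<tau>\<bar> \<le> T"
    proof -
      have "\<bar>\<tau>\<bar> = \<bar>p\<bar> / r" using r r0 by (simp add: \<tau>_def abs_divide)
      also have "\<dots> \<le> B1 / r0" using p r r0 B0 by (intro frac_le) auto
      finally show ?thesis by (simp add: T_def)
    qed
    have "prof y + \<tau> * h - C * h\<^sup>2 \<le> prof (y + h)" if h: "\<bar>h\<bar> \<le> h0" for h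
    proof -
      define w2 where "w2 = \<tau> * h - C * h\<^sup>2"
      define w where "w = (h, w2)"
      have hC: "C * \<bar>h\<bar> \<le> 1"
      proof -
        have "C * \<bar>h\<bar> \<le> C * (1 / (C + 1))" using h C0 by (intro mult_left_mono) (auto simp: h0_def)
        also have "\<dots> \<le> 1" using C0 by (simp add: field_simps)
        finally show ?thesis .
      qed
      have w2: "\<bar>w2\<bar> \<le> (T + 1) * \<bar>h\<bar>"
      proof -
        have "\<bar>w2\<bar> \<le> \<bar>\<tau>\<bar> * \<bar>h\<bar> + (C * \<bar>h\<bar>) * \<bar>h\<bar>"
          unfolding w2_def using abs_triangle_ineq4[of "\<tau> * h" "C * h\<^sup>2"] C0 by (simp add: abs_mult power2_eq_square mult.assoc)
        also have "\<dots> \<le> T * \<bar>h\<bar> + 1 * \<bar>h\<bar>" using \<tau> hC by (intro add_mono mult_right_mono) auto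
        finally show ?thesis by (simp add: algebra_simps)
      qed
      have nw: "(norm w)\<^sup>2 \<le> (1 + (T + 1)\<^sup>2) * h\<^sup>2"
      proof -
        have "w2\<^sup>2 \<le> ((T + 1) * \<bar>h\<bar>)\<^sup>2" using w2 by (metis abs_ge_zero power2_abs power_mono)
        also have "\<dots> = (T + 1)\<^sup>2 * h\<^sup>2" by (simp only: power_mult_distrib power2_abs)
        finally show ?thesis by (simp add: w_def norm_Pair distrib_right[of 1])
      qed
      have \<phi>w: "\<phi> w \<le> 1 / 2"
      proof -
        have "\<phi> w \<le> \<phi> (h, 0) + \<phi> (0, w2)" using phi_triangle[of "(h, 0)" "(0, w2)"] by (simp add: w_def)
        also have "\<dots> = \<bar>h\<bar> * pa + \<bar>w2\<bar> * pb" by (simp add: phi_axis)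
        also have "\<dots> \<le> \<bar>h\<bar> * pa + ((T + 1) * \<bar>h\<bar>) * pb" using w2 pb_pos by simp
        also have "\<dots> = \<bar>h\<bar> * (pa + (T + 1) * pb)" by (simp add: algebra_simps)
        also have "\<dots> \<le> (1 / (2 * (pa + (T + 1) * pb))) * (pa + (T + 1) * pb)"
          using h pa_pos pb_pos T0 by (intro mult_right_mono) (auto simp: h0_def)
        also have "\<dots> \<le> 1 / 2" using pa_pos pb_pos T0 by (simp add: field_simps)
        finally show ?thesis .
      qed
      have seg: "z + t *\<^sub>R w \<in> A" if "0 \<le> t" "t \<le> 1" for t
      proof -
        have tw: "\<phi> (t *\<^sub>R w) \<le> 1 / 2" using \<phi>w that phi_nonneg[of w] mult_mono[of t 1 "\<phi> w" "1 / 2"] by (simp add: phi_scale)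
        have "\<phi> (z + t *\<^sub>R w) \<le> 2" using phi_triangle[of z "t *\<^sub>R w"] \<phi>z tw by simp
        moreover have "\<phi> z \<le> \<phi> (z + t *\<^sub>R w) + \<phi> (- (t *\<^sub>R w))" using phi_triangle[of "z + t *\<^sub>R w" "- (t *\<^sub>R w)"] by simp
        moreover have "\<phi> (- (t *\<^sub>R w)) = \<phi> (t *\<^sub>R w)" using phi_scale[of "-1" "t *\<^sub>R w"] by simp
        ultimately show ?thesis using \<phi>z tw by (simp add: A_def)
      qed
      have dg: "((\<lambda>t. \<phi> (z + t *\<^sub>R w)) has_real_derivative blinfun_apply (D (z + t *\<^sub>R w)) w) (at t)" if "0 \<le> t" "t \<le> 1" for t
      proof -
        have "z + t *\<^sub>R w \<noteq> 0" using seg[OF that] A0 by auto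
        note d = D[OF this]
        have "((\<lambda>t. z + t *\<^sub>R w) has_derivative (\<lambda>t. t *\<^sub>R w)) (at t)" by (auto intro!: derivative_eq_intros)
        then have "((\<phi> \<circ> (\<lambda>t. z + t *\<^sub>R w)) has_derivative (blinfun_apply (D (z + t *\<^sub>R w)) \<circ> (\<lambda>t. t *\<^sub>R w))) (at t)"
          using d by (rule diff_chain_at)
        then show ?thesis unfolding has_field_derivative_def o_def
          by (rule has_derivative_eq_rhs) (auto simp only: blinfun.scaleR_right fun_eq_iff real_scaleR_def mult.commute)
      qed
      obtain \<xi> where \<xi>: "0 < \<xi>" "\<xi> < 1" "\<phi> (z + 1 *\<^sub>R w) - \<phi> (z + 0 *\<^sub>R w) = (1 - 0) * blinfun_apply (D (z + \<xi> *\<^sub>R w)) w"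
        using MVT2[of 0 1 "\<lambda>t. \<phi> (z + t *\<^sub>R w)" "\<lambda>t. blinfun_apply (D (z + t *\<^sub>R w)) w"] dg by auto
      have "norm (D (z + \<xi> *\<^sub>R w) - D z) \<le> B * norm (z + \<xi> *\<^sub>R w - z)"
      proof (rule differentiable_bound[where S="closed_segment z (z + w)" and f'="\<lambda>x. blinfun_apply (D2 x)"])
        fix x assume "x \<in> closed_segment z (z + w)"
        then obtain t where t: "0 \<le> t" "t \<le> 1" "x = z + t *\<^sub>R w" by (auto simp: in_segment algebra_simps)
        then have xA: "x \<in> A" using seg by simp
        then have "x \<noteq> 0" using A0 by auto
        then show "(D has_derivative blinfun_apply (D2 x)) (at x within closed_segment z (z + w))"
          using D2(1) has_derivative_at_withinI by blast
        show "onorm (blinfun_apply (D2 x)) \<le> B" using B[OF xA] by (simp add: norm_blinfun.rep_eq)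
      next
        show "z + \<xi> *\<^sub>R w \<in> closed_segment z (z + w)"
          unfolding in_segment using \<xi> by (intro exI[of _ \<xi>]) (auto simp: algebra_simps)
      qed auto
      also have "\<dots> \<le> B * norm w" using \<xi> B0 by (intro mult_left_mono) (auto simp: mult_left_le_one_le)
      finally have Dd: "norm (D (z + \<xi> *\<^sub>R w) - D z) \<le> B * norm w" .
      have "blinfun_apply (D (z + \<xi> *\<^sub>R w)) w - blinfun_apply (D z) w \<le> norm (D (z + \<xi> *\<^sub>R w) - D z) * norm w"
        using norm_blinfun[of "D (z + \<xi> *\<^sub>R w) - D z" w] by (simp add: blinfun.diff_left)
      also have "\<dots> \<le> B * norm w * norm w" using Dd by (intro mult_right_mono) auto
      also have "\<dots> \<le> B * ((1 + (T + 1)\<^sup>2) * h\<^sup>2)" using nw B0 by (simp add: mult.assoc power2_eq_square[of "norm w", symmetric] mult_left_mono)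
      finally have "\<phi> (z + w) \<le> 1 + blinfun_apply (D z) w + B * ((1 + (T + 1)\<^sup>2) * h\<^sup>2)" using \<xi>(3) \<phi>z by simp
      also have "blinfun_apply (D z) w = - (r * C * h\<^sup>2)"
        using r r0 by (simp add: w_def Dw w2_def \<tau>_def field_simps)
      also have "1 + - (r * C * h\<^sup>2) + B * ((1 + (T + 1)\<^sup>2) * h\<^sup>2) \<le> 1"
      proof -
        have "B * ((1 + (T + 1)\<^sup>2) * h\<^sup>2) = r0 * C * h\<^sup>2" using r0 by (simp add: C_def)
        also have "\<dots> \<le> r * C * h\<^sup>2" using r C0 by (intro mult_right_mono) auto
        finally show ?thesis by simp
      qed
      finally have "(y + h, prof y + w2) \<in> wulff \<phi>" by (simp add: wulff_iff z_def w_def)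
      then show ?thesis unfolding wulff_prof w2_def by auto
    qed
    then show ?thesis by blast
  qed
  then show ?thesis using that[of C h0] C0 h0 by blast
qed

text \<open>The supporting parabola at the middle point bounds the left secant slope from above and
  the right one from below.\<close>

lemma prof_semiconvex:
  assumes C2: "C2_anisotropy \<phi>" and m1: "0 \<le> m1" "m1 < 1 / pa"
  obtains S \<eta> where "S \<ge> 0" "\<eta> > 0"
    "\<And>x y z. - m1 \<le> x \<Longrightarrow> x < y \<Longrightarrow> y < z \<Longrightarrow> z \<le> m1 \<Longrightarrow> z - x \<le> \<eta> \<Longrightarrow> slope prof x y - slope prof y z \<le> S * (z - x)"
proof -
  obtain C h0 where C: "C \<ge> 0" "h0 > 0"
    "\<And>y. \<bar>y\<bar> \<le> m1 \<Longrightarrow> \<exists>\<tau>. \<forall>h. \<bar>h\<bar> \<le> h0 \<longrightarrow> prof y + \<tau> * h - C * h\<^sup>2 \<le> prof (y + h)"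
    using prof_support_parabola[OF C2 m1] by blast
  have "slope prof x y - slope prof y z \<le> C * (z - x)"
    if xyz: "- m1 \<le> x" "x < y" "y < z" "z \<le> m1" "z - x \<le> h0" for x y z
  proof -
    have "\<bar>y\<bar> \<le> m1" using xyz by auto
    then obtain \<tau> where \<tau>: "\<And>h. \<bar>h\<bar> \<le> h0 \<Longrightarrow> prof y + \<tau> * h - C * h\<^sup>2 \<le> prof (y + h)" using C(3) by blast
    define p q where "p = y - x" and "q = z - y"
    have pq: "p > 0" "q > 0" "p \<le> h0" "q \<le> h0" "x = y - p" "z = y + q" using xyz by (auto simp: p_def q_def)
    have "prof y - \<tau> * p - C * p\<^sup>2 \<le> prof x" using \<tau>[of "- p"] pq by simp
    then have "prof y - prof x \<le> (\<tau> + C * p) * p" by (simp add: algebra_simps power2_eq_square)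
    then have 1: "slope prof x y \<le> \<tau> + C * p" using pq by (simp add: slope_def pos_divide_le_eq)
    have "prof y + \<tau> * q - C * q\<^sup>2 \<le> prof z" using \<tau>[of q] pq by simp
    then have "(\<tau> - C * q) * q \<le> prof z - prof y" by (simp add: algebra_simps power2_eq_square)
    then have 2: "\<tau> - C * q \<le> slope prof y z" using pq by (simp add: slope_def pos_le_divide_eq)
    have "C * (z - x) = C * p + C * q" by (simp add: p_def q_def algebra_simps)
    then show ?thesis using 1 2 by linarith
  qed
  then show ?thesis using that[of C h0] C by blast
qed

text \<open>By concavity no secant inside \<open>[- m1, m1]\<close> is steeper downwards than the
  one from \<open>m1\<close> to the end point \<open>1 / pa\<close>, and there the profile has at
  most \<open>prof m1\<close> left to lose. Evenness handles the other sign.\<close>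

lemma prof_lipschitz:
  assumes m1: "0 \<le> m1" "m1 < 1 / pa"
  shows "(prof m1 / (1 / pa - m1))-lipschitz_on {-m1..m1} prof"
proof -
  let ?M = "1 / pa" and ?L = "prof m1 / (1 / pa - m1)"
  have step: "prof x - prof y \<le> ?L * (y - x)" if xy: "- m1 \<le> x" "x < y" "y \<le> m1" for x y
  proof -
    have "(prof ?M - prof m1) / (?M - m1) \<le> (prof ?M - prof y) / (?M - y)"
    proof (cases "y = m1")
      case False
      then show ?thesis using prof_slopes(3)[of y m1 ?M] xy m1 by auto
    qed simp
    also have "\<dots> \<le> (prof y - prof x) / (y - x)" using prof_slopes(1)[of x y ?M] xy m1 by auto
    finally have "(prof ?M - prof m1) / (?M - m1) \<le> (prof y - prof x) / (y - x)" .
    moreover have "- ?L \<le> (prof ?M - prof m1) / (?M - m1)"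
      using prof_props(2)[of ?M] pa_pos m1 by (subst minus_divide_left, intro divide_right_mono) auto
    ultimately have "- ?L \<le> (prof y - prof x) / (y - x)" by linarith
    moreover have "0 < y - x" using xy by simp
    ultimately have "- ?L * (y - x) \<le> prof y - prof x" by (metis pos_le_divide_eq)
    then show ?thesis by linarith
  qed
  have "\<bar>prof x - prof y\<bar> \<le> ?L * \<bar>x - y\<bar>" if "x \<in> {-m1..m1}" "y \<in> {-m1..m1}" for x y
    using step[of x y] step[of y x] step[of "-x" "-y"] step[of "-y" "-x"] that
    by (cases x y rule: linorder_cases) (auto simp: prof_even abs_le_iff)
  moreover have "?L \<ge> 0" using prof_props(2)[of m1] m1 by auto
  ultimately show ?thesis by (intro lipschitz_onI) (auto simp: dist_real_def)
qed

text \<open>By the intermediate value theorem some arc passes through the points of the graph over \<open>s1\<close> and \<open>s2\<close>; it lies above \<open>v\<close>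
  in between.\<close>

lemma minimizing_three_points:
  assumes min: "minimizing a b p \<gamma> g u T" and p: "p \<ge> 1" and \<gamma>: "\<gamma> > 0" and ab: "a < b"
    and K: "p * (2 * \<gamma>) powr (p - 1) < K"
    and m: "0 \<le> m" "m < m1" "m1 < 1 / pa"
    and lip: "L-lipschitz_on {a<..<b} v" and L: "L \<le> (prof m - prof m1) / (m1 - m)"
    and vu: "AE s in lborel. s \<in> {a<..<b} \<longrightarrow> v s = u s"
    and S: "\<And>x y z. - m1 \<le> x \<Longrightarrow> x < y \<Longrightarrow> y < z \<Longrightarrow> z \<le> m1 \<Longrightarrow> z - x \<le> \<eta> \<Longrightarrow> slope prof x y - slope prof y z \<le> S * (z - x)"
    and s: "a < s1" "s1 < s" "s < s2" "s2 < b" and h: "K * (s2 - s1) \<le> m1 - m" "K * (s2 - s1) \<le> \<eta>"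
  shows "slope v s1 s - slope v s s2 \<le> S * K * (s2 - s1)"
proof -
  have u [measurable]: "u \<in> borel_measurable borel" and u\<gamma>: "\<And>s. \<bar>u s\<bar> \<le> \<gamma>"
    using min unfolding minimizing_def by blast+
  have K0: "K > 0" using K p by (smt (verit) mult_nonneg_nonneg powr_ge_zero)
  have L0: "L \<ge> 0" using lip by (rule lipschitz_on_nonneg)
  have vc: "continuous_on {a<..<b} v" using lip by (rule lipschitz_on_continuous_on)
  have v\<gamma>: "- \<gamma> \<le> v s" if "s \<in> {a<..<b}" for s
  proof (rule AE_le_imp_le[OF continuous_on_const vc _ that])
    show "AE s in lborel. s \<in> {a<..<b} \<longrightarrow> - \<gamma> \<le> v s"
    proof (use vu in eventually_elim)
      fix s assume "s \<in> {a<..<b} \<longrightarrow> v s = u s"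
      then show "s \<in> {a<..<b} \<longrightarrow> - \<gamma> \<le> v s" using u\<gamma>[of s] by auto
    qed
  qed
  define l where "l = K * (s2 - s1)"
  have l: "0 < l" "l \<le> m1 - m" "l \<le> \<eta>" using K0 s h by (auto simp: l_def)
  \<comment> \<open>\<open>N x\<close> is the slope over \<open>[s1, s2]\<close> of the chord of the
    arc whose parameter starts at \<open>x\<close>; the parameter moves by \<open>l\<close> in
    between.\<close>
  define N where "N x = (prof (x - l) - prof x) / l" for x
  define \<theta> where "\<theta> = slope v s1 s2"
  have \<theta>: "\<bar>\<theta>\<bar> \<le> L"
  proof -
    have "\<bar>v s2 - v s1\<bar> \<le> L * \<bar>s2 - s1\<bar>" using lipschitz_onD[OF lip, of s2 s1] s by (simp add: dist_real_def)
    then show ?thesis using s by (simp add: \<theta>_def slope_def abs_divide pos_divide_le_eq)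
  qed
  \<comment> \<open>Because \<open>m1 - l \<ge> m\<close>, the chord over
    \<open>[m1 - l, m1]\<close> is at least as steep as the one over \<open>[m, m1]\<close>, which
    defines the bound on \<open>L\<close>. With the reflected start this puts every slope between
    \<open>- L\<close> and \<open>L\<close> in the range of \<open>N\<close>.\<close>
  have Nm1: "L \<le> N m1"
  proof -
    have "(prof m1 - prof (m1 - l)) / (m1 - (m1 - l)) \<le> (prof m1 - prof m) / (m1 - m)"
    proof (cases "m1 - l = m")
      case True
      then show ?thesis by (metis order_refl)
    next
      case False
      then show ?thesis using l m pa_pos by (intro prof_slopes(3)) auto
    qed
    then have "(prof m - prof m1) / (m1 - m) \<le> N m1"
      by (simp add: N_def) (metis minus_diff_eq minus_divide_left neg_le_iff_le)
    then show ?thesis using L by simp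
  qed
  have Nm1': "N (- m1 + l) = - N m1"
  proof -
    have "prof (- m1 + l) = prof (m1 - l)" using prof_even[of "m1 - l"] by simp
    moreover have "prof (- m1 + l - l) = prof m1" using prof_even[of m1] by simp
    ultimately show ?thesis unfolding N_def by (subst minus_divide_left) simp
  qed
  have Nc: "continuous_on {- m1 + l..m1} N"
  proof -
    have "continuous_on {- m1 + l..m1} (\<lambda>x. prof (x - l))"
      by (rule continuous_on_compose2[OF prof_continuous]) (use m l in \<open>auto intro!: continuous_intros\<close>)
    moreover have "continuous_on {- m1 + l..m1} prof"
      by (rule continuous_on_subset[OF prof_continuous]) (use m l in auto)
    ultimately show ?thesis unfolding N_def using l by (intro continuous_intros) auto
  qed
  have "\<exists>x\<ge>- m1 + l. x \<le> m1 \<and> N x = \<theta>"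
    by (rule IVT'[OF _ _ _ Nc]) (use \<theta> Nm1 Nm1' m l in auto)
  then obtain x where x: "- m1 + l \<le> x" "x \<le> m1" "N x = \<theta>" by blast
  define \<psi> where "\<psi> s = v s1 + (prof (x - K * (s - s1)) - prof x) / K" for s
  have q: "x - K * (r - s1) \<in> {-m1..m1}" if "s1 \<le> r" "r \<le> s2" for r
  proof -
    have "0 \<le> K * (r - s1)" "K * (r - s1) \<le> l" unfolding l_def using that K0 by auto
    then show ?thesis using x by auto
  qed
  have \<psi>1: "\<psi> s1 = v s1" by (simp add: \<psi>_def)
  have \<psi>2: "\<psi> s2 = v s2"
  proof -
    have "prof (x - l) - prof x = \<theta> * l" using x(3) l by (simp add: N_def field_simps)
    moreover have "v s2 - v s1 = \<theta> * (s2 - s1)" using s by (simp add: \<theta>_def slope_def)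
    ultimately show ?thesis using K0 by (simp add: \<psi>_def l_def)
  qed
  define \<Lambda> where "\<Lambda> = prof m1 / (1 / pa - m1)"
  have pl: "\<Lambda>-lipschitz_on {-m1..m1} prof" unfolding \<Lambda>_def using prof_lipschitz[of m1] m by simp
  have \<Lambda>0: "\<Lambda> \<ge> 0" using pl by (rule lipschitz_on_nonneg)
  have \<psi>lip: "\<bar>\<psi> r - \<psi> r'\<bar> \<le> \<Lambda> * \<bar>r - r'\<bar>" if "s1 \<le> r" "r \<le> s2" "s1 \<le> r'" "r' \<le> s2" for r r'
  proof -
    have "\<bar>prof (x - K * (r - s1)) - prof (x - K * (r' - s1))\<bar> \<le> \<Lambda> * \<bar>(x - K * (r - s1)) - (x - K * (r' - s1))\<bar>"
      using lipschitz_onD[OF pl q[OF that(1,2)] q[OF that(3,4)]] by (simp add: dist_real_def)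
    also have "(x - K * (r - s1)) - (x - K * (r' - s1)) = K * (r' - r)" by (simp add: algebra_simps)
    also have "\<bar>K * (r' - r)\<bar> = K * \<bar>r - r'\<bar>" using K0 by (simp add: abs_mult abs_minus_commute)
    finally have "\<bar>prof (x - K * (r - s1)) - prof (x - K * (r' - s1))\<bar> / K \<le> \<Lambda> * \<bar>r - r'\<bar>"
      using K0 by (simp add: pos_divide_le_eq mult_ac)
    moreover have "\<psi> r - \<psi> r' = (prof (x - K * (r - s1)) - prof (x - K * (r' - s1))) / K"
      by (simp add: \<psi>_def diff_divide_distrib)
    ultimately show ?thesis using K0 by (simp add: abs_divide)
  qed
  have \<psi>c: "continuous_on {s1..s2} \<psi>"
  proof -
    have "\<Lambda>-lipschitz_on {s1..s2} \<psi>" using \<psi>lip \<Lambda>0 by (intro lipschitz_onI) (auto simp: dist_real_def)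
    then show ?thesis by (rule lipschitz_on_continuous_on)
  qed
  \<comment> \<open>The profile is even and decreases with the absolute value, so on an interval it
    is at least the smaller of its end values. The arc therefore stays above the lower of the two
    points of the graph.\<close>
  have low: "- \<gamma> \<le> \<psi> r" if r: "s1 < r" "r < s2" for r
  proof -
    have Kr: "0 < K * (r - s1)" "K * (r - s1) < l" unfolding l_def using r K0 by auto
    define y where "y = x - K * (r - s1)"
    have y: "x - l < y" "y < x" using Kr by (auto simp: y_def)
    have "prof x \<le> prof y \<or> prof (x - l) \<le> prof y"
    proof (cases "\<bar>y\<bar> \<le> \<bar>x\<bar>")
      case True
      then show ?thesis using x m l by (intro disjI1 prof_antimono) auto
    next
      case False
      then have "\<bar>y\<bar> \<le> \<bar>x - l\<bar>" using y by linarith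
      then show ?thesis using x m l by (intro disjI2 prof_antimono) auto
    qed
    then have "\<psi> s1 \<le> \<psi> r \<or> \<psi> s2 \<le> \<psi> r"
      using K0 by (auto simp: \<psi>_def y_def l_def divide_right_mono)
    then show ?thesis using v\<gamma>[of s1] v\<gamma>[of s2] s unfolding \<psi>1 \<psi>2 by auto
  qed
  define d where "d s = (if s \<in> {s1<..<s2} then max 0 (u s - \<psi> s) else 0)" for s
  \<comment> \<open>\<open>v\<close> and the arc agree at \<open>s1\<close> and \<open>s2\<close>
    and are both Lipschitz, so \<open>d\<close> vanishes linearly there. This provides the
    conditions \<open>left\<close> and \<open>right\<close> of \<open>comparison\<close> at
    prescribed points.\<close>
  have d_bound: "AE s in lborel. 0 \<le> d s \<and> d s \<le> (L + \<Lambda>) * \<bar>s - s1\<bar> \<and> d s \<le> (L + \<Lambda>) * \<bar>s - s2\<bar>"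
    using vu
  proof eventually_elim
    case (elim r)
    show ?case
    proof (cases "r \<in> {s1<..<s2}")
      case True
      then have vr: "v r = u r" using elim s by auto
      have "\<bar>v r - v s1\<bar> \<le> L * \<bar>r - s1\<bar>" "\<bar>v r - v s2\<bar> \<le> L * \<bar>r - s2\<bar>"
        using lipschitz_onD[OF lip, of r s1] lipschitz_onD[OF lip, of r s2] s True by (auto simp: dist_real_def)
      moreover have "\<bar>\<psi> r - \<psi> s1\<bar> \<le> \<Lambda> * \<bar>r - s1\<bar>" "\<bar>\<psi> r - \<psi> s2\<bar> \<le> \<Lambda> * \<bar>r - s2\<bar>"
        using \<psi>lip[of r s1] \<psi>lip[of r s2] True s by auto
      ultimately have "u r - \<psi> r \<le> (L + \<Lambda>) * \<bar>r - s1\<bar>" "u r - \<psi> r \<le> (L + \<Lambda>) * \<bar>r - s2\<bar>"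
        unfolding vr[symmetric] \<psi>1 \<psi>2 distrib_right by linarith+
      moreover have "0 \<le> (L + \<Lambda>) * \<bar>r - s1\<bar>" "0 \<le> (L + \<Lambda>) * \<bar>r - s2\<bar>" using L0 \<Lambda>0 by auto
      ultimately show ?thesis using True by (simp add: d_def)
    qed (use L0 \<Lambda>0 in \<open>auto simp: d_def\<close>)
  qed
  define \<delta> where "\<delta> k = 1 / real (Suc k)" for k
  have \<delta>: "\<And>k. \<delta> k > 0" "\<delta> \<longlonglongrightarrow> 0" unfolding \<delta>_def using LIMSEQ_inverse_real_of_nat by (auto simp: inverse_eq_divide)
  have avg: "(\<lambda>k. (LINT s:J k|lborel. d s) / \<delta> k) \<longlonglongrightarrow> 0"
    if J: "\<And>k. J k \<in> sets lborel" "\<And>k. emeasure lborel (J k) = ennreal (\<delta> k)" "\<And>k s. s \<in> J k \<Longrightarrow> \<bar>s - c\<bar> \<le> \<delta> k"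
      and c: "c = s1 \<or> c = s2" for J c
  proof (rule tendsto_sandwich[of "\<lambda>_. 0" _ _ "\<lambda>k. (L + \<Lambda>) * \<delta> k"])
    have b: "0 \<le> (LINT s:J k|lborel. d s) \<and> (LINT s:J k|lborel. d s) \<le> (L + \<Lambda>) * \<delta> k * \<delta> k" for k
    proof
      show "0 \<le> (LINT s:J k|lborel. d s)" unfolding set_lebesgue_integral_def
        by (intro integral_nonneg_AE AE_I2) (auto simp: d_def indicator_def)
      have i: "integrable lborel (indicator (J k) :: real \<Rightarrow> real)"
        using J(1,2) by (intro integrable_real_indicator) (auto simp: less_top[symmetric])
      have "(LINT s:J k|lborel. d s) \<le> (LINT s|lborel. (L + \<Lambda>) * \<delta> k * indicator (J k) s)"
        unfolding set_lebesgue_integral_def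
      proof (rule integral_mono_AE')
        show "integrable lborel (\<lambda>s. (L + \<Lambda>) * \<delta> k * indicator (J k) s)" using i by simp
        show "AE s in lborel. indicator (J k) s *\<^sub>R d s \<le> (L + \<Lambda>) * \<delta> k * indicator (J k) s"
          using d_bound
        proof eventually_elim
          case (elim r)
          show ?case
          proof (cases "r \<in> J k")
            case True
            have "d r \<le> (L + \<Lambda>) * \<bar>r - c\<bar>" using elim c by auto
            also have "\<dots> \<le> (L + \<Lambda>) * \<delta> k" using J(3)[OF True] L0 \<Lambda>0 by (intro mult_left_mono) auto
            finally show ?thesis using True by simp
          qed simp
        qed
        show "AE s in lborel. 0 \<le> (L + \<Lambda>) * \<delta> k * indicator (J k) s" using L0 \<Lambda>0 \<delta>(1)[of k] by (intro AE_I2) auto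
      qed
      also have "\<dots> = (L + \<Lambda>) * \<delta> k * \<delta> k" using J(1,2) \<delta>(1)[of k] by (simp add: measure_def)
      finally show "(LINT s:J k|lborel. d s) \<le> (L + \<Lambda>) * \<delta> k * \<delta> k" .
    qed
    show "\<forall>\<^sub>F k in sequentially. 0 \<le> (LINT s:J k|lborel. d s) / \<delta> k" using b \<delta>(1) by (auto intro!: always_eventually divide_nonneg_pos)
    show "\<forall>\<^sub>F k in sequentially. (LINT s:J k|lborel. d s) / \<delta> k \<le> (L + \<Lambda>) * \<delta> k"
      using b \<delta>(1) by (auto intro!: always_eventually simp: pos_divide_le_eq)
    show "(\<lambda>k. (L + \<Lambda>) * \<delta> k) \<longlonglongrightarrow> 0" using tendsto_mult[OF tendsto_const[of "L + \<Lambda>"] \<delta>(2)] by simp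
  qed simp
  have left: "(\<lambda>k. (LINT s:{s1<..s1 + \<delta> k}|lborel. d s) / \<delta> k) \<longlonglongrightarrow> 0"
    by (rule avg[where c=s1]) (use \<delta>(1) in \<open>auto simp: less_imp_le\<close>)
  have right: "(\<lambda>k. (LINT s:{s2 - \<delta> k..<s2}|lborel. d s) / \<delta> k) \<longlonglongrightarrow> 0"
    by (rule avg[where c=s2]) (use \<delta>(1) in \<open>auto simp: less_imp_le\<close>)
  have "AE s in lborel. d s = 0"
  proof (rule comparison[OF min p \<gamma> ab K _ _ _ _ _ \<psi>_def low d_def \<delta> left disjI2[OF right]])
    show "x \<le> 1 / pa" using x m by simp
    show "- 1 / pa \<le> x - K * (s2 - s1)" using x m by (simp add: l_def[symmetric])
  qed (use s in auto)
  then have "AE s in lborel. s \<in> {s1<..<s2} \<longrightarrow> v s \<le> \<psi> s"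
    using vu by eventually_elim (use s in \<open>auto simp: d_def max_def split: if_splits\<close>)
  then have v\<psi>: "v s \<le> \<psi> s"
    using s by (intro AE_le_imp_le[of s1 s2 v \<psi> s] continuous_on_subset[OF vc] continuous_on_subset[OF \<psi>c]) auto
  define q where "q = x - K * (s - s1)"
  have Ks: "0 < K * (s - s1)" "K * (s - s1) < l" unfolding l_def using s K0 by auto
  have qq: "x - l < q" "q < x" "x - q = K * (s - s1)" "q - (x - l) = K * (s2 - s)"
    using Ks by (auto simp: q_def l_def algebra_simps)
  \<comment> \<open>Scaling by \<open>1 / K\<close> acts equally on both coordinates, so secants of
    the arc are secants of the profile; the sign appears because the parameter runs
    backwards.\<close>
  have e1: "(\<psi> s - v s1) / (s - s1) = - slope prof q x"
  proof -
    have "\<psi> s - v s1 = - (prof x - prof q) / K" by (simp add: \<psi>_def q_def)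
    then have "(\<psi> s - v s1) / (s - s1) = - (prof x - prof q) / (K * (s - s1))" by simp
    also have "\<dots> = - slope prof q x" unfolding slope_def qq(3) by (rule minus_divide_left[symmetric])
    finally show ?thesis .
  qed
  have e2: "(v s2 - \<psi> s) / (s2 - s) = - slope prof (x - l) q"
  proof -
    have "v s2 - \<psi> s = - (prof q - prof (x - l)) / K"
      unfolding \<psi>2[symmetric] by (simp add: \<psi>_def q_def l_def diff_divide_distrib)
    then have "(v s2 - \<psi> s) / (s2 - s) = - (prof q - prof (x - l)) / (K * (s2 - s))" by simp
    also have "\<dots> = - slope prof (x - l) q" unfolding slope_def qq(4) by (rule minus_divide_left[symmetric])
    finally show ?thesis .
  qed
  have "slope v s1 s \<le> (\<psi> s - v s1) / (s - s1)" using v\<psi> s by (simp add: slope_def divide_right_mono)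
  moreover have "slope v s s2 \<ge> (v s2 - \<psi> s) / (s2 - s)" using v\<psi> s by (simp add: slope_def divide_right_mono)
  ultimately have "slope v s1 s - slope v s s2 \<le> slope prof (x - l) q - slope prof q x" unfolding e1 e2 by linarith
  also have "\<dots> \<le> S * (x - (x - l))" using x qq l by (intro S) auto
  finally show ?thesis by (simp add: l_def mult_ac)
qed

lemma minimizing_C11:
  assumes min: "minimizing a b p \<gamma> g u T" and p: "p \<ge> 1" and \<gamma>: "\<gamma> > 0" and ab: "a < b"
    and K: "p * (2 * \<gamma>) powr (p - 1) < K"
    and m: "0 \<le> m" "m < m1" "m1 < 1 / pa"
    and lip: "L-lipschitz_on {a<..<b} v" and L: "L \<le> (prof m - prof m1) / (m1 - m)"
    and vu: "AE s in lborel. s \<in> {a<..<b} \<longrightarrow> v s = u s"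
    and C2: "C2_anisotropy \<phi>"
  shows "C11_on {a<..<b} v"
proof -
  have K0: "K > 0" using K p by (smt (verit) mult_nonneg_nonneg powr_ge_zero)
  have "0 \<le> m1" using m by simp
  then obtain S \<eta> where S: "S \<ge> 0" "\<eta> > 0"
    "\<And>x y z. - m1 \<le> x \<Longrightarrow> x < y \<Longrightarrow> y < z \<Longrightarrow> z \<le> m1 \<Longrightarrow> z - x \<le> \<eta> \<Longrightarrow> slope prof x y - slope prof y z \<le> S * (z - x)"
    using prof_semiconvex[OF C2 _ m(3)] by blast
  have lip': "L-lipschitz_on {a<..<b} (\<lambda>s. - v s)" using lip by (simp add: lipschitz_on_def dist_minus)
  have vu': "AE s in lborel. s \<in> {a<..<b} \<longrightarrow> - v s = - u s" using vu by eventually_elim auto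
  have neg: "slope (\<lambda>s. - v s) x y = - slope v x y" for x y
    unfolding slope_def by (subst minus_divide_left) simp
  show ?thesis
  proof (rule C11_on_if_slopes_close[OF lip, where C="S * K" and \<eta>="min (m1 - m) \<eta> / K"])
    fix x y z assume xyz: "a < x" "x < y" "y < z" "z < b" "z - x \<le> min (m1 - m) \<eta> / K"
    then have "K * (z - x) \<le> min (m1 - m) \<eta>" using K0 by (simp add: pos_le_divide_eq mult.commute)
    then have h: "K * (z - x) \<le> m1 - m" "K * (z - x) \<le> \<eta>" by auto
    have "slope v x y - slope v y z \<le> S * K * (z - x)"
      by (rule minimizing_three_points[OF min p \<gamma> ab K m lip L vu S(3) xyz(1-4) h])
    moreover have "slope (\<lambda>s. - v s) x y - slope (\<lambda>s. - v s) y z \<le> S * K * (z - x)"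
      by (rule minimizing_three_points[OF minimizing_uminus[OF min ab] p \<gamma> ab K m lip' L vu' S(3) xyz(1-4) h])
    ultimately show "\<bar>slope v x y - slope v y z\<bar> \<le> S * K * (z - x)" unfolding neg by simp
  qed (use S K0 m in auto)
qed

end

section \<open>The perimeter of the Wulff shape\<close>

definition C1 :: "('a::real_normed_vector \<Rightarrow> 'b::real_normed_vector) \<Rightarrow> bool" where
  "C1 f \<longleftrightarrow> (\<exists>D :: 'a \<Rightarrow> 'a \<Rightarrow>\<^sub>L 'b. (\<forall>x. (f has_derivative blinfun_apply (D x)) (at x)) \<and> continuous_on UNIV D)"

lemma C1_continuous: "C1 f \<Longrightarrow> continuous_on S f"
  unfolding C1_def by (meson continuous_at_imp_continuous_on has_derivative_continuous)

lemma C1_const: "C1 (\<lambda>_. c)"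
  unfolding C1_def by (intro exI[of _ "\<lambda>_. 0"]) (auto simp: zero_blinfun.rep_eq)

lemma C1_add:
  assumes "C1 f" "C1 g"
  shows "C1 (\<lambda>x. f x + g x)"
proof -
  from assms obtain D E where "\<And>x. (f has_derivative blinfun_apply (D x)) (at x)" "continuous_on UNIV D"
    "\<And>x. (g has_derivative blinfun_apply (E x)) (at x)" "continuous_on UNIV E" unfolding C1_def by blast
  then show ?thesis unfolding C1_def
    by (intro exI[of _ "\<lambda>x. D x + E x"]) (auto intro!: continuous_intros has_derivative_eq_rhs[OF has_derivative_add] simp: plus_blinfun.rep_eq)
qed

lemma C1_sum: "(\<And>i. i \<in> A \<Longrightarrow> C1 (f i)) \<Longrightarrow> C1 (\<lambda>x. \<Sum>i\<in>A. f i x)"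
  by (induction A rule: infinite_finite_induct) (auto intro: C1_const C1_add)

lemma C1_scaleR:
  fixes f :: "'a::real_normed_vector \<Rightarrow> real" and g :: "'a \<Rightarrow> 'b::real_normed_vector"
  assumes "C1 f" "C1 g"
  shows "C1 (\<lambda>x. f x *\<^sub>R g x)"
proof -
  from assms obtain D E where D: "\<And>x. (f has_derivative blinfun_apply (D x)) (at x)" "continuous_on UNIV D"
    and E: "\<And>x. (g has_derivative blinfun_apply (E x)) (at x)" "continuous_on UNIV E" unfolding C1_def by blast
  have "((\<lambda>x. f x *\<^sub>R g x) has_derivative blinfun_apply (f x *\<^sub>R E x + (blinfun_scaleR_left (g x) o\<^sub>L D x))) (at x)" for x
    by (rule has_derivative_eq_rhs[OF has_derivative_scaleR[OF D(1) E(1)]])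
       (rule ext, simp add: blinfun.add_left blinfun.scaleR_left)
  moreover have "continuous_on UNIV (\<lambda>x. f x *\<^sub>R E x + (blinfun_scaleR_left (g x) o\<^sub>L D x))"
    using C1_continuous[OF assms(1)] C1_continuous[OF assms(2)]
    by (intro continuous_intros D E bounded_linear.continuous_on[OF bounded_linear_blinfun_scaleR_left]
        bounded_bilinear.continuous_on[OF bounded_bilinear_blinfun_compose])
  ultimately show ?thesis unfolding C1_def
    by (intro exI[of _ "\<lambda>x. f x *\<^sub>R E x + (blinfun_scaleR_left (g x) o\<^sub>L D x)"] conjI allI)
qed

lemma C1_id: "C1 (\<lambda>x. x)"
  unfolding C1_def by (intro exI[of _ "\<lambda>_. id_blinfun"]) auto

lemma C1_mult: "C1 f \<Longrightarrow> C1 g \<Longrightarrow> C1 (\<lambda>x. f x * g x :: real)"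
  using C1_scaleR[of f g] by simp

lemma C1_diff: "C1 f \<Longrightarrow> C1 g \<Longrightarrow> C1 (\<lambda>x. f x - g x)"
  using C1_add[OF _ C1_scaleR[OF C1_const[of "-1"]], of f g] by simp

lemma C1_inner:
  fixes f g :: "'a::real_normed_vector \<Rightarrow> 'b::real_inner"
  assumes "C1 f" "C1 g"
  shows "C1 (\<lambda>x. f x \<bullet> g x)"
proof -
  from assms obtain D E where D: "\<And>x. (f has_derivative blinfun_apply (D x)) (at x)" "continuous_on UNIV D"
    and E: "\<And>x. (g has_derivative blinfun_apply (E x)) (at x)" "continuous_on UNIV E" unfolding C1_def by blast
  have "((\<lambda>x. f x \<bullet> g x) has_derivative blinfun_apply ((blinfun_inner_right (f x) o\<^sub>L E x) + (blinfun_inner_right (g x) o\<^sub>L D x))) (at x)" for x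
    by (rule has_derivative_eq_rhs[OF has_derivative_inner[OF D(1) E(1)]])
       (rule ext, simp add: blinfun.add_left inner_commute)
  moreover have "continuous_on UNIV (\<lambda>x. (blinfun_inner_right (f x) o\<^sub>L E x) + (blinfun_inner_right (g x) o\<^sub>L D x))"
    using C1_continuous[OF assms(1)] C1_continuous[OF assms(2)]
    by (intro continuous_intros D E bounded_linear.continuous_on[OF bounded_linear_blinfun_inner_right]
        bounded_bilinear.continuous_on[OF bounded_bilinear_blinfun_compose])
  ultimately show ?thesis unfolding C1_def
    by (intro exI[of _ "\<lambda>x. (blinfun_inner_right (f x) o\<^sub>L E x) + (blinfun_inner_right (g x) o\<^sub>L D x)"] conjI allI)
qed

text \<open>Squaring removes the kink of the positive part; this is the building block for bump
  functions and for the saturation in \<open>open_indicator_limit\<close>.\<close>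

lemma C1_pos_square:
  assumes "C1 f"
  shows "C1 (\<lambda>x. (max 0 (f x :: real))\<^sup>2)"
proof -
  from assms obtain D where D: "\<And>x. (f has_derivative blinfun_apply (D x)) (at x)" "continuous_on UNIV D"
    unfolding C1_def by blast
  have sq: "((\<lambda>t. (max 0 t)\<^sup>2) has_real_derivative 2 * max 0 t) (at t)" for t :: real
  proof -
    consider "t > 0" | "t < 0" | "t = 0" by linarith
    then show ?thesis
    proof cases
      case 1
      have "((\<lambda>t::real. t\<^sup>2) has_real_derivative 2 * t) (at t)" by (auto intro!: derivative_eq_intros)
      then have "((\<lambda>t. (max 0 t)\<^sup>2) has_real_derivative 2 * t) (at t)"
        by (rule has_field_derivative_transform_within_open[where S="{0<..}"]) (use 1 in auto)
      then show ?thesis using 1 by simp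
    next
      case 2
      have "((\<lambda>t::real. 0) has_real_derivative 0) (at t)" by simp
      then have "((\<lambda>t. (max 0 t)\<^sup>2) has_real_derivative 0) (at t)"
        by (rule has_field_derivative_transform_within_open[where S="{..<0}"]) (use 2 in auto)
      then show ?thesis using 2 by simp
    next
      case 3
      have "((\<lambda>h. ((max 0 (0 + h))\<^sup>2 - (max 0 0)\<^sup>2) / h) \<longlongrightarrow> (0::real)) (at 0)"
      proof (rule Lim_null_comparison)
        show "((\<lambda>h. \<bar>h\<bar>) \<longlongrightarrow> 0) (at (0::real))" by (auto intro!: tendsto_eq_intros)
        show "\<forall>\<^sub>F h in at 0. norm (((max 0 (0 + h))\<^sup>2 - (max 0 0)\<^sup>2) / h) \<le> \<bar>h :: real\<bar>"
          by (intro always_eventually) (auto simp: max_def power2_eq_square)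
      qed
      then show ?thesis using 3 by (simp add: DERIV_def)
    qed
  qed
  have "((\<lambda>x. (max 0 (f x))\<^sup>2) has_derivative blinfun_apply ((2 * max 0 (f x)) *\<^sub>R D x)) (at x)" for x
  proof -
    have "(((\<lambda>t. (max 0 t)\<^sup>2) \<circ> f) has_derivative ((\<lambda>h. h * (2 * max 0 (f x))) \<circ> blinfun_apply (D x))) (at x)"
    proof (intro diff_chain_at D)
      have "(\<lambda>h. h * (2 * max 0 (f x))) = (*) (2 * max 0 (f x))" by (simp add: fun_eq_iff)
      then show "((\<lambda>t. (max 0 t)\<^sup>2) has_derivative (\<lambda>h. h * (2 * max 0 (f x)))) (at (f x))"
        using sq[of "f x"] by (simp only: has_field_derivative_def)
    qed
    then show ?thesis unfolding o_def by (rule has_derivative_eq_rhs) (auto simp: blinfun.scaleR_left)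
  qed
  moreover have "continuous_on UNIV (\<lambda>x. (2 * max 0 (f x)) *\<^sub>R D x)"
    by (intro continuous_intros D C1_continuous[OF assms])
  ultimately show ?thesis unfolding C1_def
    by (intro exI[of _ "\<lambda>x. (2 * max 0 (f x)) *\<^sub>R D x"] conjI allI)
qed

lemma C1c_iff: "h \<in> C1c \<Omega> \<longleftrightarrow> C1 h \<and> compact (closure {x. h x \<noteq> 0}) \<and> closure {x. h x \<noteq> 0} \<subseteq> \<Omega>"
  by (auto simp: C1c_def C1_def)

lemma C1c_scaleR:
  assumes "\<eta> \<in> C1c \<Omega>" "C1 g"
  shows "(\<lambda>x. \<eta> x *\<^sub>R g x) \<in> C1c \<Omega>"
proof -
  have sub: "closure {x. \<eta> x *\<^sub>R g x \<noteq> 0} \<subseteq> closure {x. \<eta> x \<noteq> 0}" by (intro closure_mono) auto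
  have \<eta>: "C1 \<eta>" "compact (closure {x. \<eta> x \<noteq> 0})" "closure {x. \<eta> x \<noteq> 0} \<subseteq> \<Omega>" using assms(1) by (auto simp: C1c_iff)
  have "compact (closure {x. \<eta> x *\<^sub>R g x \<noteq> 0})"
    using compact_Int_closed[OF \<eta>(2) closed_closure[of "{x. \<eta> x *\<^sub>R g x \<noteq> 0}"]] sub by (simp add: Int_absorb1)
  then show ?thesis unfolding C1c_iff using C1_scaleR[OF \<eta>(1) assms(2)] sub \<eta>(3) by blast
qed

text \<open>Countably many balls exhaust \<open>V\<close>, each carrying a bump that is positive
  exactly on it. The \<open>n\<close>-fold partial sums eventually exceed \<open>1\<close> at every
  point of \<open>V\<close>, and \<open>1 - (max 0 (1 - t))\<^sup>2\<close> sends them to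
  \<open>1\<close> in a differentiable way.\<close>

lemma open_indicator_limit:
  fixes V :: "'a::euclidean_space set"
  assumes V: "open V"
  obtains \<eta> :: "nat \<Rightarrow> 'a \<Rightarrow> real" where "\<And>n. C1 (\<eta> n)" "\<And>n x. 0 \<le> \<eta> n x \<and> \<eta> n x \<le> 1"
    "\<And>n x. x \<notin> V \<Longrightarrow> \<eta> n x = 0" "\<And>x. (\<lambda>n. \<eta> n x) \<longlonglongrightarrow> indicator V x"
proof -
  define F where "F = {ball x r | x r. ball x r \<subseteq> V}"
  obtain F' where F': "F' \<subseteq> F" "countable F'" "\<Union>F' = \<Union>F"
    using Lindelof[of F] unfolding F_def by auto
  have UF: "\<Union>F = V"
  proof
    show "V \<subseteq> \<Union>F"
    proof
      fix x assume "x \<in> V"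
      then obtain r where "r > 0" "ball x r \<subseteq> V" using V unfolding open_contains_ball by blast
      then have "ball x r \<in> F" "x \<in> ball x r" unfolding F_def by (blast, simp)
      then show "x \<in> \<Union>F" by blast
    qed
  qed (auto simp: F_def)
  \<comment> \<open>The empty ball is added so that \<open>from_nat_into\<close> is an enumeration
    even if \<open>F'\<close> is empty.\<close>
  have "{} = ball (undefined :: 'a) 0" by simp
  then have "{} \<in> F" unfolding F_def by blast
  define B where "B = from_nat_into (insert {} F')"
  have rB: "range B = insert {} F'" unfolding B_def by (rule range_from_nat_into) (use F' in auto)
  have "\<forall>i. \<exists>x r. B i = ball x r"
  proof
    fix i have "B i \<in> F" using rB F'(1) \<open>{} \<in> F\<close> by (metis insert_subset rangeI subsetD)
    then show "\<exists>x r. B i = ball x r" by (auto simp: F_def)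
  qed
  then obtain c r where B: "\<And>i. B i = ball (c i) (r i)" by metis
  define \<beta> where "\<beta> i x = (if r i \<le> 0 then 0 else (max 0 ((r i)\<^sup>2 - (x - c i) \<bullet> (x - c i)))\<^sup>2)" for i x
  have \<beta>1: "C1 (\<beta> i)" for i
    unfolding \<beta>_def by (cases "r i \<le> 0") (auto intro!: C1_const C1_pos_square C1_diff C1_inner C1_id)
  have \<beta>pos: "\<beta> i x > 0 \<longleftrightarrow> x \<in> B i" for i x
  proof (cases "r i \<le> 0")
    case True
    then show ?thesis by (auto simp: \<beta>_def B ball_empty)
  next
    case False
    have "x \<in> B i \<longleftrightarrow> norm (x - c i) < r i" unfolding B mem_ball dist_norm norm_minus_commute[of x] ..
    also have "\<dots> \<longleftrightarrow> (norm (x - c i))\<^sup>2 < (r i)\<^sup>2" using False by (auto intro: power_strict_mono power2_less_imp_less)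
    also have "\<dots> \<longleftrightarrow> (r i)\<^sup>2 - (x - c i) \<bullet> (x - c i) > 0" by (simp add: power2_norm_eq_inner)
    finally show ?thesis using False by (auto simp: \<beta>_def max_def)
  qed
  have \<beta>nn: "\<beta> i x \<ge> 0" for i x by (simp add: \<beta>_def)
  define \<sigma> where "\<sigma> n x = real n * (\<Sum>i<n. \<beta> i x)" for n x
  have \<sigma>nn: "\<sigma> n x \<ge> 0" for n x unfolding \<sigma>_def using \<beta>nn by (intro mult_nonneg_nonneg sum_nonneg) auto
  define \<eta> where "\<eta> n x = 1 - (max 0 (1 - \<sigma> n x))\<^sup>2" for n x
  have 1: "C1 (\<eta> n)" for n
    unfolding \<eta>_def \<sigma>_def by (intro C1_diff C1_const C1_pos_square C1_mult C1_sum \<beta>1)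
  have 2: "0 \<le> \<eta> n x \<and> \<eta> n x \<le> 1" for n x
  proof -
    have "(max 0 (1 - \<sigma> n x))\<^sup>2 \<le> 1\<^sup>2" using \<sigma>nn[of n x] by (intro power_mono) auto
    then show ?thesis by (simp add: \<eta>_def)
  qed
  have Vi: "x \<in> V \<longleftrightarrow> (\<exists>i. x \<in> B i)" for x
    using rB F'(3) UF by (metis UN_iff Union_iff insertE insert_iff empty_iff rangeE rangeI)
  have 3: "\<eta> n x = 0" if "x \<notin> V" for n x
  proof -
    have "\<beta> i x = 0" for i using \<beta>pos[of i x] \<beta>nn[of i x] Vi[of x] that by force
    then show ?thesis by (simp add: \<eta>_def \<sigma>_def)
  qed
  have 4: "(\<lambda>n. \<eta> n x) \<longlonglongrightarrow> indicator V x" for x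
  proof (cases "x \<in> V")
    case True
    then obtain i where "x \<in> B i" using Vi by blast
    then have bi: "\<beta> i x > 0" using \<beta>pos by simp
    obtain N where N: "real N * \<beta> i x > 1" using reals_Archimedean3[OF bi] by blast
    have "\<eta> n x = 1" if n: "n \<ge> max N (Suc i)" for n
    proof -
      have "\<beta> i x \<le> (\<Sum>i<n. \<beta> i x)" using n \<beta>nn by (intro member_le_sum) auto
      then have "real N * \<beta> i x \<le> real n * (\<Sum>i<n. \<beta> i x)" using n bi by (intro mult_mono) auto
      then have "\<sigma> n x \<ge> 1" using N by (simp add: \<sigma>_def)
      then show ?thesis by (simp add: \<eta>_def)
    qed
    then have "\<forall>\<^sub>F n in sequentially. \<eta> n x = 1" by (auto simp: eventually_sequentially intro!: exI[of _ "max N (Suc i)"])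
    then show ?thesis using True by (simp add: tendsto_eventually)
  qed (simp add: 3)
  show ?thesis using that[OF 1 2 3 4] by blast
qed

text \<open>A one-sided fundamental lemma of the calculus of variations. On a ball, test functions
  increase the reach to indicators of open sets. Outer regularity then places an open set with
  excess measure at most \<open>e\<close> around \<open>S = {w \<le> - \<epsilon>}\<close>, which
  gives \<open>\<epsilon> * measure M S \<le> max c 0 * e\<close> for every
  \<open>e > 0\<close>.\<close>

lemma nonneg_AE_if_test_integrals_nonneg:
  fixes M :: "'a::euclidean_space measure" and w :: "'a \<Rightarrow> real"
  assumes sM: "sets M = sets borel" and \<Omega>: "open \<Omega>" and fin: "\<And>K. compact K \<Longrightarrow> K \<subseteq> \<Omega> \<Longrightarrow> emeasure M K < \<infinity>"
    and w: "w \<in> borel_measurable M" and bd: "\<And>R. \<exists>c. AE x in M. norm x \<le> R \<longrightarrow> \<bar>w x\<bar> \<le> c"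
    and pos: "\<And>\<eta>. \<eta> \<in> C1c \<Omega> \<Longrightarrow> (\<And>x. 0 \<le> \<eta> x) \<Longrightarrow> 0 \<le> (LINT x|M. \<eta> x * w x)"
  shows "AE x in M. x \<in> \<Omega> \<longrightarrow> 0 \<le> w x"
proof -
  note [measurable_cong] = sM
  note [measurable] = w
  have spM: "space M = UNIV" using sM by (metis sets_eq_imp_space_eq space_borel)
  have ball: "AE x in M. x \<in> ball x0 r0 \<longrightarrow> 0 \<le> w x" if cb: "cball x0 r0 \<subseteq> \<Omega>" for x0 r0
  proof -
    let ?U = "ball x0 r0"
    obtain c where c: "AE x in M. norm x \<le> norm x0 + \<bar>r0\<bar> \<longrightarrow> \<bar>w x\<bar> \<le> c" using bd by blast
    have inU: "norm x \<le> norm x0 + \<bar>r0\<bar>" if "x \<in> ?U" for x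
    proof -
      have "norm x \<le> norm x0 + norm (x0 - x)" by (metis norm_triangle_sub norm_minus_commute)
      then show ?thesis using that by (simp add: dist_norm)
    qed
    have cU: "AE x in M. x \<in> ?U \<longrightarrow> \<bar>w x\<bar> \<le> max c 0" using c by eventually_elim (use inU in force)
    have finU: "emeasure M ?U < \<infinity>"
      by (rule le_less_trans[OF emeasure_mono fin[OF compact_cball cb]]) (auto simp: sM)
    \<comment> \<open>The trace of \<open>M\<close> on the ball: a finite Borel measure, as
      \<open>outer_regular\<close> requires.\<close>
    define N where "N = density M (indicator ?U)"
    have sN: "sets N = sets borel" by (simp add: N_def sM)
    have eN: "emeasure N A = emeasure M (A \<inter> ?U)" if "A \<in> sets borel" for A
    proof -
      have "emeasure N A = (\<integral>\<^sup>+x. indicator ?U x * indicator A x \<partial>M)"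
        unfolding N_def by (rule emeasure_density[OF borel_measurable_indicator]) (use that in \<open>simp_all add: sM\<close>)
      also have "\<dots> = (\<integral>\<^sup>+x. indicator (A \<inter> ?U) x \<partial>M)" by (intro nn_integral_cong) (auto simp: indicator_def)
      also have "\<dots> = emeasure M (A \<inter> ?U)" using that sM by simp
      finally show ?thesis .
    qed
    have finN: "emeasure N (space N) \<noteq> \<infinity>" using eN[of UNIV] finU by (simp add: N_def spM)
    have iV: "integrable M (\<lambda>x. indicator A x * w x)" if "A \<in> sets borel" "A \<subseteq> ?U" for A
    proof (rule Bochner_Integration.integrable_bound)
      have "emeasure M A < \<infinity>" by (rule le_less_trans[OF emeasure_mono[OF that(2)] finU]) (simp add: sM)
      then show "integrable M (\<lambda>x. max c 0 * indicator A x)" using that by (intro integrable_mult_right integrable_real_indicator) (auto simp: sM)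
      show "AE x in M. norm (indicator A x * w x) \<le> norm (max c 0 * indicator A x)"
        using cU by eventually_elim (use that in \<open>auto simp: indicator_def\<close>)
    qed (use that in measurable)
    have openV: "0 \<le> (LINT x|M. indicator V x * w x)" if V: "open V" "V \<subseteq> ?U" for V
    proof -
      obtain \<eta> :: "nat \<Rightarrow> 'a \<Rightarrow> real" where \<eta>: "\<And>n. C1 (\<eta> n)" "\<And>n x. 0 \<le> \<eta> n x \<and> \<eta> n x \<le> 1"
        "\<And>n x. x \<notin> V \<Longrightarrow> \<eta> n x = 0" "\<And>x. (\<lambda>n. \<eta> n x) \<longlonglongrightarrow> indicator V x"
        using open_indicator_limit[OF V(1)] by blast
      have "\<eta> n \<in> C1c \<Omega>" for n
      proof -
        have "{x. \<eta> n x \<noteq> 0} \<subseteq> cball x0 r0" using \<eta>(3)[of _ n] V(2) ball_subset_cball by blast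
        then have "closure {x. \<eta> n x \<noteq> 0} \<subseteq> cball x0 r0" by (rule closure_minimal) simp
        then show ?thesis unfolding C1c_iff using \<eta>(1) cb
          by (meson bounded_cball bounded_subset closed_closure compact_eq_bounded_closed order_trans)
      qed
      then have nn: "0 \<le> (LINT x|M. \<eta> n x * w x)" for n using \<eta>(2) by (intro pos) auto
      have [measurable]: "\<eta> n \<in> borel_measurable borel" for n by (intro borel_measurable_continuous_onI C1_continuous \<eta>)
      have [measurable]: "V \<in> sets borel" using V by simp
      have "(\<lambda>n. LINT x|M. \<eta> n x * w x) \<longlonglongrightarrow> (LINT x|M. indicator V x * w x)"
      proof (rule integral_dominated_convergence[where w="\<lambda>x. max c 0 * indicator ?U x"])
        show "integrable M (\<lambda>x. max c 0 * indicator ?U x)"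
          using finU by (intro integrable_mult_right integrable_real_indicator) (auto simp: sM)
        show "AE x in M. norm (\<eta> n x * w x) \<le> max c 0 * indicator ?U x" for n
          using cU
        proof eventually_elim
          case (elim x)
          show ?case
          proof (cases "x \<in> V")
            case True
            have "\<eta> n x * \<bar>w x\<bar> \<le> 1 * max c 0" using \<eta>(2)[of n x] elim True V(2) by (intro mult_mono) auto
            then show ?thesis using True V(2) \<eta>(2)[of n x] by (auto simp: abs_mult)
          qed (simp add: \<eta>(3))
        qed
        show "AE x in M. (\<lambda>n. \<eta> n x * w x) \<longlonglongrightarrow> indicator V x * w x" by (intro AE_I2 tendsto_intros \<eta>)
      qed measurable
      then show ?thesis by (rule LIMSEQ_le_const) (use nn in auto)
    qed
    have Sm: "{x \<in> ?U. w x \<le> - \<epsilon>} \<in> sets borel" for \<epsilon>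
    proof -
      have "w -` {..- \<epsilon>} \<inter> space M \<in> sets M" by (rule measurable_sets[OF w]) simp
      then have "(w -` {..- \<epsilon>} \<inter> space M) \<inter> ?U \<in> sets borel" unfolding sM by (rule sets.Int) simp
      moreover have "(w -` {..- \<epsilon>} \<inter> space M) \<inter> ?U = {x \<in> ?U. w x \<le> - \<epsilon>}" by (auto simp: spM)
      ultimately show ?thesis by simp
    qed
    have Sj: "emeasure M {x \<in> ?U. w x \<le> - \<epsilon>} = 0" if \<epsilon>: "\<epsilon> > 0" for \<epsilon>
    proof -
      define S where "S = {x \<in> ?U. w x \<le> - \<epsilon>}"
      have Sb: "S \<in> sets borel" unfolding S_def by (rule Sm)
      have SU: "S \<subseteq> ?U" by (auto simp: S_def)
      have finS: "emeasure M A < \<infinity>" if "A \<subseteq> ?U" for A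
        by (rule le_less_trans[OF emeasure_mono[OF that] finU]) (simp add: sM)
      have "measure M S * \<epsilon> \<le> max c 0 * e" if e: "e > 0" for e
      proof -
        have "emeasure N S = (INF U\<in>{U. S \<subseteq> U \<and> open U}. emeasure N U)"
          by (rule outer_regular[OF sN finN Sb])
        moreover have "emeasure N S \<noteq> \<infinity>" using finS[OF SU] eN[OF Sb] SU by (simp add: Int_absorb2)
        ultimately have "(INF U\<in>{U. S \<subseteq> U \<and> open U}. emeasure N U) < emeasure N S + ennreal e"
          using e by (metis ennreal_eq_0_iff ennreal_add_left_cancel_less add.right_neutral infinity_ennreal_def linorder_not_le not_gr_zero)
        then obtain U where U: "S \<subseteq> U" "open U" "emeasure N U < emeasure N S + ennreal e"
          unfolding INF_less_iff by blast
        define V where "V = U \<inter> ?U"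
        have V: "open V" "V \<subseteq> ?U" "S \<subseteq> V" "V \<in> sets borel" using U SU by (auto simp: V_def)
        have mV: "emeasure M V < emeasure M S + ennreal e"
          using U(3) eN[of U] eN[OF Sb] U(2) SU by (simp add: V_def Int_absorb2)
        have "measure M V \<le> measure M S + e"
        proof -
          have "ennreal (measure M V) < ennreal (measure M S) + ennreal e"
            using mV finS[OF V(2)] finS[OF SU] by (simp add: emeasure_eq_ennreal_measure less_top)
          moreover have "ennreal (measure M S + e) \<le> ennreal (measure M V)" if "\<not> measure M V \<le> measure M S + e"
            using that by (intro ennreal_leI) simp
          ultimately show ?thesis using e by (cases "measure M V \<le> measure M S + e") (auto simp: not_less[symmetric])
        qed
        moreover have "measure M V = measure M S + measure M (V - S)"
        proof -
          have "emeasure M (V - S) < \<infinity>" using V(2) by (intro finS) auto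
          then show ?thesis using V(3,4) Sb finS[OF V(2)] finS[OF SU]
            by (subst measure_Union[symmetric]) (auto simp: sM Un_absorb1)
        qed
        ultimately have mVS: "measure M (V - S) \<le> e" by simp
        have VS: "V - S \<in> sets borel" "V - S \<subseteq> ?U" using V Sb by auto
        have "0 \<le> (LINT x|M. indicator V x * w x)" by (rule openV[OF V(1,2)])
        also have "\<dots> = (LINT x|M. indicator S x * w x + indicator (V - S) x * w x)"
          using V(3) by (intro Bochner_Integration.integral_cong) (auto simp: indicator_def)
        also have "\<dots> = (LINT x|M. indicator S x * w x) + (LINT x|M. indicator (V - S) x * w x)"
          using iV[OF Sb SU] iV[OF VS] by simp
        also have "(LINT x|M. indicator S x * w x) \<le> (LINT x|M. - \<epsilon> * indicator S x)"
        proof (rule integral_mono_AE[OF iV[OF Sb SU]])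
          show "integrable M (\<lambda>x. - \<epsilon> * indicator S x)" using finS[OF SU] Sb by (intro integrable_mult_right integrable_real_indicator) (auto simp: sM)
          show "AE x in M. indicator S x * w x \<le> - \<epsilon> * indicator S x" by (rule AE_I2) (auto simp: S_def indicator_def)
        qed
        also have "(LINT x|M. - \<epsilon> * indicator S x) = - \<epsilon> * measure M S" using Sb by (simp add: spM)
        also have "(LINT x|M. indicator (V - S) x * w x) \<le> (LINT x|M. max c 0 * indicator (V - S) x)"
        proof (rule integral_mono_AE[OF iV[OF VS]])
          show "integrable M (\<lambda>x. max c 0 * indicator (V - S) x)" using finS[OF VS(2)] VS by (intro integrable_mult_right integrable_real_indicator) (auto simp: sM)
          show "AE x in M. indicator (V - S) x * w x \<le> max c 0 * indicator (V - S) x"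
            using cU by eventually_elim (use VS(2) in \<open>auto simp: indicator_def\<close>)
        qed
        also have "(LINT x|M. max c 0 * indicator (V - S) x) = max c 0 * measure M (V - S)" using VS by (simp add: spM)
        also have "\<dots> \<le> max c 0 * e" using mVS by (intro mult_left_mono) auto
        finally show ?thesis by (simp add: mult.commute)
      qed
      note key = this
      have "measure M S = 0"
      proof (rule ccontr)
        assume "measure M S \<noteq> 0"
        then have p: "measure M S * \<epsilon> > 0" using \<epsilon> by (simp add: zero_less_measure_iff)
        define c' where "c' = max c 0 + 1"
        have c': "c' > 0" by (simp add: c'_def add_nonneg_pos)
        define e where "e = measure M S * \<epsilon> / (2 * c')"
        have "e > 0" using p c' by (simp add: e_def)
        from key[OF this] have "measure M S * \<epsilon> \<le> max c 0 * e" .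
        also have "\<dots> \<le> c' * e" using \<open>e > 0\<close> by (intro mult_right_mono) (auto simp: c'_def)
        also have "\<dots> = measure M S * \<epsilon> / 2" using c' by (simp add: e_def)
        finally show False using p by linarith
      qed
      then show ?thesis using finS[OF SU] by (simp add: S_def emeasure_eq_ennreal_measure less_top)
    qed
    have "AE x in M. \<forall>j. \<not> (x \<in> ?U \<and> w x \<le> - (1 / real (Suc j)))"
    proof (subst AE_all_countable, intro allI AE_I)
      fix j
      show "{x \<in> space M. \<not> \<not> (x \<in> ?U \<and> w x \<le> - (1 / real (Suc j)))} \<subseteq> {x \<in> ?U. w x \<le> - (1 / real (Suc j))}" by auto
      show "emeasure M {x \<in> ?U. w x \<le> - (1 / real (Suc j))} = 0" by (rule Sj) simp
      show "{x \<in> ?U. w x \<le> - (1 / real (Suc j))} \<in> sets M" unfolding sM by (rule Sm)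
    qed
    then show ?thesis
    proof (eventually_elim, intro impI)
      fix x assume x: "\<forall>j. \<not> (x \<in> ?U \<and> w x \<le> - (1 / real (Suc j)))" "x \<in> ?U"
      show "0 \<le> w x"
      proof (rule ccontr)
        assume "\<not> 0 \<le> w x"
        then obtain j where "1 / real (Suc j) < - w x" using nat_approx_posE[of "- w x"] by (auto simp: inverse_eq_divide)
        then have "w x \<le> - (1 / real (Suc j))" by linarith
        then show False using x by blast
      qed
    qed
  qed
  define F where "F = {ball x r | x r. cball x r \<subseteq> \<Omega>}"
  obtain F' where F': "F' \<subseteq> F" "countable F'" "\<Union>F' = \<Union>F"
    using Lindelof[of F] unfolding F_def by auto
  have UF: "\<Omega> \<subseteq> \<Union>F"
  proof
    fix x assume "x \<in> \<Omega>"
    then obtain r where "r > 0" "cball x r \<subseteq> \<Omega>" using \<Omega> unfolding open_contains_cball by blast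
    then have "ball x r \<in> F" "x \<in> ball x r" unfolding F_def by (blast, simp)
    then show "x \<in> \<Union>F" by blast
  qed
  have "AE x in M. \<forall>B\<in>F'. x \<in> B \<longrightarrow> 0 \<le> w x"
    using F' ball by (subst AE_ball_countable[OF F'(2)]) (auto simp: F_def)
  then show ?thesis by eventually_elim (use UF F'(3) in blast)
qed

section \<open>Gauss-Green measures of compact convex sets: support and normals\<close>

lemma lborel_integral_affine:
  fixes f :: "'a::euclidean_space \<Rightarrow> real"
  assumes [measurable]: "f \<in> borel_measurable borel" and c: "c \<noteq> 0"
  shows "(LINT x|lborel. f x) = (LINT x|lborel. \<bar>c\<bar> ^ DIM('a) * f (t + c *\<^sub>R x))"
proof -
  have "(LINT x|lborel. f x) = (LINT x|density (distr lborel borel (\<lambda>x. t + c *\<^sub>R x)) (\<lambda>_. \<bar>c\<bar>^DIM('a)). f x)"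
    using lborel_affine[OF c, of t] by simp
  also have "\<dots> = (LINT x|distr lborel borel (\<lambda>x. t + c *\<^sub>R x). \<bar>c\<bar>^DIM('a) *\<^sub>R f x)"
    by (rule integral_density) auto
  also have "\<dots> = (LINT x|lborel. \<bar>c\<bar>^DIM('a) *\<^sub>R f (t + c *\<^sub>R x))"
    by (rule integral_distr) auto
  finally show ?thesis by simp
qed

lemma divergence_radial:
  fixes \<eta> :: "'a::euclidean_space \<Rightarrow> real"
  assumes "(\<eta> has_derivative blinfun_apply D) (at x)"
  shows "divergence (\<lambda>x. \<eta> x *\<^sub>R (x - z)) x = real DIM('a) * \<eta> x + blinfun_apply D (x - z)"
proof -
  have "((\<lambda>x. \<eta> x *\<^sub>R (x - z)) has_derivative (\<lambda>h. \<eta> x *\<^sub>R h + blinfun_apply D h *\<^sub>R (x - z))) (at x)"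
    by (rule has_derivative_eq_rhs[OF has_derivative_scaleR[OF assms has_derivative_diff[OF has_derivative_ident has_derivative_const]]]) simp
  from frechet_derivative_at[OF this, symmetric]
  have "divergence (\<lambda>x. \<eta> x *\<^sub>R (x - z)) x = (\<Sum>i\<in>Basis. (\<eta> x *\<^sub>R i + blinfun_apply D i *\<^sub>R (x - z)) \<bullet> i)"
    by (simp add: divergence_def)
  also have "\<dots> = (\<Sum>i\<in>(Basis :: 'a set). \<eta> x * (i \<bullet> i)) + (\<Sum>i\<in>(Basis :: 'a set). blinfun_apply D i * ((x - z) \<bullet> i))"
    by (simp add: inner_add_left sum.distrib)
  also have "(\<Sum>i\<in>(Basis :: 'a set). \<eta> x * (i \<bullet> i)) = real DIM('a) * \<eta> x" by (simp add: inner_Basis)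
  also have "(\<Sum>i\<in>Basis. blinfun_apply D i * ((x - z) \<bullet> i)) = blinfun_apply D (\<Sum>i\<in>Basis. ((x - z) \<bullet> i) *\<^sub>R i)"
    by (simp add: blinfun.sum_right blinfun.scaleR_right mult.commute)
  also have "(\<Sum>i\<in>Basis. ((x - z) \<bullet> i) *\<^sub>R i) = x - z" by (rule euclidean_representation)
  finally show ?thesis .
qed

text \<open>The left-hand side is the derivative at \<open>1\<close> of \<open>t \<mapsto> \<integral> \<eta>\<close> over the dilation of \<open>W\<close> by \<open>t\<close> about \<open>z\<close>,
  and these dilations increase with \<open>t\<close>.\<close>

lemma radial_divergence_nonneg:
  fixes W :: "'a::euclidean_space set"
  assumes W: "convex W" "compact W" and z: "z \<in> W" and \<eta>: "C1 \<eta>" "\<And>x. 0 \<le> \<eta> x" "\<eta> \<in> C1c UNIV"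
  shows "0 \<le> (LINT x:W|lebesgue. divergence (\<lambda>x. \<eta> x *\<^sub>R (x - z)) x)"
proof -
  let ?d = "DIM('a)"
  obtain D where D: "\<And>x. (\<eta> has_derivative blinfun_apply (D x)) (at x)" "continuous_on UNIV D"
    using \<eta>(1) unfolding C1_def by blast
  have \<eta>c: "continuous_on S \<eta>" for S using \<eta>(1) by (rule C1_continuous)
  have [measurable]: "\<eta> \<in> borel_measurable borel" by (intro borel_measurable_continuous_onI \<eta>c)
  have [measurable]: "W \<in> sets borel" using W by (simp add: compact_imp_closed)
  obtain R where R: "R > 0" "\<And>x. x \<in> W \<Longrightarrow> norm (x - z) \<le> R"
  proof -
    obtain b where b: "\<And>x. x \<in> W \<Longrightarrow> norm x \<le> b" using compact_imp_bounded[OF W(2)] unfolding bounded_iff by blast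
    have "norm (x - z) \<le> 2 * b + 1" if "x \<in> W" for x
      using norm_triangle_ineq4[of x z] b[OF that] b[OF z] norm_ge_zero[of z] by linarith
    moreover have "2 * b + 1 > 0" using b[OF z] norm_ge_zero[of z] by linarith
    ultimately show ?thesis using that by blast
  qed
  have comp: "compact (cball z (2 * R))" by simp
  obtain B where B: "\<And>x. x \<in> cball z (2 * R) \<Longrightarrow> \<bar>\<eta> x\<bar> \<le> B"
    using compact_imp_bounded[OF compact_continuous_image[OF \<eta>c comp]] unfolding bounded_iff
    by (metis image_eqI real_norm_def)
  obtain B1 where B1: "\<And>x. x \<in> cball z (2 * R) \<Longrightarrow> norm (D x) \<le> B1"
    using compact_imp_bounded[OF compact_continuous_image[OF continuous_on_subset[OF D(2)] comp]] unfolding bounded_iff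
    by (metis image_eqI subset_UNIV)
  \<comment> \<open>The integrand over \<open>W\<close> after pulling back the dilation by
    \<open>\<mu>\<close> about \<open>z\<close>, Jacobian included. Its derivative at
    \<open>\<mu> = 1\<close> is the divergence in question.\<close>
  define G where "G x \<mu> = \<mu> ^ ?d * \<eta> (z + \<mu> *\<^sub>R (x - z))" for x \<mu>
  define G' where "G' x \<mu> = real ?d * \<mu> ^ (?d - 1) * \<eta> (z + \<mu> *\<^sub>R (x - z)) + \<mu> ^ ?d * blinfun_apply (D (z + \<mu> *\<^sub>R (x - z))) (x - z)" for x \<mu>
  have dG: "(G x has_real_derivative G' x \<mu>) (at \<mu>)" for x \<mu>
  proof -
    have "((\<lambda>\<mu>. z + \<mu> *\<^sub>R (x - z)) has_derivative (\<lambda>h. h *\<^sub>R (x - z))) (at \<mu>)" by (auto intro!: derivative_eq_intros)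
    from diff_chain_at[OF this D(1)]
    have "((\<lambda>\<mu>. \<eta> (z + \<mu> *\<^sub>R (x - z))) has_real_derivative blinfun_apply (D (z + \<mu> *\<^sub>R (x - z))) (x - z)) (at \<mu>)"
      unfolding has_field_derivative_def o_def
      by (rule has_derivative_eq_rhs) (auto simp only: blinfun.scaleR_right fun_eq_iff real_scaleR_def mult.commute)
    then show ?thesis unfolding G_def G'_def by (auto intro!: derivative_eq_intros)
  qed
  define C where "C = real ?d * 2 ^ ?d * B + 2 ^ ?d * (B1 * R)"
  have G'b: "\<bar>G' x \<mu>\<bar> \<le> C" if "x \<in> W" "1 \<le> \<mu>" "\<mu> \<le> 2" for x \<mu>
  proof -
    have "norm (\<mu> *\<^sub>R (x - z)) \<le> 2 * R" using R(2)[OF that(1)] that R(1) by (simp add: mult_mono)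
    then have in_b: "z + \<mu> *\<^sub>R (x - z) \<in> cball z (2 * R)" by (simp add: dist_norm)
    have B0: "0 \<le> B" "0 \<le> B1" using B[OF in_b] B1[OF in_b] by (meson abs_ge_zero norm_ge_zero order_trans)+
    have "\<bar>blinfun_apply (D (z + \<mu> *\<^sub>R (x - z))) (x - z)\<bar> \<le> B1 * R"
      using norm_blinfun[of "D (z + \<mu> *\<^sub>R (x - z))" "x - z"] mult_mono[OF B1[OF in_b] R(2)[OF that(1)] B0(2)] by simp
    moreover have "\<mu> ^ ?d \<le> 2 ^ ?d" "\<mu> ^ (?d - 1) \<le> 2 ^ ?d"
    proof -
      show "\<mu> ^ ?d \<le> 2 ^ ?d" using that by (intro power_mono) auto
      have "\<mu> ^ (?d - 1) \<le> \<mu> ^ ?d" using that by (intro power_increasing) auto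
      also have "\<dots> \<le> 2 ^ ?d" using that by (intro power_mono) auto
      finally show "\<mu> ^ (?d - 1) \<le> 2 ^ ?d" .
    qed
    ultimately have "\<bar>real ?d * \<mu> ^ (?d - 1) * \<eta> (z + \<mu> *\<^sub>R (x - z))\<bar> \<le> real ?d * 2 ^ ?d * B"
      "\<bar>\<mu> ^ ?d * blinfun_apply (D (z + \<mu> *\<^sub>R (x - z))) (x - z)\<bar> \<le> 2 ^ ?d * (B1 * R)"
      using B[OF in_b] that B0 R(1) by (auto simp: abs_mult intro!: mult_mono)
    then show ?thesis unfolding G'_def C_def by linarith
  qed
  define l where "l k = 1 / real (Suc k)" for k
  have l: "0 < l k" "l k \<le> 1" for k by (auto simp: l_def)
  have l0: "l \<longlonglongrightarrow> 0" unfolding l_def using LIMSEQ_inverse_real_of_nat by (simp add: inverse_eq_divide)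
  have fW: "emeasure lborel W < \<infinity>" using emeasure_bounded_finite[OF compact_imp_bounded[OF W(2)]] by simp
  define I where "I k = (LINT x|lborel. indicator W x * ((G x (1 + l k) - G x 1) / l k))" for k
  have iG: "integrable lborel (\<lambda>x. indicator W x * G x \<mu>)" for \<mu>
  proof -
    have "integrable lborel (\<lambda>x. indicator W x *\<^sub>R G x \<mu>)" unfolding G_def
      by (intro borel_integrable_compact W continuous_intros continuous_on_compose2[OF \<eta>c[of UNIV]]) auto
    then show ?thesis by simp
  qed
  have Ipos: "0 \<le> I k" for k
  proof -
    define la where "la = 1 + l k"
    have la: "la > 1" using l[of k] by (simp add: la_def)
    define g where "g y = indicator W (z + (1 / la) *\<^sub>R (y - z)) * \<eta> y" for y
    have gm: "g \<in> borel_measurable borel" unfolding g_def by measurable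
    have "(LINT x|lborel. g x) = (LINT x|lborel. \<bar>la\<bar> ^ ?d * g ((z - la *\<^sub>R z) + la *\<^sub>R x))"
      by (rule lborel_integral_affine[OF gm]) (use la in simp)
    also have "\<dots> = (LINT x|lborel. indicator W x * G x la)"
    proof (rule Bochner_Integration.integral_cong)
      fix x
      have e: "(z - la *\<^sub>R z) + la *\<^sub>R x = z + la *\<^sub>R (x - z)" by (simp add: algebra_simps)
      have "z + (1 / la) *\<^sub>R ((z + la *\<^sub>R (x - z)) - z) = x" using la by simp
      then show "\<bar>la\<bar> ^ ?d * g ((z - la *\<^sub>R z) + la *\<^sub>R x) = indicator W x * G x la"
        unfolding e g_def G_def using la by simp
    qed simp
    finally have eq: "(LINT x|lborel. g x) = (LINT x|lborel. indicator W x * G x la)" .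
    \<comment> \<open>Convexity and \<open>z \<in> W\<close> put \<open>W\<close> inside its
      dilation by \<open>la > 1\<close>; this is where the sign comes from.\<close>
    have le: "indicator W x * G x 1 \<le> g x" for x
    proof (cases "x \<in> W")
      case True
      have "z + (1 / la) *\<^sub>R (x - z) = (1 - 1 / la) *\<^sub>R z + (1 / la) *\<^sub>R x" by (simp add: algebra_simps)
      also have "\<dots> \<in> W" using la by (intro convexD[OF W(1) z True]) auto
      finally show ?thesis using True by (simp add: g_def G_def)
    qed (simp add: g_def \<eta>(2))
    have gi: "integrable lborel g"
    proof -
      have "integrable lborel (\<lambda>y. indicator (closure {x. \<eta> x \<noteq> 0}) y *\<^sub>R \<eta> y)"
        using \<eta>(3) by (intro borel_integrable_compact \<eta>c) (auto simp: C1c_iff)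
      moreover have "norm (g y) \<le> norm (indicator (closure {x. \<eta> x \<noteq> 0}) y *\<^sub>R \<eta> y)" for y
        using closure_subset[of "{x. \<eta> x \<noteq> 0}"] by (cases "\<eta> y = 0") (auto simp: g_def indicator_def)
      ultimately show ?thesis using gm by (intro Bochner_Integration.integrable_bound[of lborel _ g]) auto
    qed
    have "(LINT x|lborel. indicator W x * G x 1) \<le> (LINT x|lborel. g x)"
      by (rule integral_mono[OF iG gi le])
    moreover have "I k = ((LINT x|lborel. indicator W x * G x la) - (LINT x|lborel. indicator W x * G x 1)) / l k"
    proof -
      have "I k = (LINT x|lborel. (indicator W x * G x la - indicator W x * G x 1) / l k)"
        unfolding I_def la_def by (intro Bochner_Integration.integral_cong) (auto simp: algebra_simps)
      then show ?thesis using iG by simp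
    qed
    ultimately show ?thesis using eq l(1)[of k] by simp
  qed
  have "I \<longlonglongrightarrow> (LINT x|lborel. indicator W x * G' x 1)"
    unfolding I_def
  proof (rule integral_dominated_convergence[where w="\<lambda>x. C * indicator W x"])
    show "integrable lborel (\<lambda>x. C * indicator W x)"
      using fW by (intro integrable_mult_right integrable_real_indicator) (auto simp: less_top[symmetric])
    have Dm: "(\<lambda>x. blinfun_apply (D x) (x - z)) \<in> borel_measurable borel"
      by (intro borel_measurable_continuous_onI continuous_intros D)
    have "(\<lambda>x. G' x 1) = (\<lambda>x. real ?d * \<eta> x + blinfun_apply (D x) (x - z))" by (simp add: G'_def fun_eq_iff)
    then have [measurable]: "(\<lambda>x. G' x 1) \<in> borel_measurable borel" using Dm by simp
    show "(\<lambda>x. indicator W x * G' x 1) \<in> borel_measurable lborel" by measurable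
    show "(\<lambda>x. indicator W x * ((G x (1 + l k) - G x 1) / l k)) \<in> borel_measurable lborel" for k
      unfolding G_def by measurable
    show "AE x in lborel. norm (indicator W x * ((G x (1 + l k) - G x 1) / l k)) \<le> C * indicator W x" for k
    proof (rule AE_I2)
      fix x
      show "norm (indicator W x * ((G x (1 + l k) - G x 1) / l k)) \<le> C * indicator W x"
      proof (cases "x \<in> W")
        case True
        have "\<exists>\<mu>>1. \<mu> < 1 + l k \<and> G x (1 + l k) - G x 1 = (1 + l k - 1) * G' x \<mu>"
          using l[of k] by (intro MVT2 dG) auto
        then obtain \<mu> where \<mu>: "\<mu> > 1" "\<mu> < 1 + l k" "G x (1 + l k) - G x 1 = l k * G' x \<mu>" by auto
        have "\<bar>G' x \<mu>\<bar> \<le> C" using \<mu> l[of k] by (intro G'b True) auto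
        moreover have "(G x (1 + l k) - G x 1) / l k = G' x \<mu>" using \<mu> l[of k] by simp
        ultimately show ?thesis using True by simp
      qed simp
    qed
    show "AE x in lborel. (\<lambda>k. indicator W x * ((G x (1 + l k) - G x 1) / l k)) \<longlonglongrightarrow> indicator W x * G' x 1"
    proof (intro AE_I2 tendsto_mult tendsto_const)
      fix x
      have "((\<lambda>h. (G x (1 + h) - G x 1) / h) \<longlongrightarrow> G' x 1) (at 0)" using dG[of x 1] by (simp add: DERIV_def)
      moreover have "filterlim l (at 0) sequentially" using l0 l(1) by (auto simp: filterlim_at less_imp_neq[THEN not_sym])
      ultimately show "(\<lambda>k. (G x (1 + l k) - G x 1) / l k) \<longlonglongrightarrow> G' x 1" by (rule filterlim_compose)
    qed
  qed
  then have nn: "0 \<le> (LINT x|lborel. indicator W x * G' x 1)" by (rule LIMSEQ_le_const) (use Ipos in auto)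
  have eq: "divergence (\<lambda>x. \<eta> x *\<^sub>R (x - z)) x = G' x 1" for x
    using divergence_radial[OF D(1)[of x], of z] by (simp add: G'_def)
  have Dm: "(\<lambda>x. blinfun_apply (D x) (x - z)) \<in> borel_measurable borel"
    by (intro borel_measurable_continuous_onI continuous_intros D)
  have "(\<lambda>x. G' x 1) = (\<lambda>x. real ?d * \<eta> x + blinfun_apply (D x) (x - z))" by (simp add: G'_def fun_eq_iff)
  then have [measurable]: "(\<lambda>x. G' x 1) \<in> borel_measurable borel" using Dm by simp
  have "(LINT x:W|lebesgue. divergence (\<lambda>x. \<eta> x *\<^sub>R (x - z)) x) = (LINT x|lborel. indicator W x * G' x 1)"
    unfolding set_lebesgue_integral_def eq by (subst integral_completion) auto
  then show ?thesis using nn by simp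
qed

text \<open>A field supported off \<open>W\<close> has vanishing divergence on \<open>W\<close>.
  Testing with all signed basis vectors makes every component of \<open>n\<close> both nonnegative
  and nonpositive off \<open>W\<close>, against \<open>norm (n x) = 1\<close>.\<close>

lemma gauss_green_AE_mem:
  fixes W :: "'a::euclidean_space set"
  assumes gg: "gauss_green W UNIV M n" and W: "closed W"
  shows "AE x in M. x \<in> W"
proof -
  have sM: "sets M = sets borel" and fin: "\<And>K. compact K \<Longrightarrow> emeasure M K < \<infinity>"
    and nm: "n \<in> borel_measurable M" and n1: "AE x in M. norm (n x) = 1"
    and ident: "\<And>h. h \<in> C1c UNIV \<Longrightarrow> (LINT x:W|lebesgue. divergence h x) = (LINT x|M. h x \<bullet> n x)"
    using gg unfolding gauss_green_def by auto
  have nn: "AE x in M. x \<in> - W \<longrightarrow> 0 \<le> n x \<bullet> e" for e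
  proof (rule nonneg_AE_if_test_integrals_nonneg[OF sM])
    show "open (- W)" using W by auto
    show "(\<lambda>x. n x \<bullet> e) \<in> borel_measurable M" using nm by measurable
    show "\<exists>c. AE x in M. norm x \<le> R \<longrightarrow> \<bar>n x \<bullet> e\<bar> \<le> c" for R
    proof
      show "AE x in M. norm x \<le> R \<longrightarrow> \<bar>n x \<bullet> e\<bar> \<le> norm e"
        using n1 by eventually_elim (metis Cauchy_Schwarz_ineq2 mult_1)
    qed
    fix \<eta> :: "'a \<Rightarrow> real" assume \<eta>: "\<eta> \<in> C1c (- W)"
    have h: "(\<lambda>x. \<eta> x *\<^sub>R e) \<in> C1c (- W)" by (rule C1c_scaleR[OF \<eta> C1_const])
    then have h': "(\<lambda>x. \<eta> x *\<^sub>R e) \<in> C1c UNIV" by (auto simp: C1c_iff)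
    have "divergence (\<lambda>x. \<eta> x *\<^sub>R e) x = 0" if "x \<in> W" for x
    proof -
      let ?U = "- closure {x. \<eta> x *\<^sub>R e \<noteq> 0}"
      have "x \<in> ?U" using h that by (auto simp: C1c_iff)
      moreover have "\<eta> y *\<^sub>R e = 0" if "y \<in> ?U" for y using that closure_subset[of "{x. \<eta> x *\<^sub>R e \<noteq> 0}"] by blast
      ultimately have "((\<lambda>x. \<eta> x *\<^sub>R e) has_derivative (\<lambda>_. 0)) (at x)"
        by (rule has_derivative_transform_within_open[OF has_derivative_const[of 0] open_Compl[OF closed_closure] _ sym])
      then show ?thesis unfolding divergence_def using frechet_derivative_at[symmetric] by fastforce
    qed
    then have "(LINT x:W|lebesgue. divergence (\<lambda>x. \<eta> x *\<^sub>R e) x) = 0"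
      unfolding set_lebesgue_integral_def by (intro integral_eq_zero_AE AE_I2) (auto simp: indicator_def)
    with ident[OF h'] show "0 \<le> (LINT x|M. \<eta> x * (n x \<bullet> e))" by (simp add: inner_commute)
  qed (use fin in auto)
  have "AE x in M. \<forall>e\<in>Basis \<union> uminus ` Basis. x \<in> - W \<longrightarrow> 0 \<le> n x \<bullet> e"
    by (subst AE_ball_countable) (use nn in \<open>auto intro: countable_finite\<close>)
  with n1 show ?thesis
  proof eventually_elim
    case (elim x)
    show ?case
    proof (rule ccontr)
      assume "x \<notin> W"
      have "n x \<bullet> i = 0" if i: "i \<in> Basis" for i
      proof -
        have "0 \<le> n x \<bullet> i" "0 \<le> n x \<bullet> - i"
          using bspec[OF elim(2), of i] bspec[OF elim(2), of "- i"] i \<open>x \<notin> W\<close> by simp_all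
        then show ?thesis by (simp add: inner_minus_right)
      qed
      then have "n x = 0" using euclidean_eqI[of "n x" 0] by simp
      then show False using elim(1) by simp
    qed
  qed
qed

text \<open>Fields \<open>\<eta> x *\<^sub>R (x - z)\<close> with \<open>\<eta> \<ge> 0\<close> have
  nonnegative divergence integral, which gives the sign for one \<open>z\<close>. A countable dense
  set of points \<open>z\<close> keeps the exceptional set null, and the inequality is closed in
  \<open>z\<close>.\<close>

lemma gauss_green_normal:
  fixes W :: "'a::euclidean_space set"
  assumes gg: "gauss_green W UNIV M n" and W: "convex W" "compact W"
  shows "AE x in M. \<forall>z\<in>W. 0 \<le> n x \<bullet> (x - z)"
proof -
  have sM: "sets M = sets borel" and fin: "\<And>K. compact K \<Longrightarrow> emeasure M K < \<infinity>"
    and nm: "n \<in> borel_measurable M" and n1: "AE x in M. norm (n x) = 1"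
    and ident: "\<And>h. h \<in> C1c UNIV \<Longrightarrow> (LINT x:W|lebesgue. divergence h x) = (LINT x|M. h x \<bullet> n x)"
    using gg unfolding gauss_green_def by auto
  have idm: "(\<lambda>x. x) \<in> borel_measurable M" using sM by (simp add: measurable_cong_sets[OF sM refl])
  have nn: "AE x in M. 0 \<le> n x \<bullet> (x - z)" if z: "z \<in> W" for z
  proof -
    have "AE x in M. x \<in> UNIV \<longrightarrow> 0 \<le> n x \<bullet> (x - z)"
    proof (rule nonneg_AE_if_test_integrals_nonneg[OF sM])
      show "(\<lambda>x. n x \<bullet> (x - z)) \<in> borel_measurable M" using nm idm by measurable
      show "\<exists>c. AE x in M. norm x \<le> R \<longrightarrow> \<bar>n x \<bullet> (x - z)\<bar> \<le> c" for R
      proof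
        show "AE x in M. norm x \<le> R \<longrightarrow> \<bar>n x \<bullet> (x - z)\<bar> \<le> R + norm z"
          using n1
        proof (eventually_elim, intro impI)
          fix x assume n: "norm (n x) = 1" and x: "norm x \<le> R"
          have "\<bar>n x \<bullet> (x - z)\<bar> \<le> norm (n x) * norm (x - z)" by (rule Cauchy_Schwarz_ineq2)
          also have "\<dots> \<le> norm x + norm z" unfolding n using norm_triangle_ineq4[of x z] by simp
          finally show "\<bar>n x \<bullet> (x - z)\<bar> \<le> R + norm z" using x by simp
        qed
      qed
      fix \<eta> :: "'a \<Rightarrow> real" assume \<eta>: "\<eta> \<in> C1c UNIV" "\<And>x. 0 \<le> \<eta> x"
      have \<eta>1: "C1 \<eta>" using \<eta>(1) by (simp add: C1c_iff)
      have h: "(\<lambda>x. \<eta> x *\<^sub>R (x - z)) \<in> C1c UNIV" by (intro C1c_scaleR \<eta> C1_diff C1_id C1_const)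
      have "0 \<le> (LINT x:W|lebesgue. divergence (\<lambda>x. \<eta> x *\<^sub>R (x - z)) x)"
        by (rule radial_divergence_nonneg[OF W z \<eta>1 \<eta>(2,1)])
      then show "0 \<le> (LINT x|M. \<eta> x * (n x \<bullet> (x - z)))" unfolding ident[OF h] by (simp add: inner_commute)
    qed (use fin in auto)
    then show ?thesis by simp
  qed
  obtain T where T: "countable T" "T \<subseteq> W" "W \<subseteq> closure T" using separable[of W] by blast
  have "AE x in M. \<forall>z\<in>T. 0 \<le> n x \<bullet> (x - z)"
    by (subst AE_ball_countable[OF T(1)]) (use nn T(2) in auto)
  then show ?thesis
  proof eventually_elim
    case (elim x)
    have "closed {z. 0 \<le> n x \<bullet> (x - z)}" by (intro closed_Collect_le continuous_intros)
    then have "closure T \<subseteq> {z. 0 \<le> n x \<bullet> (x - z)}" using elim by (intro closure_minimal) auto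
    then show ?case using T(3) by auto
  qed
qed

text \<open>Existence of one pair makes \<open>gg_pair\<close> a Gauss-Green pair, and the two
  preceding lemmas hold for all such pairs. Off \<open>W\<close> small balls would be null. For
  \<open>y\<close> in \<open>ball x r\<close> the two estimates
  \<open>n y \<bullet> (z - y) \<le> 0\<close> and \<open>norm (y - x) \<le> r\<close> bound the
  averaged normal by \<open>r\<close> in direction \<open>z - x\<close>; then \<open>r\<close> tends
  to \<open>0\<close>.\<close>

lemma reduced_boundary_normal:
  fixes W :: "'a::euclidean_space set"
  assumes ex: "gauss_green W UNIV M0 n0" and W: "convex W" "compact W" and x: "x \<in> reduced_boundary W UNIV"
  shows "x \<in> W" "norm (outer_normal W UNIV x) = 1" "\<And>z. z \<in> W \<Longrightarrow> outer_normal W UNIV x \<bullet> (z - x) \<le> 0"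
proof -
  obtain M n where Mn: "gg_pair W UNIV = (M, n)" by force
  have "case gg_pair W UNIV of (M, n) \<Rightarrow> gauss_green W UNIV M n"
    unfolding gg_pair_def by (rule someI[of _ "(M0, n0)"]) (use ex in simp)
  then have gg: "gauss_green W UNIV M n" by (simp add: Mn)
  have sM: "sets M = sets borel" and fin: "\<And>K. compact K \<Longrightarrow> emeasure M K < \<infinity>"
    and nm: "n \<in> borel_measurable M" and n1: "AE x in M. norm (n x) = 1"
    using gg unfolding gauss_green_def by auto
  have spM: "space M = UNIV" using sM by (metis sets_eq_imp_space_eq space_borel)
  obtain \<nu> where \<nu>: "norm \<nu> = 1" "(gg_average W UNIV x \<longlongrightarrow> \<nu>) (at_right 0)"
    and pos: "\<And>r. r > 0 \<Longrightarrow> emeasure M (ball x r) > 0"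
    using x unfolding reduced_boundary_def by (auto simp: Mn)
  have \<nu>eq: "outer_normal W UNIV x = \<nu>"
    unfolding outer_normal_def by (rule tendsto_Lim[OF _ \<nu>(2)]) simp
  show "norm (outer_normal W UNIV x) = 1" using \<nu> \<nu>eq by simp
  show xW: "x \<in> W"
  proof (rule ccontr)
    assume "x \<notin> W"
    moreover have "open (- W)" using W(2) by (simp add: compact_imp_closed open_Compl)
    ultimately obtain r where r: "r > 0" "ball x r \<subseteq> - W" by (meson ComplI open_contains_ball)
    have "AE y in M. y \<notin> ball x r"
      using gauss_green_AE_mem[OF gg compact_imp_closed[OF W(2)]] by eventually_elim (use r in auto)
    then have "emeasure M {y \<in> space M. y \<in> ball x r} = 0" by (intro emeasure_eq_0_AE)
    then show False using pos[OF r(1)] by (simp add: spM ball_def)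
  qed
  fix z assume z: "z \<in> W"
  have fb: "emeasure M (ball x r) < \<infinity>" for r
    by (rule le_less_trans[OF emeasure_mono[OF ball_subset_cball] fin[OF compact_cball]]) (auto simp: sM)
  have avg: "gg_average W UNIV x r \<bullet> (z - x) \<le> r" if r: "r > 0" for r
  proof -
    define m where "m = measure M (ball x r)"
    have m: "m > 0" using pos[OF r] fb[of r] by (simp add: m_def measure_def enn2real_positive_iff less_top)
    have bm: "ball x r \<in> sets M" by (simp add: sM)
    have ii: "integrable M (\<lambda>y. indicator (ball x r) y :: real)"
      using fb[of r] bm by (intro integrable_real_indicator)
    have ni: "integrable M (\<lambda>y. indicator (ball x r) y *\<^sub>R n y)"
    proof (rule Bochner_Integration.integrable_bound[OF ii])
      show "(\<lambda>y. indicator (ball x r) y *\<^sub>R n y) \<in> borel_measurable M"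
        by (intro borel_measurable_scaleR borel_measurable_indicator bm nm)
      show "AE y in M. norm (indicator (ball x r) y *\<^sub>R n y) \<le> norm (indicator (ball x r) y :: real)"
        using n1 by eventually_elim (simp add: indicator_def)
    qed
    have "(LINT y:ball x r|M. n y) \<bullet> (z - x) = (LINT y|M. (indicator (ball x r) y *\<^sub>R n y) \<bullet> (z - x))"
      unfolding set_lebesgue_integral_def by (rule integral_inner_left[OF ni, symmetric])
    also have "\<dots> \<le> (LINT y|M. r * indicator (ball x r) y)"
    proof (rule integral_mono_AE)
      show "integrable M (\<lambda>y. (indicator (ball x r) y *\<^sub>R n y) \<bullet> (z - x))" using ni by (rule integrable_inner_left)
      show "integrable M (\<lambda>y. r * indicator (ball x r) y)" using ii by simp
      show "AE y in M. (indicator (ball x r) y *\<^sub>R n y) \<bullet> (z - x) \<le> r * indicator (ball x r) y"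
        using gauss_green_normal[OF gg W] n1
      proof eventually_elim
        case (elim y)
        show ?case
        proof (cases "y \<in> ball x r")
          case True
          have "n y \<bullet> (z - x) = - (n y \<bullet> (y - z)) + n y \<bullet> (y - x)" by (simp add: inner_diff_right)
          also have "- (n y \<bullet> (y - z)) \<le> 0" using elim(1) z by simp
          also have "n y \<bullet> (y - x) \<le> norm (n y) * norm (y - x)" by (rule norm_cauchy_schwarz)
          also have "\<dots> \<le> r" using True elim(2) by (simp add: dist_norm norm_minus_commute)
          finally show ?thesis using True by simp
        qed simp
      qed
    qed
    also have "\<dots> = r * m" by (simp add: m_def spM)
    finally have "(LINT y:ball x r|M. n y) \<bullet> (z - x) \<le> r * m" .
    then have "((1 / m) *\<^sub>R (LINT y:ball x r|M. n y)) \<bullet> (z - x) \<le> r"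
      using m by (simp add: pos_divide_le_eq)
    then show ?thesis by (simp add: gg_average_def Mn m_def)
  qed
  have "\<nu> \<bullet> (z - x) \<le> 0"
  proof (rule tendsto_le[of "at_right 0" "\<lambda>r. r" 0 "\<lambda>r. gg_average W UNIV x r \<bullet> (z - x)"])
    show "((\<lambda>r. gg_average W UNIV x r \<bullet> (z - x)) \<longlongrightarrow> \<nu> \<bullet> (z - x)) (at_right 0)" by (intro tendsto_intros \<nu>)
    show "\<forall>\<^sub>F r in at_right 0. gg_average W UNIV x r \<bullet> (z - x) \<le> r"
      using eventually_at_right_less[of "0::real"] by eventually_elim (rule avg)
  qed auto
  then show "outer_normal W UNIV x \<bullet> (z - x) \<le> 0" by (simp add: \<nu>eq)
qed

section \<open>Existence of a Gauss-Green pair for the Wulff shape\<close>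

lemma dominating_measure:
  fixes A B :: "'a::topological_space measure"
  assumes A: "finite_measure A" "sets A = sets borel" and B: "finite_measure B" "sets B = sets borel"
  obtains C where "finite_measure C" "sets C = sets borel"
    "\<And>N. absolutely_continuous A N \<or> absolutely_continuous B N \<Longrightarrow> absolutely_continuous C N"
proof -
  define C where "C = measure_of UNIV (sets borel) (\<lambda>X. emeasure A X + emeasure B X)"
  have sC: "sets C = sets borel" unfolding C_def using sets.sets_measure_of_eq[of borel] by simp
  have eC: "emeasure C X = emeasure A X + emeasure B X" if X: "X \<in> sets borel" for X
  proof (rule emeasure_measure_of[OF C_def])
    show "countably_additive (sets C) (\<lambda>X. emeasure A X + emeasure B X)"
      unfolding sC countably_additive_def
    proof (intro allI impI)
      fix Y :: "nat \<Rightarrow> 'a set"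
      assume Y: "range Y \<subseteq> sets borel" "disjoint_family Y" "\<Union> (range Y) \<in> sets borel"
      have "(\<Sum>i. emeasure A (Y i)) = emeasure A (\<Union> (range Y))" "(\<Sum>i. emeasure B (Y i)) = emeasure B (\<Union> (range Y))"
        using Y A(2) B(2) by (auto intro!: suminf_emeasure)
      then show "(\<Sum>i. emeasure A (Y i) + emeasure B (Y i)) = emeasure A (\<Union> (range Y)) + emeasure B (\<Union> (range Y))"
        by (simp add: suminf_add[symmetric])
    qed
  qed (use X in \<open>auto simp: sC positive_def\<close>)
  have spA: "space A = UNIV" "space B = UNIV" "space C = UNIV"
    using A(2) B(2) sC by (metis sets_eq_imp_space_eq space_borel)+
  have "finite_measure C"
    by (rule finite_measureI)
       (use eC[of UNIV] finite_measure.emeasure_finite[OF A(1), of UNIV] finite_measure.emeasure_finite[OF B(1), of UNIV] in \<open>simp add: spA\<close>)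
  moreover have "absolutely_continuous C N" if N: "absolutely_continuous A N \<or> absolutely_continuous B N" for N
    unfolding absolutely_continuous_def
  proof
    fix X assume "X \<in> null_sets C"
    then have "X \<in> null_sets A" "X \<in> null_sets B" using eC[of X] by (auto simp: null_sets_def sC A(2) B(2))
    then show "X \<in> null_sets N" using N by (auto simp: absolutely_continuous_def)
  qed
  ultimately show ?thesis using that sC by blast
qed

lemma real_density_exists:
  assumes C: "finite_measure C" and N: "finite_measure N" "absolutely_continuous C N" "sets N = sets C"
  obtains r :: "_ \<Rightarrow> real" where "r \<in> borel_measurable C" "\<And>x. 0 \<le> r x" "N = density C (\<lambda>x. ennreal (r x))" "integrable C r"
proof -
  interpret C: finite_measure C by fact
  interpret N: finite_measure N by fact
  define r where "r x = enn2real (RN_deriv C N x)" for x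
  have rm: "r \<in> borel_measurable C" unfolding r_def by measurable
  have "AE x in C. RN_deriv C N x \<noteq> \<infinity>"
    by (rule C.RN_deriv_finite[OF N.sigma_finite_measure_axioms N(2,3)])
  then have ae: "AE x in C. RN_deriv C N x = ennreal (r x)"
    by eventually_elim (simp add: r_def less_top)
  have "N = density C (RN_deriv C N)" using C.density_RN_deriv[OF N(2,3)] by simp
  also have "\<dots> = density C (\<lambda>x. ennreal (r x))" by (rule density_cong[OF _ _ ae]) (use rm in auto)
  finally have Nd: "N = density C (\<lambda>x. ennreal (r x))" .
  have "(\<integral>\<^sup>+x. ennreal (r x) \<partial>C) = emeasure N (space C)"
    unfolding Nd using rm by (simp add: emeasure_density)
  then have "(\<integral>\<^sup>+x. ennreal (r x) \<partial>C) < \<infinity>" using N.emeasure_finite by (simp add: less_top[symmetric])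
  then have "integrable C r" by (intro integrableI_nonneg rm) (auto simp: r_def)
  moreover have "0 \<le> r x" for x by (simp add: r_def)
  ultimately show ?thesis using that[OF rm _ Nd] by blast
qed

lemma C1c_bounded:
  fixes h :: "'a::real_normed_vector \<Rightarrow> 'b::real_normed_vector"
  assumes "h \<in> C1c \<Omega>"
  shows "\<exists>B. \<forall>x. norm (h x) \<le> B"
proof -
  let ?K = "closure {x. h x \<noteq> 0}"
  have "C1 h" and K: "compact ?K" using assms by (auto simp: C1c_iff)
  then obtain B where B: "\<And>x. x \<in> ?K \<Longrightarrow> norm (h x) \<le> B"
    using compact_imp_bounded[OF compact_continuous_image[OF C1_continuous K]] unfolding bounded_iff by (metis image_eqI)
  have "norm (h x) \<le> max B 0" for x
    using B[of x] closure_subset[of "{x. h x \<noteq> 0}"] by (cases "h x = 0") (auto simp: le_max_iff_disj)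
  then show ?thesis by blast
qed

text \<open>The polar decomposition of a vector measure. All four measures have densities with
  respect to one finite measure \<open>C\<close>; if \<open>v\<close> is the resulting vector
  density, then \<open>M\<close> has density \<open>norm (v x)\<close> and \<open>n\<close> is the
  direction of \<open>v\<close>.\<close>

lemma gauss_green_from_coordinate_measures:
  fixes W :: "plane set" and N1 N2 N3 N4 :: "plane measure"
  assumes N: "finite_measure N1" "finite_measure N2" "finite_measure N3" "finite_measure N4"
    "sets N1 = sets borel" "sets N2 = sets borel" "sets N3 = sets borel" "sets N4 = sets borel"
    and id: "\<And>h. h \<in> C1c UNIV \<Longrightarrow> (LINT z:W|lebesgue. divergence h z) =
      (LINT z|N1. fst (h z)) - (LINT z|N2. fst (h z)) + (LINT z|N3. snd (h z)) - (LINT z|N4. snd (h z))"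
  shows "\<exists>M n. gauss_green W UNIV M n"
proof -
  obtain C1' where C1': "finite_measure C1'" "sets C1' = sets borel"
    "\<And>N. absolutely_continuous N1 N \<or> absolutely_continuous N2 N \<Longrightarrow> absolutely_continuous C1' N"
    using dominating_measure[OF N(1,5) N(2,6)] by blast
  obtain C2' where C2': "finite_measure C2'" "sets C2' = sets borel"
    "\<And>N. absolutely_continuous N3 N \<or> absolutely_continuous N4 N \<Longrightarrow> absolutely_continuous C2' N"
    using dominating_measure[OF N(3,7) N(4,8)] by blast
  obtain C where C: "finite_measure C" and sC: "sets C = sets borel" and ac: "\<And>N. absolutely_continuous C1' N \<or> absolutely_continuous C2' N \<Longrightarrow> absolutely_continuous C N"
    using dominating_measure[OF C1'(1,2) C2'(1,2)] by blast
  interpret C: finite_measure C by fact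
  have ac_refl: "absolutely_continuous M M" for M :: "plane measure" by (simp add: absolutely_continuous_def)
  have acN: "absolutely_continuous C N1" "absolutely_continuous C N2" "absolutely_continuous C N3" "absolutely_continuous C N4"
    using ac C1'(3) C2'(3) ac_refl by blast+
  obtain r1 where r1: "r1 \<in> borel_measurable C" "\<And>x. 0 \<le> r1 x" "N1 = density C (\<lambda>x. ennreal (r1 x))" "integrable C r1"
    using real_density_exists[OF C N(1) acN(1)] N(5) sC by metis
  obtain r2 where r2: "r2 \<in> borel_measurable C" "\<And>x. 0 \<le> r2 x" "N2 = density C (\<lambda>x. ennreal (r2 x))" "integrable C r2"
    using real_density_exists[OF C N(2) acN(2)] N(6) sC by metis
  obtain r3 where r3: "r3 \<in> borel_measurable C" "\<And>x. 0 \<le> r3 x" "N3 = density C (\<lambda>x. ennreal (r3 x))" "integrable C r3"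
    using real_density_exists[OF C N(3) acN(3)] N(7) sC by metis
  obtain r4 where r4: "r4 \<in> borel_measurable C" "\<And>x. 0 \<le> r4 x" "N4 = density C (\<lambda>x. ennreal (r4 x))" "integrable C r4"
    using real_density_exists[OF C N(4) acN(4)] N(8) sC by metis
  note [measurable] = r1(1) r2(1) r3(1) r4(1)
  define v where "v x = (r1 x - r2 x, r3 x - r4 x)" for x
  have vm [measurable]: "v \<in> borel_measurable C" unfolding v_def by measurable
  have vi: "integrable C v"
  proof (rule Bochner_Integration.integrable_bound)
    show "integrable C (\<lambda>x. \<bar>r1 x - r2 x\<bar> + \<bar>r3 x - r4 x\<bar>)" using r1(4) r2(4) r3(4) r4(4) by auto
    show "AE x in C. norm (v x) \<le> norm (\<bar>r1 x - r2 x\<bar> + \<bar>r3 x - r4 x\<bar>)"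
      unfolding v_def by (intro AE_I2 order_trans[OF norm_Pair_le]) auto
  qed measurable
  \<comment> \<open>Where \<open>v\<close> vanishes this is \<open>0\<close> and not a unit vector,
    but that set is null for \<open>M\<close>.\<close>
  define n where "n x = v x /\<^sub>R norm (v x)" for x
  have nm [measurable]: "n \<in> borel_measurable C" unfolding n_def by measurable
  define M where "M = density C (\<lambda>x. ennreal (norm (v x)))"
  have sM: "sets M = sets borel" by (simp add: M_def sC)
  have fM: "emeasure M X < \<infinity>" for X
  proof -
    have "emeasure M X \<le> emeasure M (space M)" by (rule emeasure_space)
    also have "\<dots> = (\<integral>\<^sup>+x. ennreal (norm (v x)) \<partial>C)" by (simp add: M_def emeasure_density)
    also have "\<dots> < \<infinity>" using vi unfolding integrable_iff_bounded by simp
    finally show ?thesis .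
  qed
  have "gauss_green W UNIV M n"
    unfolding gauss_green_def
  proof (intro conjI ballI allI impI sM fM)
    show "emeasure M (- UNIV) = 0" by simp
    show "n \<in> borel_measurable M" using nm by (simp add: M_def)
    have "AE x in C. 0 < ennreal (norm (v x)) \<longrightarrow> norm (n x) = 1" by (rule AE_I2) (simp add: n_def)
    then show "AE x in M. norm (n x) = 1" unfolding M_def by (subst AE_density) auto
    fix h :: "plane \<Rightarrow> plane" assume h: "h \<in> C1c UNIV"
    obtain B where B: "\<And>x. norm (h x) \<le> B" using C1c_bounded[OF h] by blast
    have hc: "continuous_on UNIV h" using h by (auto simp: C1c_iff intro: C1_continuous)
    have hm [measurable]: "h \<in> borel_measurable C"
      using borel_measurable_continuous_onI[OF hc] by (simp add: measurable_cong_sets[OF sC refl])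
    have [measurable]: "(\<lambda>x. fst (h x)) \<in> borel_measurable C" "(\<lambda>x. snd (h x)) \<in> borel_measurable C"
      unfolding measurable_cong_sets[OF sC refl] by (auto intro!: borel_measurable_continuous_onI continuous_intros hc)
    have B': "\<bar>fst (h x)\<bar> \<le> B" "\<bar>snd (h x)\<bar> \<le> B" for x
      using B[of x] norm_fst_le[of "fst (h x)" "snd (h x)"] norm_snd_le[of "snd (h x)" "fst (h x)"] by auto
    have ib: "integrable C (\<lambda>x. r x * fst (h x))" "integrable C (\<lambda>x. r x * snd (h x))" if "integrable C r" for r :: "plane \<Rightarrow> real"
    proof -
      have [measurable]: "r \<in> borel_measurable C" using that by auto
      have b: "norm (r x * fst (h x)) \<le> norm (B * r x)" "norm (r x * snd (h x)) \<le> norm (B * r x)" for x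
        using mult_left_mono[OF B'(1)[of x], of "\<bar>r x\<bar>"] mult_left_mono[OF B'(2)[of x], of "\<bar>r x\<bar>"] order_trans[OF norm_ge_zero B[of x]]
        by (simp_all add: abs_mult mult.commute[of B])
      show "integrable C (\<lambda>x. r x * fst (h x))" "integrable C (\<lambda>x. r x * snd (h x))"
        by (rule Bochner_Integration.integrable_bound[of C "\<lambda>x. B * r x"]; use that b in simp)+
    qed
    have hc': "(LINT z|N1. fst (h z)) = (LINT z|C. r1 z * fst (h z))" "(LINT z|N2. fst (h z)) = (LINT z|C. r2 z * fst (h z))"
      "(LINT z|N3. snd (h z)) = (LINT z|C. r3 z * snd (h z))" "(LINT z|N4. snd (h z)) = (LINT z|C. r4 z * snd (h z))"
      unfolding r1(3) r2(3) r3(3) r4(3) using r1(2) r2(2) r3(2) r4(2)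
      by (subst integral_density; simp)+
    have "(LINT z:W|lebesgue. divergence h z) =
      (LINT z|C. (r1 z * fst (h z) - r2 z * fst (h z)) + (r3 z * snd (h z) - r4 z * snd (h z)))"
      unfolding id[OF h] hc' using ib r1(4) r2(4) r3(4) r4(4) by simp
    also have "\<dots> = (LINT z|C. norm (v z) *\<^sub>R (h z \<bullet> n z))"
    proof (rule Bochner_Integration.integral_cong[OF refl])
      fix z
      have "norm (v z) *\<^sub>R (h z \<bullet> n z) = h z \<bullet> v z" by (cases "v z = 0") (simp_all add: n_def)
      also have "\<dots> = (r1 z * fst (h z) - r2 z * fst (h z)) + (r3 z * snd (h z) - r4 z * snd (h z))"
        by (simp add: v_def inner_prod_def algebra_simps)
      finally show "(r1 z * fst (h z) - r2 z * fst (h z)) + (r3 z * snd (h z) - r4 z * snd (h z)) = norm (v z) *\<^sub>R (h z \<bullet> n z)" by simp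
    qed
    also have "\<dots> = (LINT z|M. h z \<bullet> n z)" unfolding M_def by (subst integral_density) auto
    finally show "(LINT z:W|lebesgue. divergence h z) = (LINT z|M. h z \<bullet> n z)" .
  qed
  then show ?thesis by blast
qed

lemma finite_graph_measure:
  fixes F :: "real \<Rightarrow> 'a::topological_space"
  assumes "F \<in> borel_measurable borel"
  shows "finite_measure (distr (density lborel (indicator {-m<..<m})) borel F)"
proof (rule finite_measureI)
  have "emeasure (distr (density lborel (indicator {-m<..<m})) borel F) (space (distr (density lborel (indicator {-m<..<m})) borel F)) = emeasure lborel {-m<..<m}"
    using assms by (simp add: emeasure_distr emeasure_density)
  also have "\<dots> \<noteq> \<infinity>" by (cases "-m \<le> m") (simp_all add: less_top[symmetric])
  finally show "emeasure (distr (density lborel (indicator {-m<..<m})) borel F) (space (distr (density lborel (indicator {-m<..<m})) borel F)) \<noteq> \<infinity>" .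
qed

lemma integral_graph_measure:
  fixes F :: "real \<Rightarrow> 'a::topological_space" and g :: "'a \<Rightarrow> real"
  assumes [measurable]: "F \<in> borel_measurable borel" "g \<in> borel_measurable borel"
  shows "(LINT z|distr (density lborel (indicator {-m<..<m})) borel F. g z) = (LINT t|lborel. indicator {-m<..<m} t * g (F t))"
proof -
  have "(LINT z|distr (density lborel (indicator {-m<..<m})) borel F. g z) = (LINT t|density lborel (indicator {-m<..<m}). g (F t))"
    by (rule integral_distr) auto
  also have "\<dots> = (LINT t|density lborel (\<lambda>t. ennreal (indicator {-m<..<m} t)). g (F t))"
    by (simp add: ennreal_indicator)
  also have "\<dots> = (LINT t|lborel. indicator {-m<..<m} t * g (F t))"
    by (subst integral_density) auto
  finally show ?thesis .
qed

context monotone_anisotropy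
begin

text \<open>Allows the statements about the vertical direction to be used for the horizontal
  one.\<close>

lemma swap: "monotone_anisotropy (\<lambda>z. \<phi> (prod.swap z))"
proof
  have "convex_on UNIV (\<lambda>z. \<phi> (prod.swap z))"
  proof (rule convex_onI)
    fix t :: real and x y :: plane assume t: "0 < t" "t < 1"
    have "\<phi> ((1 - t) *\<^sub>R prod.swap x + t *\<^sub>R prod.swap y) \<le> (1 - t) * \<phi> (prod.swap x) + t * \<phi> (prod.swap y)"
      using phi_triangle[of "(1 - t) *\<^sub>R prod.swap x" "t *\<^sub>R prod.swap y"] t by (simp add: phi_scale)
    then show "\<phi> (prod.swap ((1 - t) *\<^sub>R x + t *\<^sub>R y)) \<le> (1 - t) * \<phi> (prod.swap x) + t * \<phi> (prod.swap y)"
      by (simp add: prod.swap_def)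
  qed simp
  note cv = this
  have ns: "norm (prod.swap x) = norm x" for x :: plane by (cases x) (simp add: norm_Pair add.commute)
  have sc: "\<phi> (prod.swap (t *\<^sub>R x)) = \<bar>t\<bar> * \<phi> (prod.swap x)" for t x
    using phi_scale[of t "prod.swap x"] by (simp add: prod.swap_def)
  obtain c where c: "0 < c" "c \<le> 1" "\<And>x. norm x = 1 \<Longrightarrow> c \<le> \<phi> x \<and> \<phi> x \<le> 1 / c"
    using aniso unfolding anisotropy_def by blast
  show "anisotropy (\<lambda>z. \<phi> (prod.swap z))"
    unfolding anisotropy_def
  proof (intro conjI allI impI exI[of _ c])
    show "\<phi> (prod.swap (- x)) = \<phi> (prod.swap x)" for x using sc[of "-1" x] by simp
    show "\<phi> (prod.swap (t *\<^sub>R x)) = t * \<phi> (prod.swap x)" if "0 < t" for t x using sc[of t x] that by simp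
    show "c \<le> \<phi> (prod.swap x)" "\<phi> (prod.swap x) \<le> 1 / c" if "norm x = 1" for x using c(3)[of "prod.swap x"] that ns by auto
  qed (use cv c phi_nonneg in auto)
  show "partially_monotone (\<lambda>z. \<phi> (prod.swap z))"
    unfolding partially_monotone_def by (auto intro: phi_mono)
qed

text \<open>Extension by zero, since the values of \<open>prof\<close> outside the interval are
  unspecified; this makes the profile a Borel function on the line.\<close>

definition gprof :: "real \<Rightarrow> real" where
  "gprof x = (if x \<in> {-1/pa<..<1/pa} then prof x else 0)"

lemma gprof_measurable [measurable]: "gprof \<in> borel_measurable borel"
proof -
  have "(\<lambda>x. indicator {-1/pa<..<1/pa} x *\<^sub>R prof x) \<in> borel_measurable borel"
    by (rule borel_measurable_continuous_on_indicator[OF _ prof_continuous]) simp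
  moreover have "gprof = (\<lambda>x. indicator {-1/pa<..<1/pa} x *\<^sub>R prof x)" by (auto simp: gprof_def)
  ultimately show ?thesis by simp
qed

lemma wulff_measurable [measurable]: "wulff \<phi> \<in> sets borel"
  using wulff_closed by simp

text \<open>Fubini and the fundamental theorem of calculus on each vertical section
  \<open>{- prof x..prof x}\<close>. The two lines over \<open>x = 1 / pa\<close> and
  \<open>x = - (1 / pa)\<close> form a null set.\<close>

lemma vertical_divergence:
  assumes d: "\<And>x y. ((\<lambda>y. g (x, y)) has_real_derivative d (x, y)) (at y)" and dc: "continuous_on UNIV d"
  shows "(LINT z|lborel. indicator (wulff \<phi>) z * d z) =
    (LINT x|lborel. indicator {-(1/pa)<..<1/pa} x * (g (x, gprof x) - g (x, - gprof x)))"
proof -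
  have [measurable]: "d \<in> borel_measurable borel" by (intro borel_measurable_continuous_onI dc)
  have i: "integrable lborel (\<lambda>z. indicator (wulff \<phi>) z * d z)"
    using borel_integrable_compact[OF wulff_compact continuous_on_subset[OF dc]] by simp
  then have i': "integrable (lborel \<Otimes>\<^sub>M lborel) (\<lambda>z. indicator (wulff \<phi>) z * d z)" by (simp add: lborel_prod)
  have "(LINT z|lborel. indicator (wulff \<phi>) z * d z) = (LINT z|(lborel \<Otimes>\<^sub>M lborel). indicator (wulff \<phi>) z * d z)" by (simp add: lborel_prod)
  also have "\<dots> = (LINT x|lborel. LINT y|lborel. indicator (wulff \<phi>) (x, y) * d (x, y))"
    by (rule lborel_pair.integral_fst'[OF i', symmetric])
  also have "\<dots> = (LINT x|lborel. indicator {-(1/pa)<..<1/pa} x * (g (x, gprof x) - g (x, - gprof x)))"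
  proof (rule integral_cong_AE)
    show "(\<lambda>x. LINT y|lborel. indicator (wulff \<phi>) (x, y) * d (x, y)) \<in> borel_measurable lborel"
      using lborel_pair.integrable_fst'[OF i'] by auto
    have inner: "(LINT y|lborel. indicator (wulff \<phi>) (x, y) * d (x, y)) = indicator {-(1/pa)<..<1/pa} x * (g (x, gprof x) - g (x, - gprof x))"
      if "x \<noteq> 1 / pa" "x \<noteq> - (1 / pa)" for x
    proof (cases "\<bar>x\<bar> < 1 / pa")
      case True
      then have x: "x \<in> {-(1/pa)<..<1/pa}" "gprof x = prof x" by (auto simp: gprof_def abs_less_iff)
      have "(LINT y|lborel. indicator (wulff \<phi>) (x, y) * d (x, y)) = (LINT y|lborel. indicator {- prof x..prof x} y *\<^sub>R d (x, y))"
        using True by (intro Bochner_Integration.integral_cong) (auto simp: indicator_def wulff_prof)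
      also have "\<dots> = g (x, prof x) - g (x, - prof x)"
      proof (rule integral_FTC_atLeastAtMost)
        show "- prof x \<le> prof x" using prof_props(2)[of x] True by simp
        show "continuous_on {- prof x..prof x} (\<lambda>y. d (x, y))"
          by (rule continuous_on_compose2[OF dc]) (auto intro!: continuous_intros)
        show "((\<lambda>y. g (x, y)) has_vector_derivative d (x, y)) (at y within {- prof x..prof x})" for y
          using d[of x y] by (simp add: has_real_derivative_iff_has_vector_derivative has_vector_derivative_at_within)
      qed
      finally show ?thesis using x by simp
    next
      case False
      then have "indicator (wulff \<phi>) (x, y) = (0::real)" for y using that wulff_bounds(1)[of x y] by (auto simp: indicator_def abs_if split: if_splits)
      moreover have "x \<notin> {-(1/pa)<..<1/pa}" using False by auto
      ultimately show ?thesis by simp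
    qed
    have "AE x in lborel. x \<noteq> 1 / pa" "AE x in lborel. x \<noteq> - (1 / pa)" by (rule AE_lborel_singleton)+
    then show ae: "AE x in lborel. (LINT y|lborel. indicator (wulff \<phi>) (x, y) * d (x, y)) = indicator {-(1/pa)<..<1/pa} x * (g (x, gprof x) - g (x, - gprof x))"
      by eventually_elim (rule inner)
    show "(\<lambda>x. indicator {-(1/pa)<..<1/pa} x * (g (x, gprof x) - g (x, - gprof x))) \<in> borel_measurable lborel"
    proof -
      have "(\<lambda>x. indicator {-(1/pa)<..<1/pa} x * (g (x, gprof x) - g (x, - gprof x))) =
        (\<lambda>x. if x = 1 / pa \<or> x = - (1 / pa) then 0 else (LINT y|lborel. indicator (wulff \<phi>) (x, y) * d (x, y)))"
        using inner by (auto simp: fun_eq_iff)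
      moreover have "(\<lambda>x. LINT y|lborel. indicator (wulff \<phi>) (x, y) * d (x, y)) \<in> borel_measurable lborel"
        using lborel_pair.integrable_fst'[OF i'] by auto
      ultimately show ?thesis by simp
    qed
  qed
  finally show ?thesis .
qed

text \<open>The vertical part of the divergence is carried by the upper and lower graphs, the
  horizontal part by the right and left graphs of the swapped shape. Lebesgue measure on the base,
  pushed to the graph, already is the corresponding component of the boundary measure, so no slope
  of the graph appears.\<close>

lemma gauss_green_wulff: "\<exists>M n. gauss_green (wulff \<phi>) UNIV M n"
proof -
  interpret sw: monotone_anisotropy "\<lambda>z. \<phi> (prod.swap z)" by (rule swap)
  let ?G = "\<lambda>m F. distr (density lborel (indicator {-m<..<m})) borel (F :: real \<Rightarrow> plane)"
  have gm [measurable]: "gprof \<in> borel_measurable borel" "sw.gprof \<in> borel_measurable borel" by (rule gprof_measurable sw.gprof_measurable)+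
  show ?thesis
  proof (rule gauss_green_from_coordinate_measures)
    show "finite_measure (?G (1/sw.pa) (\<lambda>y. (sw.gprof y, y)))" "finite_measure (?G (1/sw.pa) (\<lambda>y. (- sw.gprof y, y)))"
      "finite_measure (?G (1/pa) (\<lambda>x. (x, gprof x)))" "finite_measure (?G (1/pa) (\<lambda>x. (x, - gprof x)))"
      by (rule finite_graph_measure, measurable)+
    fix h :: "plane \<Rightarrow> plane" assume h: "h \<in> C1c UNIV"
    obtain D where D: "\<And>x. (h has_derivative blinfun_apply (D x)) (at x)" "continuous_on UNIV D"
      using h unfolding C1c_def by blast
    obtain B where B: "\<And>x. norm (h x) \<le> B" using C1c_bounded[OF h] by blast
    have hc: "continuous_on UNIV h" using h by (auto simp: C1c_iff intro: C1_continuous)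
    have hm [measurable]: "(\<lambda>z. fst (h z)) \<in> borel_measurable borel" "(\<lambda>z. snd (h z)) \<in> borel_measurable borel"
      by (auto intro!: borel_measurable_continuous_onI continuous_intros hc)
    define d1 d2 where "d1 z = fst (blinfun_apply (D z) (1, 0))" and "d2 z = snd (blinfun_apply (D z) (0, 1))" for z
    have dc: "continuous_on UNIV d1" "continuous_on UNIV d2" unfolding d1_def d2_def by (intro continuous_intros D)+
    have div: "divergence h z = d1 z + d2 z" for z
    proof -
      have B: "(Basis :: plane set) = {(1, 0), (0, 1)}" by (auto simp: Basis_prod_def)
      show ?thesis unfolding divergence_def B d1_def d2_def frechet_derivative_at[OF D(1), symmetric] by (simp add: inner_prod_def)
    qed
    have D2: "((\<lambda>y. snd (h (x, y))) has_real_derivative d2 (x, y)) (at y)" for x y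
    proof -
      have "((\<lambda>y. (x, y)) has_derivative (\<lambda>t. (0, t))) (at y)" by (auto intro!: derivative_eq_intros)
      from diff_chain_at[OF this D(1)[of "(x, y)"]]
      have "((\<lambda>y. h (x, y)) has_derivative (\<lambda>t. blinfun_apply (D (x, y)) (0, t))) (at y)" by (simp add: o_def)
      from has_derivative_snd[OF this]
      have "((\<lambda>y. snd (h (x, y))) has_derivative (\<lambda>t. snd (blinfun_apply (D (x, y)) (0, t)))) (at y)" .
      moreover have "(\<lambda>t. snd (blinfun_apply (D (x, y)) (0, t))) = (*) (d2 (x, y))"
      proof
        fix t show "snd (blinfun_apply (D (x, y)) (0, t)) = d2 (x, y) * t"
          using blinfun.scaleR_right[of "D (x, y)" t "(0, 1)"] by (simp add: d2_def mult.commute)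
      qed
      ultimately show ?thesis by (simp only: has_field_derivative_def)
    qed
    have D1: "((\<lambda>y. fst (h (prod.swap (x, y)))) has_real_derivative d1 (prod.swap (x, y))) (at y)" for x y
    proof -
      have "((\<lambda>y. (y, x)) has_derivative (\<lambda>t. (t, 0))) (at y)" by (auto intro!: derivative_eq_intros)
      from diff_chain_at[OF this D(1)[of "(y, x)"]]
      have "((\<lambda>y. h (y, x)) has_derivative (\<lambda>t. blinfun_apply (D (y, x)) (t, 0))) (at y)" by (simp add: o_def)
      from has_derivative_fst[OF this]
      have "((\<lambda>y. fst (h (y, x))) has_derivative (\<lambda>t. fst (blinfun_apply (D (y, x)) (t, 0)))) (at y)" .
      moreover have "(\<lambda>t. fst (blinfun_apply (D (y, x)) (t, 0))) = (*) (d1 (y, x))"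
      proof
        fix t show "fst (blinfun_apply (D (y, x)) (t, 0)) = d1 (y, x) * t"
          using blinfun.scaleR_right[of "D (y, x)" t "(1, 0)"] by (simp add: d1_def mult.commute)
      qed
      ultimately show ?thesis by (simp only: has_field_derivative_def swap_simp)
    qed
    have v: "(LINT z|lborel. indicator (wulff \<phi>) z * d2 z) =
      (LINT x|lborel. indicator {-(1/pa)<..<1/pa} x * (snd (h (x, gprof x)) - snd (h (x, - gprof x))))"
      using vertical_divergence[where g="\<lambda>z. snd (h z)", OF D2 dc(2)] .
    have i: "integrable lborel (\<lambda>z. indicator (wulff \<phi>) z * d1 z)" "integrable lborel (\<lambda>z. indicator (wulff \<phi>) z * d2 z)"
      using borel_integrable_compact[OF wulff_compact continuous_on_subset[OF dc(1)]]
        borel_integrable_compact[OF wulff_compact continuous_on_subset[OF dc(2)]] by simp_all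
    have "(LINT z|lborel. indicator (wulff \<phi>) z * d1 z) = (LINT z|(lborel \<Otimes>\<^sub>M lborel). indicator (wulff \<phi>) z * d1 z)" by (simp add: lborel_prod)
    also have "\<dots> = (LINT z|(lborel \<Otimes>\<^sub>M lborel). indicator (wulff \<phi>) (prod.swap z) * d1 (prod.swap z))"
      using lborel_pair.integral_product_swap[of "\<lambda>z. indicator (wulff \<phi>) z * d1 z"] i(1)
      by (simp add: lborel_prod case_prod_unfold prod.swap_def)
    also have "\<dots> = (LINT z|lborel. indicator (wulff (\<lambda>z. \<phi> (prod.swap z))) z * d1 (prod.swap z))"
      by (simp add: lborel_prod wulff_def indicator_def)
    also have "\<dots> = (LINT x|lborel. indicator {-(1/sw.pa)<..<1/sw.pa} x * (fst (h (prod.swap (x, sw.gprof x))) - fst (h (prod.swap (x, - sw.gprof x)))))"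
    proof (rule sw.vertical_divergence[where g="\<lambda>z. fst (h (prod.swap z))", OF D1])
      show "continuous_on UNIV (\<lambda>z. d1 (prod.swap z))"
        unfolding prod.swap_def by (rule continuous_on_compose2[OF dc(1)]) (auto intro!: continuous_intros)
    qed
    finally have hz: "(LINT z|lborel. indicator (wulff \<phi>) z * d1 z) =
      (LINT x|lborel. indicator {-(1/sw.pa)<..<1/sw.pa} x * (fst (h (sw.gprof x, x)) - fst (h (- sw.gprof x, x))))" by simp
    have bi: "integrable lborel (\<lambda>x. indicator {-m<..<m} x * q x)" if "q \<in> borel_measurable borel" "\<And>x. \<bar>q x\<bar> \<le> B" for q :: "real \<Rightarrow> real" and m
    proof (rule Bochner_Integration.integrable_bound)
      have "emeasure lborel {-m<..<m} < \<infinity>" by (cases "-m \<le> m") (simp_all add: less_top[symmetric])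
      then show "integrable lborel (\<lambda>x. B * indicator {-m<..<m} x)"
        by (intro integrable_mult_right integrable_real_indicator) (auto simp: less_top[symmetric])
      show "AE x in lborel. norm (indicator {-m<..<m} x * q x) \<le> norm (B * indicator {-m<..<m} x)"
        using that(2) by (intro AE_I2) (auto simp: indicator_def intro: order_trans[OF that(2) abs_ge_self])
    qed (use that(1) in measurable)
    have B': "\<bar>fst (h x)\<bar> \<le> B" "\<bar>snd (h x)\<bar> \<le> B" for x
      using B[of x] norm_fst_le[of "fst (h x)" "snd (h x)"] norm_snd_le[of "snd (h x)" "fst (h x)"] by auto
    have m4: "(\<lambda>x. fst (h (sw.gprof x, x))) \<in> borel_measurable borel" "(\<lambda>x. fst (h (- sw.gprof x, x))) \<in> borel_measurable borel"
      "(\<lambda>x. snd (h (x, gprof x))) \<in> borel_measurable borel" "(\<lambda>x. snd (h (x, - gprof x))) \<in> borel_measurable borel"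
      by (rule measurable_compose[OF _ hm(1)] measurable_compose[OF _ hm(2)], measurable)+
    have [measurable]: "(\<lambda>z. divergence h z) \<in> borel_measurable borel"
      unfolding div using dc by (intro borel_measurable_add borel_measurable_continuous_onI)
    have "(LINT z:wulff \<phi>|lebesgue. divergence h z) = (LINT z|lborel. indicator (wulff \<phi>) z *\<^sub>R divergence h z)"
      unfolding set_lebesgue_integral_def by (intro integral_completion) measurable
    also have "\<dots> = (LINT z|lborel. indicator (wulff \<phi>) z * d1 z + indicator (wulff \<phi>) z * d2 z)"
      by (simp add: div distrib_left)
    also have "\<dots> = (LINT z|lborel. indicator (wulff \<phi>) z * d1 z) + (LINT z|lborel. indicator (wulff \<phi>) z * d2 z)"
      using i by simp
    also have "(LINT z|lborel. indicator (wulff \<phi>) z * d1 z) = (LINT z|?G (1/sw.pa) (\<lambda>y. (sw.gprof y, y)). fst (h z)) - (LINT z|?G (1/sw.pa) (\<lambda>y. (- sw.gprof y, y)). fst (h z))"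
      unfolding hz right_diff_distrib
      by (subst integral_graph_measure, measurable, subst integral_graph_measure, measurable)
         (rule Bochner_Integration.integral_diff; intro bi m4 B')
    also have "(LINT z|lborel. indicator (wulff \<phi>) z * d2 z) = (LINT z|?G (1/pa) (\<lambda>x. (x, gprof x)). snd (h z)) - (LINT z|?G (1/pa) (\<lambda>x. (x, - gprof x)). snd (h z))"
      unfolding v right_diff_distrib
      by (subst integral_graph_measure, measurable, subst integral_graph_measure, measurable)
         (rule Bochner_Integration.integral_diff; intro bi m4 B')
    finally show "(LINT z:wulff \<phi>|lebesgue. divergence h z) =
      (LINT z|?G (1/sw.pa) (\<lambda>y. (sw.gprof y, y)). fst (h z)) - (LINT z|?G (1/sw.pa) (\<lambda>y. (- sw.gprof y, y)). fst (h z))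
      + (LINT z|?G (1/pa) (\<lambda>x. (x, gprof x)). snd (h z)) - (LINT z|?G (1/pa) (\<lambda>x. (x, - gprof x)). snd (h z))" by simp
  qed auto
qed

end

section \<open>Upper bounds for one-dimensional Hausdorff measure\<close>

lemma sets_hausdorff1 [simp]: "sets hausdorff1 = sets borel"
  unfolding hausdorff1_def using sets.sets_measure_of_eq[of borel] by simp

text \<open>No Caratheodory construction is needed here: should \<open>hausdorff1_outer\<close> fail to be countably
  additive, \<open>measure_of\<close> would return the zero measure.\<close>

lemma emeasure_hausdorff1_le: "emeasure hausdorff1 A \<le> hausdorff1_outer A"
  unfolding hausdorff1_def by (simp add: emeasure_measure_of_conv)

lemma hausdorff1_outer_le:
  fixes A :: "'a::metric_space set"
  assumes "\<And>\<delta>. \<delta> > 0 \<Longrightarrow> \<exists>(N::nat) S. A \<subseteq> (\<Union>j<N. S j) \<and> (\<forall>j<N. bounded (S j) \<and> diameter (S j) \<le> \<delta>) \<and>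
    (\<Sum>j<N. diameter (S j)) \<le> L"
  shows "hausdorff1_outer A \<le> ennreal L"
  unfolding hausdorff1_outer_def
proof (rule SUP_least)
  fix \<delta> :: real assume "\<delta> \<in> {0<..}"
  then have \<delta>: "\<delta> > 0" by simp
  then obtain N :: nat and S where S: "A \<subseteq> (\<Union>j<N. S j)" "\<And>j. j < N \<Longrightarrow> bounded (S j) \<and> diameter (S j) \<le> \<delta>"
    "(\<Sum>j<N. diameter (S j)) \<le> L" using assms by meson
  define C where "C i = (if i < N then S i else {})" for i
  have "(\<Sum>i. ennreal (diameter (C i))) = (\<Sum>i<N. ennreal (diameter (C i)))"
    by (rule suminf_finite) (auto simp: C_def)
  also have "\<dots> = (\<Sum>i<N. ennreal (diameter (S i)))" by (rule sum.cong) (auto simp: C_def)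
  also have "\<dots> = ennreal (\<Sum>i<N. diameter (S i))" using S(2) by (intro sum_ennreal) (auto intro: diameter_ge_0)
  also have "\<dots> \<le> ennreal L" by (intro ennreal_leI S)
  finally have le: "(\<Sum>i. ennreal (diameter (C i))) \<le> ennreal L" .
  have "A \<subseteq> (\<Union>i. C i)" using S(1) by (fastforce simp: C_def)
  moreover have "bounded (C i) \<and> diameter (C i) \<le> \<delta>" for i using S(2)[of i] \<delta> by (simp add: C_def)
  ultimately show "(INF C\<in>{C :: nat \<Rightarrow> 'a set. A \<subseteq> (\<Union>i. C i) \<and> (\<forall>i. bounded (C i) \<and> diameter (C i) \<le> \<delta>)}.
      \<Sum>i. ennreal (diameter (C i))) \<le> ennreal L"
    using le by (intro INF_lower2[of C]) auto
qed

text \<open>Exchanging the coordinates is an isometry, so it carries admissible coverings to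
  admissible coverings with the same diameters.\<close>

lemma hausdorff1_outer_swap: "hausdorff1_outer {z :: plane. prod.swap z \<in> A} \<le> hausdorff1_outer A"
  unfolding hausdorff1_outer_def
proof (rule SUP_mono)
  fix \<delta> :: real assume \<delta>: "\<delta> \<in> {0<..}"
  have ds: "dist (prod.swap x) (prod.swap y) = dist x y" for x y :: plane
    by (cases x; cases y) (simp add: dist_Pair_Pair add.commute)
  have inv: "{z. prod.swap z \<in> X} = prod.swap ` X" for X :: "plane set"
    by (auto simp: image_iff) (metis swap_simp swap_swap prod.collapse)
  have bd: "bounded {z. prod.swap z \<in> X}" "diameter {z. prod.swap z \<in> X} = diameter X" if X: "bounded X" for X :: "plane set"
  proof -
    show b: "bounded {z. prod.swap z \<in> X}"
      unfolding inv by (rule bounded_subset[OF bounded_Times[OF bounded_snd[OF X] bounded_fst[OF X]]]) (force simp: prod.swap_def)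
    show "diameter {z. prod.swap z \<in> X} = diameter X"
    proof (cases "X = {}")
      case False
      have "diameter (prod.swap ` X) = (SUP p\<in>(prod.swap ` X) \<times> (prod.swap ` X). dist (fst p) (snd p))"
        using False by (simp add: diameter_def case_prod_unfold)
      also have "\<dots> = (SUP p\<in>X \<times> X. dist (fst p) (snd p))"
      proof -
        have "(\<lambda>p. dist (fst p) (snd p)) ` ((prod.swap ` X) \<times> (prod.swap ` X)) = (\<lambda>p. dist (fst p) (snd p)) ` (X \<times> X)"
          using ds by (force simp: image_iff)
        then show ?thesis by simp
      qed
      also have "\<dots> = diameter X" using False by (simp add: diameter_def case_prod_unfold)
      finally show ?thesis unfolding inv .
    qed simp
  qed
  show "\<exists>m\<in>{0<..}. (INF C\<in>{C. {z. prod.swap z \<in> A} \<subseteq> (\<Union>i. C i) \<and> (\<forall>i. bounded (C i) \<and> diameter (C i) \<le> \<delta>)}. \<Sum>i. ennreal (diameter (C i)))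
    \<le> (INF C\<in>{C. A \<subseteq> (\<Union>i. C i) \<and> (\<forall>i. bounded (C i) \<and> diameter (C i) \<le> m)}. \<Sum>i. ennreal (diameter (C i)))"
  proof (intro bexI[OF _ \<delta>] INF_mono)
    fix C :: "nat \<Rightarrow> plane set" assume "C \<in> {C. A \<subseteq> (\<Union>i. C i) \<and> (\<forall>i. bounded (C i) \<and> diameter (C i) \<le> \<delta>)}"
    then have C: "A \<subseteq> (\<Union>i. C i)" "\<And>i. bounded (C i)" "\<And>i. diameter (C i) \<le> \<delta>" by auto
    show "\<exists>m\<in>{C. {z. prod.swap z \<in> A} \<subseteq> (\<Union>i. C i) \<and> (\<forall>i. bounded (C i) \<and> diameter (C i) \<le> \<delta>)}.
      (\<Sum>i. ennreal (diameter (m i))) \<le> (\<Sum>i. ennreal (diameter (C i)))"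
    proof (intro bexI[of _ "\<lambda>i. {z. prod.swap z \<in> C i}"] CollectI conjI allI)
      show "{z. prod.swap z \<in> A} \<subseteq> (\<Union>i. {z. prod.swap z \<in> C i})" using C(1) by blast
    qed (use bd C in auto)
  qed
qed

text \<open>The set consists of four reflected copies of a graph, each cut into \<open>n\<close>
  pieces of width \<open>h\<close>. A piece has diameter at most
  \<open>sqrt 2 * h \<le> 3 / 2 * h\<close>, and \<open>4 * (3 / 2) = 6\<close>.\<close>

lemma hausdorff1_outer_graph_le:
  fixes f :: "real \<Rightarrow> real"
  assumes st: "0 \<le> s" "s \<le> t" and f: "\<And>x y. s \<le> x \<Longrightarrow> x \<le> y \<Longrightarrow> y \<le> t \<Longrightarrow> \<bar>f x - f y\<bar> \<le> y - x"
  shows "hausdorff1_outer {z. s \<le> \<bar>fst z\<bar> \<and> \<bar>fst z\<bar> \<le> t \<and> \<bar>snd z\<bar> = f \<bar>fst z\<bar>} \<le> ennreal (6 * (t - s))"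
proof (rule hausdorff1_outer_le)
  fix \<delta> :: real assume \<delta>: "\<delta> > 0"
  obtain n0 :: nat where n0: "2 * (t - s) / \<delta> < real n0" using reals_Archimedean2 by blast
  define n where "n = Suc n0"
  define h where "h = (t - s) / real n"
  have h0: "h \<ge> 0" "real n * h = t - s" using st by (auto simp: h_def n_def)
  have hd: "3 / 2 * h \<le> \<delta>"
  proof -
    have "2 * (t - s) < real n * \<delta>" using n0 \<delta> by (simp add: pos_divide_less_eq n_def algebra_simps)
    then have "2 * h \<le> \<delta>" by (simp add: h_def pos_divide_le_eq n_def mult.commute)
    then show ?thesis using h0 by simp
  qed
  define u where "u m = s + real m * h" for m
  have u: "s \<le> u m" "u m \<le> u (Suc m)" "u (Suc m) = u m + h" for m using h0 by (auto simp: u_def algebra_simps)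
  have ut: "u m \<le> t" if "m \<le> n" for m
  proof -
    have "real m * h \<le> real n * h" using that h0 by (intro mult_right_mono) auto
    then show ?thesis using h0 by (simp add: u_def)
  qed
  \<comment> \<open>The index \<open>j\<close> encodes the piece in \<open>j div 4\<close> and the
    quadrant in \<open>j mod 4\<close>: the upper bit is the sign of the abscissa, the parity that
    of the ordinate.\<close>
  define \<sigma>1 \<sigma>2 :: "nat \<Rightarrow> real" where "\<sigma>1 j = (if j mod 4 < 2 then 1 else -1)" and "\<sigma>2 j = (if even j then 1 else -1)" for j
  define S where "S j = (\<lambda>x. (\<sigma>1 j * x, \<sigma>2 j * f x)) ` {u (j div 4)..u (Suc (j div 4))}" for j
  have S: "bounded (S j) \<and> diameter (S j) \<le> 3 / 2 * h" if j: "j < 4 * n" for j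
  proof -
    have jn: "Suc (j div 4) \<le> n" using j by auto
    have close: "norm (z - z') \<le> 3 / 2 * h" if zz: "z \<in> S j" "z' \<in> S j" for z z'
    proof -
      obtain x where x: "x \<in> {u (j div 4)..u (Suc (j div 4))}" "z = (\<sigma>1 j * x, \<sigma>2 j * f x)" using zz(1) by (auto simp: S_def)
      obtain x' where x': "x' \<in> {u (j div 4)..u (Suc (j div 4))}" "z' = (\<sigma>1 j * x', \<sigma>2 j * f x')" using zz(2) by (auto simp: S_def)
      have dx: "\<bar>x - x'\<bar> \<le> h" using x(1) x'(1) u(3)[of "j div 4"] by auto
      have df: "\<bar>f x - f x'\<bar> \<le> h"
        using f[of x x'] f[of x' x] x(1) x'(1) u(1)[of "j div 4"] ut[OF jn] dx by (cases "x \<le> x'") auto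
      have "norm (z - z') = sqrt ((\<sigma>1 j * (x - x'))\<^sup>2 + (\<sigma>2 j * (f x - f x'))\<^sup>2)"
        unfolding x(2) x'(2) by (simp add: norm_Pair algebra_simps)
      also have "\<dots> = sqrt (\<bar>x - x'\<bar>\<^sup>2 + \<bar>f x - f x'\<bar>\<^sup>2)" by (simp add: \<sigma>1_def \<sigma>2_def power_mult_distrib)
      also have "\<dots> \<le> sqrt (h\<^sup>2 + h\<^sup>2)" using dx df by (intro real_sqrt_le_mono add_mono power_mono) auto
      also have "\<dots> \<le> sqrt ((3 / 2 * h)\<^sup>2)" by (intro real_sqrt_le_mono) (simp add: power2_eq_square)
      also have "\<dots> = 3 / 2 * h" using h0 by simp
      finally show ?thesis .
    qed
    have "diameter (S j) \<le> 3 / 2 * h" by (rule diameter_le) (use close h0 in auto)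
    moreover have "bounded (S j)"
    proof (cases "S j = {}")
      case False
      then obtain z0 where "z0 \<in> S j" by blast
      then have "S j \<subseteq> cball z0 (3 / 2 * h)" using close by (intro subsetI) (simp only: mem_cball dist_norm)
      then show ?thesis using bounded_cball bounded_subset by blast
    qed simp
    ultimately show ?thesis by simp
  qed
  have cover: "z \<in> (\<Union>j<4 * n. S j)" if z: "s \<le> \<bar>fst z\<bar>" "\<bar>fst z\<bar> \<le> t" "\<bar>snd z\<bar> = f \<bar>fst z\<bar>" for z
  proof -
    have "\<exists>m<n. u m \<le> \<bar>fst z\<bar> \<and> \<bar>fst z\<bar> \<le> u (Suc m)"
    proof (rule ccontr)
      assume no: "\<not> ?thesis"
      have "m \<le> n \<Longrightarrow> u m \<le> \<bar>fst z\<bar> \<and> (0 < m \<longrightarrow> u m < \<bar>fst z\<bar>)" for m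
      proof (induction m)
        case 0
        then show ?case using z(1) by (simp add: u_def)
      next
        case (Suc m)
        then show ?case using no by (metis Suc_le_lessD less_imp_le linorder_not_le)
      qed
      from this[of n] have "u n < \<bar>fst z\<bar>" by (simp add: n_def)
      then show False using z(2) h0 by (simp add: u_def)
    qed
    then obtain m where m: "m < n" "\<bar>fst z\<bar> \<in> {u m..u (Suc m)}" by auto
    define k :: nat where "k = (if fst z \<ge> 0 then 0 else 2) + (if snd z \<ge> 0 then 0 else 1)"
    define j where "j = 4 * m + k"
    have k4: "k < 4" by (simp add: k_def)
    then have j: "j < 4 * n" "j div 4 = m" "j mod 4 = k" using m(1) by (auto simp: j_def)
    have "even j \<longleftrightarrow> snd z \<ge> 0" by (auto simp: j_def k_def)
    then have "\<sigma>1 j * \<bar>fst z\<bar> = fst z" "\<sigma>2 j * f \<bar>fst z\<bar> = snd z"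
      using z(3)[symmetric] j(3) by (auto simp: \<sigma>1_def \<sigma>2_def k_def)
    then have "z = (\<sigma>1 j * \<bar>fst z\<bar>, \<sigma>2 j * f \<bar>fst z\<bar>)" by (simp add: prod_eq_iff)
    then have "z \<in> S j" unfolding S_def j(2) using m(2) by blast
    then show ?thesis using j(1) by blast
  qed
  have "(\<Sum>j<4 * n. diameter (S j)) \<le> (\<Sum>j<4 * n. 3 / 2 * h)" using S by (intro sum_mono) auto
  also have "\<dots> = 6 * (t - s)" using h0(2) by simp
  finally have sum: "(\<Sum>j<4 * n. diameter (S j)) \<le> 6 * (t - s)" .
  have "diameter (S j) \<le> \<delta>" if "j < 4 * n" for j using S[OF that] hd by linarith
  then show "\<exists>(N::nat) S. {z. s \<le> \<bar>fst z\<bar> \<and> \<bar>fst z\<bar> \<le> t \<and> \<bar>snd z\<bar> = f \<bar>fst z\<bar>} \<subseteq> (\<Union>j<N. S j) \<and>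
      (\<forall>j<N. bounded (S j) \<and> diameter (S j) \<le> \<delta>) \<and> (\<Sum>j<N. diameter (S j)) \<le> 6 * (t - s)"
    using cover S sum by (intro exI[of _ "4 * n"] exI[of _ S] conjI) blast+
qed

section \<open>Perimeter and area of the Wulff shape, and the bound on \<open>alpha0\<close>\<close>

context monotone_anisotropy
begin

text \<open>Up to a point where \<open>x + y\<close> is maximal on the Wulff shape, its boundary is the graph of a
  \<open>1\<close>-Lipschitz function; on each arc the support function is controlled by the slope of the next chord,
  and these slopes telescope.\<close>

lemma arc_cover:
  assumes x0: "0 \<le> x0" "x0 \<le> 1 / pa" and mx: "\<forall>x y. (x, y) \<in> wulff \<phi> \<longrightarrow> x + y \<le> x0 + prof x0" and e: "e > 0"
  shows "\<exists>(n::nat) K c. (\<forall>i<n. closed (K i) \<and> 0 \<le> c i) \<and>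
    (\<Sum>i<n. ennreal (c i) * hausdorff1_outer (K i)) \<le> ennreal (6 * x0 * (2 / pb - prof x0) + e) \<and>
    (\<forall>x y v1 v2. \<bar>x\<bar> \<le> x0 \<longrightarrow> \<bar>y\<bar> = prof x \<longrightarrow> v1\<^sup>2 + v2\<^sup>2 = 1 \<longrightarrow>
       (\<forall>x' y'. (x', y') \<in> wulff \<phi> \<longrightarrow> v1 * (x' - x) + v2 * (y' - y) \<le> 0) \<longrightarrow>
       (\<exists>i<n. (x, y) \<in> K i \<and> v1 * x + v2 * y \<le> c i))"
proof -
  \<comment> \<open>Maximality of \<open>x + y\<close> at \<open>x0\<close> bounds the secants
    ending at \<open>x0\<close> from below by \<open>-1\<close>; concavity passes this to all
    secants to the left.\<close>
  have lip: "0 \<le> prof x - prof y \<and> prof x - prof y \<le> y - x" if xy: "0 \<le> x" "x \<le> y" "y \<le> x0" for x y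
  proof
    show "0 \<le> prof x - prof y" using prof_antimono[of x y] xy x0 by simp
    have to0: "prof x - prof x0 \<le> x0 - x" if "0 \<le> x" "x \<le> x0" for x
      using mx[rule_format, OF prof_props(1)[of x]] that x0 by simp
    consider "x = y" | "y = x0" | "x < y" "y < x0" using xy by linarith
    then show "prof x - prof y \<le> y - x"
    proof cases
      case 3
      have "(prof x0 - prof y) / (x0 - y) \<le> (prof y - prof x) / (y - x)" using 3 xy x0 pa_pos by (intro prof_slopes) auto
      moreover have "-1 \<le> (prof x0 - prof y) / (x0 - y)" using to0[of y] 3 xy by (simp add: pos_le_divide_eq)
      ultimately have "-1 \<le> (prof y - prof x) / (y - x)" by linarith
      then show ?thesis using 3 by (simp add: pos_le_divide_eq)
    qed (use to0[of x] xy in auto)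
  qed
  \<comment> \<open>The last arc contributes an excess \<open>6 * x0\<^sup>2 / n\<close>, and this
    choice makes it at most \<open>e\<close>.\<close>
  obtain k :: nat where k: "6 * x0\<^sup>2 / e < real k" using reals_Archimedean2 by blast
  define n where "n = Suc k"
  define t where "t i = real i * (x0 / real n)" for i
  have n0: "real n > 0" by (simp add: n_def)
  have t0: "t 0 = 0" "t n = x0" "\<And>i. 0 \<le> t i" "\<And>i. t i \<le> t (Suc i)" "\<And>i. t (Suc i) - t i = x0 / real n"
    using x0 n0 by (auto simp: t_def algebra_simps add_divide_distrib)
  have tx0: "t i \<le> x0" if "i \<le> n" for i
  proof -
    have "t i \<le> real n * (x0 / real n)" unfolding t_def using that x0 by (intro mult_right_mono) auto
    then show ?thesis using n0 by simp
  qed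
  define K where "K i = {z. t i \<le> \<bar>fst z\<bar> \<and> \<bar>fst z\<bar> \<le> t (Suc i) \<and> \<bar>snd z\<bar> = prof \<bar>fst z\<bar>}" for i
  \<comment> \<open>A bound for the support function at normals on arc \<open>i\<close>. The first
    component of the normal is at most the downward slope of the next chord, whose base is
    \<open>x0 / n\<close>; the abscissa is at most \<open>x0\<close>, and the vertical part at most
    \<open>1 / pb\<close>. The last arc has no next chord, so there the first component is bounded
    by \<open>1\<close>.\<close>
  define c where "c i = (if i < k then real n * (prof (t (Suc i)) - prof (t (Suc (Suc i)))) + 1 / pb else x0 + 1 / pb)" for i
  have c0: "0 \<le> c i" if "i < n" for i
  proof (cases "i < k")
    case True
    then have "Suc (Suc i) \<le> n" by (simp add: n_def)
    then have "0 \<le> prof (t (Suc i)) - prof (t (Suc (Suc i)))" using lip[OF t0(3,4) tx0] by blast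
    then show ?thesis using True pb_pos by (simp add: c_def)
  qed (use x0 pb_pos in \<open>simp add: c_def\<close>)
  have H: "hausdorff1_outer (K i) \<le> ennreal (6 * (x0 / real n))" if i: "i < n" for i
  proof -
    have "hausdorff1_outer (K i) \<le> ennreal (6 * (t (Suc i) - t i))"
      unfolding K_def
    proof (rule hausdorff1_outer_graph_le[OF t0(3,4)])
      fix x y assume xy: "t i \<le> x" "x \<le> y" "y \<le> t (Suc i)"
      have "0 \<le> prof x - prof y \<and> prof x - prof y \<le> y - x"
        using xy t0(3)[of i] tx0[of "Suc i"] i by (intro lip) auto
      then show "\<bar>prof x - prof y\<bar> \<le> y - x" by simp
    qed
    then show ?thesis by (simp add: t0(5))
  qed
  have Kclosed: "closed (K i)" if i: "i < n" for i
  proof -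
    \<comment> \<open>Clamping the argument to \<open>[t i, t (Suc i)]\<close> gives a function
      continuous on the whole line that describes the same set.\<close>
    define F where "F x = prof (max (t i) (min (t (Suc i)) \<bar>x\<bar>))" for x
    have "1-lipschitz_on {0..x0} prof"
    proof (rule lipschitz_onI)
      fix x y assume "x \<in> {0..x0}" "y \<in> {0..x0}"
      then show "dist (prof x) (prof y) \<le> 1 * dist x y"
        using lip[of x y] lip[of y x] by (cases "x \<le> y") (auto simp: dist_real_def)
    qed simp
    then have pc: "continuous_on {0..x0} prof" by (rule lipschitz_on_continuous_on)
    have Fc: "continuous_on UNIV F" unfolding F_def
      by (rule continuous_on_compose2[OF pc]) (use t0(3)[of i] t0(4)[of i] tx0[of "Suc i"] i in \<open>auto intro!: continuous_intros simp: le_max_iff_disj\<close>)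
    have "K i = {z. t i \<le> \<bar>fst z\<bar>} \<inter> {z. \<bar>fst z\<bar> \<le> t (Suc i)} \<inter> {z. \<bar>snd z\<bar> = F (fst z)}"
      by (auto simp: K_def F_def min_def max_def)
    also have "closed \<dots>"
      by (intro closed_Int closed_Collect_le closed_Collect_eq continuous_intros continuous_on_compose2[OF Fc]) auto
    finally show ?thesis .
  qed
  have csum: "(\<Sum>i<n. c i * (6 * (x0 / real n))) \<le> 6 * x0 * (2 / pb - prof x0) + e"
  proof -
    have "(\<Sum>i<n. c i) = (\<Sum>i<k. c i) + (x0 + 1 / pb)" by (simp add: n_def c_def)
    also have "(\<Sum>i<k. c i) = real n * (\<Sum>i<k. prof (t (Suc i)) - prof (t (Suc (Suc i)))) + real k / pb"
      by (simp add: c_def sum.distrib sum_distrib_left)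
    also have "(\<Sum>i<k. prof (t (Suc i)) - prof (t (Suc (Suc i)))) = prof (t (Suc 0)) - prof x0"
      using sum_lessThan_telescope'[of "\<lambda>i. prof (t (Suc i))" k] t0(2) by (simp add: n_def)
    finally have s: "(\<Sum>i<n. c i) = real n * (prof (t (Suc 0)) - prof x0) + real k / pb + (x0 + 1 / pb)" .
    also have "\<dots> \<le> real n * (1 / pb - prof x0) + real n / pb + x0"
    proof -
      have "prof (t (Suc 0)) \<le> 1 / pb" using tx0[of 1] t0(3)[of 1] x0 by (intro prof_le) (auto simp: n_def)
      then have "real n * (prof (t (Suc 0)) - prof x0) \<le> real n * (1 / pb - prof x0)" by (intro mult_left_mono) auto
      then show ?thesis by (simp add: n_def add_divide_distrib)
    qed
    finally have le: "(\<Sum>i<n. c i) \<le> real n * (2 / pb - prof x0) + x0" by (simp add: algebra_simps)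
    have "(\<Sum>i<n. c i * (6 * (x0 / real n))) = (\<Sum>i<n. c i) * (6 * (x0 / real n))" by (rule sum_distrib_right[symmetric])
    also have "\<dots> \<le> (real n * (2 / pb - prof x0) + x0) * (6 * (x0 / real n))" using le x0 by (intro mult_right_mono) auto
    also have "\<dots> = 6 * x0 * (2 / pb - prof x0) + 6 * x0\<^sup>2 / real n"
    proof -
      have "(real n * q + x0) * (6 * (x0 / real n)) = 6 * x0 * q + 6 * x0\<^sup>2 / real n" for q
        using n0 by (simp add: field_simps power2_eq_square)
      then show ?thesis .
    qed
    also have "6 * x0\<^sup>2 / real n \<le> e"
    proof -
      have "6 * x0\<^sup>2 < real k * e" using k e by (simp add: pos_divide_less_eq)
      also have "\<dots> \<le> real n * e" using e by (simp add: n_def)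
      finally show ?thesis using n0 by (simp add: pos_divide_le_eq mult.commute)
    qed
    finally show ?thesis by simp
  qed
  have hsum: "(\<Sum>i<n. ennreal (c i) * hausdorff1_outer (K i)) \<le> ennreal (6 * x0 * (2 / pb - prof x0) + e)"
  proof -
    have "(\<Sum>i<n. ennreal (c i) * hausdorff1_outer (K i)) \<le> (\<Sum>i<n. ennreal (c i * (6 * (x0 / real n))))"
    proof (rule sum_mono)
      fix i assume "i \<in> {..<n}"
      then have i: "i < n" by simp
      show "ennreal (c i) * hausdorff1_outer (K i) \<le> ennreal (c i * (6 * (x0 / real n)))"
        using mult_left_mono[OF H[OF i], of "ennreal (c i)"] c0[OF i] x0 by (subst ennreal_mult) auto
    qed
    also have "\<dots> = ennreal (\<Sum>i<n. c i * (6 * (x0 / real n)))"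
      using c0 x0 by (intro sum_ennreal) auto
    also have "\<dots> \<le> ennreal (6 * x0 * (2 / pb - prof x0) + e)" by (intro ennreal_leI csum)
    finally show ?thesis .
  qed
  have cover: "\<exists>i<n. (x, y) \<in> K i \<and> v1 * x + v2 * y \<le> c i"
    if x: "\<bar>x\<bar> \<le> x0" and y: "\<bar>y\<bar> = prof x" and v: "v1\<^sup>2 + v2\<^sup>2 = 1"
      and nrm: "\<And>x' y'. (x', y') \<in> wulff \<phi> \<Longrightarrow> v1 * (x' - x) + v2 * (y' - y) \<le> 0" for x y v1 v2
  proof -
    define X where "X = \<bar>x\<bar>"
    \<comment> \<open>Reflection into the first quadrant; both the Wulff shape and the normal
      inequality are invariant under it.\<close>
    define \<sigma>1 \<sigma>2 :: real where "\<sigma>1 = (if x \<ge> 0 then 1 else -1)" and "\<sigma>2 = (if y \<ge> 0 then 1 else -1)"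
    define A B where "A = \<sigma>1 * v1" and "B = \<sigma>2 * v2"
    have yX: "\<bar>y\<bar> = prof X" using y prof_even[of x] by (auto simp: X_def abs_if)
    have AB: "v1 * x + v2 * y = A * X + B * prof X"
      unfolding yX[symmetric] by (auto simp: A_def B_def \<sigma>1_def \<sigma>2_def X_def)
    have A1: "\<bar>A\<bar> \<le> 1" "\<bar>B\<bar> \<le> 1"
    proof -
      have "v1\<^sup>2 \<le> 1" "v2\<^sup>2 \<le> 1" using v by (smt (verit) zero_le_power2)+
      then have "\<bar>v1\<bar> \<le> 1" "\<bar>v2\<bar> \<le> 1" by (auto simp: abs_square_le_1)
      then show "\<bar>A\<bar> \<le> 1" "\<bar>B\<bar> \<le> 1" by (auto simp: A_def B_def \<sigma>1_def \<sigma>2_def)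
    qed
    have X0: "0 \<le> X" "X \<le> x0" using x by (auto simp: X_def)
    have XM: "\<bar>X\<bar> \<le> 1 / pa" using X0 x0 by simp
    have BY: "B * prof X \<le> 1 / pb"
    proof -
      have "B * prof X \<le> 1 * prof X" using A1 prof_props(2)[OF XM] by (intro mult_right_mono) auto
      then show ?thesis using prof_le[OF XM] by simp
    qed
    have nrm': "A * (x' - X) + B * (prof x' - prof X) \<le> 0" if "\<bar>x'\<bar> \<le> 1 / pa" for x'
    proof -
      have "(\<sigma>1 * x', \<sigma>2 * prof x') \<in> wulff \<phi>"
        using prof_props(1,2)[OF that] that prof_even[of x'] by (auto simp: wulff_prof \<sigma>1_def \<sigma>2_def)
      from nrm[OF this] show ?thesis unfolding yX[symmetric] by (auto simp: A_def B_def \<sigma>1_def \<sigma>2_def X_def algebra_simps)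
    qed
    have "\<exists>i<n. t i \<le> X \<and> X \<le> t (Suc i)"
    proof (rule ccontr)
      assume no: "\<not> ?thesis"
      have "i \<le> n \<Longrightarrow> t i \<le> X \<and> (0 < i \<longrightarrow> t i < X)" for i
      proof (induction i)
        case 0
        then show ?case using X0 t0 by simp
      next
        case (Suc i)
        then show ?case using no by (metis Suc_le_lessD less_imp_le linorder_not_le)
      qed
      from this[of n] have "t n < X" by (simp add: n_def)
      then show False using X0 t0 by simp
    qed
    then obtain i where i: "i < n" "t i \<le> X" "X \<le> t (Suc i)" by blast
    have "(x, y) \<in> K i" using i yX by (simp add: K_def X_def)
    moreover have "A * X + B * prof X \<le> c i"
    proof (cases "i < k")
      case False
      have "A * X \<le> 1 * X" using A1 X0 by (intro mult_right_mono) auto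
      then show ?thesis using BY X0 False by (simp add: c_def)
    next
      case True
      define t1 t2 where "t1 = t (Suc i)" and "t2 = t (Suc (Suc i))"
      have i2: "Suc (Suc i) \<le> n" using True by (simp add: n_def)
      have t2: "t2 - t1 = x0 / real n" "t1 \<le> t2" "t2 \<le> x0" "0 \<le> t1" "X \<le> t1"
        using t0(3-5) tx0[OF i2] i by (auto simp: t1_def t2_def)
      have d12: "0 \<le> prof t1 - prof t2" using lip[of t1 t2] t2 by auto
      have "A * X \<le> real n * (prof t1 - prof t2)"
      proof (cases "x0 = 0")
        case True
        then have "X = 0" using X0 by simp
        then show ?thesis using d12 by simp
      next
        case False
        then have pos: "x0 > 0" using x0 by simp
        then have lt: "t1 < t2" using t2(1) n0 by (metis diff_gt_0_iff_gt divide_pos_pos)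
        have "A * (t2 - X) \<le> B * (prof X - prof t2)" using nrm'[of t2] t2 x0 by (simp add: algebra_simps)
        also have "\<dots> \<le> 1 * (prof X - prof t2)" using A1 lip[of X t2] X0 t2 by (intro mult_right_mono) auto
        finally have "A \<le> (prof X - prof t2) / (t2 - X)" using lt t2 by (simp add: pos_le_divide_eq)
        also have "\<dots> \<le> (prof t1 - prof t2) / (t2 - t1)"
        proof (cases "X = t1")
          case False
          have "(prof t2 - prof t1) / (t2 - t1) \<le> (prof t2 - prof X) / (t2 - X)"
            using False t2 lt X0 x0 pa_pos by (intro prof_slopes(3)) auto
          then have "- ((prof t2 - prof X) / (t2 - X)) \<le> - ((prof t2 - prof t1) / (t2 - t1))" by linarith
          then show ?thesis unfolding minus_divide_left by simp
        qed simp
        finally have "A \<le> (prof t1 - prof t2) / (x0 / real n)" using t2(1) by simp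
        then have "A * X \<le> ((prof t1 - prof t2) / (x0 / real n)) * X" using X0 by (intro mult_right_mono) auto
        also have "\<dots> \<le> ((prof t1 - prof t2) / (x0 / real n)) * x0" using X0 d12 pos n0 by (intro mult_left_mono) auto
        also have "\<dots> = real n * (prof t1 - prof t2)" using pos n0 by (simp add: field_simps)
        finally show ?thesis .
      qed
      then show ?thesis using BY True by (simp add: c_def t1_def t2_def)
    qed
    ultimately show ?thesis using i(1) AB by auto
  qed
  show ?thesis
    apply (intro exI[of _ n] exI[of _ K] exI[of _ c] conjI)
    subgoal using Kclosed c0 by blast
    subgoal using hsum by simp
    subgoal by (intro allI impI) (rule cover; blast)
    done
qed

text \<open>A boundary point strictly below the profile lies on a vertical edge:
  \<open>(x, \<bar>y\<bar>)\<close> is a convex combination of \<open>(x, 0)\<close> and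
  \<open>(x, prof x)\<close> with positive weight on the first, so \<open>\<phi> (x, 0) < 1\<close>
  would make \<open>\<phi>\<close> less than \<open>1\<close> there.\<close>

lemma phi_eq_1_prof:
  assumes "\<phi> (x, y) = 1" "\<bar>y\<bar> < prof x"
  shows "\<bar>x\<bar> = 1 / pa"
proof -
  have xM: "\<bar>x\<bar> \<le> 1 / pa" using assms(1) by (intro wulff_bounds(1)[of x y]) (simp add: wulff_iff)
  define \<theta> where "\<theta> = \<bar>y\<bar> / prof x"
  have py: "prof x > 0" using assms(2) by linarith
  have \<theta>: "0 \<le> \<theta>" "\<theta> < 1" "\<theta> * prof x = \<bar>y\<bar>" using assms(2) py by (auto simp: \<theta>_def)
  have "1 = \<phi> (x, \<bar>y\<bar>)" using assms(1) phi_abs[of x y] phi_abs[of x "\<bar>y\<bar>"] by simp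
  also have "(x, \<bar>y\<bar>) = (1 - \<theta>) *\<^sub>R (x, 0) + \<theta> *\<^sub>R (x, prof x)" using \<theta>(3) by (simp add: algebra_simps)
  also have "\<phi> \<dots> \<le> (1 - \<theta>) * \<phi> (x, 0) + \<theta> * \<phi> (x, prof x)"
    using phi_triangle[of "(1 - \<theta>) *\<^sub>R (x, 0)" "\<theta> *\<^sub>R (x, prof x)"] \<theta> by (simp add: phi_scale del: scaleR_Pair)
  also have "\<dots> \<le> (1 - \<theta>) * (\<bar>x\<bar> * pa) + \<theta> * 1"
    using prof_props(1)[OF xM] \<theta> by (intro add_mono mult_left_mono) (auto simp: phi_axis wulff_iff)
  finally have "(1 - \<theta>) * 1 \<le> (1 - \<theta>) * (\<bar>x\<bar> * pa)" by simp
  then have "1 \<le> \<bar>x\<bar> * pa" using \<theta> by (simp add: mult_le_cancel_left_pos)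
  then show ?thesis using xM pa_pos by (simp add: field_simps)
qed

text \<open>Replaces the perimeter integrand at a boundary point by the product of normal and
  position, the quantity that \<open>arc_cover\<close> bounds.\<close>

lemma dual_anisotropy_le:
  assumes "\<And>z'. z' \<in> wulff \<phi> \<Longrightarrow> v \<bullet> (z' - z) \<le> 0"
  shows "dual_anisotropy \<phi> v \<le> v \<bullet> z"
  unfolding dual_anisotropy_def
proof (rule cSUP_least)
  show "{\<eta>. \<phi> \<eta> = 1} \<noteq> {}" using pa_pos phi_axis(1)[of "1 / pa"] by auto
  fix \<eta> assume "\<eta> \<in> {\<eta>. \<phi> \<eta> = 1}"
  then show "v \<bullet> \<eta> \<le> v \<bullet> z" using assms[of \<eta>] by (simp add: wulff_iff inner_diff_right)
qed

text \<open>The part of the boundary beyond the maximum of \<open>x + y\<close> is covered by arcs after exchanging the coordinates.\<close>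

lemma perimeter_wulff_le: "perimeter \<phi> (wulff \<phi>) UNIV \<le> ennreal (14 / (pa * pb))"
proof -
  interpret sw: monotone_anisotropy "\<lambda>z. \<phi> (prod.swap z)" by (rule swap)
  have swp: "sw.pa = pb" "sw.pb = pa" by (simp_all add: sw.pa_def sw.pb_def pa_def pb_def)
  have sww: "(x, y) \<in> wulff (\<lambda>z. \<phi> (prod.swap z)) \<longleftrightarrow> (y, x) \<in> wulff \<phi>" for x y by (simp add: wulff_def)
  have "wulff \<phi> \<noteq> {}" using prof_props(1)[of 0] pa_pos by auto
  \<comment> \<open>A maximum point of \<open>x + y\<close> splits each quarter of the boundary into
    a flat part, a graph over \<open>x\<close>, and a steep part, a graph over \<open>y\<close>,
    both with Lipschitz constant \<open>1\<close>.\<close>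
  then obtain z0 where z0: "z0 \<in> wulff \<phi>" "\<And>z. z \<in> wulff \<phi> \<Longrightarrow> fst z + snd z \<le> fst z0 + snd z0"
    using continuous_attains_sup[OF wulff_compact, of "\<lambda>z. fst z + snd z"] continuous_on_add[OF continuous_on_fst[OF continuous_on_id] continuous_on_snd[OF continuous_on_id]]
    by blast
  define x0 y0 where "x0 = fst z0" and "y0 = snd z0"
  have W0: "(x0, y0) \<in> wulff \<phi>" and mx: "\<And>x y. (x, y) \<in> wulff \<phi> \<Longrightarrow> x + y \<le> x0 + y0"
    using z0 by (auto simp: x0_def y0_def)
  have "(\<bar>x0\<bar>, \<bar>y0\<bar>) \<in> wulff \<phi>" using W0 by (simp add: wulff_iff phi_abs)
  then have nn: "x0 \<ge> 0" "y0 \<ge> 0" using mx by (auto dest!: mx)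
  have b: "x0 \<le> 1 / pa" "y0 \<le> 1 / pb" using wulff_bounds[OF W0] by auto
  have y0: "prof x0 = y0"
  proof (rule antisym)
    show "prof x0 \<le> y0" using mx[OF prof_props(1)[of x0]] nn b by simp
    show "y0 \<le> prof x0" using W0 by (auto simp: wulff_prof)
  qed
  have x0: "sw.prof y0 = x0"
  proof (rule antisym)
    have "(y0, sw.prof y0) \<in> wulff (\<lambda>z. \<phi> (prod.swap z))" using sw.prof_props(1)[of y0] nn b by (simp add: swp)
    then show "sw.prof y0 \<le> x0" using mx[of "sw.prof y0" y0] by (simp add: sww)
    show "x0 \<le> sw.prof y0" using W0 sww[of y0 x0] by (auto simp: sw.wulff_prof)
  qed
  define e where "e = 1 / (pa * pb)"
  have e: "e > 0" using pa_pos pb_pos by (simp add: e_def)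
  have "\<forall>x y. (x, y) \<in> wulff \<phi> \<longrightarrow> x + y \<le> x0 + prof x0" using mx y0 by simp
  note arc = arc_cover[OF nn(1) b(1) this e, unfolded y0]
  obtain n :: nat and K c where
    K': "\<forall>i<n. closed (K i) \<and> 0 \<le> c i"
      "(\<Sum>i<n. ennreal (c i) * hausdorff1_outer (K i)) \<le> ennreal (6 * x0 * (2 / pb - y0) + e)"
      "\<forall>x y v1 v2. \<bar>x\<bar> \<le> x0 \<longrightarrow> \<bar>y\<bar> = prof x \<longrightarrow> v1\<^sup>2 + v2\<^sup>2 = 1 \<longrightarrow>
       (\<forall>x' y'. (x', y') \<in> wulff \<phi> \<longrightarrow> v1 * (x' - x) + v2 * (y' - y) \<le> 0) \<longrightarrow>
       (\<exists>i<n. (x, y) \<in> K i \<and> v1 * x + v2 * y \<le> c i)"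
    by (insert arc) (elim exE conjE, rule that)
  note K = K'(1)[rule_format] K'(2) K'(3)[rule_format]
  have mx': "\<forall>x y. (x, y) \<in> wulff (\<lambda>z. \<phi> (prod.swap z)) \<longrightarrow> x + y \<le> y0 + sw.prof y0"
  proof (intro allI impI)
    fix x y assume "(x, y) \<in> wulff (\<lambda>z. \<phi> (prod.swap z))"
    then show "x + y \<le> y0 + sw.prof y0" using mx[of y x] by (simp add: sww x0 add.commute)
  qed
  have b': "y0 \<le> 1 / sw.pa" using b by (simp add: swp)
  note arc' = sw.arc_cover[OF nn(2) b' mx' e, unfolded swp x0]
  obtain n' :: nat and K' c' where
    K'': "\<forall>i<n'. closed (K' i) \<and> 0 \<le> c' i"
      "(\<Sum>i<n'. ennreal (c' i) * hausdorff1_outer (K' i)) \<le> ennreal (6 * y0 * (2 / pa - x0) + e)"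
      "\<forall>x y v1 v2. \<bar>x\<bar> \<le> y0 \<longrightarrow> \<bar>y\<bar> = sw.prof x \<longrightarrow> v1\<^sup>2 + v2\<^sup>2 = 1 \<longrightarrow>
       (\<forall>x' y'. (x', y') \<in> wulff (\<lambda>z. \<phi> (prod.swap z)) \<longrightarrow> v1 * (x' - x) + v2 * (y' - y) \<le> 0) \<longrightarrow>
       (\<exists>i<n'. (x, y) \<in> K' i \<and> v1 * x + v2 * y \<le> c' i)"
    by (insert arc') (elim exE conjE, rule that)
  note K' = K''(1)[rule_format] K''(2) K''(3)[rule_format]
  define L where "L i = {z. prod.swap z \<in> K' i}" for i
  have Lclosed: "closed (L i)" if "i < n'" for i
  proof -
    have "closed ((\<lambda>z. (snd z, fst z)) -` K' i)"
      using K'(1)[OF that] by (intro continuous_closed_vimage) (auto intro!: continuous_intros)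
    moreover have "(\<lambda>z. (snd z, fst z)) -` K' i = L i" by (auto simp: L_def prod.swap_def)
    ultimately show ?thesis by simp
  qed
  obtain M0 n0 where gg: "gauss_green (wulff \<phi>) UNIV M0 n0" using gauss_green_wulff by blast
  define R where "R = reduced_boundary (wulff \<phi>) UNIV"
  define \<nu> where "\<nu> = outer_normal (wulff \<phi>) UNIV"
  have pt: "ennreal (dual_anisotropy \<phi> (\<nu> z)) * indicator R z \<le>
    (\<Sum>i<n. ennreal (c i) * indicator (K i) z) + (\<Sum>i<n'. ennreal (c' i) * indicator (L i) z)" for z
  proof (cases "z \<in> R")
    case True
    note rb = reduced_boundary_normal[OF gg wulff_convex wulff_compact True[unfolded R_def], folded \<nu>_def]
    obtain x y where z: "z = (x, y)" by force
    obtain v1 v2 where v: "\<nu> z = (v1, v2)" by force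
    have v1: "v1\<^sup>2 + v2\<^sup>2 = 1" using rb(2) unfolding v by (simp add: norm_Pair)
    have nrm: "v1 * (x' - x) + v2 * (y' - y) \<le> 0" if "(x', y') \<in> wulff \<phi>" for x' y'
      using rb(3)[OF that] unfolding v unfolding z by (simp add: inner_prod_def)
    have dual: "dual_anisotropy \<phi> (\<nu> z) \<le> v1 * x + v2 * y"
      using dual_anisotropy_le[of "\<nu> z" z] rb(3) unfolding v unfolding z by (simp add: inner_prod_def)
    \<comment> \<open>At a point with \<open>\<phi> < 1\<close> a small step in the direction of the
      normal would stay in the Wulff shape, against the supporting property.\<close>
    have phi1: "\<phi> (x, y) = 1"
    proof (rule ccontr)
      assume "\<phi> (x, y) \<noteq> 1"
      then have lt: "\<phi> (x, y) < 1" using rb(1) by (simp add: z wulff_iff)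
      define r where "r = (1 - \<phi> (x, y)) / (\<phi> (v1, v2) + 1)"
      have r: "r > 0" "r * \<phi> (v1, v2) \<le> 1 - \<phi> (x, y)"
      proof -
        have p: "\<phi> (v1, v2) + 1 > 0" using phi_nonneg[of "(v1, v2)"] by linarith
        then show "r > 0" using lt by (simp add: r_def)
        then have "r * \<phi> (v1, v2) \<le> r * (\<phi> (v1, v2) + 1)" by simp
        also have "\<dots> = 1 - \<phi> (x, y)" using p by (simp add: r_def)
        finally show "r * \<phi> (v1, v2) \<le> 1 - \<phi> (x, y)" .
      qed
      have "\<phi> ((x, y) + r *\<^sub>R (v1, v2)) \<le> \<phi> (x, y) + r * \<phi> (v1, v2)"
        using phi_triangle[of "(x, y)" "r *\<^sub>R (v1, v2)"] r(1) unfolding phi_scale by simp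
      then have "(x + r * v1, y + r * v2) \<in> wulff \<phi>" using r(2) by (simp add: wulff_iff)
      from nrm[OF this] have "r * (v1\<^sup>2 + v2\<^sup>2) \<le> 0" by (simp add: power2_eq_square algebra_simps)
      then show False using v1 r(1) by simp
    qed
    have xW: "\<bar>x\<bar> \<le> 1 / pa" "\<bar>y\<bar> \<le> prof x" using rb(1) unfolding z wulff_prof by auto
    have yW: "\<bar>y\<bar> \<le> 1 / pb" "\<bar>x\<bar> \<le> sw.prof y" using rb(1) sww[of y x] unfolding z sw.wulff_prof swp by auto
    have phi1': "\<phi> (prod.swap (y, x)) = 1" using phi1 by simp
    \<comment> \<open>If \<open>\<bar>x\<bar> \<le> x0\<close> but the point is below the profile,
      it lies on a vertical edge, so \<open>\<bar>x\<bar> = x0 = 1 / pa\<close> and the second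
      alternative holds. If \<open>\<bar>x\<bar> > x0\<close> and the point is not on the swapped
      graph, it lies on a horizontal edge, and \<open>x + y\<close> would exceed its
      maximum.\<close>
    have cases: "(\<bar>x\<bar> \<le> x0 \<and> \<bar>y\<bar> = prof x) \<or> (\<bar>y\<bar> \<le> y0 \<and> \<bar>x\<bar> = sw.prof y)"
    proof (cases "\<bar>x\<bar> \<le> x0")
      case True
      show ?thesis
      proof (cases "\<bar>y\<bar> = prof x")
        case False
        then have "\<bar>x\<bar> = 1 / pa" using xW phi_eq_1_prof[OF phi1] by simp
        then have "\<bar>x\<bar> = x0" "\<bar>x\<bar> = sw.prof y" using True b(1) yW sw.prof_le[of y] by (auto simp: swp)
        moreover have "prof x = prof x0" using \<open>\<bar>x\<bar> = x0\<close> prof_even[of x] by (auto simp: abs_if split: if_splits)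
        ultimately show ?thesis using xW y0 by simp
      qed (use True in simp)
    next
      case False
      have "prof x \<le> prof x0" using False nn xW by (intro prof_antimono) auto
      then have "\<bar>y\<bar> \<le> y0" using xW y0 by simp
      moreover have "\<bar>x\<bar> = sw.prof y"
      proof (rule ccontr)
        assume "\<bar>x\<bar> \<noteq> sw.prof y"
        then have lt: "\<bar>x\<bar> < sw.prof y" using yW by simp
        then have "\<bar>y\<bar> = 1 / pb" using sw.phi_eq_1_prof[OF phi1'] by (simp add: swp)
        moreover have "(sw.prof y, \<bar>y\<bar>) \<in> wulff \<phi>"
        proof -
          have "(y, sw.prof y) \<in> wulff (\<lambda>z. \<phi> (prod.swap z))" using sw.prof_props(1)[of y] yW by (simp add: swp)
          then have "(sw.prof y, y) \<in> wulff \<phi>" by (simp add: sww)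
          then show ?thesis using phi_abs[of "sw.prof y" y] phi_abs[of "sw.prof y" "\<bar>y\<bar>"] by (simp add: wulff_iff)
        qed
        ultimately show False using mx[of "sw.prof y" "\<bar>y\<bar>"] lt False b by auto
      qed
      ultimately show ?thesis by simp
    qed
    from cases show ?thesis
    proof
      assume a: "\<bar>x\<bar> \<le> x0 \<and> \<bar>y\<bar> = prof x"
      then obtain i where i: "i < n" "(x, y) \<in> K i" "v1 * x + v2 * y \<le> c i" using K(3)[OF _ _ v1 nrm] by blast
      have "ennreal (dual_anisotropy \<phi> (\<nu> z)) * indicator R z \<le> ennreal (c i) * indicator (K i) z"
        using i dual True by (simp add: z[symmetric] ennreal_leI)
      also have "\<dots> \<le> (\<Sum>i<n. ennreal (c i) * indicator (K i) z)" using i(1) by (intro member_le_sum) auto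
      also have "\<dots> \<le> (\<Sum>i<n. ennreal (c i) * indicator (K i) z) + (\<Sum>i<n'. ennreal (c' i) * indicator (L i) z)" by simp
      finally show ?thesis .
    next
      assume a: "\<bar>y\<bar> \<le> y0 \<and> \<bar>x\<bar> = sw.prof y"
      have "v2\<^sup>2 + v1\<^sup>2 = 1" using v1 by simp
      moreover have "v2 * (x' - y) + v1 * (y' - x) \<le> 0" if "(x', y') \<in> wulff (\<lambda>z. \<phi> (prod.swap z))" for x' y'
        using nrm[of y' x'] that by (simp add: sww)
      ultimately obtain i where i: "i < n'" "(y, x) \<in> K' i" "v2 * y + v1 * x \<le> c' i" using K'(3)[of y x v2 v1] a by blast
      have "ennreal (dual_anisotropy \<phi> (\<nu> z)) * indicator R z \<le> ennreal (c' i) * indicator (L i) z"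
        using i dual True by (simp add: L_def z ennreal_leI)
      also have "\<dots> \<le> (\<Sum>i<n'. ennreal (c' i) * indicator (L i) z)" using i(1) by (intro member_le_sum) auto
      also have "\<dots> \<le> (\<Sum>i<n. ennreal (c i) * indicator (K i) z) + (\<Sum>i<n'. ennreal (c' i) * indicator (L i) z)" by simp
      finally show ?thesis .
    qed
  qed simp
  have Km: "K i \<in> sets hausdorff1" if "i < n" for i using K(1)[OF that] by simp
  have Lm: "L i \<in> sets hausdorff1" if "i < n'" for i using Lclosed[OF that] by simp
  have KI: "indicator (K i) \<in> borel_measurable hausdorff1" if "i < n" for i using Km[OF that] by (rule borel_measurable_indicator)
  have LI: "indicator (L i) \<in> borel_measurable hausdorff1" if "i < n'" for i using Lm[OF that] by (rule borel_measurable_indicator)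
  have "perimeter \<phi> (wulff \<phi>) UNIV = (\<integral>\<^sup>+z. ennreal (dual_anisotropy \<phi> (\<nu> z)) * indicator R z \<partial>hausdorff1)"
    by (simp add: perimeter_def R_def \<nu>_def)
  also have "\<dots> \<le> (\<integral>\<^sup>+z. (\<Sum>i<n. ennreal (c i) * indicator (K i) z) + (\<Sum>i<n'. ennreal (c' i) * indicator (L i) z) \<partial>hausdorff1)"
    by (intro nn_integral_mono pt)
  also have "\<dots> = (\<integral>\<^sup>+z. (\<Sum>i<n. ennreal (c i) * indicator (K i) z) \<partial>hausdorff1) + (\<integral>\<^sup>+z. (\<Sum>i<n'. ennreal (c' i) * indicator (L i) z) \<partial>hausdorff1)"
    by (intro nn_integral_add borel_measurable_sum borel_measurable_times_ennreal borel_measurable_const KI LI) auto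
  also have "(\<integral>\<^sup>+z. (\<Sum>i<n. ennreal (c i) * indicator (K i) z) \<partial>hausdorff1) = (\<Sum>i<n. ennreal (c i) * emeasure hausdorff1 (K i))"
    using Km KI by (subst nn_integral_sum) (auto simp: nn_integral_cmult_indicator intro!: borel_measurable_times_ennreal)
  also have "(\<integral>\<^sup>+z. (\<Sum>i<n'. ennreal (c' i) * indicator (L i) z) \<partial>hausdorff1) = (\<Sum>i<n'. ennreal (c' i) * emeasure hausdorff1 (L i))"
    using Lm LI by (subst nn_integral_sum) (auto simp: nn_integral_cmult_indicator intro!: borel_measurable_times_ennreal)
  also have "(\<Sum>i<n. ennreal (c i) * emeasure hausdorff1 (K i)) \<le> (\<Sum>i<n. ennreal (c i) * hausdorff1_outer (K i))"
    by (intro sum_mono mult_left_mono emeasure_hausdorff1_le) simp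
  also note K(2)
  also have "(\<Sum>i<n'. ennreal (c' i) * emeasure hausdorff1 (L i)) \<le> (\<Sum>i<n'. ennreal (c' i) * hausdorff1_outer (K' i))"
    unfolding L_def by (intro sum_mono mult_left_mono order_trans[OF emeasure_hausdorff1_le hausdorff1_outer_swap]) simp
  also note K'(2)
  also have "ennreal (6 * x0 * (2 / pb - y0) + e) + ennreal (6 * y0 * (2 / pa - x0) + e)
      = ennreal ((6 * x0 * (2 / pb - y0) + e) + (6 * y0 * (2 / pa - x0) + e))"
  proof (rule ennreal_plus[symmetric])
    have "2 / pb - y0 \<ge> 0" "2 / pa - x0 \<ge> 0" using b pa_pos pb_pos by (auto intro: order_trans[OF _ divide_right_mono[of 1 2]])
    then show "0 \<le> 6 * x0 * (2 / pb - y0) + e" "0 \<le> 6 * y0 * (2 / pa - x0) + e" using nn e by auto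
  qed
  also have "\<dots> \<le> ennreal (14 / (pa * pb))"
  proof (rule ennreal_leI)
    \<comment> \<open>Expanding this product bounds the sum of the two contributions by
      \<open>12 / (pa * pb)\<close>; the choice of \<open>e\<close> adds the remaining
      \<open>2 / (pa * pb)\<close>.\<close>
    have "0 \<le> (1 / pa - x0) * (1 / pb - y0)" using b by simp
    then have "x0 * (1 / pb) + y0 * (1 / pa) - x0 * y0 \<le> 1 / (pa * pb)" by (simp add: algebra_simps)
    then have "12 * (x0 * (1 / pb) + y0 * (1 / pa) - x0 * y0) \<le> 12 * (1 / (pa * pb))" by (intro mult_left_mono) auto
    moreover have "(6 * x0 * (2 / pb - y0) + e) + (6 * y0 * (2 / pa - x0) + e) = 12 * (x0 * (1 / pb) + y0 * (1 / pa) - x0 * y0) + 2 * e"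
      by (simp add: algebra_simps)
    ultimately have "(6 * x0 * (2 / pb - y0) + e) + (6 * y0 * (2 / pa - x0) + e) \<le> 12 * (1 / (pa * pb)) + 2 * e"
      by linarith
    also have "\<dots> = 14 / (pa * pb)" by (simp add: e_def)
    finally show "(6 * x0 * (2 / pb - y0) + e) + (6 * y0 * (2 / pa - x0) + e) \<le> 14 / (pa * pb)" .
  qed
  finally show ?thesis by (simp add: add_mono)
qed

text \<open>The right-hand side contains the rhombus with vertices at distance \<open>1 / pa\<close>
  and \<open>1 / pb\<close> on the axes, by the triangle inequality; the left-hand side is the area
  of this rhombus.\<close>

lemma measure_wulff_ge: "2 / (pa * pb) \<le> measure lebesgue (wulff \<phi>)"
proof -
  define M where "M = 1 / pa"
  have M: "M > 0" "pa * M = 1" "pb \<noteq> 0" using pa_pos pb_pos by (auto simp: M_def)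
  have "measure lebesgue (wulff \<phi>) = measure lborel (wulff \<phi>)" using wulff_measurable by simp
  also have "\<dots> = (LINT z|lborel. indicator (wulff \<phi>) z * (1::real))" by simp
  also have "\<dots> = (LINT x|lborel. indicator {-(1/pa)<..<1/pa} x * (gprof x - - gprof x))"
    using vertical_divergence[of snd "\<lambda>_. 1"] by simp
  finally have eq: "measure lebesgue (wulff \<phi>) = (LINT x|lborel. indicator {-M<..<M} x * (2 * gprof x))" by (simp add: M_def)
  have i0: "integrable lborel (\<lambda>x. indicator {-M<..<M} x * (2 * gprof x))"
  proof (rule Bochner_Integration.integrable_bound)
    have "emeasure lborel {-M<..<M} < \<infinity>" using M by (simp add: less_top[symmetric])
    then show "integrable lborel (\<lambda>x. 2 / pb * indicator {-M<..<M} x)"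
      by (intro integrable_mult_right integrable_real_indicator) (auto simp: less_top[symmetric])
    show "AE x in lborel. norm (indicator {-M<..<M} x * (2 * gprof x)) \<le> norm (2 / pb * indicator {-M<..<M} x)"
    proof (rule AE_I2)
      fix x
      show "norm (indicator {-M<..<M} x * (2 * gprof x)) \<le> norm (2 / pb * indicator {-M<..<M} x)"
      proof (cases "x \<in> {-M<..<M}")
        case True
        then have "\<bar>x\<bar> \<le> 1 / pa" by (auto simp: M_def)
        then show ?thesis using True prof_le[of x] prof_props(2)[of x] pb_pos by (auto simp: gprof_def M_def abs_of_nonneg)
      qed simp
    qed
  qed measurable
  have p1: "(LINT x|lborel. indicator {0..M} x *\<^sub>R (2 / pb * (1 - pa * x))) = 2 / pb * (M - pa * M\<^sup>2 / 2) - 2 / pb * (0 - pa * 0\<^sup>2 / 2)"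
    by (rule integral_FTC_atLeastAtMost)
       (use M in \<open>auto intro!: derivative_eq_intros continuous_intros simp: has_real_derivative_iff_has_vector_derivative[symmetric]\<close>)
  have p2: "(LINT x|lborel. indicator {-M..0} x *\<^sub>R (2 / pb * (1 + pa * x))) = 2 / pb * (0 + pa * 0\<^sup>2 / 2) - 2 / pb * (- M + pa * (- M)\<^sup>2 / 2)"
    by (rule integral_FTC_atLeastAtMost)
       (use M in \<open>auto intro!: derivative_eq_intros continuous_intros simp: has_real_derivative_iff_has_vector_derivative[symmetric]\<close>)
  have i1: "integrable lborel (\<lambda>x. indicator {0..M} x *\<^sub>R (2 / pb * (1 - pa * x)))"
    "integrable lborel (\<lambda>x. indicator {-M..0} x *\<^sub>R (2 / pb * (1 + pa * x)))"
    by (intro borel_integrable_compact compact_Icc continuous_intros)+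
  have "(LINT x|lborel. indicator {0..M} x *\<^sub>R (2 / pb * (1 - pa * x)) + indicator {-M..0} x *\<^sub>R (2 / pb * (1 + pa * x))) \<le> measure lebesgue (wulff \<phi>)"
    unfolding eq
  proof (rule integral_mono_AE)
    have "AE x in lborel. x \<noteq> (0::real)" by (rule AE_lborel_singleton)
    then show "AE x in lborel. indicator {0..M} x *\<^sub>R (2 / pb * (1 - pa * x)) + indicator {-M..0} x *\<^sub>R (2 / pb * (1 + pa * x)) \<le> indicator {-M<..<M} x * (2 * gprof x)"
    proof eventually_elim
      case (elim x)
      consider "\<bar>x\<bar> < M" | "\<bar>x\<bar> = M" | "\<bar>x\<bar> > M" by linarith
      then show ?case
      proof cases
        case 1
        then have xa: "\<bar>x\<bar> \<le> 1 / pa" by (simp add: M_def)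
        define y where "y = (1 - \<bar>x\<bar> * pa) / pb"
        have "\<phi> (x, y) \<le> \<phi> (x, 0) + \<phi> (0, y)" using phi_triangle[of "(x, 0)" "(0, y)"] by simp
        also have "\<dots> = \<bar>x\<bar> * pa + \<bar>1 - \<bar>x\<bar> * pa\<bar>" using pb_pos by (simp add: phi_axis y_def abs_divide)
        also have "\<dots> \<le> 1" using xa pa_pos by (simp add: field_simps)
        finally have "y \<le> prof x" using prof_props(3)[OF xa, of y] by simp
        moreover have "gprof x = prof x" using 1 by (auto simp: gprof_def M_def)
        ultimately have "2 * y \<le> 2 * gprof x" by simp
        then have "2 * ((1 - \<bar>x\<bar> * pa) / pb) \<le> 2 * gprof x" unfolding y_def .
        moreover have "x \<in> {-M<..<M}" using 1 by (simp add: abs_less_iff)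
        then have "indicator {-M<..<M} x = (1::real)" by simp
        ultimately show ?thesis using 1 elim by (cases "x > 0") (auto simp: indicator_def mult.commute)
      next
        case 2
        then have "x = M \<or> x = - M" by linarith
        then show ?thesis using M by (auto simp: indicator_def)
      next
        case 3
        then show ?thesis using M by (auto simp: indicator_def)
      qed
    qed
  qed (use i0 i1 in auto)
  then have "2 / pb * (M - pa * M\<^sup>2 / 2) + 2 / pb * (M - pa * M\<^sup>2 / 2) \<le> measure lebesgue (wulff \<phi>)"
    unfolding Bochner_Integration.integral_add[OF i1] p1 p2 by (simp add: algebra_simps)
  moreover have "pa * M\<^sup>2 = M" using M by (simp add: power2_eq_square mult.assoc[symmetric])
  ultimately have "2 * M / pb \<le> measure lebesgue (wulff \<phi>)" by (simp add: field_simps)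
  then show ?thesis by (simp add: M_def)
qed

text \<open>With \<open>w\<close> the square root of the area, the upper bound says
  \<open>P \<le> (2 * P + 1) * w\<close>. This is clear for \<open>w \<ge> 1 / 2\<close>. Otherwise
  \<open>P \<le> 7 * w\<^sup>2\<close> gives
  \<open>P * (1 - 2 * w) \<le> 7 * w * (w * (1 - 2 * w))\<close>, and \<open>w * (1 - 2 * w)\<close>
  is at most \<open>1 / 8\<close>.\<close>

lemma alpha0_bounds: "0 \<le> alpha0 \<phi>" "alpha0 \<phi> \<le> 1"
proof -
  define P where "P = enn2real (perimeter \<phi> (wulff \<phi>) UNIV)"
  define w where "w = sqrt (measure lebesgue (wulff \<phi>))"
  have P0: "P \<ge> 0" by (simp add: P_def)
  have "0 < 2 / (pa * pb)" using pa_pos pb_pos by simp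
  then have m: "0 < measure lebesgue (wulff \<phi>)" using measure_wulff_ge by linarith
  then have w0: "w > 0" "w\<^sup>2 = measure lebesgue (wulff \<phi>)" by (auto simp: w_def)
  have "P \<le> 14 / (pa * pb)"
    unfolding P_def using perimeter_wulff_le pa_pos pb_pos by (intro enn2real_leI) auto
  also have "\<dots> = 7 * (2 / (pa * pb))" by simp
  also have "\<dots> \<le> 7 * w\<^sup>2" using measure_wulff_ge w0(2) by simp
  finally have Pw: "P \<le> 7 * w\<^sup>2" .
  have "P \<le> (2 * P + 1) * w"
  proof (cases "w \<ge> 1/2")
    case True
    then have "P * 1 \<le> P * (2 * w)" using P0 by (intro mult_left_mono) auto
    then show ?thesis using w0 by (simp add: algebra_simps)
  next
    case False
    have "P * (1 - 2 * w) \<le> 7 * w\<^sup>2 * (1 - 2 * w)" using Pw False by (intro mult_right_mono) auto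
    also have "\<dots> = w * (7 * (w * (1 - 2 * w)))" by (simp add: power2_eq_square)
    also have "\<dots> \<le> w * 1"
    proof (rule mult_left_mono)
      have "0 \<le> 2 * (w - 1/4)\<^sup>2" by simp
      then have "w * (1 - 2 * w) \<le> 1 / 8" by (simp add: power2_eq_square algebra_simps)
      then show "7 * (w * (1 - 2 * w)) \<le> 1" by linarith
    qed (use w0 in simp)
    finally show ?thesis by (simp add: algebra_simps)
  qed
  moreover have "(2 * P + 1) * w > 0" using P0 w0 by simp
  ultimately show "alpha0 \<phi> \<le> 1" unfolding alpha0_def Let_def P_def[symmetric] w_def[symmetric] by simp
  show "0 \<le> alpha0 \<phi>" unfolding alpha0_def Let_def P_def[symmetric] w_def[symmetric] using P0 w0 by simp
qed

end

section \<open>Regularity of minimizers\<close>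

lemma Linf_norm_AE_le:
  assumes I: "I \<in> sets lebesgue" and r: "Linf_norm I g \<le> ereal r"
  shows "AE s in lebesgue. s \<in> I \<longrightarrow> \<bar>g s\<bar> \<le> r"
proof -
  have "AE s in restrict_space lebesgue I. ereal \<bar>g s\<bar> \<le> Linf_norm I g"
    unfolding Linf_norm_def by (rule esssup_AE)
  then have "AE s in lebesgue. s \<in> I \<longrightarrow> ereal \<bar>g s\<bar> \<le> Linf_norm I g"
    using I by (subst (asm) AE_restrict_space_iff) auto
  then show ?thesis
  proof eventually_elim
    case (elim s)
    then show ?case using r order_trans[of "ereal \<bar>g s\<bar>" "Linf_norm I g" "ereal r"] by auto
  qed
qed

context monotone_anisotropy
begin

text \<open>Makes room for a constant \<open>K\<close> above the Lipschitz constant of the fidelity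
  term with \<open>2 * \<gamma> * K < 1 / pb = prof 0\<close>. It comes from the entry of the
  minimum with \<open>\<phi> (0, 1)\<close> alone in the denominator, from
  \<open>alpha0 \<phi> \<le> 1\<close>, and from
  \<open>2 powr p \<le> 2 * 4 powr (p - 1)\<close>.\<close>

lemma datum_bound:
  assumes p: "p \<ge> 1" and \<gamma>: "0 < \<gamma>" "\<gamma> < sigma_threshold \<phi> p I" and al: "0 \<le> alpha0 \<phi>" "alpha0 \<phi> \<le> 1"
  shows "p * (2 * \<gamma>) powr (p - 1) * (2 * \<gamma>) < 1 / pb"
proof -
  define X where "X = 1 / (4 powr (p - 1) * p) *
       Min {alpha0 \<phi> * \<phi> (1, 0) / 4, alpha0 \<phi> / (2 * \<phi> (0, 1)), measure lebesgue I * \<phi> (1, 0) / (4 * \<phi> (0, 1))}"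
  have sig: "sigma_threshold \<phi> p I = X powr (1 / p)" by (simp add: sigma_threshold_def X_def)
  have "X \<ge> 0" unfolding X_def using al p pa_pos pb_pos by (intro mult_nonneg_nonneg) (auto simp: pa_def pb_def)
  then have "X = (X powr (1 / p)) powr p" using p by (simp add: powr_powr)
  then have "\<gamma> powr p < X" using powr_less_mono2[of p \<gamma> "X powr (1 / p)"] \<gamma> p sig by simp
  moreover have "X \<le> 1 / (4 powr (p - 1) * p) * (1 / (2 * pb))"
  proof -
    have "alpha0 \<phi> / (2 * pb) \<le> 1 / (2 * pb)" using al pb_pos by (intro divide_right_mono) auto
    then show ?thesis unfolding X_def pb_def using p by (intro mult_left_mono) (auto simp: min_le_iff_disj)
  qed
  ultimately have "\<gamma> powr p < 1 / (2 * pb) / (4 powr (p - 1) * p)" by (simp add: mult.commute mult.left_commute)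
  then have 1: "\<gamma> powr p * (4 powr (p - 1) * p) < 1 / (2 * pb)"
    using p by (subst (asm) pos_less_divide_eq) auto
  have "p * (2 * \<gamma>) powr (p - 1) * (2 * \<gamma>) = p * (2 * \<gamma>) powr p"
    using \<gamma> powr_add[of "2 * \<gamma>" "p - 1" 1] by simp
  also have "\<dots> = 2 powr p * (p * \<gamma> powr p)" using \<gamma> by (simp add: powr_mult)
  also have "\<dots> \<le> (2 * 4 powr (p - 1)) * (p * \<gamma> powr p)"
  proof (rule mult_right_mono)
    have "2 powr p = 2 * 2 powr (p - 1)" using powr_add[of 2 "p - 1" 1] by simp
    also have "\<dots> \<le> 2 * 4 powr (p - 1)" using p by (intro mult_left_mono powr_mono2) auto
    finally show "2 powr p \<le> 2 * 4 powr (p - 1)" .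
  qed (use p in simp)
  also have "\<dots> < 1 / pb" using 1 by (simp add: mult.commute mult.left_commute)
  finally show ?thesis .
qed

text \<open>Fixes the parameters: \<open>K\<close> strictly between the fidelity constant and
  \<open>prof 0 / (2 * \<gamma>)\<close>, then \<open>m\<close> so close to \<open>1 / pa\<close>
  that the arc starting there rises by more than \<open>2 * \<gamma>\<close> up to its
  summit.\<close>

lemma minimizer_regular:
  assumes nv: "no_vertical_facets (wulff \<phi>)" and ab: "a < b" and p: "p \<ge> 1"
    and \<gamma>: "0 < \<gamma>" "p * (2 * \<gamma>) powr (p - 1) * (2 * \<gamma>) < 1 / pb"
    and g: "set_borel_measurable lebesgue {a<..<b} g" "AE s in lebesgue. s \<in> {a<..<b} \<longrightarrow> \<bar>g s\<bar> \<le> \<gamma>"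
    and u: "G_minimizer \<phi> p g {a<..<b} u"
  obtains v L where "AE s in lebesgue. s \<in> {a<..<b} \<longrightarrow> v s = u s" "L-lipschitz_on {a<..<b} v"
    "C2_anisotropy \<phi> \<Longrightarrow> C11_on {a<..<b} v"
proof -
  have "p * (2 * \<gamma>) powr (p - 1) < 1 / pb / (2 * \<gamma>)" using \<gamma> by (subst pos_less_divide_eq) auto
  then obtain K where K: "p * (2 * \<gamma>) powr (p - 1) < K" "K < 1 / pb / (2 * \<gamma>)" using dense by blast
  have "0 \<le> p * (2 * \<gamma>) powr (p - 1)" using p by simp
  then have K0: "K > 0" using K by linarith
  have "K * (2 * \<gamma>) < prof 0" using K(2) \<gamma>(1) unfolding prof_0 by (subst (asm) pos_less_divide_eq) auto
  then obtain m where m: "0 \<le> m" "m < 1 / pa" "prof m < prof 0 - K * (2 * \<gamma>)"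
    using prof_small[OF nv, of "prof 0 - K * (2 * \<gamma>)"] by auto
  have m': "2 * \<gamma> < (prof 0 - prof m) / K" using m(3) K0 by (simp add: pos_less_divide_eq mult.commute)
  \<comment> \<open>The downward chord slope over \<open>[m, m1]\<close> dominates those over
    intervals to the left of \<open>m\<close>, so it is a Lipschitz constant. Arcs starting up to
    \<open>m1\<close> attain all slopes of that size, as the second-order argument demands.\<close>
  define m1 where "m1 = (m + 1 / pa) / 2"
  have m1: "m < m1" "m1 < 1 / pa" using m by (auto simp: m1_def field_simps)
  define L where "L = (prof m - prof m1) / (m1 - m)"
  have "prof m1 \<le> prof m" using m m1 by (intro prof_antimono) auto
  then have L0: "0 \<le> L" using m1 by (simp add: L_def)
  have L: "prof q - prof m \<le> L * (m - q)" if q: "0 \<le> q" "q < m" for q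
  proof -
    have "- (1 / pa) \<le> q" using q pa_pos by (intro order_trans[OF _ q(1)]) simp
    then have "(prof m1 - prof m) / (m1 - m) \<le> (prof m - prof q) / (m - q)"
      using q m1 by (intro prof_slopes(1)) auto
    then have "(prof q - prof m) / (m - q) \<le> L"
      unfolding L_def by (smt (verit) minus_divide_left)
    then show ?thesis using q by (simp add: pos_divide_le_eq)
  qed
  obtain g' w T where w: "minimizing a b p \<gamma> g' w T" "AE s in lebesgue. s \<in> {a<..<b} \<longrightarrow> w s = u s"
    using minimizer_minimizing[OF ab p \<gamma>(1) g u] by blast
  obtain v where v: "L-lipschitz_on {a<..<b} v" "AE s in lborel. s \<in> {a<..<b} \<longrightarrow> v s = w s"
    using minimizing_lipschitz[OF w(1) p \<gamma>(1) ab K(1) m(1) less_imp_le[OF m(2)] m' L0 L] by blast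
  have "AE s in lebesgue. s \<in> {a<..<b} \<longrightarrow> v s = u s"
    using w(2) AE_completion[OF v(2)] by eventually_elim auto
  moreover have "C11_on {a<..<b} v" if "C2_anisotropy \<phi>"
    using minimizing_C11[OF w(1) p \<gamma>(1) ab K(1) m(1) m1 v(1) _ v(2) that] by (simp add: L_def)
  ultimately show ?thesis using that v(1) by blast
qed

end

theorem theorem5p4:
  fixes \<phi> :: "real \<times> real \<Rightarrow> real" and a b p :: real and I :: "real set" and g :: "real \<Rightarrow> real"
  assumes "anisotropy \<phi>" and "partially_monotone \<phi>" and "no_vertical_facets (wulff \<phi>)"
    and "a < b" and "I = {a<..<b}" and "p \<ge> 1"
    and "Linf_on I g" and "Linf_norm I g < ereal (sigma_threshold \<phi> p I)"
  shows "\<forall>u. G_minimizer \<phi> p g I u \<longrightarrow>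
           (\<exists>v. (AE s in lebesgue. s \<in> I \<longrightarrow> v s = u s) \<and> (\<exists>L. L-lipschitz_on I v)) \<and>
           (elliptic \<phi> \<and> C2_anisotropy \<phi> \<longrightarrow>
             (\<exists>v. (AE s in lebesgue. s \<in> I \<longrightarrow> v s = u s) \<and> C11_on I v))"
proof -
  interpret monotone_anisotropy \<phi> by standard fact+
  obtain r where r: "Linf_norm I g < ereal r" "r < sigma_threshold \<phi> p I"
    using ereal_dense2[OF assms(8)] by auto
  \<comment> \<open>A strictly positive bound for the datum that is still strictly below the
    threshold, also when the datum vanishes.\<close>
  define \<gamma> where "\<gamma> = (max r 0 + sigma_threshold \<phi> p I) / 2"
  have bd: "AE s in lebesgue. s \<in> I \<longrightarrow> \<bar>g s\<bar> \<le> r"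
    using assms(5) r(1) by (intro Linf_norm_AE_le) auto
  have "r \<ge> 0"
  proof (rule ccontr)
    assume neg: "\<not> r \<ge> 0"
    from bd have "AE s in lebesgue. s \<notin> I" by eventually_elim (use neg in auto)
    then have "AE s in lborel. s \<notin> I" by (simp add: AE_completion_iff)
    from AE_lborel_ex_between[OF this \<open>a < b\<close>] show False by (auto simp: assms(5))
  qed
  then have \<gamma>: "r \<le> \<gamma>" "0 < \<gamma>" "\<gamma> < sigma_threshold \<phi> p I" using r(2) by (auto simp: \<gamma>_def)
  have gm: "set_borel_measurable lebesgue {a<..<b} g" using assms(5,7) by (simp add: Linf_on_def)
  have g\<gamma>: "AE s in lebesgue. s \<in> {a<..<b} \<longrightarrow> \<bar>g s\<bar> \<le> \<gamma>"
    using bd by eventually_elim (use \<gamma>(1) assms(5) in auto)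
  note small = datum_bound[OF \<open>p \<ge> 1\<close> \<gamma>(2,3) alpha0_bounds]
  show ?thesis
    unfolding \<open>I = _\<close> by (metis minimizer_regular[OF assms(3,4,6) \<gamma>(2) small gm g\<gamma>])
qed

end
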